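(* Under a suitable identification $H^1(vP_3;\mathbb{C})\cong H^1(\overline{P}_4;\mathbb{C})\times\mathbb{C}$ (induced by an isomorphism $vP_3\cong\overline{P}_4*\mathbb{Z}$), the resonance varieties of $vP_3$ are given, for $d\ge1$ and $i\ge1$, by $$\mathcal{R}^i_d(vP_3)\cong\begin{cases}\mathcal{R}^1_{d-1}(\overline{P}_4)\times\mathbb{C}&\text{for } i=1,\ d\le5,\\ \{0\}&\text{for } i=1,\ d=6,\\ \mathcal{R}^1_{d-2}(\overline{P}_4)\times\mathbb{C}&\text{for } i=2,\ d\le6,\\ \emptyset&\text{otherwise.}\end{cases}$$ Consequently, $\mathcal{R}^1_1(vP_3)=H^1(vP_3;\mathbb{C})=\mathbb{C}^6$, while $\mathcal{R}^1_2(vP_3)$ is a union of five $3$-dimensional linear subspaces, pairwise intersecting in the $1$-dimensional subspace $\mathcal{R}^1_3(vP_3)=\mathcal{R}^1_4(vP_3)=\mathcal{R}^1_5(vP_3)$.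
   Context: The pure virtual braid group $vP_3$ has generators $x_{ij}$ ($1\le i\ne j\le3$) and relations $x_{ij}x_{ik}x_{jk}=x_{jk}x_{ik}x_{ij}$ for distinct $i,j,k$. $\overline{P}_4=P_4/Z(P_4)$ is the quotient of the Artin pure braid group on $4$ strings by its (infinite cyclic) center. There is an isomorphism $vP_3\cong\overline{P}_4*\mathbb{Z}$ (free product). For a group $G$ admitting a classifying space with finitely many cells in each dimension, let $A=H^*(G;\mathbb{C})$; for $a\in A^1$ let $(A,a)$ be the cochain complex with differentials $A^i\to A^{i+1}$, $u\mapsto a\cdot u$. Then $\mathcal{R}^i_d(G)=\{a\in H^1(G;\mathbb{C})\mid\dim H^i(A,a)\ge d\}$; in particular $\mathcal{R}^i_d(G)=H^1(G;\mathbb{C})$ for $d\le0$. *)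

theory Defs
  imports
    "Jordan_Normal_Form.VS_Connect"
    "HOL-Algebra.AbelCoset"
    "HOL-Algebra.Elementary_Groups"
    "HOL-Algebra.Sym_Groups"
begin

section \<open>Group presentations\<close>

text \<open>A letter \<open>(x, True)\<close> stands for the generator \<open>x\<close> and \<open>(x, False)\<close> for its formal inverse.
  A relation is a pair of words.\<close>

type_synonym 'a word = "('a \<times> bool) list"

definition words :: "'a set \<Rightarrow> 'a word set" where
  "words X = lists (X \<times> UNIV)"

inductive pres_cong :: "'a set \<Rightarrow> ('a word \<times> 'a word) set \<Rightarrow> 'a word \<Rightarrow> 'a word \<Rightarrow> bool"
  for X R where
  refl: "w \<in> words X \<Longrightarrow> pres_cong X R w w"
| sym: "pres_cong X R u v \<Longrightarrow> pres_cong X R v u"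
| trans: "pres_cong X R u v \<Longrightarrow> pres_cong X R v w \<Longrightarrow> pres_cong X R u w"
| append: "pres_cong X R u u' \<Longrightarrow> pres_cong X R v v' \<Longrightarrow> pres_cong X R (u @ v) (u' @ v')"
| cancel: "x \<in> X \<Longrightarrow> pres_cong X R [(x, b), (x, \<not> b)] []"
| rel: "(u, v) \<in> R \<Longrightarrow> u \<in> words X \<Longrightarrow> v \<in> words X \<Longrightarrow> pres_cong X R u v"

definition pres_class :: "'a set \<Rightarrow> ('a word \<times> 'a word) set \<Rightarrow> 'a word \<Rightarrow> 'a word set" where
  "pres_class X R w = {v. pres_cong X R w v}"

definition presented_group :: "'a set \<Rightarrow> ('a word \<times> 'a word) set \<Rightarrow> 'a word set monoid" where
  "presented_group X R =
    \<lparr>carrier = pres_class X R ` words X,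
     monoid.mult = (\<lambda>A B. \<Union>u\<in>A. \<Union>v\<in>B. pres_class X R (u @ v)),
     one = pres_class X R []\<rparr>"

definition positive_word :: "'a list \<Rightarrow> 'a word" where
  "positive_word xs = map (\<lambda>x. (x, True)) xs"


section \<open>The groups\<close>

text \<open>The free product is presented by the disjoint union of the two groups, subject to their
  multiplication tables.\<close>

definition free_product_gens ::
  "('a, 'm) monoid_scheme \<Rightarrow> ('b, 'n) monoid_scheme \<Rightarrow> ('a + 'b) set" where
  "free_product_gens G H = Inl ` carrier G \<union> Inr ` carrier H"

definition free_product_rels ::
  "('a, 'm) monoid_scheme \<Rightarrow> ('b, 'n) monoid_scheme \<Rightarrow> (('a + 'b) word \<times> ('a + 'b) word) set" where
  "free_product_rels G H =
    {(positive_word [Inl x, Inl y], positive_word [Inl (x \<otimes>\<^bsub>G\<^esub> y)]) | x y.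
       x \<in> carrier G \<and> y \<in> carrier G} \<union>
    {(positive_word [Inr x, Inr y], positive_word [Inr (x \<otimes>\<^bsub>H\<^esub> y)]) | x y.
       x \<in> carrier H \<and> y \<in> carrier H}"

definition free_product ::
  "('a, 'm) monoid_scheme \<Rightarrow> ('b, 'n) monoid_scheme \<Rightarrow> ('a + 'b) word set monoid" where
  "free_product G H = presented_group (free_product_gens G H) (free_product_rels G H)"

definition free_product_inl ::
  "('a, 'm) monoid_scheme \<Rightarrow> ('b, 'n) monoid_scheme \<Rightarrow> 'a \<Rightarrow> ('a + 'b) word set" where
  "free_product_inl G H x =
    pres_class (free_product_gens G H) (free_product_rels G H) (positive_word [Inl x])"

definition free_product_inr ::
  "('a, 'm) monoid_scheme \<Rightarrow> ('b, 'n) monoid_scheme \<Rightarrow> 'b \<Rightarrow> ('a + 'b) word set" where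
  "free_product_inr G H y =
    pres_class (free_product_gens G H) (free_product_rels G H) (positive_word [Inr y])"

definition braid_rels :: "nat \<Rightarrow> (nat word \<times> nat word) set" where
  "braid_rels n =
    {(positive_word [i, j], positive_word [j, i]) | i j.
       i \<in> {1..<n} \<and> j \<in> {1..<n} \<and> (i + 2 \<le> j \<or> j + 2 \<le> i)} \<union>
    {(positive_word [i, Suc i, i], positive_word [Suc i, i, Suc i]) | i.
       i \<in> {1..<n} \<and> Suc i \<in> {1..<n}}"

definition braid_group :: "nat \<Rightarrow> nat word set monoid" where
  "braid_group n = presented_group {1..<n} (braid_rels n)"

text \<open>The projection to the symmetric group sends the \<open>i\<close>-th generator, and hence also its inverse,
  to the transposition of \<open>i\<close> and \<open>i + 1\<close>; it is constant on classes of words.\<close>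

definition word_perm :: "nat word \<Rightarrow> nat \<Rightarrow> nat" where
  "word_perm w = foldr (\<lambda>(i, b) p. Transposition.transpose i (Suc i) \<circ> p) w id"

definition braid_perm :: "nat word set \<Rightarrow> nat \<Rightarrow> nat" where
  "braid_perm A = the_elem (word_perm ` A)"

definition pure_braid_group :: "nat \<Rightarrow> nat word set monoid" where
  "pure_braid_group n =
    (braid_group n)\<lparr>carrier := kernel (braid_group n) (sym_group n) braid_perm\<rparr>"

definition center :: "('a, 'm) monoid_scheme \<Rightarrow> 'a set" where
  "center G = {z \<in> carrier G. \<forall>g\<in>carrier G. z \<otimes>\<^bsub>G\<^esub> g = g \<otimes>\<^bsub>G\<^esub> z}"

definition P4_bar :: "nat word set set monoid" where
  "P4_bar = pure_braid_group 4 Mod center (pure_braid_group 4)"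

definition vP3 :: "(nat \<times> nat) word set monoid" where
  "vP3 = presented_group {(i, j). i \<in> {1..3} \<and> j \<in> {1..3} \<and> i \<noteq> j}
    {(positive_word [(i, j), (i, k), (j, k)], positive_word [(j, k), (i, k), (i, j)]) | i j k.
       {i, j, k} \<subseteq> {1..3} \<and> i \<noteq> j \<and> i \<noteq> k \<and> j \<noteq> k}"


section \<open>Cohomology of complexes of complex vector spaces\<close>

text \<open>Vector spaces are HOL-Algebra modules over the ring record of the complex numbers. Modules
  extend ring records, so the fields \<open>mult\<close> and \<open>one\<close> below are dummies.\<close>

definition quotient_module ::
  "(complex, 'v, 'm) module_scheme \<Rightarrow> 'v set \<Rightarrow> (complex, 'v set) module" where
  "quotient_module M N =
    \<lparr>carrier = a_rcosets\<^bsub>M\<^esub> N, monoid.mult = (\<lambda>_ _. N), one = N, zero = N,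
     add = set_add M, smult = (\<lambda>c X. \<Union>x\<in>X. N +>\<^bsub>M\<^esub> (c \<odot>\<^bsub>M\<^esub> x))\<rparr>"

text \<open>In degree 0 the incoming differential is the one from the zero space.\<close>

fun boundaries ::
  "(nat \<Rightarrow> (complex, 'v, 'm) module_scheme) \<Rightarrow> (nat \<Rightarrow> 'v \<Rightarrow> 'v) \<Rightarrow> nat \<Rightarrow> 'v set" where
  "boundaries M d 0 = {\<zero>\<^bsub>M 0\<^esub>}"
| "boundaries M d (Suc n) = d n ` carrier (M n)"

definition cohomology_of_complex ::
  "(nat \<Rightarrow> (complex, 'v, 'm) module_scheme) \<Rightarrow> (nat \<Rightarrow> 'v \<Rightarrow> 'v) \<Rightarrow> nat \<Rightarrow> (complex, 'v set) module" where
  "cohomology_of_complex M d n =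
    quotient_module ((M n)\<lparr>carrier := a_kernel (M n) (M (Suc n)) (d n)\<rparr>) (boundaries M d n)"


section \<open>Group cohomology with complex coefficients\<close>

text \<open>The cohomology ring of (a classifying space of) a discrete group with trivial coefficients,
  by inhomogeneous cochains (the cochains of the bar construction).\<close>

definition tuples :: "('g, 'm) monoid_scheme \<Rightarrow> nat \<Rightarrow> 'g list set" where
  "tuples G n = {xs. length xs = n \<and> set xs \<subseteq> carrier G}"

definition cochains :: "('g, 'm) monoid_scheme \<Rightarrow> nat \<Rightarrow> (complex, 'g list \<Rightarrow> complex) module" where
  "cochains G n = ring.func_space class_ring (tuples G n)"

definition merge_at :: "('g, 'm) monoid_scheme \<Rightarrow> nat \<Rightarrow> 'g list \<Rightarrow> 'g list" where
  "merge_at G i xs = take i xs @ [xs ! i \<otimes>\<^bsub>G\<^esub> xs ! Suc i] @ drop (i + 2) xs"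

definition coboundary ::
  "('g, 'm) monoid_scheme \<Rightarrow> nat \<Rightarrow> ('g list \<Rightarrow> complex) \<Rightarrow> 'g list \<Rightarrow> complex" where
  "coboundary G n f =
    (\<lambda>xs\<in>tuples G (Suc n).
       f (tl xs) + (\<Sum>i<n. (-1) ^ Suc i * f (merge_at G i xs)) + (-1) ^ Suc n * f (butlast xs))"

definition group_cohomology ::
  "('g, 'm) monoid_scheme \<Rightarrow> nat \<Rightarrow> (complex, ('g list \<Rightarrow> complex) set) module" where
  "group_cohomology G = cohomology_of_complex (cochains G) (coboundary G)"

definition coh_class ::
  "('g, 'm) monoid_scheme \<Rightarrow> nat \<Rightarrow> ('g list \<Rightarrow> complex) \<Rightarrow> ('g list \<Rightarrow> complex) set" where
  "coh_class G n f = boundaries (cochains G) (coboundary G) n +>\<^bsub>cochains G n\<^esub> f"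

definition cup ::
  "('g, 'm) monoid_scheme \<Rightarrow> nat \<Rightarrow> nat \<Rightarrow>
    ('g list \<Rightarrow> complex) set \<Rightarrow> ('g list \<Rightarrow> complex) set \<Rightarrow> ('g list \<Rightarrow> complex) set" where
  "cup G p q a b =
    (\<Union>f\<in>a. \<Union>h\<in>b. coh_class G (p + q) (\<lambda>xs\<in>tuples G (p + q). f (take p xs) * h (drop p xs)))"

text \<open>The map in degree \<open>n\<close> cohomology from \<open>K\<close> to \<open>G\<close> induced by a homomorphism \<open>\<phi>\<close> from
  \<open>G\<close> to \<open>K\<close>.\<close>

definition coh_pullback ::
  "('g, 'm) monoid_scheme \<Rightarrow> nat \<Rightarrow> ('g \<Rightarrow> 'k) \<Rightarrow>
    ('k list \<Rightarrow> complex) set \<Rightarrow> ('g list \<Rightarrow> complex) set" where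
  "coh_pullback G n \<phi> a = (\<Union>f\<in>a. coh_class G n (\<lambda>xs\<in>tuples G n. f (map \<phi> xs)))"


section \<open>Resonance varieties\<close>

text \<open>As \<open>vectorspace.dim\<close> is the minimal size of a generating set, this is meaningful
  only if the cohomology of \<open>G\<close> is finite dimensional in each degree.\<close>

definition resonance_variety ::
  "nat \<Rightarrow> int \<Rightarrow> ('g, 'm) monoid_scheme \<Rightarrow> ('g list \<Rightarrow> complex) set set" where
  "resonance_variety i d G =
    {a \<in> carrier (group_cohomology G 1).
       int (vectorspace.dim class_ring
         (cohomology_of_complex (group_cohomology G) (\<lambda>n. cup G 1 n a) i)) \<ge> d}"

definition complex_line :: "(complex, complex) module" where
  "complex_line = \<lparr>carrier = UNIV, monoid.mult = (*), one = 1, zero = 0, add = (+), smult = (*)\<rparr>"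

text \<open>The isomorphism from the first cohomology of the infinite cyclic group to the complex numbers:
  evaluation at the generator 1. There are no nonzero coboundaries in degree 1, so a class
  consists of a single cocycle.\<close>

definition H1_integer_eval :: "(int list \<Rightarrow> complex) set \<Rightarrow> complex" where
  "H1_integer_eval a = the_elem ((\<lambda>f. f [1]) ` a)"

text \<open>The coordinates on the first cohomology of \<open>K\<close> given by an isomorphism \<open>\<psi>\<close> from the free product
  of \<open>G\<close> and the integers to \<open>K\<close>: restrict the pullback along \<open>\<psi>\<close> to the two free factors.\<close>

definition free_factor_coords ::
  "('g, 'm) monoid_scheme \<Rightarrow> (('g + int) word set \<Rightarrow> 'k) \<Rightarrow>
    ('k list \<Rightarrow> complex) set \<Rightarrow> ('g list \<Rightarrow> complex) set \<times> complex" where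
  "free_factor_coords G \<psi> a =
    (coh_pullback G 1 (\<psi> \<circ> free_product_inl G integer_group) a,
     H1_integer_eval (coh_pullback integer_group 1 (\<psi> \<circ> free_product_inr G integer_group) a))"

end

(* In suitable generators x1, x2, x3, p, q, t of vP3 the relations involve only the first five and
   present a semidirect product of free groups F3 x| F2, so vP3 is the free product of F3 x| F2 and Z.
   The braid group B4 acts on F3 x| F2 in such a way that F3 x| F2, mapped to P4, acts on itself by inner
   automorphisms. As F3 x| F2 has trivial center, it embeds into P4/Z(P4). It maps onto this group
   because modulo its image and central elements the generators of B4 satisfy the Coxeter relations.

   The Cayley complex of the six relations is acyclic, so the cohomology of vP3 vanishes above degree
   two. The class of a 2-cocycle is determined by its values on the relations, computed in the central
   extension that it defines, and for the product of two classes of degree one these values are 2 x 2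
   determinants. Hence the annihilator of a class a in H^1 has dimension 6 if only the t-coordinate
   of a is nonzero, 3 if a lies in one of five explicit subspaces, and 2 otherwise. The dimensions in
   the complex (A, a) follow by rank and nullity. Finally P4/Z(P4) is a retract of vP3, so that its
   annihilators are those of vP3 modulo the t-line. *)

theory Submission
  imports Defs "HOL-Algebra.Bij"
begin

section \<open>Linear algebra: quotients and dimensions\<close>

section \<open>Dimensions of quotient spaces\<close>

text \<open>P4 is given only as a kernel in B4; neither a presentation of it nor its center is
  computed. The obstacle is injectivity of F3 x| F2 \<rightarrow> P4/Z(P4). It is met by a
  representation instead of a normal form: conjugation by each braid generator is written out in the
  coordinates of F3 x| F2 modulo the center, the formulas are checked to be automorphisms satisfying
  the braid relations, and an element is recovered from its inner automorphism because the center is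
  trivial. Many other steps rest on actions too: on reduced words, on F3, on the product of vP3 with
  the complex numbers, on spaces of functions.

  The five subspaces are the resonance components of P4: one for each triple of strands, and one for
  the splittings of the strands into pairs.

  The shifts of d: let n be the dimension of the annihilator of a in vP3. As H^1 and H^2 both have
  dimension 6, the complex has dimension n in degree two, and n - 1 in degree one if a is nonzero.
  In P4/Z(P4) the annihilator has dimension n - 1, so degree one has dimension n - 2 if the image of
  a is nonzero.\<close>

lemma linear_mapI:
  assumes "vectorspace class_ring V" "vectorspace class_ring W"
    and "\<And>x. x \<in> carrier V \<Longrightarrow> f x \<in> carrier W"
    and "\<And>x y. x \<in> carrier V \<Longrightarrow> y \<in> carrier V \<Longrightarrow> f (x \<oplus>\<^bsub>V\<^esub> y) = f x \<oplus>\<^bsub>W\<^esub> f y"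
    and "\<And>(c::complex) x. x \<in> carrier V \<Longrightarrow> f (c \<odot>\<^bsub>V\<^esub> x) = c \<odot>\<^bsub>W\<^esub> f x"
  shows "linear_map class_ring V W f"
  using assms
  by (simp add: linear_map_def mod_hom_def mod_hom_axioms_def LinearCombinations.module_hom_def
      vectorspace_def Pi_iff)

lemma subspaceI:
  assumes V: "vectorspace class_ring V"
    and "N \<subseteq> carrier V" "\<zero>\<^bsub>V\<^esub> \<in> N"
    and "\<And>x y. x \<in> N \<Longrightarrow> y \<in> N \<Longrightarrow> x \<oplus>\<^bsub>V\<^esub> y \<in> N"
    and "\<And>(c::complex) x. x \<in> N \<Longrightarrow> c \<odot>\<^bsub>V\<^esub> x \<in> N"
  shows "VectorSpace.subspace class_ring N V"
  using assms
  by (simp add: VectorSpace.subspace_def LinearCombinations.submodule_def vectorspace_def)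

lemma subspaceD:
  assumes "VectorSpace.subspace class_ring N V"
  shows "N \<subseteq> carrier V" "\<zero>\<^bsub>V\<^esub> \<in> N" "x \<in> N \<Longrightarrow> y \<in> N \<Longrightarrow> x \<oplus>\<^bsub>V\<^esub> y \<in> N"
    "x \<in> N \<Longrightarrow> (c::complex) \<odot>\<^bsub>V\<^esub> x \<in> N"
  using assms by (simp_all add: VectorSpace.subspace_def LinearCombinations.submodule_def)

lemma subspace_vectorspace:
  "VectorSpace.subspace class_ring N V \<Longrightarrow> vectorspace class_ring (V\<lparr>carrier := N\<rparr>)"
  using vectorspace.subspace_is_vs VectorSpace.subspace_def by blast

text \<open>Each axiom for \<open>W\<close> is the image of the axiom for \<open>V\<close>. This
  serves records such as \<open>quotient_module\<close> and \<open>complex_line\<close>, whose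
  operations are mere formulas at first.\<close>

lemma vectorspace_image:
  assumes V: "vectorspace class_ring V"
    and surj: "f ` carrier V = carrier W"
    and zero: "f \<zero>\<^bsub>V\<^esub> = \<zero>\<^bsub>W\<^esub>"
    and add: "\<And>x y. x \<in> carrier V \<Longrightarrow> y \<in> carrier V \<Longrightarrow> f x \<oplus>\<^bsub>W\<^esub> f y = f (x \<oplus>\<^bsub>V\<^esub> y)"
    and smult: "\<And>(c::complex) x. x \<in> carrier V \<Longrightarrow> c \<odot>\<^bsub>W\<^esub> f x = f (c \<odot>\<^bsub>V\<^esub> x)"
  shows "vectorspace class_ring W" "linear_map class_ring V W f"
proof -
  interpret V: vectorspace class_ring V by fact
  have ex: "\<exists>x\<in>carrier V. w = f x" if "w \<in> carrier W" for w using that surj by auto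
  have cl: "f x \<in> carrier W" if "x \<in> carrier V" for x using that surj by auto
  show W: "vectorspace class_ring W"
  proof (rule vs_criteria)
    show "field (class_ring :: complex ring)" by (rule class_field)
    show "\<zero>\<^bsub>W\<^esub> \<in> carrier W" using cl[OF V.zero_closed] zero by simp
    show "\<forall>v w. v \<in> carrier W \<and> w \<in> carrier W \<longrightarrow> v \<oplus>\<^bsub>W\<^esub> w \<in> carrier W"
      using ex by (auto simp: add cl dest!: ex)
    show "\<forall>v\<in>carrier W. \<exists>neg_v\<in>carrier W. v \<oplus>\<^bsub>W\<^esub> neg_v = \<zero>\<^bsub>W\<^esub>"
    proof
      fix v assume "v \<in> carrier W"
      then obtain x where x: "x \<in> carrier V" "v = f x" using ex by blast
      then have "v \<oplus>\<^bsub>W\<^esub> f (\<ominus>\<^bsub>V\<^esub> x) = \<zero>\<^bsub>W\<^esub>" by (simp add: add zero V.r_neg)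
      then show "\<exists>neg_v\<in>carrier W. v \<oplus>\<^bsub>W\<^esub> neg_v = \<zero>\<^bsub>W\<^esub>" using x cl by blast
    qed
    show "\<forall>c v. c \<in> carrier class_ring \<and> v \<in> carrier W \<longrightarrow> c \<odot>\<^bsub>W\<^esub> v \<in> carrier W"
      by (auto simp: smult cl dest!: ex)
    show "\<forall>v w. v \<in> carrier W \<and> w \<in> carrier W \<longrightarrow> v \<oplus>\<^bsub>W\<^esub> w = w \<oplus>\<^bsub>W\<^esub> v"
      by (auto simp: add V.a_comm dest!: ex)
    show "\<forall>v w x. v \<in> carrier W \<and> w \<in> carrier W \<and> x \<in> carrier W \<longrightarrow> v \<oplus>\<^bsub>W\<^esub> w \<oplus>\<^bsub>W\<^esub> x = v \<oplus>\<^bsub>W\<^esub> (w \<oplus>\<^bsub>W\<^esub> x)"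
      by (auto simp: add V.a_assoc dest!: ex)
    show "\<forall>v\<in>carrier W. v \<oplus>\<^bsub>W\<^esub> \<zero>\<^bsub>W\<^esub> = v"
      by (auto simp: add zero[symmetric] dest!: ex)
    show "\<forall>a b v. a \<in> carrier class_ring \<and> b \<in> carrier class_ring \<and> v \<in> carrier W \<longrightarrow>
        (a \<otimes>\<^bsub>class_ring\<^esub> b) \<odot>\<^bsub>W\<^esub> v = a \<odot>\<^bsub>W\<^esub> (b \<odot>\<^bsub>W\<^esub> v)"
      using V.smult_assoc1 by (auto simp: smult dest!: ex)
    show "\<forall>v\<in>carrier W. \<one>\<^bsub>class_ring\<^esub> \<odot>\<^bsub>W\<^esub> v = v"
      using V.smult_one by (auto simp: smult dest!: ex)
    show "\<forall>a b v. a \<in> carrier class_ring \<and> b \<in> carrier class_ring \<and> v \<in> carrier W \<longrightarrow>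
        (a \<oplus>\<^bsub>class_ring\<^esub> b) \<odot>\<^bsub>W\<^esub> v = a \<odot>\<^bsub>W\<^esub> v \<oplus>\<^bsub>W\<^esub> b \<odot>\<^bsub>W\<^esub> v"
      using V.smult_l_distr by (auto simp: smult add dest!: ex)
    show "\<forall>a v w. a \<in> carrier class_ring \<and> v \<in> carrier W \<and> w \<in> carrier W \<longrightarrow>
        a \<odot>\<^bsub>W\<^esub> (v \<oplus>\<^bsub>W\<^esub> w) = a \<odot>\<^bsub>W\<^esub> v \<oplus>\<^bsub>W\<^esub> a \<odot>\<^bsub>W\<^esub> w"
      using V.smult_r_distr by (auto simp: smult add dest!: ex)
  qed
  show "linear_map class_ring V W f"
    by (rule linear_mapI[OF V W]) (auto simp: cl add smult)
qed

lemma quotient_module: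
  assumes V: "vectorspace class_ring V" and N: "VectorSpace.subspace class_ring N V"
  shows "vectorspace class_ring (quotient_module V N)"
    "linear_map class_ring V (quotient_module V N) (\<lambda>x. N +>\<^bsub>V\<^esub> x)"
    "carrier (quotient_module V N) = (\<lambda>x. N +>\<^bsub>V\<^esub> x) ` carrier V"
    "\<zero>\<^bsub>quotient_module V N\<^esub> = N"
    "\<And>x y. x \<in> carrier V \<Longrightarrow> y \<in> carrier V \<Longrightarrow> N +>\<^bsub>V\<^esub> x = N +>\<^bsub>V\<^esub> y \<longleftrightarrow> x \<ominus>\<^bsub>V\<^esub> y \<in> N"
    "\<And>x. x \<in> carrier V \<Longrightarrow> N +>\<^bsub>V\<^esub> x = N \<longleftrightarrow> x \<in> N"
    "\<And>x y. x \<in> carrier V \<Longrightarrow> y \<in> N +>\<^bsub>V\<^esub> x \<Longrightarrow> y \<in> carrier V \<and> N +>\<^bsub>V\<^esub> y = N +>\<^bsub>V\<^esub> x"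
    "\<And>x. x \<in> carrier V \<Longrightarrow> x \<in> N +>\<^bsub>V\<^esub> x"
proof -
  interpret V: vectorspace class_ring V by fact
  note S = subspaceD[OF N]
  have "\<ominus>\<^bsub>V\<^esub> x \<in> N" if "x \<in> N" for x
    using S(4)[OF that, of "-1"] V.smult_minus_1[of x] S(1) that by (auto simp: class_ring_simps)
  then have sub: "subgroup N (add_monoid V)"
    by (intro subgroup.intro) (use S in \<open>auto simp: a_inv_def\<close>)
  interpret A: abelian_subgroup N V
    by (rule abelian_subgroupI3) (use sub V.abelian_group_axioms in \<open>auto simp: additive_subgroup_def\<close>)
  show car: "carrier (quotient_module V N) = (\<lambda>x. N +>\<^bsub>V\<^esub> x) ` carrier V"
    by (auto simp: quotient_module_def A_RCOSETS_def RCOSETS_def a_r_coset_def)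
  show zero: "\<zero>\<^bsub>quotient_module V N\<^esub> = N" by (simp add: quotient_module_def)
  show repr: "y \<in> carrier V \<and> N +>\<^bsub>V\<^esub> y = N +>\<^bsub>V\<^esub> x" if "x \<in> carrier V" "y \<in> N +>\<^bsub>V\<^esub> x" for x y
    using abelian_group.a_repr_independence[OF V.abelian_group_axioms that(2,1) sub] A.a_elemrcos_carrier[OF that] by simp
  show self: "x \<in> N +>\<^bsub>V\<^esub> x" if "x \<in> carrier V" for x using that by (rule A.a_rcos_self)
  \<comment> \<open>The record takes a union over all representatives. They all yield the same
    coset, so the union of this nonempty family is that coset.\<close>
  have smult: "(\<Union>y\<in>N +>\<^bsub>V\<^esub> x. N +>\<^bsub>V\<^esub> (c \<odot>\<^bsub>V\<^esub> y)) = N +>\<^bsub>V\<^esub> (c \<odot>\<^bsub>V\<^esub> x)" if x: "x \<in> carrier V" for c x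
  proof -
    have "N +>\<^bsub>V\<^esub> (c \<odot>\<^bsub>V\<^esub> y) = N +>\<^bsub>V\<^esub> (c \<odot>\<^bsub>V\<^esub> x)" if y: "y \<in> N +>\<^bsub>V\<^esub> x" for y
    proof -
      have yV: "y \<in> carrier V" using repr[OF x y] by simp
      obtain n where n: "n \<in> N" "y = n \<oplus>\<^bsub>V\<^esub> x" using y by (auto simp: a_r_coset_def r_coset_def)
      have nV: "n \<in> carrier V" using n(1) S(1) by auto
      have "c \<odot>\<^bsub>V\<^esub> y = c \<odot>\<^bsub>V\<^esub> n \<oplus>\<^bsub>V\<^esub> c \<odot>\<^bsub>V\<^esub> x"
        using n nV x V.smult_r_distr[of c n x] by simp
      moreover have "c \<odot>\<^bsub>V\<^esub> n \<in> N" using S(4)[OF n(1), of c] by simp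
      ultimately have "c \<odot>\<^bsub>V\<^esub> y \<in> N +>\<^bsub>V\<^esub> (c \<odot>\<^bsub>V\<^esub> x)" by (auto simp: a_r_coset_def r_coset_def)
      then show ?thesis using repr[of "c \<odot>\<^bsub>V\<^esub> x" "c \<odot>\<^bsub>V\<^esub> y"] V.smult_closed[of c x] x by simp
    qed
    then show ?thesis using self[OF x] by blast
  qed
  show "vectorspace class_ring (quotient_module V N)"
    "linear_map class_ring V (quotient_module V N) (\<lambda>x. N +>\<^bsub>V\<^esub> x)"
    by (rule vectorspace_image[OF V car[symmetric]];
      simp add: quotient_module_def A.a_rcos_sum smult A.a_rcos_const S(2))+
  show "N +>\<^bsub>V\<^esub> x = N \<longleftrightarrow> x \<in> N" if x: "x \<in> carrier V" for x
    using A.a_rcos_const[of x] self[OF x] by auto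
  show "N +>\<^bsub>V\<^esub> x = N +>\<^bsub>V\<^esub> y \<longleftrightarrow> x \<ominus>\<^bsub>V\<^esub> y \<in> N" if "x \<in> carrier V" "y \<in> carrier V" for x y
  proof
    assume "N +>\<^bsub>V\<^esub> x = N +>\<^bsub>V\<^esub> y"
    then have "x \<in> N +>\<^bsub>V\<^esub> y" using self[OF that(1)] by simp
    then show "x \<ominus>\<^bsub>V\<^esub> y \<in> N" using A.a_rcos_module_imp[OF that(2)] by (simp add: a_minus_def)
  next
    assume "x \<ominus>\<^bsub>V\<^esub> y \<in> N"
    then have "x \<in> N +>\<^bsub>V\<^esub> y" using A.a_rcos_module_rev[OF that(2,1)] by (simp add: a_minus_def)
    then show "N +>\<^bsub>V\<^esub> x = N +>\<^bsub>V\<^esub> y" using repr[OF that(2)] by simp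
  qed
qed

lemma linear_map_rank_nullity:
  assumes "linear_map class_ring V W f" "vectorspace.fin_dim class_ring V"
  shows "VectorSpace.subspace class_ring {v \<in> carrier V. f v = \<zero>\<^bsub>W\<^esub>} V"
    "VectorSpace.subspace class_ring (f ` carrier V) W"
    "vectorspace.dim class_ring (W\<lparr>carrier := f ` carrier V\<rparr>)
      + vectorspace.dim class_ring (V\<lparr>carrier := {v \<in> carrier V. f v = \<zero>\<^bsub>W\<^esub>}\<rparr>)
      = vectorspace.dim class_ring V"
proof -
  interpret linear_map class_ring V W f by fact
  show "VectorSpace.subspace class_ring {v \<in> carrier V. f v = \<zero>\<^bsub>W\<^esub>} V"
    using kerT_is_subspace by (simp add: ker_def)
  show "VectorSpace.subspace class_ring (f ` carrier V) W"
    using imT_is_subspace by (simp add: im_def)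
  show "vectorspace.dim class_ring (W\<lparr>carrier := f ` carrier V\<rparr>)
      + vectorspace.dim class_ring (V\<lparr>carrier := {v \<in> carrier V. f v = \<zero>\<^bsub>W\<^esub>}\<rparr>)
      = vectorspace.dim class_ring V"
    using rank_nullity[OF assms(2)] by (simp add: ker_def im_def)
qed

lemma dim_quotient_module:
  assumes V: "vectorspace class_ring V" and N: "VectorSpace.subspace class_ring N V"
    and fin: "vectorspace.fin_dim class_ring V"
  shows "vectorspace.dim class_ring (quotient_module V N) + vectorspace.dim class_ring (V\<lparr>carrier := N\<rparr>)
    = vectorspace.dim class_ring V"
proof -
  note q = quotient_module[OF V N]
  have "{x \<in> carrier V. N +>\<^bsub>V\<^esub> x = \<zero>\<^bsub>quotient_module V N\<^esub>} = N"
    using q(4,6) subspaceD(1)[OF N] by auto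
  moreover have "(quotient_module V N)\<lparr>carrier := (\<lambda>x. N +>\<^bsub>V\<^esub> x) ` carrier V\<rparr> = quotient_module V N"
    unfolding q(3)[symmetric] by simp
  ultimately show ?thesis using linear_map_rank_nullity(3)[OF q(2) fin] by simp
qed

text \<open>The functionals map \<open>V\<close> isomorphically onto the coordinate space: joint
  separation gives injectivity, biorthogonality gives surjectivity. The dimensions of spaces of
  classes below are found by exhibiting functionals and vectors in this way.\<close>

lemma dim_dual_basis:
  fixes V :: "(complex, 'v, 'm) module_scheme" and \<phi> :: "nat \<Rightarrow> 'v \<Rightarrow> complex"
  assumes V: "vectorspace class_ring V"
    and add: "\<And>i x y. i < n \<Longrightarrow> x \<in> carrier V \<Longrightarrow> y \<in> carrier V \<Longrightarrow> \<phi> i (x \<oplus>\<^bsub>V\<^esub> y) = \<phi> i x + \<phi> i y"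
    and smult: "\<And>i c x. i < n \<Longrightarrow> x \<in> carrier V \<Longrightarrow> \<phi> i (c \<odot>\<^bsub>V\<^esub> x) = c * \<phi> i x"
    and b: "\<And>j. j < n \<Longrightarrow> b j \<in> carrier V"
      "\<And>i j. i < n \<Longrightarrow> j < n \<Longrightarrow> \<phi> i (b j) = (if i = j then 1 else 0)"
    and sep: "\<And>x. x \<in> carrier V \<Longrightarrow> (\<And>i. i < n \<Longrightarrow> \<phi> i x = 0) \<Longrightarrow> x = \<zero>\<^bsub>V\<^esub>"
  shows "vectorspace.fin_dim class_ring V" "vectorspace.dim class_ring V = n"
proof -
  interpret V: vectorspace class_ring V by fact
  let ?C = "module_vec TYPE(complex) n"
  interpret C: vec_space "TYPE(complex)" n .
  have C: "vectorspace class_ring ?C" by (rule vec_vs)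
  define T where "T x = vec n (\<lambda>i. \<phi> i x)" for x
  have T_add: "T (x \<oplus>\<^bsub>V\<^esub> y) = T x + T y" if "x \<in> carrier V" "y \<in> carrier V" for x y
    using that by (auto simp: T_def add)
  have T_smult: "T (c \<odot>\<^bsub>V\<^esub> x) = c \<cdot>\<^sub>v T x" if "x \<in> carrier V" for c x
    using that by (auto simp: T_def smult)
  have T_lin: "linear_map class_ring V ?C T"
    by (rule linear_mapI[OF V C]) (auto simp: module_vec_simps T_add T_smult, simp add: T_def)
  interpret T: linear_map class_ring V ?C T by (rule T_lin)
  have inj: "inj_on T (carrier V)"
  proof (rule inj_onI)
    fix x y assume xy: "x \<in> carrier V" "y \<in> carrier V" "T x = T y"
    have neg: "\<ominus>\<^bsub>V\<^esub> y = (-1) \<odot>\<^bsub>V\<^esub> y"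
      using V.smult_minus_1[of y] xy(2) by (simp add: class_ring_simps)
    have "x \<ominus>\<^bsub>V\<^esub> y = \<zero>\<^bsub>V\<^esub>"
    proof (rule sep)
      show "\<phi> i (x \<ominus>\<^bsub>V\<^esub> y) = 0" if "i < n" for i
      proof -
        have "\<phi> i x = \<phi> i y" using arg_cong[OF xy(3), of "\<lambda>v. v $ i"] that by (simp add: T_def)
        then show ?thesis using that xy V.smult_closed[of "-1" y] by (simp add: a_minus_def neg add smult)
      qed
    qed (use xy in simp)
    then show "x = y" using xy by simp
  qed
  have img: "T ` carrier V = carrier_vec n"
  proof
    show "T ` carrier V \<subseteq> carrier_vec n" by (auto simp: T_def)
    show "carrier_vec n \<subseteq> T ` carrier V"
    proof
      fix v :: "complex vec" assume v: "v \<in> carrier_vec n"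
      \<comment> \<open>The preimage of \<open>v\<close> is the combination of the
        \<open>b i\<close> with coefficients \<open>v $ i\<close>, built one coordinate at a
        time.\<close>
      have "\<exists>x\<in>carrier V. \<forall>i<n. \<phi> i x = (if i < m then v $ i else 0)" if "m \<le> n" for m
        using that
      proof (induction m)
        case 0
        have "\<phi> i \<zero>\<^bsub>V\<^esub> = 0" if "i < n" for i
          using add[OF that V.zero_closed V.zero_closed] by simp
        then show ?case by (intro bexI[of _ "\<zero>\<^bsub>V\<^esub>"]) auto
      next
        case (Suc m)
        then obtain x where x: "x \<in> carrier V" "\<forall>i<n. \<phi> i x = (if i < m then v $ i else 0)" by auto
        have bm: "b m \<in> carrier V" "(v $ m) \<odot>\<^bsub>V\<^esub> b m \<in> carrier V"
          using b(1)[of m] V.smult_closed[of "v $ m" "b m"] Suc.prems by auto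
        show ?case
        proof (intro bexI allI impI)
          show "\<phi> i (x \<oplus>\<^bsub>V\<^esub> (v $ m) \<odot>\<^bsub>V\<^esub> b m) = (if i < Suc m then v $ i else 0)" if "i < n" for i
            using that x bm Suc.prems by (auto simp: add smult b(2) less_Suc_eq)
        qed (use x bm in simp)
      qed
      from this[of n] obtain x where "x \<in> carrier V" "\<forall>i<n. \<phi> i x = v $ i" by auto
      then show "v \<in> T ` carrier V" using v by (intro image_eqI[of _ _ x]) (auto simp: T_def)
    qed
  qed
  \<comment> \<open>The inverse map is used because the dimension is known for its source, the
    coordinate space.\<close>
  define S where "S = inv_into (carrier V) T"
  have TS: "T (S v) = v" "S v \<in> carrier V" if "v \<in> carrier_vec n" for v
    using that img by (auto simp: S_def f_inv_into_f inv_into_into)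
  have ST: "S (T x) = x" if "x \<in> carrier V" for x using that inj by (simp add: S_def)
  have S_lin: "linear_map class_ring ?C V S"
  proof (rule linear_mapI[OF C V])
    show "S (u \<oplus>\<^bsub>?C\<^esub> w) = S u \<oplus>\<^bsub>V\<^esub> S w" if "u \<in> carrier ?C" "w \<in> carrier ?C" for u w
      using that TS[of u] TS[of w] ST[of "S u \<oplus>\<^bsub>V\<^esub> S w"] by (simp add: module_vec_simps T_add)
    show "S (c \<odot>\<^bsub>?C\<^esub> u) = c \<odot>\<^bsub>V\<^esub> S u" if "u \<in> carrier ?C" for c u
      using that TS[of u] ST[of "c \<odot>\<^bsub>V\<^esub> S u"] V.smult_closed[of c "S u"] by (simp add: module_vec_simps T_smult)
  qed (auto simp: module_vec_simps TS)
  interpret S: linear_map class_ring ?C V S by (rule S_lin)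
  have surj: "S ` carrier ?C = carrier V"
  proof
    show "S ` carrier ?C \<subseteq> carrier V" by (auto simp: module_vec_simps TS)
    have "x = S (T x)" "T x \<in> carrier ?C" if "x \<in> carrier V" for x
      using that by (simp_all add: ST) (simp add: module_vec_simps T_def)
    then show "carrier V \<subseteq> S ` carrier ?C" by blast
  qed
  have S_inj: "inj_on S (carrier ?C)"
    by (rule inj_on_inverseI[of _ T]) (simp add: module_vec_simps TS)
  show "vectorspace.fin_dim class_ring V" by (rule S.surj_fin_dim[OF C.fin_dim surj])
  show "vectorspace.dim class_ring V = n" using S.dim_eq[OF C.fin_dim S_inj surj] C.dim_is_n by simp
qed

section \<open>The bar complex and its cohomology classes\<close>

section \<open>The bar complex\<close>

text \<open>Minus the coboundary without its first term, as a recursion on the tuple.\<close>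

fun inner_cob :: "('g, 'm) monoid_scheme \<Rightarrow> ('g list \<Rightarrow> complex) \<Rightarrow> 'g \<Rightarrow> 'g list \<Rightarrow> complex" where
  "inner_cob G f x [] = f []"
| "inner_cob G f x (y # ys) = f ((x \<otimes>\<^bsub>G\<^esub> y) # ys) - inner_cob G (\<lambda>l. f (x # l)) y ys"

definition cob :: "('g, 'm) monoid_scheme \<Rightarrow> ('g list \<Rightarrow> complex) \<Rightarrow> 'g list \<Rightarrow> complex" where
  "cob G f xs = f (tl xs) - inner_cob G f (hd xs) (tl xs)"

lemma cob_simps [simp]: "cob G f (x # xs) = f xs - inner_cob G f x xs"
  by (simp add: cob_def)

text \<open>Splitting off the merge at position 0 leaves the same sum for the shorter tuple with
  opposite signs, and the minus sign in the recursion absorbs this.\<close>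

lemma inner_cob_sum:
  "inner_cob G f x xs = - (\<Sum>i<length xs. (-1) ^ Suc i * f (merge_at G i (x # xs)))
     - (-1) ^ Suc (length xs) * f (butlast (x # xs))"
proof (induction xs arbitrary: f x)
  case (Cons y ys)
  have "(\<Sum>i<length (y # ys). (-1) ^ Suc i * f (merge_at G i (x # y # ys)))
      = - f ((x \<otimes>\<^bsub>G\<^esub> y) # ys) - (\<Sum>i<length ys. (-1) ^ Suc i * f (x # merge_at G i (y # ys)))"
    by (simp add: sum.lessThan_Suc_shift merge_at_def sum_negf del: sum.lessThan_Suc)
  then show ?case by (simp add: Cons.IH)
qed simp

lemma coboundary_eq_cob:
  assumes "xs \<in> tuples G (Suc n)"
  shows "coboundary G n f xs = cob G f xs"
proof -
  obtain y ys where "xs = y # ys" "length ys = n"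
    using assms by (cases xs) (auto simp: tuples_def)
  then show ?thesis using assms by (simp add: coboundary_def inner_cob_sum)
qed

lemma coboundary_restrict: "coboundary G n f = restrict (cob G f) (tuples G (Suc n))"
  using coboundary_eq_cob[of _ G n f] by (auto simp: fun_eq_iff coboundary_def)

lemma tuples_simps [simp]:
  "xs \<in> tuples G 0 \<longleftrightarrow> xs = []"
  "[] \<notin> tuples G (Suc n)"
  "x # xs \<in> tuples G (Suc n) \<longleftrightarrow> x \<in> carrier G \<and> xs \<in> tuples G n"
  by (auto simp: tuples_def)

lemma tuples_Suc_E:
  assumes "xs \<in> tuples G (Suc n)"
  obtains y ys where "xs = y # ys" "y \<in> carrier G" "ys \<in> tuples G n"
  using assms by (cases xs) (auto simp: tuples_def)

context group
begin

lemma inner_cob_cong: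
  assumes "\<And>l. l \<in> tuples G n \<Longrightarrow> f l = f' l" "x \<in> carrier G" "xs \<in> tuples G n"
  shows "inner_cob G f x xs = inner_cob G f' x xs"
  using assms
proof (induction xs arbitrary: n f f' x)
  case Nil
  then show ?case by (simp add: tuples_def)
next
  case (Cons y ys)
  then obtain m where n: "n = Suc m" by (cases n) auto
  then show ?case using Cons.prems Cons.IH[of m "\<lambda>l. f (x # l)" "\<lambda>l. f' (x # l)" y] by simp
qed

lemma cob_cong:
  assumes "\<And>l. l \<in> tuples G n \<Longrightarrow> f l = f' l" "xs \<in> tuples G (Suc n)"
  shows "cob G f xs = cob G f' xs"
  using assms by (elim tuples_Suc_E) (simp add: inner_cob_cong[of n f f'])

lemma inner_cob_linear:
  "inner_cob G (\<lambda>l. f l + g l) x xs = inner_cob G f x xs + inner_cob G g x xs"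
  "inner_cob G (\<lambda>l. c * f l) x xs = c * inner_cob G f x xs"
  by (induction xs arbitrary: f g x) (simp_all add: algebra_simps)

lemma inner_cob_minus: "inner_cob G (\<lambda>l. f l - g l) x xs = inner_cob G f x xs - inner_cob G g x xs"
  by (induction xs arbitrary: f g x) (simp_all add: algebra_simps)

lemma inner_cob_tl: "xs \<noteq> [] \<Longrightarrow> inner_cob G (\<lambda>l. f (tl l)) x xs = f (tl xs) - inner_cob G f (hd xs) (tl xs)"
  by (cases xs) simp_all

text \<open>The square of the differential on cochains whose values are functions of the head. The
  induction hypothesis removes the terms that leave \<open>x\<close> untouched; in the others,
  associativity lets translation by \<open>x\<close> pass through the merging.\<close>

lemma inner_cob_inner_cob:
  assumes "x \<in> carrier G" "xs \<in> tuples G (Suc n)"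
  shows "inner_cob G (\<lambda>l. inner_cob G f (hd l) (tl l)) x xs = 0"
  using assms
proof (induction n arbitrary: f x xs)
  case 0
  then show ?case by (elim tuples_Suc_E) simp
next
  case (Suc n)
  obtain y ys where xs: "xs = y # ys" "y \<in> carrier G" "ys \<in> tuples G (Suc n)"
    using Suc.prems(2) by (rule tuples_Suc_E)
  obtain z zs where ys: "ys = z # zs" "z \<in> carrier G" "zs \<in> tuples G n"
    using xs(3) by (rule tuples_Suc_E)
  have "inner_cob G (\<lambda>l. inner_cob G f x l) y ys
      = inner_cob G (\<lambda>l. f ((x \<otimes> hd l) # tl l) - inner_cob G (\<lambda>l. f (x # l)) (hd l) (tl l)) y ys"
  proof (rule inner_cob_cong[OF _ xs(2,3)])
    show "inner_cob G f x l = f ((x \<otimes> hd l) # tl l) - inner_cob G (\<lambda>l. f (x # l)) (hd l) (tl l)"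
      if "l \<in> tuples G (Suc n)" for l
      using that by (elim tuples_Suc_E) simp
  qed
  also have "\<dots> = inner_cob G (\<lambda>l. f ((x \<otimes> hd l) # tl l)) y ys"
    using Suc.IH[OF xs(2,3), of "\<lambda>l. f (x # l)"] by (simp add: inner_cob_minus)
  also have "\<dots> = inner_cob G f (x \<otimes> y) ys"
    using ys xs Suc.prems(1) by (simp add: m_assoc)
  finally show ?case using xs ys by simp
qed

text \<open>\<open>cob\<close> differs from \<open>inner_cob\<close> by a term that drops the head.
  The cross terms cancel and \<open>inner_cob_inner_cob\<close> does the rest.\<close>

lemma cob_cob:
  assumes "xs \<in> tuples G (Suc (Suc n))"
  shows "cob G (cob G f) xs = 0"
proof -
  obtain x l where l: "xs = x # l" "x \<in> carrier G" "l \<in> tuples G (Suc n)"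
    using assms by (rule tuples_Suc_E)
  obtain y ys where "l = y # ys" "y \<in> carrier G" "ys \<in> tuples G n"
    using l(3) by (rule tuples_Suc_E)
  with l have xs: "xs = x # y # ys" "x \<in> carrier G" "y \<in> carrier G" "ys \<in> tuples G n" by simp_all
  have "inner_cob G (cob G f) x (y # ys)
      = inner_cob G (\<lambda>l. f (tl l)) x (y # ys) - inner_cob G (\<lambda>l. inner_cob G f (hd l) (tl l)) x (y # ys)"
    unfolding cob_def[abs_def] by (rule inner_cob_minus)
  also have "\<dots> = cob G f (y # ys)"
    using inner_cob_inner_cob[of x "y # ys" n f] xs by (simp add: inner_cob_tl del: inner_cob.simps)
  finally show ?thesis by (simp add: xs(1) cob_def[of G "cob G f"] del: cob_simps inner_cob.simps)
qed

end

subsection \<open>Cohomology classes\<close>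

lemma vectorspace_cochains: "vectorspace class_ring (cochains G n)"
proof -
  interpret vectorspace class_ring "module_vec TYPE(complex) 0" by (rule vec_vs)
  show ?thesis unfolding cochains_def by (rule func_space_is_vs)
qed

lemma cochains_simps [simp]:
  "carrier (cochains G n) = tuples G n \<rightarrow>\<^sub>E UNIV"
  "\<zero>\<^bsub>cochains G n\<^esub> = (\<lambda>xs\<in>tuples G n. 0)"
  "f \<oplus>\<^bsub>cochains G n\<^esub> g = (\<lambda>xs\<in>tuples G n. f xs + g xs)"
  "c \<odot>\<^bsub>cochains G n\<^esub> f = (\<lambda>xs\<in>tuples G n. c * f xs)"
proof -
  have R: "ring (class_ring :: complex ring)" by (rule class_ring.ring_axioms)
  show "carrier (cochains G n) = tuples G n \<rightarrow>\<^sub>E UNIV"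
    "\<zero>\<^bsub>cochains G n\<^esub> = (\<lambda>xs\<in>tuples G n. 0)"
    "f \<oplus>\<^bsub>cochains G n\<^esub> g = (\<lambda>xs\<in>tuples G n. f xs + g xs)"
    "c \<odot>\<^bsub>cochains G n\<^esub> f = (\<lambda>xs\<in>tuples G n. c * f xs)"
    by (simp_all add: cochains_def ring.func_space_def[OF R])
qed

definition is_cocycle :: "('g, 'm) monoid_scheme \<Rightarrow> nat \<Rightarrow> ('g list \<Rightarrow> complex) \<Rightarrow> bool" where
  "is_cocycle G n f \<longleftrightarrow> f \<in> tuples G n \<rightarrow>\<^sub>E UNIV \<and> (\<forall>xs\<in>tuples G (Suc n). cob G f xs = 0)"

text \<open>Equality is asked only on tuples, and the primitive may be any function, so that
  witnesses can be written down without restricting them. \<open>coboundaries_iff\<close> returns to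
  extensional cochains. In degree 0 only zero is a coboundary.\<close>

definition is_coboundary :: "('g, 'm) monoid_scheme \<Rightarrow> nat \<Rightarrow> ('g list \<Rightarrow> complex) \<Rightarrow> bool" where
  "is_coboundary G n f \<longleftrightarrow> (case n of 0 \<Rightarrow> \<forall>xs\<in>tuples G 0. f xs = 0
    | Suc m \<Rightarrow> \<exists>h. \<forall>xs\<in>tuples G n. f xs = cob G h xs)"

definition cocycles :: "('g, 'm) monoid_scheme \<Rightarrow> nat \<Rightarrow> (complex, 'g list \<Rightarrow> complex) module" where
  "cocycles G n = (cochains G n)\<lparr>carrier := {f. is_cocycle G n f}\<rparr>"

abbreviation coboundaries :: "('g, 'm) monoid_scheme \<Rightarrow> nat \<Rightarrow> ('g list \<Rightarrow> complex) set" where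
  "coboundaries G n \<equiv> boundaries (cochains G) (coboundary G) n"

lemma cocycle_kernel: "a_kernel (cochains G n) (cochains G (Suc n)) (coboundary G n) = {f. is_cocycle G n f}"
  by (auto simp: a_kernel_def kernel_def is_cocycle_def coboundary_restrict fun_eq_iff)

lemma group_cohomology_eq: "group_cohomology G n = quotient_module (cocycles G n) (coboundaries G n)"
  by (simp add: group_cohomology_def cohomology_of_complex_def cocycle_kernel cocycles_def)

context group
begin

lemma coboundaries_iff: "f \<in> coboundaries G n \<longleftrightarrow> f \<in> tuples G n \<rightarrow>\<^sub>E UNIV \<and> is_coboundary G n f"
proof (cases n)
  case 0
  then show ?thesis by (auto simp: is_coboundary_def fun_eq_iff PiE_iff extensional_def)
next
  case (Suc m)
  have "is_coboundary G n f \<longleftrightarrow> (\<exists>h\<in>tuples G m \<rightarrow>\<^sub>E UNIV. \<forall>xs\<in>tuples G n. f xs = cob G h xs)"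
  proof
    assume "is_coboundary G n f"
    then obtain h where "\<forall>xs\<in>tuples G n. f xs = cob G h xs" by (auto simp: is_coboundary_def Suc)
    then have "\<forall>xs\<in>tuples G n. f xs = cob G (restrict h (tuples G m)) xs"
      using cob_cong[of m h "restrict h (tuples G m)"] Suc by simp
    then show "\<exists>h\<in>tuples G m \<rightarrow>\<^sub>E UNIV. \<forall>xs\<in>tuples G n. f xs = cob G h xs"
      by (intro bexI[of _ "restrict h (tuples G m)"]) auto
  qed (auto simp: is_coboundary_def Suc)
  moreover have "f \<in> coboundaries G n \<longleftrightarrow> (\<exists>h\<in>tuples G m \<rightarrow>\<^sub>E UNIV. f = restrict (cob G h) (tuples G n))"
    by (auto simp: Suc coboundary_restrict)
  moreover have "f = restrict g (tuples G n) \<longleftrightarrow> f \<in> tuples G n \<rightarrow>\<^sub>E UNIV \<and> (\<forall>xs\<in>tuples G n. f xs = g xs)" for g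
    by (auto simp: fun_eq_iff PiE_iff extensional_def)
  ultimately show ?thesis by auto
qed

lemma cob_linear:
  "cob G (\<lambda>l. f l + g l) xs = cob G f xs + cob G g xs"
  "cob G (\<lambda>l. c * f l) xs = c * cob G f xs"
  "cob G (\<lambda>l. 0) xs = 0"
proof -
  show "cob G (\<lambda>l. f l + g l) xs = cob G f xs + cob G g xs" "cob G (\<lambda>l. c * f l) xs = c * cob G f xs"
    by (simp_all add: cob_def inner_cob_linear algebra_simps)
  have "inner_cob G (\<lambda>l. 0 :: complex) x ys = 0" for x ys by (induction ys arbitrary: x) simp_all
  then show "cob G (\<lambda>l. 0) xs = 0" by (simp add: cob_def)
qed

lemma cob_restrict: "xs \<in> tuples G (Suc n) \<Longrightarrow> cob G (restrict f (tuples G n)) xs = cob G f xs"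
  by (rule cob_cong[of n]) simp_all

lemma vectorspace_cocycles: "vectorspace class_ring (cocycles G n)"
  unfolding cocycles_def
proof (rule subspace_vectorspace, rule subspaceI[OF vectorspace_cochains])
  show "x \<oplus>\<^bsub>cochains G n\<^esub> y \<in> {f. is_cocycle G n f}" if "x \<in> {f. is_cocycle G n f}" "y \<in> {f. is_cocycle G n f}" for x y
    using that by (auto simp: is_cocycle_def cob_restrict cob_linear)
  show "c \<odot>\<^bsub>cochains G n\<^esub> x \<in> {f. is_cocycle G n f}" if "x \<in> {f. is_cocycle G n f}" for c x
    using that by (auto simp: is_cocycle_def cob_restrict cob_linear)
qed (auto simp: is_cocycle_def cob_restrict cob_linear)

lemma cocycles_simps [simp]:
  "carrier (cocycles G n) = {f. is_cocycle G n f}"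
  "\<zero>\<^bsub>cocycles G n\<^esub> = (\<lambda>xs\<in>tuples G n. 0)"
  "f \<oplus>\<^bsub>cocycles G n\<^esub> g = (\<lambda>xs\<in>tuples G n. f xs + g xs)"
  "c \<odot>\<^bsub>cocycles G n\<^esub> f = (\<lambda>xs\<in>tuples G n. c * f xs)"
  by (simp_all add: cocycles_def)

lemma coboundary_cocycle: "f \<in> coboundaries G n \<Longrightarrow> is_cocycle G n f"
proof (cases n)
  case 0
  then show "f \<in> coboundaries G n \<Longrightarrow> is_cocycle G n f"
    by (auto simp: is_cocycle_def cob_restrict cob_linear)
next
  case (Suc m)
  assume f: "f \<in> coboundaries G n"
  then obtain h where h: "\<forall>xs\<in>tuples G n. f xs = cob G h xs"
    unfolding coboundaries_iff is_coboundary_def Suc nat.case by blast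
  have "cob G f xs = 0" if "xs \<in> tuples G (Suc n)" for xs
    using that cob_cong[of n f "cob G h" xs] cob_cob[of xs m h] h Suc by simp
  then show "is_cocycle G n f" using f unfolding is_cocycle_def coboundaries_iff by blast
qed

lemma coboundaries_subspace: "VectorSpace.subspace class_ring (coboundaries G n) (cocycles G n)"
proof (rule subspaceI[OF vectorspace_cocycles])
  show "coboundaries G n \<subseteq> carrier (cocycles G n)" using coboundary_cocycle by auto
  show "\<zero>\<^bsub>cocycles G n\<^esub> \<in> coboundaries G n"
    by (auto simp: coboundaries_iff is_coboundary_def cob_linear intro!: exI[of _ "\<lambda>_. 0"] split: nat.split)
  show "x \<oplus>\<^bsub>cocycles G n\<^esub> y \<in> coboundaries G n" if xy: "x \<in> coboundaries G n" "y \<in> coboundaries G n" for x y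
  proof (cases n)
    case (Suc m)
    obtain h h' where "\<forall>xs\<in>tuples G n. x xs = cob G h xs" "\<forall>xs\<in>tuples G n. y xs = cob G h' xs"
      using xy unfolding coboundaries_iff is_coboundary_def Suc nat.case by blast
    then show ?thesis
      unfolding coboundaries_iff is_coboundary_def Suc nat.case
      by (auto simp: cob_linear intro!: exI[of _ "\<lambda>l. h l + h' l"])
  qed (use xy in \<open>auto simp: coboundaries_iff is_coboundary_def\<close>)
  show "c \<odot>\<^bsub>cocycles G n\<^esub> x \<in> coboundaries G n" if xy: "x \<in> coboundaries G n" for c x
  proof (cases n)
    case (Suc m)
    obtain h where "\<forall>xs\<in>tuples G n. x xs = cob G h xs"
      using xy unfolding coboundaries_iff is_coboundary_def Suc nat.case by blast
    then show ?thesis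
      unfolding coboundaries_iff is_coboundary_def Suc nat.case
      by (auto simp: cob_linear intro!: exI[of _ "\<lambda>l. c * h l"])
  qed (use xy in \<open>auto simp: coboundaries_iff is_coboundary_def\<close>)
qed

lemma coh_class_eq_coset: "coh_class G n f = coboundaries G n +>\<^bsub>cocycles G n\<^esub> f"
  by (simp add: coh_class_def a_r_coset_def r_coset_def)

lemmas cohomology_quotient =
  quotient_module[OF vectorspace_cocycles coboundaries_subspace, folded group_cohomology_eq coh_class_eq_coset]

lemma vectorspace_cohomology: "vectorspace class_ring (group_cohomology G n)"
  by (rule cohomology_quotient(1))

lemma carrier_cohomology: "carrier (group_cohomology G n) = coh_class G n ` {f. is_cocycle G n f}"
  using cohomology_quotient(3)[of n] by simp

lemma coh_class_zero: "\<zero>\<^bsub>group_cohomology G n\<^esub> = coboundaries G n"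
  by (rule cohomology_quotient(4))

lemma coh_class_eq_iff:
  assumes "is_cocycle G n f" "is_cocycle G n g"
  shows "coh_class G n f = coh_class G n g \<longleftrightarrow> is_coboundary G n (\<lambda>xs. f xs - g xs)"
proof -
  interpret vectorspace class_ring "cocycles G n" by (rule vectorspace_cocycles)
  have g: "g \<in> carrier (cocycles G n)" using assms by simp
  have neg: "\<ominus>\<^bsub>cocycles G n\<^esub> g = (-1) \<odot>\<^bsub>cocycles G n\<^esub> g"
    using smult_minus_1[OF g] by (simp add: class_ring_simps)
  have "coh_class G n f = coh_class G n g \<longleftrightarrow> (\<lambda>xs\<in>tuples G n. f xs - g xs) \<in> coboundaries G n"
    using cohomology_quotient(5)[of f n g] assms
    by (simp add: a_minus_def neg cong: restrict_cong)
  also have "\<dots> \<longleftrightarrow> is_coboundary G n (\<lambda>xs. f xs - g xs)"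
    by (auto simp: coboundaries_iff is_coboundary_def split: nat.split)
  finally show ?thesis .
qed

lemma coh_class_eq_zero_iff:
  "is_cocycle G n f \<Longrightarrow> coh_class G n f = coboundaries G n \<longleftrightarrow> is_coboundary G n f"
  using cohomology_quotient(6)[of f n] by (auto simp: coboundaries_iff is_cocycle_def)

lemma coh_class_add:
  "is_cocycle G n f \<Longrightarrow> is_cocycle G n g \<Longrightarrow>
    coh_class G n f \<oplus>\<^bsub>group_cohomology G n\<^esub> coh_class G n g = coh_class G n (\<lambda>xs\<in>tuples G n. f xs + g xs)"
proof -
  assume *: "is_cocycle G n f" "is_cocycle G n g"
  interpret linear_map class_ring "cocycles G n" "group_cohomology G n" "coh_class G n"
    by (rule cohomology_quotient(2))
  show ?thesis using T_add[of f g] * by simp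
qed

lemma coh_class_smult:
  "is_cocycle G n f \<Longrightarrow>
    c \<odot>\<^bsub>group_cohomology G n\<^esub> coh_class G n f = coh_class G n (\<lambda>xs\<in>tuples G n. c * f xs)"
proof -
  assume *: "is_cocycle G n f"
  interpret linear_map class_ring "cocycles G n" "group_cohomology G n" "coh_class G n"
    by (rule cohomology_quotient(2))
  show ?thesis using T_smult[of c f] * by simp
qed

end

section \<open>Presentations and their universal property\<close>

section \<open>Presented groups\<close>

lemma words_simps [simp]:
  "[] \<in> words X" "(a # w \<in> words X) = (fst a \<in> X \<and> w \<in> words X)"
  "(u @ v \<in> words X) = (u \<in> words X \<and> v \<in> words X)"
  by (auto simp: words_def mem_Times_iff)

lemma pres_cong_words: "pres_cong X R u v \<Longrightarrow> u \<in> words X \<and> v \<in> words X"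
  by (induction rule: pres_cong.induct) auto

lemma pres_class_eq_iff:
  "u \<in> words X \<Longrightarrow> v \<in> words X \<Longrightarrow> pres_class X R u = pres_class X R v \<longleftrightarrow> pres_cong X R u v"
  unfolding pres_class_def set_eq_iff mem_Collect_eq
  by (metis pres_cong.refl pres_cong.sym pres_cong.trans)

lemma mem_pres_class: "u \<in> pres_class X R w \<longleftrightarrow> pres_cong X R w u"
  by (simp add: pres_class_def)

text \<open>Concatenation respects the congruence, so every pair of representatives contributes the
  same class to the union.\<close>

lemma presented_group_mult:
  assumes "u \<in> words X" "v \<in> words X"
  shows "pres_class X R u \<otimes>\<^bsub>presented_group X R\<^esub> pres_class X R v = pres_class X R (u @ v)"
proof -
  have "pres_class X R (u' @ v') = pres_class X R (u @ v)"
    if "u' \<in> pres_class X R u" "v' \<in> pres_class X R v" for u' v'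
    using that pres_cong_words[of X R] assms
    by (subst pres_class_eq_iff) (auto simp: mem_pres_class intro: pres_cong.append pres_cong.sym)
  then have "pres_class X R u \<otimes>\<^bsub>presented_group X R\<^esub> pres_class X R v
      = (\<Union>u'\<in>pres_class X R u. \<Union>v'\<in>pres_class X R v. pres_class X R (u @ v))"
    by (simp add: presented_group_def)
  moreover have "u \<in> pres_class X R u" "v \<in> pres_class X R v"
    using assms by (simp_all add: mem_pres_class pres_cong.refl)
  ultimately show ?thesis by blast
qed

lemma carrier_presented_group: "carrier (presented_group X R) = pres_class X R ` words X"
  by (simp add: presented_group_def)

lemma one_presented_group: "\<one>\<^bsub>presented_group X R\<^esub> = pres_class X R []"
  by (simp add: presented_group_def)

definition inv_word :: "'a word \<Rightarrow> 'a word" where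
  "inv_word w = rev (map (\<lambda>(x, b). (x, \<not> b)) w)"

lemma inv_word_words [simp]: "w \<in> words X \<Longrightarrow> inv_word w \<in> words X"
  by (induction w) (auto simp: inv_word_def)

lemma inv_word_cancel: "w \<in> words X \<Longrightarrow> pres_cong X R (inv_word w @ w) []"
proof (induction w)
  case Nil
  show ?case by (simp add: inv_word_def pres_cong.refl)
next
  case (Cons a w)
  obtain x b where a: "a = (x, b)" by force
  have w: "w \<in> words X" and x: "x \<in> X" using Cons.prems a by auto
  have "pres_cong X R [(x, \<not> b), (x, b)] []"
    using pres_cong.cancel[OF x, of R "\<not> b"] by simp
  then have "pres_cong X R ([(x, \<not> b), (x, b)] @ w) ([] @ w)"
    by (rule pres_cong.append) (rule pres_cong.refl[OF w])
  then have "pres_cong X R (inv_word w @ ([(x, \<not> b), (x, b)] @ w)) (inv_word w @ ([] @ w))"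
    using w by (intro pres_cong.append[OF pres_cong.refl]) auto
  then show ?case using Cons.IH[OF w] a
    by (auto simp: inv_word_def intro: pres_cong.trans)
qed

theorem group_presented_group: "group (presented_group X R)"
proof (rule groupI)
  show "\<exists>y\<in>carrier (presented_group X R).
      y \<otimes>\<^bsub>presented_group X R\<^esub> x = \<one>\<^bsub>presented_group X R\<^esub>"
    if x: "x \<in> carrier (presented_group X R)" for x
  proof -
    obtain w where w: "w \<in> words X" "x = pres_class X R w"
      using x by (auto simp: carrier_presented_group)
    have "pres_class X R (inv_word w) \<otimes>\<^bsub>presented_group X R\<^esub> x = \<one>\<^bsub>presented_group X R\<^esub>"
      using w inv_word_cancel[of w X R]
      by (auto simp: presented_group_mult one_presented_group pres_class_eq_iff)
    then show ?thesis using w by (auto simp: carrier_presented_group)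
  qed
qed (auto simp: carrier_presented_group one_presented_group presented_group_mult)

definition pres_gen :: "'a set \<Rightarrow> ('a word \<times> 'a word) set \<Rightarrow> 'a \<Rightarrow> 'a word set" where
  "pres_gen X R x = pres_class X R [(x, True)]"

lemma pres_gen_closed [simp]: "x \<in> X \<Longrightarrow> pres_gen X R x \<in> carrier (presented_group X R)"
  by (simp add: pres_gen_def carrier_presented_group)

lemma inv_pres_gen:
  assumes "x \<in> X"
  shows "inv\<^bsub>presented_group X R\<^esub> (pres_gen X R x) = pres_class X R [(x, False)]"
proof -
  interpret group "presented_group X R" by (rule group_presented_group)
  have "pres_class X R [(x, False)] \<otimes>\<^bsub>presented_group X R\<^esub> pres_gen X R x = \<one>\<^bsub>presented_group X R\<^esub>"
    using assms pres_cong.cancel[of x X R False]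
    by (simp add: pres_gen_def presented_group_mult one_presented_group pres_class_eq_iff)
  then show ?thesis
    by (rule inv_equality) (use assms in \<open>auto simp: carrier_presented_group pres_gen_def\<close>)
qed

definition word_eval :: "('h, 'm) monoid_scheme \<Rightarrow> ('a \<Rightarrow> 'h) \<Rightarrow> 'a word \<Rightarrow> 'h" where
  "word_eval H \<phi> w = foldr (\<lambda>(x, b) h. (if b then \<phi> x else inv\<^bsub>H\<^esub> \<phi> x) \<otimes>\<^bsub>H\<^esub> h) w \<one>\<^bsub>H\<^esub>"

lemma word_eval_simps [simp]:
  "word_eval H \<phi> [] = \<one>\<^bsub>H\<^esub>"
  "word_eval H \<phi> ((x, b) # w) = (if b then \<phi> x else inv\<^bsub>H\<^esub> \<phi> x) \<otimes>\<^bsub>H\<^esub> word_eval H \<phi> w"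
  by (simp_all add: word_eval_def)

lemma positive_word_simps [simp]:
  "positive_word [] = []" "positive_word (x # xs) = (x, True) # positive_word xs"
  by (simp_all add: positive_word_def)

lemma positive_word_words [simp]: "positive_word xs \<in> words X \<longleftrightarrow> set xs \<subseteq> X"
  by (induction xs) auto

context group
begin

lemma word_eval_closed [simp]:
  "\<phi> \<in> X \<rightarrow> carrier G \<Longrightarrow> w \<in> words X \<Longrightarrow> word_eval G \<phi> w \<in> carrier G"
  by (induction w) (auto simp: Pi_iff)

lemma word_eval_append:
  "\<phi> \<in> X \<rightarrow> carrier G \<Longrightarrow> u \<in> words X \<Longrightarrow> v \<in> words X \<Longrightarrow>
    word_eval G \<phi> (u @ v) = word_eval G \<phi> u \<otimes> word_eval G \<phi> v"
proof (induction u)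
  case (Cons a u)
  then show ?case
    by (cases a) (auto simp: m_assoc Pi_iff word_eval_closed[of \<phi> X])
qed (auto simp: word_eval_closed[of \<phi> X])

lemma word_eval_cong:
  assumes "\<phi> \<in> X \<rightarrow> carrier G"
    and "\<And>u v. (u, v) \<in> R \<Longrightarrow> u \<in> words X \<Longrightarrow> v \<in> words X \<Longrightarrow> word_eval G \<phi> u = word_eval G \<phi> v"
    and "pres_cong X R u v"
  shows "word_eval G \<phi> u = word_eval G \<phi> v"
  using assms(3)
proof (induction rule: pres_cong.induct)
  case (append u u' v v')
  then show ?case
    using word_eval_append[OF assms(1)] pres_cong_words[of X R] by metis
next
  case (cancel x b)
  have "\<phi> x \<in> carrier G" using assms(1) cancel by auto
  then show ?case by auto
qed (use assms(2) in auto)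

text \<open>Von Dyck's theorem. The map evaluates an arbitrary representative; by
  \<open>word_eval_cong\<close> the choice is immaterial.\<close>

theorem presented_group_hom:
  assumes "\<phi> \<in> X \<rightarrow> carrier G"
    and "\<And>u v. (u, v) \<in> R \<Longrightarrow> u \<in> words X \<Longrightarrow> v \<in> words X \<Longrightarrow> word_eval G \<phi> u = word_eval G \<phi> v"
  obtains f where "f \<in> hom (presented_group X R) G"
    and "\<And>w. w \<in> words X \<Longrightarrow> f (pres_class X R w) = word_eval G \<phi> w"
    and "\<And>x. x \<in> X \<Longrightarrow> f (pres_gen X R x) = \<phi> x"
proof
  let ?f = "\<lambda>A. word_eval G \<phi> (SOME w. w \<in> A)"
  have val: "?f (pres_class X R w) = word_eval G \<phi> w" if "w \<in> words X" for w
  proof -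
    have "w \<in> pres_class X R w"
      using that by (simp add: mem_pres_class pres_cong.refl)
    then have "(SOME v. v \<in> pres_class X R w) \<in> pres_class X R w"
      by (rule someI)
    then have "pres_cong X R w (SOME v. v \<in> pres_class X R w)"
      by (simp only: mem_pres_class)
    from word_eval_cong[OF assms this] show ?thesis by simp
  qed
  show "?f \<in> hom (presented_group X R) G"
  proof (rule homI)
    fix A B
    assume "A \<in> carrier (presented_group X R)" "B \<in> carrier (presented_group X R)"
    then obtain u v where "u \<in> words X" "v \<in> words X" "A = pres_class X R u" "B = pres_class X R v"
      by (auto simp: carrier_presented_group)
    then show "?f (A \<otimes>\<^bsub>presented_group X R\<^esub> B) = ?f A \<otimes> ?f B"
      by (simp add: presented_group_mult val word_eval_append[OF assms(1)])
  qed (use val word_eval_closed[OF assms(1)] in \<open>auto simp: carrier_presented_group\<close>)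
  show "?f (pres_class X R w) = word_eval G \<phi> w" if "w \<in> words X" for w
    using that by (rule val)
  show "?f (pres_gen X R x) = \<phi> x" if "x \<in> X" for x
  proof -
    have "\<phi> x \<in> carrier G" using assms(1) that by auto
    then show ?thesis using that val[of "[(x, True)]"] by (simp add: pres_gen_def)
  qed
qed

end

lemma pres_class_eq_word_eval:
  "w \<in> words X \<Longrightarrow> pres_class X R w = word_eval (presented_group X R) (pres_gen X R) w"
proof (induction w)
  case (Cons a w)
  obtain x b where a: "a = (x, b)" by force
  have "pres_class X R (a # w) = pres_class X R [a] \<otimes>\<^bsub>presented_group X R\<^esub> pres_class X R w"
    using Cons.prems by (subst presented_group_mult) auto
  moreover have "pres_class X R [a] = (if b then pres_gen X R x else inv\<^bsub>presented_group X R\<^esub> pres_gen X R x)"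
    using Cons.prems a by (simp add: inv_pres_gen) (simp add: pres_gen_def)
  ultimately show ?case using Cons a by simp
qed (simp add: one_presented_group)

lemma presented_group_rel:
  assumes "(u, v) \<in> R" "u \<in> words X" "v \<in> words X"
  shows "word_eval (presented_group X R) (pres_gen X R) u
    = word_eval (presented_group X R) (pres_gen X R) v"
proof -
  have "pres_class X R u = pres_class X R v"
    using assms by (simp add: pres_class_eq_iff pres_cong.rel)
  then show ?thesis using assms by (simp add: pres_class_eq_word_eval)
qed

lemma presented_group_induct [consumes 1, case_names one gen inv_gen]:
  assumes "g \<in> carrier (presented_group X R)"
    and "P \<one>\<^bsub>presented_group X R\<^esub>"
    and "\<And>x h. x \<in> X \<Longrightarrow> h \<in> carrier (presented_group X R) \<Longrightarrow> P h \<Longrightarrow>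
      P (pres_gen X R x \<otimes>\<^bsub>presented_group X R\<^esub> h)"
    and "\<And>x h. x \<in> X \<Longrightarrow> h \<in> carrier (presented_group X R) \<Longrightarrow> P h \<Longrightarrow>
      P (inv\<^bsub>presented_group X R\<^esub> (pres_gen X R x) \<otimes>\<^bsub>presented_group X R\<^esub> h)"
  shows "P g"
proof -
  interpret group "presented_group X R" by (rule group_presented_group)
  have gens: "pres_gen X R \<in> X \<rightarrow> carrier (presented_group X R)" by auto
  have "w \<in> words X \<Longrightarrow> P (word_eval (presented_group X R) (pres_gen X R) w)" for w
  proof (induction w)
    case (Cons a w)
    then show ?case
      using assms(3,4) word_eval_closed[OF gens] by (cases a) auto
  qed (use assms(2) in auto)
  moreover obtain w where "w \<in> words X" "g = pres_class X R w"
    using assms(1) by (auto simp: carrier_presented_group)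
  ultimately show ?thesis by (simp add: pres_class_eq_word_eval)
qed

lemma presented_group_subset:
  assumes "subgroup S (presented_group X R)" "\<And>x. x \<in> X \<Longrightarrow> pres_gen X R x \<in> S"
  shows "carrier (presented_group X R) \<subseteq> S"
proof
  show "g \<in> S" if "g \<in> carrier (presented_group X R)" for g
    using that
    by (induction rule: presented_group_induct)
      (auto simp: subgroup.one_closed[OF assms(1)] assms(2) subgroup.m_closed[OF assms(1)]
        subgroup.m_inv_closed[OF assms(1)])
qed

lemma presented_group_hom_eq:
  assumes "group H" "f \<in> hom (presented_group X R) H" "f' \<in> hom (presented_group X R) H"
    and "\<And>x. x \<in> X \<Longrightarrow> f (pres_gen X R x) = f' (pres_gen X R x)"
    and "g \<in> carrier (presented_group X R)"
  shows "f g = f' g"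
proof -
  interpret G: group "presented_group X R" by (rule group_presented_group)
  interpret f: group_hom "presented_group X R" H f
    using assms(1,2) by (simp add: group_hom_def group_hom_axioms_def G.is_group)
  interpret f': group_hom "presented_group X R" H f'
    using assms(1,3) by (simp add: group_hom_def group_hom_axioms_def G.is_group)
  from assms(5) show ?thesis
    by (induction rule: presented_group_induct) (auto simp: assms(4))
qed

section \<open>A rewriting calculus for F3 x| F2\<close>

section \<open>The group \<open>F\<^sub>3 \<rtimes> F\<^sub>2\<close>\<close>

text \<open>\<open>p\<close> fixes \<open>x1\<close> and \<open>x3\<close> and acts on
  \<open>x2\<close> as conjugation by \<open>x3 x1\<close>; \<open>q\<close> fixes \<open>x1\<close>
  and \<open>x2\<close> and acts on \<open>x3\<close> as conjugation by \<open>x1 x2\<close>. The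
  relations are written between positive words, so that no inverse has to be computed when they are
  verified in a concrete group.\<close>

definition f3f2_rels :: "('a, 'm) monoid_scheme \<Rightarrow> 'a \<Rightarrow> 'a \<Rightarrow> 'a \<Rightarrow> 'a \<Rightarrow> 'a \<Rightarrow> bool" where
  "f3f2_rels G x1 x2 x3 p q \<longleftrightarrow>
    {x1, x2, x3, p, q} \<subseteq> carrier G \<and>
    p \<otimes>\<^bsub>G\<^esub> x1 = x1 \<otimes>\<^bsub>G\<^esub> p \<and> p \<otimes>\<^bsub>G\<^esub> x3 = x3 \<otimes>\<^bsub>G\<^esub> p \<and>
    p \<otimes>\<^bsub>G\<^esub> (x2 \<otimes>\<^bsub>G\<^esub> (x3 \<otimes>\<^bsub>G\<^esub> x1)) = x3 \<otimes>\<^bsub>G\<^esub> (x1 \<otimes>\<^bsub>G\<^esub> (x2 \<otimes>\<^bsub>G\<^esub> p)) \<and>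
    q \<otimes>\<^bsub>G\<^esub> x1 = x1 \<otimes>\<^bsub>G\<^esub> q \<and> q \<otimes>\<^bsub>G\<^esub> x2 = x2 \<otimes>\<^bsub>G\<^esub> q \<and>
    q \<otimes>\<^bsub>G\<^esub> (x3 \<otimes>\<^bsub>G\<^esub> (x1 \<otimes>\<^bsub>G\<^esub> x2)) = x1 \<otimes>\<^bsub>G\<^esub> (x2 \<otimes>\<^bsub>G\<^esub> (x3 \<otimes>\<^bsub>G\<^esub> q))"

context group
begin

lemma mult_tail:
  "a \<otimes> b = d \<Longrightarrow> a \<in> carrier G \<Longrightarrow> b \<in> carrier G \<Longrightarrow> y \<in> carrier G \<Longrightarrow> a \<otimes> (b \<otimes> y) = d \<otimes> y"
  by (simp add: m_assoc[symmetric])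

lemma inv_cancel_tail [simp]:
  "a \<in> carrier G \<Longrightarrow> y \<in> carrier G \<Longrightarrow> a \<otimes> (inv a \<otimes> y) = y"
  "a \<in> carrier G \<Longrightarrow> y \<in> carrier G \<Longrightarrow> inv a \<otimes> (a \<otimes> y) = y"
  by (simp_all add: m_assoc[symmetric])

text \<open>Since \<open>a\<close> commutes with \<open>c\<close> and conjugates \<open>b\<close> in
  the same way as \<open>c\<close> does, each of \<open>a\<close> and its inverse can be moved to
  the right of \<open>b\<close> and its inverse at the price of conjugating by \<open>c\<close> or
  its inverse. These are the rewrite rules for \<open>p\<close> past \<open>x2\<close> and
  \<open>q\<close> past \<open>x3\<close>.\<close>

lemma twisted_commute:
  assumes "a \<in> carrier G" "b \<in> carrier G" "c \<in> carrier G"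
    and ac: "a \<otimes> c = c \<otimes> a" and ab: "a \<otimes> (b \<otimes> c) = c \<otimes> (b \<otimes> a)"
  shows "a \<otimes> b = c \<otimes> (b \<otimes> (inv c \<otimes> a))" "a \<otimes> inv b = c \<otimes> (inv b \<otimes> (inv c \<otimes> a))"
    "inv a \<otimes> b = inv c \<otimes> (b \<otimes> (c \<otimes> inv a))" "inv a \<otimes> inv b = inv c \<otimes> (inv b \<otimes> (c \<otimes> inv a))"
proof -
  have ac': "inv c \<otimes> a = a \<otimes> inv c" "inv a \<otimes> c = c \<otimes> inv a"
    using assms(1-3) ac by (metis inv_closed inv_solve_left inv_solve_right m_assoc m_closed)+
  have 1: "a \<otimes> b = c \<otimes> b \<otimes> a \<otimes> inv c"
    using assms by (simp add: m_assoc[symmetric] inv_solve_right)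
  show 2: "a \<otimes> b = c \<otimes> (b \<otimes> (inv c \<otimes> a))"
    using assms(1-3) by (simp add: 1 ac' m_assoc)
  have conj: "a \<otimes> b \<otimes> inv a = c \<otimes> b \<otimes> inv c"
    using assms(1-3) by (simp add: 2 m_assoc)
  then have "inv (a \<otimes> b \<otimes> inv a) = inv (c \<otimes> b \<otimes> inv c)" by simp
  then have 3: "a \<otimes> inv b \<otimes> inv a = c \<otimes> inv b \<otimes> inv c"
    using assms(1-3) by (simp add: inv_mult_group m_assoc)
  show "a \<otimes> inv b = c \<otimes> (inv b \<otimes> (inv c \<otimes> a))"
    using assms(1-3) 3 by (metis inv_closed inv_solve_right m_assoc m_closed inv_inv)
  have comm: "inv a \<otimes> (c \<otimes> z) = c \<otimes> (inv a \<otimes> z)" "inv a \<otimes> (inv c \<otimes> z) = inv c \<otimes> (inv a \<otimes> z)"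
    if "z \<in> carrier G" for z
  proof -
    have "inv a \<otimes> inv c = inv c \<otimes> inv a"
      using ac assms(1-3) by (metis inv_mult_group)
    then show "inv a \<otimes> (inv c \<otimes> z) = inv c \<otimes> (inv a \<otimes> z)"
      using assms(1-3) that by (simp add: m_assoc[symmetric])
    show "inv a \<otimes> (c \<otimes> z) = c \<otimes> (inv a \<otimes> z)"
      using assms(1-3) that ac' by (simp add: m_assoc[symmetric])
  qed
  have "b \<otimes> inv a = inv a \<otimes> (a \<otimes> b \<otimes> inv a)" using assms(1-3) by (simp add: m_assoc)
  also have "\<dots> = c \<otimes> (inv a \<otimes> (b \<otimes> inv c))" using assms(1-3) by (simp add: conj m_assoc comm)
  finally have "inv c \<otimes> (b \<otimes> inv a) = inv a \<otimes> (b \<otimes> inv c)" using assms(1-3) by simp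
  then have "inv c \<otimes> (b \<otimes> inv a) \<otimes> c = inv a \<otimes> (b \<otimes> inv c) \<otimes> c" by simp
  then show "inv a \<otimes> b = inv c \<otimes> (b \<otimes> (c \<otimes> inv a))"
    using assms(1-3) by (simp add: m_assoc ac')
  have "inv b \<otimes> inv a = inv a \<otimes> (a \<otimes> inv b \<otimes> inv a)" using assms(1-3) by (simp add: m_assoc)
  also have "\<dots> = c \<otimes> (inv a \<otimes> (inv b \<otimes> inv c))" using assms(1-3) by (simp add: 3 m_assoc comm)
  finally have "inv c \<otimes> (inv b \<otimes> inv a) = inv a \<otimes> (inv b \<otimes> inv c)" using assms(1-3) by simp
  then have "inv c \<otimes> (inv b \<otimes> inv a) \<otimes> c = inv a \<otimes> (inv b \<otimes> inv c) \<otimes> c" by simp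
  then show "inv a \<otimes> inv b = inv c \<otimes> (inv b \<otimes> (c \<otimes> inv a))"
    using assms(1-3) by (simp add: m_assoc ac')
qed

lemma commute_inv:
  assumes "a \<in> carrier G" "b \<in> carrier G" and ab: "a \<otimes> b = b \<otimes> a"
  shows "a \<otimes> inv b = inv b \<otimes> a" "inv a \<otimes> b = b \<otimes> inv a" "inv a \<otimes> inv b = inv b \<otimes> inv a"
  using twisted_commute[of a b \<one>] assms by simp_all

end

locale f3f2 = group +
  fixes x1 x2 x3 p q
  assumes rels: "f3f2_rels G x1 x2 x3 p q"
begin

lemma closed [simp]:
  "x1 \<in> carrier G" "x2 \<in> carrier G" "x3 \<in> carrier G" "p \<in> carrier G" "q \<in> carrier G"
  using rels by (auto simp: f3f2_rels_def)

lemma commute: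
  "p \<otimes> x1 = x1 \<otimes> p" "p \<otimes> x3 = x3 \<otimes> p" "q \<otimes> x1 = x1 \<otimes> q" "q \<otimes> x2 = x2 \<otimes> q"
  using rels by (auto simp: f3f2_rels_def)

lemma p_x31: "p \<otimes> (x3 \<otimes> x1) = (x3 \<otimes> x1) \<otimes> p"
  using commute by (metis m_assoc closed)

lemma q_x12: "q \<otimes> (x1 \<otimes> x2) = (x1 \<otimes> x2) \<otimes> q"
  using commute by (metis m_assoc closed)

lemma p_x2: "p \<otimes> (x2 \<otimes> (x3 \<otimes> x1)) = (x3 \<otimes> x1) \<otimes> (x2 \<otimes> p)"
  using rels by (simp add: f3f2_rels_def m_assoc)

lemma q_x3: "q \<otimes> (x3 \<otimes> (x1 \<otimes> x2)) = (x1 \<otimes> x2) \<otimes> (x3 \<otimes> q)"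
  using rels by (simp add: f3f2_rels_def m_assoc)

lemmas move =
  commute(1) commute_inv[OF _ _ commute(1), OF closed(4,1)]
  commute(2) commute_inv[OF _ _ commute(2), OF closed(4,3)]
  commute(3) commute_inv[OF _ _ commute(3), OF closed(5,1)]
  commute(4) commute_inv[OF _ _ commute(4), OF closed(5,2)]
  twisted_commute[OF closed(4,2) _ p_x31 p_x2, OF m_closed, OF closed(3,1)]
  twisted_commute[OF closed(5,3) _ q_x12 q_x3, OF m_closed, OF closed(1,2)]

text \<open>A terminating and confluent rewrite system that moves \<open>p\<close> and \<open>q\<close> to the right.\<close>

lemmas nf = move move[THEN mult_tail] m_assoc inv_mult_group

text \<open>This tuple and the next two are the conjugates of the generators by the three standard
  generators of B4, computed in P4 modulo its center and expressed in the generators again. That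
  they satisfy the relations makes them endomorphisms; see \<open>braid_action\<close>.\<close>

lemma rels_c1: "f3f2_rels G x1 (inv (x3 \<otimes> (x1 \<otimes> x2))) x3 p (inv q \<otimes> (x1 \<otimes> inv p))"
  by (simp add: f3f2_rels_def nf)

lemma rels_c2: "f3f2_rels G x2 (inv x2 \<otimes> (x1 \<otimes> x2)) x3 (inv p \<otimes> (x3 \<otimes> (inv q \<otimes> (x1 \<otimes> x2)))) q"
  by (simp add: f3f2_rels_def nf)

lemma rels_c3: "f3f2_rels G x1 (inv x2 \<otimes> (inv x1 \<otimes> q)) (inv x3 \<otimes> (p \<otimes> inv x1)) p q"
  by (simp add: f3f2_rels_def nf)

lemma rels_hom:
  assumes "group_hom G H f"
  shows "f3f2_rels H (f x1) (f x2) (f x3) (f p) (f q)"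
proof -
  interpret f: group_hom G H f by fact
  show ?thesis using rels unfolding f3f2_rels_def
    by (simp add: f.hom_mult[symmetric] del: f.hom_mult)
qed

end

section \<open>Free groups through reduced words\<close>

section \<open>Free groups have trivial center\<close>

definition inv_letter :: "'a \<times> bool \<Rightarrow> 'a \<times> bool" where
  "inv_letter a = (fst a, \<not> snd a)"

fun reduced :: "'a word \<Rightarrow> bool" where
  "reduced (a # b # w) \<longleftrightarrow> b \<noteq> inv_letter a \<and> reduced (b # w)"
| "reduced w \<longleftrightarrow> True"

fun cons_red :: "'a \<times> bool \<Rightarrow> 'a word \<Rightarrow> 'a word" where
  "cons_red a (b # w) = (if b = inv_letter a then w else a # b # w)"
| "cons_red a [] = [a]"

lemma inv_letter_simps [simp]: "inv_letter (inv_letter a) = a" "inv_letter a \<noteq> a" "a \<noteq> inv_letter a"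
  by (cases a; simp add: inv_letter_def)+

lemma reduced_tl: "reduced (a # w) \<Longrightarrow> reduced w"
  by (cases w) auto

lemma reduced_cons_red: "reduced w \<Longrightarrow> reduced (cons_red a w)"
  by (cases w) (auto dest: reduced_tl)

lemma cons_red_inv: "reduced w \<Longrightarrow> cons_red a (cons_red (inv_letter a) w) = w"
  by (cases w rule: reduced.cases) auto

lemma reduced_foldr: "reduced w \<Longrightarrow> reduced (foldr cons_red u w)"
  by (induction u) (auto intro: reduced_cons_red)

text \<open>Van der Waerden's argument: letters act on reduced words by \<open>cons_red\<close>,
  inverse letters act inversely, so congruent words act equally. Acting on the empty word gives a
  unique reduced form without any confluence argument.\<close>

lemma foldr_cons_red_cong:
  "pres_cong X {} u v \<Longrightarrow> reduced w \<Longrightarrow> foldr cons_red u w = foldr cons_red v w"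
proof (induction arbitrary: w rule: pres_cong.induct)
  case (append u u' v v')
  then show ?case by (simp add: reduced_foldr)
next
  case (cancel x b)
  then show ?case using cons_red_inv[of w "(x, b)"] by (simp add: inv_letter_def)
qed auto

lemma cons_red_words: "fst a \<in> X \<Longrightarrow> w \<in> words X \<Longrightarrow> cons_red a w \<in> words X"
  by (cases w) auto

lemma pres_cong_cons_red:
  assumes "fst a \<in> X" "w \<in> words X"
  shows "pres_cong X R (a # w) (cons_red a w)"
proof (cases "\<exists>w'. w = inv_letter a # w'")
  case True
  then obtain w' where w: "w = inv_letter a # w'" by auto
  have "pres_cong X R ([a, inv_letter a] @ w') ([] @ w')"
    using pres_cong.cancel[of "fst a" X R "snd a"] assms w
    by (intro pres_cong.append pres_cong.refl) (auto simp: inv_letter_def)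
  then show ?thesis using w by simp
next
  case False
  then have "cons_red a w = a # w" by (cases w) auto
  then show ?thesis using assms by (simp add: pres_cong.refl)
qed

lemma pres_cong_foldr: "w \<in> words X \<Longrightarrow>
  foldr cons_red w [] \<in> words X \<and> pres_cong X R w (foldr cons_red w [])"
proof (induction w)
  case (Cons a w)
  then have "pres_cong X R ([a] @ w) ([a] @ foldr cons_red w [])"
    by (intro pres_cong.append[OF pres_cong.refl]) auto
  then show ?case using Cons
    by (auto intro: pres_cong.trans pres_cong_cons_red cons_red_words)
qed (simp add: pres_cong.refl)

lemma foldr_cons_red_reduced: "reduced w \<Longrightarrow> foldr cons_red w [] = w"
proof (induction w)
  case (Cons a w)
  then show ?case by (cases w) (auto dest: reduced_tl)
qed simp

lemma foldr_cons_red_snoc: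
  "reduced w \<Longrightarrow> w \<noteq> [] \<Longrightarrow>
    foldr cons_red w [c] = (if last w = inv_letter c then butlast w else w @ [c])"
proof (induction w)
  case (Cons a w)
  show ?case
  proof (cases w)
    case Nil
    then show ?thesis by auto
  next
    case (Cons b w')
    then have "foldr cons_red w [c] = (if last w = inv_letter c then butlast w else w @ [c])"
      using Cons.IH Cons.prems reduced_tl by blast
    then show ?thesis using Cons Cons.prems by (cases w') auto
  qed
qed simp

text \<open>Let \<open>r\<close> be the reduced form of \<open>g\<close> and \<open>y\<close> a
  letter other than the first one of \<open>r\<close>. Then \<open>y r\<close> is reduced and starts
  with \<open>y\<close>, whereas the reduced form of \<open>r y\<close> either starts like
  \<open>r\<close> or is shorter than \<open>r\<close>.\<close>

lemma free_group_center_trivial: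
  assumes X: "\<And>x. x \<in> X \<Longrightarrow> \<exists>y\<in>X. y \<noteq> x"
    and g: "g \<in> carrier (presented_group X {})"
    and comm: "\<And>y. y \<in> X \<Longrightarrow> pres_gen X {} y \<otimes>\<^bsub>presented_group X {}\<^esub> g = g \<otimes>\<^bsub>presented_group X {}\<^esub> pres_gen X {} y"
  shows "g = \<one>\<^bsub>presented_group X {}\<^esub>"
proof -
  obtain w where "w \<in> words X" "g = pres_class X {} w"
    using g by (auto simp: carrier_presented_group)
  then obtain r where r: "r \<in> words X" "g = pres_class X {} r" "reduced r"
    using pres_cong_foldr[of w X "{}"] reduced_foldr[of "[]" w]
    by (metis pres_class_eq_iff reduced.simps(2))
  have "r = []"
  proof (rule ccontr)
    assume "r \<noteq> []"
    then obtain a r' where r': "r = a # r'" by (cases r) auto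
    then obtain y where y: "y \<in> X" "y \<noteq> fst a" using X r by auto
    let ?c = "(y, True)"
    have "pres_class X {} ([?c] @ r) = pres_class X {} (r @ [?c])"
      using comm[OF y(1)] r y by (simp add: pres_gen_def presented_group_mult)
    then have "pres_cong X {} ([?c] @ r) (r @ [?c])"
      using r y by (subst pres_class_eq_iff[symmetric]) auto
    then have "foldr cons_red ([?c] @ r) [] = foldr cons_red (r @ [?c]) []"
      by (rule foldr_cons_red_cong) simp
    then have "cons_red ?c (foldr cons_red r []) = foldr cons_red r [?c]" by simp
    moreover have "cons_red ?c (foldr cons_red r []) = ?c # r"
      using r' y r(3) by (simp add: foldr_cons_red_reduced inv_letter_def del: foldr.simps)
        (auto simp: inv_letter_def)
    ultimately have "?c # r = (if last r = inv_letter ?c then butlast r else r @ [?c])"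
      using foldr_cons_red_snoc[of r ?c] r(3) \<open>r \<noteq> []\<close> by simp
    then show False using r' y by (auto simp: inv_letter_def split: if_splits)
  qed
  then show ?thesis using r by (simp add: one_presented_group)
qed

section \<open>The presented group \<open>F\<^sub>3 \<rtimes> F\<^sub>2\<close> and its center\<close>

datatype f3f2_letter = X1 | X2 | X3 | P | Q

definition f3f2_rel_words :: "(f3f2_letter word \<times> f3f2_letter word) set" where
  "f3f2_rel_words = (\<lambda>(u, v). (positive_word u, positive_word v)) `
    {([P, X1], [X1, P]), ([P, X3], [X3, P]), ([P, X2, X3, X1], [X3, X1, X2, P]),
     ([Q, X1], [X1, Q]), ([Q, X2], [X2, Q]), ([Q, X3, X1, X2], [X1, X2, X3, Q])}"

abbreviation f3f2_group :: "f3f2_letter word set monoid" where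
  "f3f2_group \<equiv> presented_group UNIV f3f2_rel_words"

abbreviation f3f2_gen :: "f3f2_letter \<Rightarrow> f3f2_letter word set" where
  "f3f2_gen \<equiv> pres_gen UNIV f3f2_rel_words"

lemma hom_group_hom: "group G \<Longrightarrow> group H \<Longrightarrow> f \<in> hom G H \<Longrightarrow> group_hom G H f"
  by (simp add: group_hom_def group_hom_axioms_def)

lemma f3f2_group_hom:
  assumes "group H" "f3f2_rels H a b c d e"
  obtains f where "group_hom f3f2_group H f"
    "f (f3f2_gen X1) = a" "f (f3f2_gen X2) = b" "f (f3f2_gen X3) = c"
    "f (f3f2_gen P) = d" "f (f3f2_gen Q) = e"
proof -
  interpret H: group H by fact
  let ?\<phi> = "case_f3f2_letter a b c d e"
  have closed: "?\<phi> \<in> UNIV \<rightarrow> carrier H"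
    using assms(2) by (auto simp: f3f2_rels_def split: f3f2_letter.split)
  have rel: "word_eval H ?\<phi> u = word_eval H ?\<phi> v" if "(u, v) \<in> f3f2_rel_words" for u v
    using that assms(2) by (auto simp: f3f2_rel_words_def f3f2_rels_def)
  obtain f where f: "f \<in> hom f3f2_group H" "\<And>x. f (f3f2_gen x) = ?\<phi> x"
    using H.presented_group_hom[OF closed rel] by (metis UNIV_I)
  show thesis
    by (rule that[OF hom_group_hom[OF group_presented_group assms(1) f(1)]]) (simp_all add: f(2))
qed

lemma f3f2_group_rels:
  "f3f2_rels f3f2_group (f3f2_gen X1) (f3f2_gen X2) (f3f2_gen X3) (f3f2_gen P) (f3f2_gen Q)"
proof -
  interpret group f3f2_group by (rule group_presented_group)
  have rel: "word_eval f3f2_group f3f2_gen (positive_word u) = word_eval f3f2_group f3f2_gen (positive_word v)"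
    if "(u, v) \<in> {([P, X1], [X1, P]), ([P, X3], [X3, P]), ([P, X2, X3, X1], [X3, X1, X2, P]),
     ([Q, X1], [X1, Q]), ([Q, X2], [X2, Q]), ([Q, X3, X1, X2], [X1, X2, X3, Q])}" for u v
    by (rule presented_group_rel)
      (use that in \<open>auto simp only: f3f2_rel_words_def image_iff positive_word_words split_beta\<close>, auto)
  show ?thesis
    using rel[of "[P, X1]"] rel[of "[P, X3]"] rel[of "[P, X2, X3, X1]"]
      rel[of "[Q, X1]"] rel[of "[Q, X2]"] rel[of "[Q, X3, X1, X2]"]
    by (simp add: f3f2_rels_def)
qed

interpretation SD: f3f2 f3f2_group "f3f2_gen X1" "f3f2_gen X2" "f3f2_gen X3" "f3f2_gen P" "f3f2_gen Q"
  by (intro f3f2.intro group_presented_group f3f2_axioms.intro f3f2_group_rels)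

lemma free_group_hom:
  assumes "group H" "\<phi> \<in> X \<rightarrow> carrier H"
  obtains f where "group_hom (presented_group X {}) H f"
    "\<And>x. x \<in> X \<Longrightarrow> f (pres_gen X {} x) = \<phi> x"
proof -
  obtain f where "f \<in> hom (presented_group X {}) H" "\<And>x. x \<in> X \<Longrightarrow> f (pres_gen X {} x) = \<phi> x"
    using group.presented_group_hom[OF assms(1,2), of "{}"] by blast
  then show thesis
    using that hom_group_hom[OF group_presented_group assms(1)] by blast
qed

lemma free_group_endo_cancel:
  assumes "group_hom (presented_group X R) (presented_group X R) f"
    "group_hom (presented_group X R) (presented_group X R) f'"
    and "\<And>x. x \<in> X \<Longrightarrow> f (f' (pres_gen X R x)) = pres_gen X R x"
    and "g \<in> carrier (presented_group X R)"
  shows "f (f' g) = g"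
proof -
  interpret f: group_hom "presented_group X R" "presented_group X R" f by fact
  interpret f': group_hom "presented_group X R" "presented_group X R" f' by fact
  show ?thesis
    using assms(4)
    by (induction rule: presented_group_induct) (auto simp: assms(3))
qed

lemma BijGroup_mult:
  "f \<in> Bij S \<Longrightarrow> g \<in> Bij S \<Longrightarrow> f \<otimes>\<^bsub>BijGroup S\<^esub> g = compose S f g"
  by (simp add: BijGroup_def)

lemma BijI:
  assumes "\<And>x. x \<in> S \<Longrightarrow> f x \<in> S" "\<And>x. x \<in> S \<Longrightarrow> f' x \<in> S"
    and "\<And>x. x \<in> S \<Longrightarrow> f' (f x) = x" "\<And>x. x \<in> S \<Longrightarrow> f (f' x) = x"
  shows "restrict f S \<in> Bij S"
  unfolding Bij_def using bij_betw_byWitness[of S f' f S] assms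
  by (auto simp: bij_betw_restrict_eq)

lemma Bij_mult_eqI:
  assumes "f \<in> Bij S" "g \<in> Bij S" "f' \<in> Bij S" "g' \<in> Bij S"
    and "\<And>x. x \<in> S \<Longrightarrow> f (g x) = f' (g' x)"
  shows "f \<otimes>\<^bsub>BijGroup S\<^esub> g = f' \<otimes>\<^bsub>BijGroup S\<^esub> g'"
  using assms by (auto simp: BijGroup_mult compose_def restrict_def)

lemma BijGroup_closed: "f \<in> Bij S \<Longrightarrow> g \<in> Bij S \<Longrightarrow> f \<otimes>\<^bsub>BijGroup S\<^esub> g \<in> Bij S"
  using group.is_monoid[OF group_BijGroup, of S] monoid.m_closed[of "BijGroup S" f g]
  by (simp add: BijGroup_def)

lemma BijGroup_apply: "f \<in> Bij S \<Longrightarrow> g \<in> Bij S \<Longrightarrow> x \<in> S \<Longrightarrow> (f \<otimes>\<^bsub>BijGroup S\<^esub> g) x = f (g x)"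
  by (simp add: BijGroup_mult compose_def)

lemma carrier_BijGroup: "carrier (BijGroup S) = Bij S"
  by (simp add: BijGroup_def)

text \<open>A central element dies in \<open>F\<^sub>2\<close>, so it lies in \<open>F\<^sub>3\<close>, on which the group acts: \<open>F\<^sub>3\<close> by
  translations, \<open>F\<^sub>2\<close> by automorphisms. Hence it is central in \<open>F\<^sub>3\<close>.\<close>

theorem f3f2_group_center_trivial:
  assumes g: "g \<in> carrier f3f2_group"
    and central: "\<And>h. h \<in> carrier f3f2_group \<Longrightarrow> g \<otimes>\<^bsub>f3f2_group\<^esub> h = h \<otimes>\<^bsub>f3f2_group\<^esub> g"
  shows "g = \<one>\<^bsub>f3f2_group\<^esub>"
proof -
  define F where "F = presented_group {X1, X2, X3} {}"
  define y where "y = pres_gen {X1, X2, X3} {}"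
  interpret F: group F unfolding F_def by (rule group_presented_group)
  have F_induct [consumes 1, case_names one gen inv_gen]: "Pr n"
    if "n \<in> carrier F" "Pr \<one>\<^bsub>F\<^esub>"
      "\<And>k n. k \<in> {X1, X2, X3} \<Longrightarrow> n \<in> carrier F \<Longrightarrow> Pr n \<Longrightarrow> Pr (y k \<otimes>\<^bsub>F\<^esub> n)"
      "\<And>k n. k \<in> {X1, X2, X3} \<Longrightarrow> n \<in> carrier F \<Longrightarrow> Pr n \<Longrightarrow> Pr (inv\<^bsub>F\<^esub> y k \<otimes>\<^bsub>F\<^esub> n)" for Pr n
    using that presented_group_induct[of n "{X1, X2, X3}" "{}" Pr] unfolding F_def y_def by blast
  have y [simp]: "y X1 \<in> carrier F" "y X2 \<in> carrier F" "y X3 \<in> carrier F"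
    unfolding F_def y_def by auto
  have F_hom: "\<exists>f. group_hom F H f \<and> f (y X1) = a \<and> f (y X2) = b \<and> f (y X3) = c"
    if abc: "group H" "a \<in> carrier H" "b \<in> carrier H" "c \<in> carrier H" for H :: "f3f2_letter word set monoid" and a b c
  proof -
    obtain f where "group_hom (presented_group {X1, X2, X3} {}) H f"
      "\<And>x. x \<in> {X1, X2, X3} \<Longrightarrow> f (pres_gen {X1, X2, X3} {} x) = case_f3f2_letter a b c a a x"
      using free_group_hom[OF abc(1), of "case_f3f2_letter a b c a a" "{X1, X2, X3}"] abc(2-4)
      by (auto simp: Pi_iff)
    then show ?thesis unfolding F_def y_def by (intro exI[of _ f]) auto
  qed
  define u where "u = y X3 \<otimes>\<^bsub>F\<^esub> y X1"
  define v where "v = y X1 \<otimes>\<^bsub>F\<^esub> y X2"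
  have uv [simp]: "u \<in> carrier F" "v \<in> carrier F" by (simp_all add: u_def v_def)
  \<comment> \<open>\<open>fP\<close> and \<open>fQ\<close> are the automorphisms by which
    \<open>p\<close> and \<open>q\<close> act on F3. They fix \<open>u\<close> and \<open>v\<close>
    respectively, so conjugating in the opposite direction gives the inverses \<open>fP'\<close> and
    \<open>fQ'\<close>.\<close>
  obtain fP where fP: "group_hom F F fP" "fP (y X1) = y X1" "fP (y X2) = u \<otimes>\<^bsub>F\<^esub> (y X2 \<otimes>\<^bsub>F\<^esub> inv\<^bsub>F\<^esub> u)" "fP (y X3) = y X3"
    using F_hom[of F "y X1" "u \<otimes>\<^bsub>F\<^esub> (y X2 \<otimes>\<^bsub>F\<^esub> inv\<^bsub>F\<^esub> u)" "y X3"] F.is_group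
    by auto
  obtain fP' where fP': "group_hom F F fP'" "fP' (y X1) = y X1" "fP' (y X2) = inv\<^bsub>F\<^esub> u \<otimes>\<^bsub>F\<^esub> (y X2 \<otimes>\<^bsub>F\<^esub> u)" "fP' (y X3) = y X3"
    using F_hom[of F "y X1" "inv\<^bsub>F\<^esub> u \<otimes>\<^bsub>F\<^esub> (y X2 \<otimes>\<^bsub>F\<^esub> u)" "y X3"] F.is_group
    by auto
  obtain fQ where fQ: "group_hom F F fQ" "fQ (y X1) = y X1" "fQ (y X2) = y X2" "fQ (y X3) = v \<otimes>\<^bsub>F\<^esub> (y X3 \<otimes>\<^bsub>F\<^esub> inv\<^bsub>F\<^esub> v)"
    using F_hom[of F "y X1" "y X2" "v \<otimes>\<^bsub>F\<^esub> (y X3 \<otimes>\<^bsub>F\<^esub> inv\<^bsub>F\<^esub> v)"] F.is_group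
    by auto
  obtain fQ' where fQ': "group_hom F F fQ'" "fQ' (y X1) = y X1" "fQ' (y X2) = y X2" "fQ' (y X3) = inv\<^bsub>F\<^esub> v \<otimes>\<^bsub>F\<^esub> (y X3 \<otimes>\<^bsub>F\<^esub> v)"
    using F_hom[of F "y X1" "y X2" "inv\<^bsub>F\<^esub> v \<otimes>\<^bsub>F\<^esub> (y X3 \<otimes>\<^bsub>F\<^esub> v)"] F.is_group
    by auto
  interpret fP: group_hom F F fP by fact
  interpret fP': group_hom F F fP' by fact
  interpret fQ: group_hom F F fQ by fact
  interpret fQ': group_hom F F fQ' by fact
  have endo: "f (f' n) = n"
    if "group_hom F F f" "group_hom F F f'" "n \<in> carrier F"
      "f (f' (y X1)) = y X1" "f (f' (y X2)) = y X2" "f (f' (y X3)) = y X3" for f f' n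
    using that free_group_endo_cancel[of "{X1, X2, X3}" "{}" f f' n] unfolding F_def y_def by auto
  have PP': "fP (fP' n) = n" "fP' (fP n) = n" if "n \<in> carrier F" for n
    by (rule endo; use that fP fP' in \<open>simp add: u_def F.m_assoc F.inv_mult_group\<close>)+
  have QQ': "fQ (fQ' n) = n" "fQ' (fQ n) = n" if "n \<in> carrier F" for n
    by (rule endo; use that fQ fQ' in \<open>simp add: v_def F.m_assoc F.inv_mult_group\<close>)+

  let ?x = f3f2_gen
  obtain i where i: "group_hom F f3f2_group i" "i (y X1) = ?x X1" "i (y X2) = ?x X2" "i (y X3) = ?x X3"
    using F_hom[OF group_presented_group SD.closed(1-3)] by auto
  interpret i: group_hom F f3f2_group i by fact
  have xP: "?x P \<otimes>\<^bsub>f3f2_group\<^esub> i n = i (fP n) \<otimes>\<^bsub>f3f2_group\<^esub> ?x P" if "n \<in> carrier F" for n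
    using that
  proof (induction rule: F_induct)
    case (gen k n)
    then show ?case using i fP by (auto simp: u_def SD.nf)
  next
    case (inv_gen k n)
    then show ?case using i fP by (auto simp: u_def SD.nf)
  qed simp
  have xQ: "?x Q \<otimes>\<^bsub>f3f2_group\<^esub> i n = i (fQ n) \<otimes>\<^bsub>f3f2_group\<^esub> ?x Q" if "n \<in> carrier F" for n
    using that
  proof (induction rule: F_induct)
    case (gen k n)
    then show ?case using i fQ by (auto simp: v_def SD.nf)
  next
    case (inv_gen k n)
    then show ?case using i fQ by (auto simp: v_def SD.nf)
  qed simp

  define E where "E = presented_group {P, Q} {}"
  define e where "e = pres_gen {P, Q} {}"
  interpret E: group E unfolding E_def by (rule group_presented_group)
  have e: "e P \<in> carrier E" "e Q \<in> carrier E" unfolding E_def e_def by auto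
  obtain s where s: "group_hom E f3f2_group s" "s (e P) = ?x P" "s (e Q) = ?x Q"
  proof -
    obtain f where "group_hom (presented_group {P, Q} {}) f3f2_group f"
      "\<And>x. x \<in> {P, Q} \<Longrightarrow> f (pres_gen {P, Q} {} x) = ?x x"
      using free_group_hom[OF SD.is_group, of ?x "{P, Q}"] by auto
    then show ?thesis by (intro that[of f]) (simp_all add: E_def e_def)
  qed
  have E_induct [consumes 1, case_names one gen inv_gen]: "Pr n"
    if "n \<in> carrier E" "Pr \<one>\<^bsub>E\<^esub>"
      "\<And>k n. k \<in> {P, Q} \<Longrightarrow> n \<in> carrier E \<Longrightarrow> Pr n \<Longrightarrow> Pr (e k \<otimes>\<^bsub>E\<^esub> n)"
      "\<And>k n. k \<in> {P, Q} \<Longrightarrow> n \<in> carrier E \<Longrightarrow> Pr n \<Longrightarrow> Pr (inv\<^bsub>E\<^esub> e k \<otimes>\<^bsub>E\<^esub> n)" for Pr n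
    using that presented_group_induct[of n "{P, Q}" "{}" Pr] unfolding E_def e_def by blast
  interpret s: group_hom E f3f2_group s by fact
  have "f3f2_rels E \<one>\<^bsub>E\<^esub> \<one>\<^bsub>E\<^esub> \<one>\<^bsub>E\<^esub> (e P) (e Q)"
    using e by (simp add: f3f2_rels_def)
  then obtain \<pi> where \<pi>: "group_hom f3f2_group E \<pi>" "\<pi> (?x X1) = \<one>\<^bsub>E\<^esub>" "\<pi> (?x X2) = \<one>\<^bsub>E\<^esub>" "\<pi> (?x X3) = \<one>\<^bsub>E\<^esub>"
    "\<pi> (?x P) = e P" "\<pi> (?x Q) = e Q"
    using f3f2_group_hom[OF E.is_group] by metis
  interpret \<pi>: group_hom f3f2_group E \<pi> by fact
  have \<pi>i: "\<pi> (i n) = \<one>\<^bsub>E\<^esub>" if "n \<in> carrier F" for n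
    using that by (induction rule: F_induct) (use i \<pi> in auto)
  have \<pi>s: "\<pi> (s m) = m" if "m \<in> carrier E" for m
    using that
  proof (induction rule: E_induct)
    case (gen k n)
    then show ?case using s \<pi> e by auto
  next
    case (inv_gen k n)
    then show ?case using s \<pi> e by auto
  qed simp
  \<comment> \<open>Existence of a factorization into an F3 part and an F2 part. The factors are
    recovered from the element by \<open>\<pi>\<close> and, later, by the action
    \<open>l\<close>.\<close>
  have decomp: "\<exists>n\<in>carrier F. \<exists>m\<in>carrier E. h = i n \<otimes>\<^bsub>f3f2_group\<^esub> s m"
    if "h \<in> carrier f3f2_group" for h
    using that
  proof (induction rule: presented_group_induct)
    case one
    show ?case by (rule bexI[of _ "\<one>\<^bsub>F\<^esub>"], rule bexI[of _ "\<one>\<^bsub>E\<^esub>"]) simp_all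
  next
    case (gen k h)
    then obtain n m where nm: "n \<in> carrier F" "m \<in> carrier E" "h = i n \<otimes>\<^bsub>f3f2_group\<^esub> s m" by auto
    have "?x k \<otimes>\<^bsub>f3f2_group\<^esub> h = i (y k \<otimes>\<^bsub>F\<^esub> n) \<otimes>\<^bsub>f3f2_group\<^esub> s m" if "k \<in> {X1, X2, X3}"
      using nm that i by (auto simp: SD.m_assoc)
    moreover have "?x P \<otimes>\<^bsub>f3f2_group\<^esub> h = i (fP n) \<otimes>\<^bsub>f3f2_group\<^esub> s (e P \<otimes>\<^bsub>E\<^esub> m)"
      using nm s e xP[OF nm(1)] by (simp add: SD.m_assoc SD.mult_tail[OF xP[OF nm(1)]])
    moreover have "?x Q \<otimes>\<^bsub>f3f2_group\<^esub> h = i (fQ n) \<otimes>\<^bsub>f3f2_group\<^esub> s (e Q \<otimes>\<^bsub>E\<^esub> m)"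
      using nm s e by (simp add: SD.m_assoc SD.mult_tail[OF xQ[OF nm(1)]])
    moreover have "k \<in> {X1, X2, X3} \<or> k = P \<or> k = Q" using gen(1) by (cases k) auto
    moreover have "y k \<otimes>\<^bsub>F\<^esub> n \<in> carrier F" if "k \<in> {X1, X2, X3}" using that nm by auto
    ultimately show ?case using nm e by (metis E.m_closed fP.hom_closed fQ.hom_closed)
  next
    case (inv_gen k h)
    then obtain n m where nm: "n \<in> carrier F" "m \<in> carrier E" "h = i n \<otimes>\<^bsub>f3f2_group\<^esub> s m" by auto
    have xP': "inv\<^bsub>f3f2_group\<^esub> ?x P \<otimes>\<^bsub>f3f2_group\<^esub> i n = i (fP' n) \<otimes>\<^bsub>f3f2_group\<^esub> inv\<^bsub>f3f2_group\<^esub> ?x P"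
      using xP[of "fP' n"] nm
      by (metis PP'(1) fP'.hom_closed SD.closed(4) SD.inv_closed SD.inv_solve_left SD.inv_solve_right
          SD.m_assoc SD.m_closed i.hom_closed)
    have xQ': "inv\<^bsub>f3f2_group\<^esub> ?x Q \<otimes>\<^bsub>f3f2_group\<^esub> i n = i (fQ' n) \<otimes>\<^bsub>f3f2_group\<^esub> inv\<^bsub>f3f2_group\<^esub> ?x Q"
      using xQ[of "fQ' n"] nm
      by (metis QQ'(1) fQ'.hom_closed SD.closed(5) SD.inv_closed SD.inv_solve_left SD.inv_solve_right
          SD.m_assoc SD.m_closed i.hom_closed)
    have "inv\<^bsub>f3f2_group\<^esub> ?x k \<otimes>\<^bsub>f3f2_group\<^esub> h = i (inv\<^bsub>F\<^esub> y k \<otimes>\<^bsub>F\<^esub> n) \<otimes>\<^bsub>f3f2_group\<^esub> s m" if "k \<in> {X1, X2, X3}"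
      using nm that i by (auto simp: SD.m_assoc)
    moreover have "inv\<^bsub>f3f2_group\<^esub> ?x P \<otimes>\<^bsub>f3f2_group\<^esub> h = i (fP' n) \<otimes>\<^bsub>f3f2_group\<^esub> s (inv\<^bsub>E\<^esub> e P \<otimes>\<^bsub>E\<^esub> m)"
      using nm s e by (simp add: SD.m_assoc SD.mult_tail[OF xP'])
    moreover have "inv\<^bsub>f3f2_group\<^esub> ?x Q \<otimes>\<^bsub>f3f2_group\<^esub> h = i (fQ' n) \<otimes>\<^bsub>f3f2_group\<^esub> s (inv\<^bsub>E\<^esub> e Q \<otimes>\<^bsub>E\<^esub> m)"
      using nm s e by (simp add: SD.m_assoc SD.mult_tail[OF xQ'])
    moreover have "k \<in> {X1, X2, X3} \<or> k = P \<or> k = Q" using inv_gen(1) by (cases k) auto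
    moreover have "inv\<^bsub>F\<^esub> y k \<otimes>\<^bsub>F\<^esub> n \<in> carrier F" if "k \<in> {X1, X2, X3}" using that nm by auto
    ultimately show ?case using nm e by (metis E.m_closed E.inv_closed fP'.hom_closed fQ'.hom_closed)
  qed
  obtain n m where nm: "n \<in> carrier F" "m \<in> carrier E" "g = i n \<otimes>\<^bsub>f3f2_group\<^esub> s m"
    using decomp[OF g] by auto
  have "\<pi> g = m" using nm by (simp add: \<pi>i \<pi>s)
  have "e k \<otimes>\<^bsub>E\<^esub> m = m \<otimes>\<^bsub>E\<^esub> e k" if "k \<in> {P, Q}" for k
  proof -
    have "\<pi> (g \<otimes>\<^bsub>f3f2_group\<^esub> ?x k) = \<pi> (?x k \<otimes>\<^bsub>f3f2_group\<^esub> g)"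
      using central that by (auto simp: SD.closed)
    then show ?thesis using g \<pi> that by (auto simp: \<open>\<pi> g = m\<close>)
  qed
  then have "m = \<one>\<^bsub>E\<^esub>"
    using nm(2) unfolding E_def e_def by (intro free_group_center_trivial) blast+
  then have g_i: "g = i n" using nm by simp

  define L where "L k = restrict (\<lambda>m. y k \<otimes>\<^bsub>F\<^esub> m) (carrier F)" for k
  have L: "L k \<in> Bij (carrier F)" if "k \<in> {X1, X2, X3}" for k
    unfolding L_def by (rule BijI[where f' = "\<lambda>m. inv\<^bsub>F\<^esub> y k \<otimes>\<^bsub>F\<^esub> m"]) (use that in auto)
  have bij: "restrict fP (carrier F) \<in> Bij (carrier F)" "restrict fQ (carrier F) \<in> Bij (carrier F)"
    by (rule BijI[where f' = fP'], simp_all add: PP') (rule BijI[where f' = fQ'], simp_all add: QQ')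
  let ?B = "BijGroup (carrier F)"
  \<comment> \<open>An automorphism \<open>f\<close> composed with translation by \<open>n\<close>
    is translation by \<open>f n\<close> composed with \<open>f\<close>; with the values of
    \<open>fP\<close> and \<open>fQ\<close> on generators this yields the relations.\<close>
  have "f3f2_rels ?B (L X1) (L X2) (L X3) (restrict fP (carrier F)) (restrict fQ (carrier F))"
    unfolding f3f2_rels_def
    by (intro conjI Bij_mult_eqI BijGroup_closed L bij)
      (use L bij fP fQ in \<open>auto simp: L_def carrier_BijGroup BijGroup_apply BijGroup_closed u_def v_def
        F.m_assoc F.inv_mult_group\<close>)
  then obtain l where l: "group_hom f3f2_group ?B l" "l (?x X1) = L X1" "l (?x X2) = L X2" "l (?x X3) = L X3"
    using f3f2_group_hom[OF group_BijGroup] by metis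
  interpret l: group_hom f3f2_group ?B l by fact
  have l_Bij: "l h \<in> Bij (carrier F)" if "h \<in> carrier f3f2_group" for h
    using l.hom_closed[OF that] by (simp add: carrier_BijGroup)
  have lx: "l (?x k) = L k" "?x k \<in> carrier f3f2_group" "i (y k) = ?x k" if "k \<in> {X1, X2, X3}" for k
    using that l i by auto
  have y_closed: "y k \<in> carrier F" if "k \<in> {X1, X2, X3}" for k using that by auto
  have l_apply: "l (h \<otimes>\<^bsub>f3f2_group\<^esub> h') m = l h (l h' m)"
    if "h \<in> carrier f3f2_group" "h' \<in> carrier f3f2_group" "m \<in> carrier F" for h h' m
    using that by (simp add: BijGroup_apply l_Bij)
  have li: "\<forall>m\<in>carrier F. l (i n) m = n \<otimes>\<^bsub>F\<^esub> m" if "n \<in> carrier F" for n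
    using that
  proof (induction rule: F_induct)
    case one
    have "l \<one>\<^bsub>f3f2_group\<^esub> = (\<lambda>x\<in>carrier F. x)"
      using l.hom_one by (simp add: BijGroup_def)
    then show ?case by simp
  next
    case (gen k n)
    then show ?case by (simp add: l_apply lx y_closed L_def F.m_assoc del: l.hom_mult)
  next
    case (inv_gen k n)
    show ?case
    proof
      fix m assume m: "m \<in> carrier F"
      let ?n = "inv\<^bsub>F\<^esub> y k \<otimes>\<^bsub>F\<^esub> n"
      have "l (?x k \<otimes>\<^bsub>f3f2_group\<^esub> i ?n) m = l (i (y k \<otimes>\<^bsub>F\<^esub> ?n)) m"
        using inv_gen by (simp add: lx y_closed)
      then have "y k \<otimes>\<^bsub>F\<^esub> l (i ?n) m = n \<otimes>\<^bsub>F\<^esub> m"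
        using inv_gen m y_closed Bij_imp_funcset[OF l_Bij, of "i ?n"]
        by (simp add: l_apply lx L_def Pi_iff del: l.hom_mult i.hom_mult i.hom_inv l.hom_inv)
      moreover have "l (i ?n) m \<in> carrier F"
        using inv_gen m y_closed Bij_imp_funcset[OF l_Bij, of "i ?n"]
        by (simp add: Pi_iff del: l.hom_mult i.hom_mult i.hom_inv l.hom_inv)
      ultimately show "l (i ?n) m = ?n \<otimes>\<^bsub>F\<^esub> m"
        using inv_gen m y_closed by (metis F.inv_closed F.inv_cancel_tail(2) F.m_assoc)
    qed
  qed
  have "y k \<otimes>\<^bsub>F\<^esub> n = n \<otimes>\<^bsub>F\<^esub> y k" if k: "k \<in> {X1, X2, X3}" for k
  proof -
    have "i (n \<otimes>\<^bsub>F\<^esub> y k) = i (y k \<otimes>\<^bsub>F\<^esub> n)"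
      using central[OF lx(2)[OF k]] k nm(1) y_closed[OF k] by (simp add: lx g_i)
    \<comment> \<open>Elements of F3 act by translation, so evaluation at the unit shows that
      \<open>i\<close> is injective.\<close>
    then have "l (i (n \<otimes>\<^bsub>F\<^esub> y k)) \<one>\<^bsub>F\<^esub> = l (i (y k \<otimes>\<^bsub>F\<^esub> n)) \<one>\<^bsub>F\<^esub>" by simp
    then show ?thesis using k nm(1) y_closed[OF k] by (simp add: li del: i.hom_mult)
  qed
  then have "n = \<one>\<^bsub>F\<^esub>"
    using nm(1) unfolding F_def y_def by (intro free_group_center_trivial) blast+
  then show ?thesis by (simp add: g_i)
qed

section \<open>A change of generators in vP3\<close>

section \<open>The group \<open>vP\<^sub>3\<close> in free product coordinates\<close>

abbreviation vP3_gens :: "(nat \<times> nat) set" where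
  "vP3_gens \<equiv> {(i, j). i \<in> {1..3} \<and> j \<in> {1..3} \<and> i \<noteq> j}"

abbreviation vP3_rel_words :: "((nat \<times> nat) word \<times> (nat \<times> nat) word) set" where
  "vP3_rel_words \<equiv> {(positive_word [(i, j), (i, k), (j, k)], positive_word [(j, k), (i, k), (i, j)]) | i j k.
       {i, j, k} \<subseteq> {1..3} \<and> i \<noteq> j \<and> i \<noteq> k \<and> j \<noteq> k}"

definition vgen :: "nat \<Rightarrow> nat \<Rightarrow> (nat \<times> nat) word set" where
  "vgen i j = pres_gen vP3_gens vP3_rel_words (i, j)"

lemma nat_1_3: "i \<in> {1..3::nat} \<longleftrightarrow> i = 1 \<or> i = 2 \<or> i = 3"
  by auto

lemma group_vP3: "group vP3"
  unfolding vP3_def by (rule group_presented_group)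

lemma vgen_closed: "i \<in> {1..3} \<Longrightarrow> j \<in> {1..3} \<Longrightarrow> i \<noteq> j \<Longrightarrow> vgen i j \<in> carrier vP3"
  unfolding vgen_def vP3_def by (rule pres_gen_closed) simp

lemma vgen_rel:
  assumes "{i, j, k} \<subseteq> {1..3}" "i \<noteq> j" "i \<noteq> k" "j \<noteq> k"
  shows "vgen i j \<otimes>\<^bsub>vP3\<^esub> (vgen i k \<otimes>\<^bsub>vP3\<^esub> vgen j k) = vgen j k \<otimes>\<^bsub>vP3\<^esub> (vgen i k \<otimes>\<^bsub>vP3\<^esub> vgen i j)"
proof -
  interpret group vP3 by (rule group_vP3)
  have "word_eval vP3 (\<lambda>(i, j). vgen i j) (positive_word [(i, j), (i, k), (j, k)])
      = word_eval vP3 (\<lambda>(i, j). vgen i j) (positive_word [(j, k), (i, k), (i, j)])"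
    unfolding vP3_def vgen_def case_prod_eta
    by (rule presented_group_rel) (use assms in auto)
  then show ?thesis using assms by (simp add: vgen_closed)
qed

lemma vP3_hom_vgen:
  assumes H: "group H"
    and closed: "\<And>i j. i \<in> {1..3} \<Longrightarrow> j \<in> {1..3} \<Longrightarrow> i \<noteq> j \<Longrightarrow> h i j \<in> carrier H"
    and rels: "\<And>i j k. {i, j, k} \<subseteq> {1..3} \<Longrightarrow> i \<noteq> j \<Longrightarrow> i \<noteq> k \<Longrightarrow> j \<noteq> k \<Longrightarrow>
      h i j \<otimes>\<^bsub>H\<^esub> (h i k \<otimes>\<^bsub>H\<^esub> h j k) = h j k \<otimes>\<^bsub>H\<^esub> (h i k \<otimes>\<^bsub>H\<^esub> h i j)"
  obtains f where "group_hom vP3 H f"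
    "\<And>i j. i \<in> {1..3} \<Longrightarrow> j \<in> {1..3} \<Longrightarrow> i \<noteq> j \<Longrightarrow> f (vgen i j) = h i j"
proof -
  interpret H: group H by fact
  let ?\<phi> = "\<lambda>(i, j). h i j"
  have cl: "?\<phi> \<in> vP3_gens \<rightarrow> carrier H" using closed by auto
  have rel: "word_eval H ?\<phi> u = word_eval H ?\<phi> v" if uv: "(u, v) \<in> vP3_rel_words" for u v
  proof -
    obtain i j k where ijk: "u = positive_word [(i, j), (i, k), (j, k)]" "v = positive_word [(j, k), (i, k), (i, j)]"
      "{i, j, k} \<subseteq> {1..3}" "i \<noteq> j" "i \<noteq> k" "j \<noteq> k"
      using uv by blast
    then have "h i j \<in> carrier H" "h j k \<in> carrier H" by (simp_all add: closed)
    then show ?thesis using rels[OF ijk(3-6)] by (simp add: ijk(1,2))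
  qed
  obtain f where f: "f \<in> hom vP3 H" "\<And>x. x \<in> vP3_gens \<Longrightarrow> f (pres_gen vP3_gens vP3_rel_words x) = ?\<phi> x"
    unfolding vP3_def by (rule H.presented_group_hom[OF cl rel], assumption, blast)
  show thesis
  proof (rule that[OF hom_group_hom[OF group_vP3 H f(1)]])
    show "f (vgen i j) = h i j" if "i \<in> {1..3}" "j \<in> {1..3}" "i \<noteq> j" for i j
      unfolding vgen_def using f(2)[of "(i, j)"] that by simp
  qed
qed

text \<open>In these coordinates the relations of \<open>vP3\<close> do not involve \<open>vt\<close>, and the first five elements
  satisfy exactly the relations of \<open>F\<^sub>3 \<rtimes> F\<^sub>2\<close>.\<close>

definition "vt = vgen 1 3"
definition "vx1 = vgen 2 3 \<otimes>\<^bsub>vP3\<^esub> vgen 1 3"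
definition "vx2 = inv\<^bsub>vP3\<^esub> vgen 1 3 \<otimes>\<^bsub>vP3\<^esub> (vgen 2 1 \<otimes>\<^bsub>vP3\<^esub> (vgen 3 1 \<otimes>\<^bsub>vP3\<^esub> vgen 1 3))"
definition "vx3 = vgen 1 2 \<otimes>\<^bsub>vP3\<^esub> vgen 3 2"
definition "vp = vgen 1 2 \<otimes>\<^bsub>vP3\<^esub> vgen 1 3"
definition "vq = vgen 2 3 \<otimes>\<^bsub>vP3\<^esub> vgen 2 1"

lemma vt_closed [simp]: "vt \<in> carrier vP3"
  unfolding vt_def by (rule vgen_closed) auto

context group
begin

text \<open>Here \<open>a\<close>, \<open>b\<close>, \<open>c\<close> stand for the generators with
  indices 12, 23, 31, \<open>a'\<close> and \<open>b'\<close> for 21 and 32, and \<open>t\<close>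
  for 13. After replacing \<open>a\<close>, \<open>b\<close>, \<open>c\<close> by their products
  with \<open>t\<close> on the right and \<open>a'\<close>, \<open>b'\<close> by their products with
  the inverse of \<open>t\<close> on the left, \<open>t\<close> cancels from all six relations.
  Three of them become commutations, which suggest the products chosen as new generators.\<close>

lemma vP3_rels_imp_f3f2_rels:
  assumes cl [simp]: "a \<in> carrier G" "b \<in> carrier G" "c \<in> carrier G" "a' \<in> carrier G" "b' \<in> carrier G" "t \<in> carrier G"
    and r: "a \<otimes> (t \<otimes> b) = b \<otimes> (t \<otimes> a)" "b \<otimes> (a' \<otimes> c) = c \<otimes> (a' \<otimes> b)" "c \<otimes> (b' \<otimes> a) = a \<otimes> (b' \<otimes> c)"
      "t \<otimes> (a \<otimes> b') = b' \<otimes> (a \<otimes> t)" "a' \<otimes> (b \<otimes> t) = t \<otimes> (b \<otimes> a')" "b' \<otimes> (c \<otimes> a') = a' \<otimes> (c \<otimes> b')"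
  shows "f3f2_rels G (b \<otimes> t) (inv t \<otimes> (a' \<otimes> (c \<otimes> t))) (a \<otimes> b') (a \<otimes> t) (b \<otimes> a')"
proof -
  define \<alpha> \<beta> \<gamma> \<alpha>' \<beta>' where d: "\<alpha> = a \<otimes> t" "\<beta> = b \<otimes> t" "\<gamma> = c \<otimes> t" "\<alpha>' = inv t \<otimes> a'" "\<beta>' = inv t \<otimes> b'"
  have [simp]: "\<alpha> \<in> carrier G" "\<beta> \<in> carrier G" "\<gamma> \<in> carrier G" "\<alpha>' \<in> carrier G" "\<beta>' \<in> carrier G"
    by (simp_all add: d)
  have 1: "\<beta> \<otimes> \<alpha> = \<alpha> \<otimes> \<beta>"
    using arg_cong[OF r(1), of "\<lambda>z. z \<otimes> t"] by (simp add: d m_assoc)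
  have 4: "\<beta>' \<otimes> \<alpha> = \<alpha> \<otimes> \<beta>'"
    using arg_cong[OF r(4), of "\<lambda>z. inv t \<otimes> z"] by (simp add: d m_assoc)
  have 5: "\<beta> \<otimes> \<alpha>' = \<alpha>' \<otimes> \<beta>"
    using arg_cong[OF r(5), of "\<lambda>z. inv t \<otimes> z"] by (simp add: d m_assoc)
  have 2: "\<gamma> \<otimes> (\<alpha>' \<otimes> \<beta>) = \<alpha>' \<otimes> (\<beta> \<otimes> \<gamma>)"
    using arg_cong[OF r(2), of "\<lambda>z. z \<otimes> t"] mult_tail[OF 5, of \<gamma>] by (simp add: d m_assoc)
  have 3: "\<gamma> \<otimes> (\<alpha> \<otimes> \<beta>') = \<alpha> \<otimes> (\<beta>' \<otimes> \<gamma>)"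
    using arg_cong[OF r(3), of "\<lambda>z. z \<otimes> t"] by (subst 4[symmetric]) (simp add: d m_assoc)
  have 6: "\<alpha>' \<otimes> (\<gamma> \<otimes> \<beta>') = \<beta>' \<otimes> (\<gamma> \<otimes> \<alpha>')"
    using arg_cong[OF r(6), of "\<lambda>z. inv t \<otimes> z"] by (simp add: d m_assoc)
  note tail5 = mult_tail[OF 5]
  have tail2: "\<gamma> \<otimes> (\<alpha>' \<otimes> (\<beta> \<otimes> z)) = \<alpha>' \<otimes> (\<beta> \<otimes> (\<gamma> \<otimes> z))" if "z \<in> carrier G" for z
    using arg_cong[OF 2, of "\<lambda>y. y \<otimes> z"] that by (simp add: m_assoc)
  have tail3: "\<gamma> \<otimes> (\<alpha> \<otimes> (\<beta>' \<otimes> z)) = \<alpha> \<otimes> (\<beta>' \<otimes> (\<gamma> \<otimes> z))" if "z \<in> carrier G" for z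
    using arg_cong[OF 3, of "\<lambda>y. y \<otimes> z"] that by (simp add: m_assoc)
  \<comment> \<open>Multiplied by \<open>\<alpha>\<close> on the left, this is the relation between
    \<open>p\<close> and \<open>x2\<close>.\<close>
  have "\<alpha>' \<otimes> (\<gamma> \<otimes> (\<alpha> \<otimes> (\<beta>' \<otimes> \<beta>))) = (\<alpha>' \<otimes> (\<gamma> \<otimes> \<beta>')) \<otimes> (\<alpha> \<otimes> \<beta>)"
    by (simp add: m_assoc mult_tail[OF 4])
  also have "\<dots> = \<beta>' \<otimes> (\<gamma> \<otimes> (\<alpha>' \<otimes> (\<beta> \<otimes> \<alpha>)))"
    by (simp add: 6 m_assoc 1)
  also have "\<dots> = \<beta>' \<otimes> (\<beta> \<otimes> (\<alpha>' \<otimes> (\<gamma> \<otimes> \<alpha>)))"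
    by (simp add: tail2 tail5 m_assoc)
  finally have "f3f2_rels G \<beta> (\<alpha>' \<otimes> \<gamma>) (\<alpha> \<otimes> \<beta>') \<alpha> (\<beta> \<otimes> \<alpha>')"
    unfolding f3f2_rels_def
    by (simp add: m_assoc 1 4 5 mult_tail[OF 1] mult_tail[OF 4] tail5 2 tail2 3 tail3)
  moreover have "\<alpha>' \<otimes> \<gamma> = inv t \<otimes> (a' \<otimes> (c \<otimes> t))" "\<alpha> \<otimes> \<beta>' = a \<otimes> b'" "\<beta> \<otimes> \<alpha>' = b \<otimes> a'"
    by (simp_all add: d m_assoc)
  ultimately show ?thesis by (simp add: d)
qed

text \<open>The words solve the substitution of \<open>vP3_rels_imp_f3f2_rels\<close> for the
  original generators; the rewrite system \<open>nf\<close> then decides each relation.\<close>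

lemma f3f2_rels_imp_vP3_rels:
  assumes "f3f2_rels G x1 x2 x3 p q" and t [simp]: "t \<in> carrier G"
  defines "a \<equiv> p \<otimes> inv t" and "b \<equiv> x1 \<otimes> inv t" and "c \<equiv> inv q \<otimes> (x1 \<otimes> (x2 \<otimes> inv t))"
    and "a' \<equiv> t \<otimes> (inv x1 \<otimes> q)" and "b' \<equiv> t \<otimes> (inv p \<otimes> x3)"
  shows "a \<otimes> (t \<otimes> b) = b \<otimes> (t \<otimes> a)" "b \<otimes> (a' \<otimes> c) = c \<otimes> (a' \<otimes> b)" "c \<otimes> (b' \<otimes> a) = a \<otimes> (b' \<otimes> c)"
      "t \<otimes> (a \<otimes> b') = b' \<otimes> (a \<otimes> t)" "a' \<otimes> (b \<otimes> t) = t \<otimes> (b \<otimes> a')" "b' \<otimes> (c \<otimes> a') = a' \<otimes> (c \<otimes> b')"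
proof -
  interpret f3f2 G x1 x2 x3 p q by unfold_locales fact
  show "a \<otimes> (t \<otimes> b) = b \<otimes> (t \<otimes> a)" "b \<otimes> (a' \<otimes> c) = c \<otimes> (a' \<otimes> b)" "c \<otimes> (b' \<otimes> a) = a \<otimes> (b' \<otimes> c)"
      "t \<otimes> (a \<otimes> b') = b' \<otimes> (a \<otimes> t)" "a' \<otimes> (b \<otimes> t) = t \<otimes> (b \<otimes> a')" "b' \<otimes> (c \<otimes> a') = a' \<otimes> (c \<otimes> b')"
    by (simp_all add: assms(3-) nf)
qed

end

theorem vP3_f3f2_rels: "f3f2_rels vP3 vx1 vx2 vx3 vp vq"
  unfolding vx1_def vx2_def vx3_def vp_def vq_def
  by (rule group.vP3_rels_imp_f3f2_rels[OF group_vP3]; (rule vgen_closed | rule vgen_rel); simp)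

text \<open>The universal property of the free product of F3 x| F2 with the integers: the image of
  \<open>vt\<close> is subject to no condition.\<close>

theorem vP3_hom:
  assumes H: "group H" and rels: "f3f2_rels H x1 x2 x3 p q" and t: "t \<in> carrier H"
  obtains f where "group_hom vP3 H f"
    "f vx1 = x1" "f vx2 = x2" "f vx3 = x3" "f vp = p" "f vq = q" "f vt = t"
proof -
  interpret H: f3f2 H x1 x2 x3 p q using H rels by (simp add: f3f2_def f3f2_axioms_def)
  \<comment> \<open>The images of the six generators are forced by the equations
    \<open>vgen_eqs\<close>.\<close>
  define h where "h = (\<lambda>(i :: nat) (j :: nat).
    if i = 1 then (if j = 2 then p \<otimes>\<^bsub>H\<^esub> inv\<^bsub>H\<^esub> t else t)
    else if i = 2 then (if j = 3 then x1 \<otimes>\<^bsub>H\<^esub> inv\<^bsub>H\<^esub> t else t \<otimes>\<^bsub>H\<^esub> (inv\<^bsub>H\<^esub> x1 \<otimes>\<^bsub>H\<^esub> q))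
    else if j = 1 then inv\<^bsub>H\<^esub> q \<otimes>\<^bsub>H\<^esub> (x1 \<otimes>\<^bsub>H\<^esub> (x2 \<otimes>\<^bsub>H\<^esub> inv\<^bsub>H\<^esub> t)) else t \<otimes>\<^bsub>H\<^esub> (inv\<^bsub>H\<^esub> p \<otimes>\<^bsub>H\<^esub> x3))"
  have h: "h 1 2 = p \<otimes>\<^bsub>H\<^esub> inv\<^bsub>H\<^esub> t" "h 1 3 = t" "h 2 3 = x1 \<otimes>\<^bsub>H\<^esub> inv\<^bsub>H\<^esub> t"
    "h 2 1 = t \<otimes>\<^bsub>H\<^esub> (inv\<^bsub>H\<^esub> x1 \<otimes>\<^bsub>H\<^esub> q)" "h 3 1 = inv\<^bsub>H\<^esub> q \<otimes>\<^bsub>H\<^esub> (x1 \<otimes>\<^bsub>H\<^esub> (x2 \<otimes>\<^bsub>H\<^esub> inv\<^bsub>H\<^esub> t))"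
    "h 3 2 = t \<otimes>\<^bsub>H\<^esub> (inv\<^bsub>H\<^esub> p \<otimes>\<^bsub>H\<^esub> x3)"
    by (simp_all add: h_def)
  have closed: "h i j \<in> carrier H" for i j
    using t by (auto simp: h_def)
  have "t = h 1 3" by (simp add: h del: One_nat_def)
  note v = H.f3f2_rels_imp_vP3_rels[OF rels t, folded h(1,3-6), unfolded this]
  have v': "h i j \<otimes>\<^bsub>H\<^esub> (h i k \<otimes>\<^bsub>H\<^esub> h j k) = h j k \<otimes>\<^bsub>H\<^esub> (h i k \<otimes>\<^bsub>H\<^esub> h i j)"
    if "{i, j, k} \<subseteq> {1..3}" "i \<noteq> j" "i \<noteq> k" "j \<noteq> k" for i j k
  proof -
    have "(i, j, k) \<in> {(1, 2, 3), (2, 3, 1), (3, 1, 2), (1, 3, 2), (2, 1, 3), (3, 2, 1)}"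
      using that unfolding insert_subset nat_1_3 by auto
    then show ?thesis using v by (auto simp del: One_nat_def)
  qed
  obtain f where f: "group_hom vP3 H f"
    "\<And>i j. i \<in> {1..3} \<Longrightarrow> j \<in> {1..3} \<Longrightarrow> i \<noteq> j \<Longrightarrow> f (vgen i j) = h i j"
    using vP3_hom_vgen[OF H, of h] closed v' by blast
  interpret f: group_hom vP3 H f by (rule f(1))
  have fv: "f (vgen 1 2) = h 1 2" "f (vgen 1 3) = h 1 3" "f (vgen 2 3) = h 2 3"
    "f (vgen 2 1) = h 2 1" "f (vgen 3 1) = h 3 1" "f (vgen 3 2) = h 3 2"
    by (rule f(2); simp)+
  have cl: "vgen 1 2 \<in> carrier vP3" "vgen 1 3 \<in> carrier vP3" "vgen 2 3 \<in> carrier vP3"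
    "vgen 2 1 \<in> carrier vP3" "vgen 3 1 \<in> carrier vP3" "vgen 3 2 \<in> carrier vP3"
    by (rule vgen_closed; simp)+
  show thesis
    by (rule that[OF f(1)])
      (simp_all add: vx1_def vx2_def vx3_def vp_def vq_def vt_def cl fv h t H.nf del: One_nat_def)
qed

lemma vgen_eqs:
  "vgen 1 2 = vp \<otimes>\<^bsub>vP3\<^esub> inv\<^bsub>vP3\<^esub> vt" "vgen 1 3 = vt" "vgen 2 3 = vx1 \<otimes>\<^bsub>vP3\<^esub> inv\<^bsub>vP3\<^esub> vt"
  "vgen 2 1 = vt \<otimes>\<^bsub>vP3\<^esub> (inv\<^bsub>vP3\<^esub> vx1 \<otimes>\<^bsub>vP3\<^esub> vq)"
  "vgen 3 1 = inv\<^bsub>vP3\<^esub> vq \<otimes>\<^bsub>vP3\<^esub> (vx1 \<otimes>\<^bsub>vP3\<^esub> (vx2 \<otimes>\<^bsub>vP3\<^esub> inv\<^bsub>vP3\<^esub> vt))"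
  "vgen 3 2 = vt \<otimes>\<^bsub>vP3\<^esub> (inv\<^bsub>vP3\<^esub> vp \<otimes>\<^bsub>vP3\<^esub> vx3)"
proof -
  interpret group vP3 by (rule group_vP3)
  have cl: "vgen 1 2 \<in> carrier vP3" "vgen 1 3 \<in> carrier vP3" "vgen 2 3 \<in> carrier vP3"
    "vgen 2 1 \<in> carrier vP3" "vgen 3 1 \<in> carrier vP3" "vgen 3 2 \<in> carrier vP3"
    by (rule vgen_closed; simp)+
  show "vgen 1 2 = vp \<otimes>\<^bsub>vP3\<^esub> inv\<^bsub>vP3\<^esub> vt" "vgen 1 3 = vt" "vgen 2 3 = vx1 \<otimes>\<^bsub>vP3\<^esub> inv\<^bsub>vP3\<^esub> vt"
    "vgen 2 1 = vt \<otimes>\<^bsub>vP3\<^esub> (inv\<^bsub>vP3\<^esub> vx1 \<otimes>\<^bsub>vP3\<^esub> vq)"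
    "vgen 3 1 = inv\<^bsub>vP3\<^esub> vq \<otimes>\<^bsub>vP3\<^esub> (vx1 \<otimes>\<^bsub>vP3\<^esub> (vx2 \<otimes>\<^bsub>vP3\<^esub> inv\<^bsub>vP3\<^esub> vt))"
    "vgen 3 2 = vt \<otimes>\<^bsub>vP3\<^esub> (inv\<^bsub>vP3\<^esub> vp \<otimes>\<^bsub>vP3\<^esub> vx3)"
    unfolding vx1_def vx2_def vx3_def vp_def vq_def vt_def
    using cl by (simp_all only: m_assoc inv_mult_group m_closed inv_closed inv_inv inv_cancel_tail
      r_inv l_inv r_one l_one)
qed

theorem vP3_hom_eq:
  assumes "group_hom vP3 H f" "group_hom vP3 H f'"
    and eq: "f vx1 = f' vx1" "f vx2 = f' vx2" "f vx3 = f' vx3" "f vp = f' vp" "f vq = f' vq" "f vt = f' vt"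
    and g: "g \<in> carrier vP3"
  shows "f g = f' g"
proof -
  interpret f: group_hom vP3 H f by fact
  interpret f': group_hom vP3 H f' by fact
  interpret V: f3f2 vP3 vx1 vx2 vx3 vp vq
    using group_vP3 vP3_f3f2_rels by (simp add: f3f2_def f3f2_axioms_def)
  have cl: "vx1 \<in> carrier vP3" "vx2 \<in> carrier vP3" "vx3 \<in> carrier vP3" "vp \<in> carrier vP3" "vq \<in> carrier vP3"
    by simp_all
  have "f (vgen i j) = f' (vgen i j)" if "i \<in> {1..3}" "j \<in> {1..3}" "i \<noteq> j" for i j
  proof -
    have "(i, j) \<in> {(1, 2), (1, 3), (2, 3), (2, 1), (3, 1), (3, 2)}"
      using that unfolding nat_1_3 by auto
    then show ?thesis
      by (auto simp: vgen_eqs eq cl simp del: One_nat_def)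
  qed
  then show ?thesis
    using presented_group_hom_eq[OF f.H.is_group f.homh[unfolded vP3_def] f'.homh[unfolded vP3_def] _ g[unfolded vP3_def]]
    unfolding vgen_def by blast
qed

theorem vP3_subset:
  assumes S: "subgroup S vP3" and "{vx1, vx2, vx3, vp, vq, vt} \<subseteq> S"
  shows "carrier vP3 \<subseteq> S"
proof -
  have "vgen i j \<in> S" if "i \<in> {1..3}" "j \<in> {1..3}" "i \<noteq> j" for i j
  proof -
    have "(i, j) \<in> {(1, 2), (1, 3), (2, 3), (2, 1), (3, 1), (3, 2)}"
      using that unfolding nat_1_3 by auto
    then show ?thesis
      using assms(2) by (auto simp: vgen_eqs subgroup.m_closed[OF S] subgroup.m_inv_closed[OF S] simp del: One_nat_def)
  qed
  then show ?thesis
    using presented_group_subset[OF S[unfolded vP3_def]] unfolding vP3_def vgen_def by blast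
qed

section \<open>Pure braids inside B4\<close>

section \<open>Identities in the braid group on four strands\<close>

locale braid4 = group +
  fixes a b c
  assumes closed [simp]: "a \<in> carrier G" "b \<in> carrier G" "c \<in> carrier G"
    and ac: "a \<otimes> c = c \<otimes> a"
    and aba: "a \<otimes> (b \<otimes> a) = b \<otimes> (a \<otimes> b)"
    and bcb: "b \<otimes> (c \<otimes> b) = c \<otimes> (b \<otimes> c)"
begin

text \<open>With A_ij the standard pure braid generators, the squares are A_12, A_23 and A_34. In
  \<open>da\<close> strand 3 encircles strands 1 and 2, so it is a product of conjugates of A_13 and
  A_23; \<open>dc\<close> is its mirror image, and \<open>za\<close> is the full twist on four
  strands.\<close>

definition "sqa = a \<otimes> a"
definition "sqb = b \<otimes> b"
definition "sqc = c \<otimes> c"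
definition "da = b \<otimes> (a \<otimes> (a \<otimes> b))"
definition "dc = b \<otimes> (c \<otimes> (c \<otimes> b))"
definition "za = sqa \<otimes> (da \<otimes> (c \<otimes> (da \<otimes> c)))"

lemma sq_closed [simp]: "sqa \<in> carrier G" "sqb \<in> carrier G" "sqc \<in> carrier G"
  "da \<in> carrier G" "dc \<in> carrier G" "za \<in> carrier G"
  by (simp_all add: sqa_def sqb_def sqc_def da_def dc_def za_def)

lemma aba_tail: "y \<in> carrier G \<Longrightarrow> a \<otimes> (b \<otimes> (a \<otimes> y)) = b \<otimes> (a \<otimes> (b \<otimes> y))"
  using arg_cong[OF aba, of "\<lambda>z. z \<otimes> y"] by (simp add: m_assoc)

lemma bcb_tail: "y \<in> carrier G \<Longrightarrow> b \<otimes> (c \<otimes> (b \<otimes> y)) = c \<otimes> (b \<otimes> (c \<otimes> y))"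
  using arg_cong[OF bcb, of "\<lambda>z. z \<otimes> y"] by (simp add: m_assoc)

lemmas ac_tail = mult_tail[OF ac, simplified m_assoc]

text \<open>Reversing the order of the strands. It exchanges \<open>sqa\<close> with
  \<open>sqc\<close> and \<open>da\<close> with \<open>dc\<close>, so that each identity is proved
  for one end of the braid only.\<close>

lemma flip: "braid4 G c b a"
  by unfold_locales (simp_all add: ac aba bcb)

lemma a_da: "a \<otimes> da = da \<otimes> a"
  by (simp add: da_def m_assoc aba aba_tail)

lemma sqb_conj: "sqb \<otimes> (a \<otimes> sqb) = da \<otimes> a"
  by (simp add: da_def sqb_def m_assoc aba aba_tail)

lemma sqa_da: "sqa \<otimes> da = da \<otimes> sqa"
  using a_da by (simp add: sqa_def m_assoc) (simp add: m_assoc[symmetric])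

lemma b_sqa_da: "b \<otimes> (sqa \<otimes> da) = (sqa \<otimes> da) \<otimes> b"
proof -
  have "b \<otimes> (sqa \<otimes> da) = da \<otimes> (sqa \<otimes> b)"
    by (simp add: sqa_def da_def m_assoc)
  also have "\<dots> = (sqa \<otimes> da) \<otimes> b" by (simp add: sqa_da m_assoc)
  finally show ?thesis .
qed

lemma c_sqa: "c \<otimes> sqa = sqa \<otimes> c"
  using ac by (simp add: sqa_def m_assoc) (simp add: m_assoc[symmetric])

lemma commute_mult: "x \<in> carrier G \<Longrightarrow> y \<in> carrier G \<Longrightarrow> z \<in> carrier G \<Longrightarrow>
  x \<otimes> y = y \<otimes> x \<Longrightarrow> x \<otimes> z = z \<otimes> x \<Longrightarrow> x \<otimes> (y \<otimes> z) = (y \<otimes> z) \<otimes> x"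
  by (metis m_assoc)

lemma a_cdac: "a \<otimes> (c \<otimes> (da \<otimes> c)) = c \<otimes> (da \<otimes> c) \<otimes> a"
  by (intro commute_mult) (simp_all only: ac a_da closed sq_closed m_closed)

lemma b_cdac: "b \<otimes> (c \<otimes> (da \<otimes> c)) = c \<otimes> (da \<otimes> c) \<otimes> b"
proof -
  have "b \<otimes> (c \<otimes> (da \<otimes> c)) = c \<otimes> (b \<otimes> (c \<otimes> (sqa \<otimes> (b \<otimes> c))))"
    by (simp add: da_def sqa_def m_assoc bcb_tail)
  also have "\<dots> = c \<otimes> (b \<otimes> (sqa \<otimes> (b \<otimes> (c \<otimes> b))))"
    by (simp add: mult_tail[OF c_sqa] m_assoc bcb)
  also have "\<dots> = c \<otimes> (da \<otimes> c) \<otimes> b" by (simp add: da_def sqa_def m_assoc)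
  finally show ?thesis .
qed

lemma da_alt: "da = b \<otimes> (sqa \<otimes> b)"
  by (simp add: da_def sqa_def m_assoc)

text \<open>The four-term braid relation of type B between the crossing \<open>c\<close> and the
  element \<open>da\<close>.\<close>

lemma c_da_c_da: "c \<otimes> (da \<otimes> (c \<otimes> da)) = da \<otimes> (c \<otimes> (da \<otimes> c))"
proof -
  have swap: "b \<otimes> (sqa \<otimes> (b \<otimes> sqa)) = sqa \<otimes> (b \<otimes> (sqa \<otimes> b))"
    using sqa_da by (simp add: da_alt m_assoc)
  have "c \<otimes> (da \<otimes> (c \<otimes> da)) = c \<otimes> (b \<otimes> (sqa \<otimes> (c \<otimes> (b \<otimes> (c \<otimes> (sqa \<otimes> b))))))"
    by (simp add: da_alt m_assoc bcb_tail)
  also have "\<dots> = c \<otimes> (b \<otimes> (c \<otimes> (sqa \<otimes> (b \<otimes> (sqa \<otimes> (c \<otimes> b))))))"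
    by (simp add: m_assoc c_sqa mult_tail[OF c_sqa])
  also have "\<dots> = b \<otimes> (c \<otimes> ((b \<otimes> (sqa \<otimes> (b \<otimes> sqa))) \<otimes> (c \<otimes> b)))"
    by (simp add: m_assoc bcb_tail)
  also have "\<dots> = b \<otimes> (c \<otimes> (sqa \<otimes> (b \<otimes> (sqa \<otimes> (c \<otimes> (b \<otimes> c))))))"
    by (simp add: swap m_assoc bcb)
  also have "\<dots> = b \<otimes> (sqa \<otimes> (c \<otimes> (b \<otimes> (c \<otimes> (sqa \<otimes> (b \<otimes> c))))))"
    by (simp add: m_assoc c_sqa mult_tail[OF c_sqa])
  also have "\<dots> = da \<otimes> (c \<otimes> (da \<otimes> c))"
    by (simp add: da_alt m_assoc bcb_tail)
  finally show ?thesis .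
qed

lemma za_alt: "za = (sqa \<otimes> da) \<otimes> (c \<otimes> (da \<otimes> c))"
  by (simp add: za_def m_assoc)

text \<open>\<open>a\<close> and \<open>b\<close> commute with both factors in
  \<open>za_alt\<close>. For \<open>c\<close> another grouping is needed: it commutes with
  \<open>sqa\<close>, and by the type B relation with the remaining factor of
  \<open>za\<close>.\<close>

lemma za_central: "a \<otimes> za = za \<otimes> a" "b \<otimes> za = za \<otimes> b" "c \<otimes> za = za \<otimes> c"
proof -
  have "a \<otimes> (sqa \<otimes> da) = (sqa \<otimes> da) \<otimes> a"
    by (rule commute_mult) (simp_all only: a_da sq_closed closed, simp add: sqa_def m_assoc)
  then show "a \<otimes> za = za \<otimes> a"
    unfolding za_alt using commute_mult[OF closed(1) _ _ _ a_cdac] by simp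
  show "b \<otimes> za = za \<otimes> b"
    unfolding za_alt using commute_mult[OF closed(2) _ _ b_sqa_da b_cdac] by simp
  have "c \<otimes> za = sqa \<otimes> ((c \<otimes> (da \<otimes> (c \<otimes> da))) \<otimes> c)"
    by (simp add: za_def m_assoc mult_tail[OF c_sqa])
  also have "\<dots> = za \<otimes> c" by (simp add: c_da_c_da) (simp add: za_def m_assoc)
  finally show "c \<otimes> za = za \<otimes> c" .
qed

lemma conj_eqI: "g \<in> carrier G \<Longrightarrow> h \<in> carrier G \<Longrightarrow> k \<in> carrier G \<Longrightarrow> g \<otimes> h = k \<otimes> g \<Longrightarrow> g \<otimes> (h \<otimes> inv g) = k"
  by (metis inv_closed m_assoc m_closed r_inv r_one)

lemma conj_a:
  "a \<otimes> (sqa \<otimes> inv a) = sqa" "a \<otimes> (sqc \<otimes> inv a) = sqc" "a \<otimes> (da \<otimes> inv a) = da"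
  "a \<otimes> (sqb \<otimes> inv a) = inv sqb \<otimes> da"
proof -
  show "a \<otimes> (sqa \<otimes> inv a) = sqa" by (rule conj_eqI) (simp_all add: sqa_def m_assoc)
  show "a \<otimes> (sqc \<otimes> inv a) = sqc" by (rule conj_eqI) (simp_all add: sqc_def m_assoc ac ac_tail)
  show "a \<otimes> (da \<otimes> inv a) = da" by (rule conj_eqI) (simp_all add: a_da)
  have "inv sqb \<otimes> (sqb \<otimes> (a \<otimes> sqb)) = inv sqb \<otimes> (da \<otimes> a)" by (simp add: sqb_conj)
  then show "a \<otimes> (sqb \<otimes> inv a) = inv sqb \<otimes> da" by (intro conj_eqI) (simp_all add: m_assoc)
qed

lemma conj_b:
  "b \<otimes> (sqa \<otimes> inv b) = da \<otimes> inv sqb" "b \<otimes> (sqb \<otimes> inv b) = sqb" "b \<otimes> (da \<otimes> inv b) = sqb \<otimes> sqa"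
  by (simp_all add: da_def sqa_def sqb_def m_assoc inv_mult_group)

text \<open>Obtained by solving the definition of \<open>za\<close> for \<open>c da c\<close>. A
  central factor is left over, which is why the subgroup generated by the squares, \<open>da\<close>
  and \<open>dc\<close> is considered together with central elements when its normality is
  shown.\<close>

lemma conj_c_da: "c \<otimes> (da \<otimes> inv c) = inv da \<otimes> (inv sqa \<otimes> (inv sqc \<otimes> za))"
proof (rule conj_eqI)
  have "inv sqc \<otimes> za = za \<otimes> inv sqc"
    using za_central(3) by (intro commute_inv(2)) (simp_all add: sqc_def m_assoc, metis m_assoc closed sq_closed(6))
  then have "inv da \<otimes> (inv sqa \<otimes> (inv sqc \<otimes> za)) \<otimes> c = inv da \<otimes> (inv sqa \<otimes> (za \<otimes> (inv sqc \<otimes> c)))"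
    by (simp add: m_assoc)
  also have "\<dots> = c \<otimes> da"
    by (simp add: za_def sqc_def m_assoc inv_mult_group)
  finally show "c \<otimes> da = inv da \<otimes> (inv sqa \<otimes> (inv sqc \<otimes> za)) \<otimes> c" by simp
qed simp_all

end

context braid4 begin

text \<open>The third and fifth entries are the full twists on the first and on the last three
  strands, and the second is the conjugate of \<open>sqc\<close> by \<open>b\<close>. Each full
  twist commutes with the crossings of its own strands, which gives most of the relations; only the
  one between \<open>sqa\<close> and the second entry takes a computation.\<close>

lemma f3f2_rels_braid: "f3f2_rels G sqc (dc \<otimes> inv sqb) (sqa \<otimes> da) sqa (sqc \<otimes> dc)"
proof -
  interpret F: braid4 G c b a by (rule flip)
  have fl: "F.sqa = sqc" "F.da = dc"
    by (simp_all add: F.sqa_def F.da_def sqc_def dc_def)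
  define q where "q = sqc \<otimes> dc"
  define x3 where "x3 = sqa \<otimes> da"
  have qx [simp]: "q \<in> carrier G" "x3 \<in> carrier G" by (simp_all add: q_def x3_def)
  have pq: "sqa \<otimes> sqc = sqc \<otimes> sqa"
    by (simp add: sqc_def m_assoc c_sqa[symmetric] mult_tail[OF c_sqa[symmetric]])
  have bq: "b \<otimes> q = q \<otimes> b" using F.b_sqa_da by (simp add: fl q_def)
  have bx3: "b \<otimes> x3 = x3 \<otimes> b" using b_sqa_da by (simp add: x3_def)
  have EC: "sqc \<otimes> dc = dc \<otimes> sqc" using F.sqa_da by (simp add: fl)
  have qC: "q \<otimes> sqc = sqc \<otimes> q"
    by (simp add: q_def m_assoc EC mult_tail[OF EC])
  have x2: "dc \<otimes> inv sqb = b \<otimes> (sqc \<otimes> inv b)"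
    by (simp add: dc_def sqc_def sqb_def inv_mult_group m_assoc)
  have qb: "q \<otimes> b = b \<otimes> q" "q \<otimes> inv b = inv b \<otimes> q"
    using bq commute_inv(1)[of q b] by simp_all
  have "q \<otimes> (b \<otimes> (sqc \<otimes> inv b)) = (b \<otimes> (sqc \<otimes> inv b)) \<otimes> q"
    by (intro commute_mult) (simp_all only: qb qC qx closed sq_closed m_closed inv_closed)
  then have 5: "q \<otimes> (dc \<otimes> inv sqb) = (dc \<otimes> inv sqb) \<otimes> q" by (simp add: x2)
  have "sqb \<otimes> q = q \<otimes> sqb" "sqb \<otimes> x3 = x3 \<otimes> sqb"
    by (simp_all add: sqb_def m_assoc bq bx3 mult_tail[OF bq] mult_tail[OF bx3])
  then have Bq: "inv sqb \<otimes> q = q \<otimes> inv sqb" and Bx3: "inv sqb \<otimes> x3 = x3 \<otimes> inv sqb"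
    using commute_inv(2)[of sqb q] commute_inv(2)[of sqb x3] by simp_all
  have Cx2: "sqc \<otimes> (dc \<otimes> inv sqb) = q \<otimes> inv sqb" by (simp add: q_def m_assoc)
  have "q \<otimes> (x3 \<otimes> (sqc \<otimes> (dc \<otimes> inv sqb))) = (sqc \<otimes> (dc \<otimes> inv sqb)) \<otimes> (x3 \<otimes> q)"
    by (simp add: Cx2 m_assoc mult_tail[OF Bx3] Bq)
  then have 6: "q \<otimes> (x3 \<otimes> (sqc \<otimes> (dc \<otimes> inv sqb))) = sqc \<otimes> ((dc \<otimes> inv sqb) \<otimes> (x3 \<otimes> q))"
    by (simp add: m_assoc)
  have x3b: "inv b \<otimes> x3 = x3 \<otimes> inv b" using bx3 commute_inv(2)[of b x3] by simp
  have x3_b: "x3 \<otimes> inv b = sqa \<otimes> (b \<otimes> sqa)" by (simp add: x3_def da_alt m_assoc)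
  have "sqa \<otimes> ((b \<otimes> (sqc \<otimes> inv b)) \<otimes> (x3 \<otimes> sqc)) = sqa \<otimes> (b \<otimes> (sqc \<otimes> ((x3 \<otimes> inv b) \<otimes> sqc)))"
    by (simp add: m_assoc mult_tail[OF x3b])
  also have "\<dots> = sqa \<otimes> (b \<otimes> (sqa \<otimes> (sqc \<otimes> (b \<otimes> (sqc \<otimes> sqa)))))"
    by (simp add: x3_b m_assoc pq mult_tail[OF pq])
  also have "\<dots> = sqa \<otimes> (b \<otimes> (sqa \<otimes> ((sqc \<otimes> dc) \<otimes> (inv b \<otimes> sqa))))"
    by (simp add: dc_def sqc_def m_assoc)
  also have "\<dots> = sqa \<otimes> (b \<otimes> (sqa \<otimes> (dc \<otimes> (sqc \<otimes> (inv b \<otimes> sqa)))))"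
    by (simp add: EC m_assoc)
  also have "\<dots> = x3 \<otimes> (sqc \<otimes> ((b \<otimes> (sqc \<otimes> inv b)) \<otimes> sqa))"
    by (simp add: x3_def da_alt dc_def sqc_def m_assoc)
  finally have 3: "sqa \<otimes> ((dc \<otimes> inv sqb) \<otimes> (x3 \<otimes> sqc)) = x3 \<otimes> (sqc \<otimes> ((dc \<otimes> inv sqb) \<otimes> sqa))"
    by (simp only: x2)
  have 2: "sqa \<otimes> x3 = x3 \<otimes> sqa" by (simp add: x3_def m_assoc sqa_da mult_tail[OF sqa_da])
  show ?thesis
    unfolding f3f2_rels_def q_def[symmetric] x3_def[symmetric]
    using pq 2 3 qC 5 6 by simp
qed

end

section \<open>The Coxeter presentation of the symmetric group on four points\<close>

locale coxeter4 = group +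
  fixes s :: "nat \<Rightarrow> 'a"
  assumes s_closed [simp]: "s 1 \<in> carrier G" "s 2 \<in> carrier G" "s 3 \<in> carrier G"
    and sq: "s 1 \<otimes> s 1 = \<one>" "s 2 \<otimes> s 2 = \<one>" "s 3 \<otimes> s 3 = \<one>"
    and s13: "s 3 \<otimes> s 1 = s 1 \<otimes> s 3"
    and s121: "s 2 \<otimes> (s 1 \<otimes> s 2) = s 1 \<otimes> (s 2 \<otimes> s 1)"
    and s232: "s 3 \<otimes> (s 2 \<otimes> s 3) = s 2 \<otimes> (s 3 \<otimes> s 2)"

text \<open>Products of coset representatives along the chain of symmetric groups on 2, 3 and 4
  points: 2 * 3 * 4 = 24 words.\<close>

definition coxeter4_nf :: "nat list set" where
  "coxeter4_nf = (\<lambda>(u, v, w). u @ v @ w) ` ({[], [1]} \<times> {[], [2], [2, 1]} \<times> {[], [3], [3, 2], [3, 2, 1]})"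

context coxeter4
begin

lemma coxeter_tail:
  assumes "y \<in> carrier G"
  shows "s 1 \<otimes> (s 1 \<otimes> y) = y" "s 2 \<otimes> (s 2 \<otimes> y) = y" "s 3 \<otimes> (s 3 \<otimes> y) = y"
    "s 3 \<otimes> (s 1 \<otimes> y) = s 1 \<otimes> (s 3 \<otimes> y)"
    "s 2 \<otimes> (s 1 \<otimes> (s 2 \<otimes> y)) = s 1 \<otimes> (s 2 \<otimes> (s 1 \<otimes> y))"
    "s 3 \<otimes> (s 2 \<otimes> (s 3 \<otimes> y)) = s 2 \<otimes> (s 3 \<otimes> (s 2 \<otimes> y))"
  using assms sq s13 s121 s232 by (simp_all add: m_assoc[symmetric] del: One_nat_def)

lemma coxeter_long:
  "y \<in> carrier G \<Longrightarrow> s 3 \<otimes> (s 2 \<otimes> (s 1 \<otimes> (s 3 \<otimes> y))) = s 2 \<otimes> (s 3 \<otimes> (s 2 \<otimes> (s 1 \<otimes> y)))"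
  using coxeter_tail(4)[of y] coxeter_tail(6)[of "s 1 \<otimes> y"] by (simp del: One_nat_def)

lemma coxeter_long':
  "s 3 \<otimes> (s 2 \<otimes> (s 1 \<otimes> s 3)) = s 2 \<otimes> (s 3 \<otimes> (s 2 \<otimes> s 1))"
  using coxeter_long[of \<one>] by (simp del: One_nat_def)

lemma s_inv: "inv (s 1) = s 1" "inv (s 2) = s 2" "inv (s 3) = s 3"
  using sq by (auto intro!: inv_equality simp del: One_nat_def)

text \<open>The generators are involutions, so signs of letters disappear, and left multiplication
  of each of the 24 words by a generator rewrites to a word of the list.\<close>

lemma coxeter_nf:
  "w \<in> words {1..<4} \<Longrightarrow> \<exists>w0\<in>coxeter4_nf. word_eval G s w = word_eval G s (positive_word w0)"
proof (induction w)
  case Nil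
  show ?case by (auto simp: coxeter4_nf_def)
next
  case (Cons x w)
  then obtain w0 where w0: "w0 \<in> coxeter4_nf" "word_eval G s w = word_eval G s (positive_word w0)"
    by auto
  obtain k e where x: "x = (k, e)" by force
  have k: "k \<in> {1, 2, 3}" using Cons.prems x by auto
  have "word_eval G s (x # w) = s k \<otimes> word_eval G s (positive_word w0)"
    using k s_inv by (auto simp: x w0 simp del: One_nat_def)
  moreover have "\<exists>w1\<in>coxeter4_nf. s k \<otimes> word_eval G s (positive_word w0) = word_eval G s (positive_word w1)"
    using k w0(1) unfolding coxeter4_nf_def
    by (auto simp: sq s13 s121 s232 coxeter_tail coxeter_long coxeter_long' simp del: One_nat_def)
  ultimately show ?case by simp
qed

end

text \<open>The images of the four points rule out the other 23 words.\<close>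

lemma coxeter4_nf_perm:
  assumes "w \<in> coxeter4_nf" "word_perm (positive_word w) = id"
  shows "w = []"
proof -
  have "word_perm (positive_word w) 1 = 1" "word_perm (positive_word w) 2 = 2"
    "word_perm (positive_word w) 3 = 3" "word_perm (positive_word w) 4 = 4"
    using assms(2) by simp_all
  then show ?thesis
    using assms(1) unfolding coxeter4_nf_def
    by (auto simp: word_perm_def positive_word_def transpose_def split: if_splits)
qed

section \<open>From B4 to P4 modulo its center\<close>

section \<open>The pure braid group on four strands modulo its center\<close>

declare One_nat_def [simp del]

abbreviation B4 :: "nat word set monoid" where
  "B4 \<equiv> braid_group 4"

definition bgen :: "nat \<Rightarrow> nat word set" where
  "bgen i = pres_gen {1..<4} (braid_rels 4) i"

lemma group_B4: "group B4"
  unfolding braid_group_def by (rule group_presented_group)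

lemma nat_1_4: "i \<in> {1..<4::nat} \<longleftrightarrow> i = 1 \<or> i = 2 \<or> i = 3"
  by auto

lemma bgen_closed: "i \<in> {1..<4} \<Longrightarrow> bgen i \<in> carrier B4"
  unfolding bgen_def braid_group_def by (rule pres_gen_closed)

lemma braid4_B4: "braid4 B4 (bgen 1) (bgen 2) (bgen 3)"
proof -
  interpret group B4 by (rule group_B4)
  have cl: "bgen 1 \<in> carrier B4" "bgen 2 \<in> carrier B4" "bgen 3 \<in> carrier B4"
    by (rule bgen_closed; simp)+
  have rel: "word_eval B4 bgen (positive_word u) = word_eval B4 bgen (positive_word v)"
    if "(positive_word u, positive_word v) \<in> braid_rels 4" "set u \<subseteq> {1..<4}" "set v \<subseteq> {1..<4}" for u v
    unfolding braid_group_def bgen_def[abs_def] by (rule presented_group_rel) (use that in auto)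
  have "(positive_word [1, 3], positive_word [3, 1]) \<in> braid_rels 4"
    "(positive_word [1, 2, 1], positive_word [2, 1, 2]) \<in> braid_rels 4"
    "(positive_word [2, 3, 2], positive_word [3, 2, 3]) \<in> braid_rels 4"
    by (auto simp: braid_rels_def)
  from this[THEN rel] show ?thesis
    by unfold_locales (simp_all add: cl)
qed

interpretation B: braid4 B4 "bgen 1" "bgen 2" "bgen 3"
  by (rule braid4_B4)

lemma braid_word_eval_rel:
  assumes "braid4 H a b c" "(u, v) \<in> braid_rels 4"
  shows "word_eval H (\<lambda>i. if i = 1 then a else if i = 2 then b else c) u
    = word_eval H (\<lambda>i. if i = 1 then a else if i = 2 then b else c) v"
proof -
  interpret braid4 H a b c by fact
  consider i j where "u = positive_word [i, j]" "v = positive_word [j, i]" "i \<in> {1..<4}" "j \<in> {1..<4}"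
      "i + 2 \<le> j \<or> j + 2 \<le> i"
    | i where "u = positive_word [i, Suc i, i]" "v = positive_word [Suc i, i, Suc i]"
      "i \<in> {1..<4}" "Suc i \<in> {1..<4}"
    using assms(2) unfolding braid_rels_def by blast
  then show ?thesis
  proof cases
    case 1
    then have "(i, j) = (1, 3) \<or> (i, j) = (3, 1)" unfolding nat_1_4 by auto
    then show ?thesis using 1 ac by auto
  next
    case 2
    then have "i = 1 \<or> i = 2" unfolding nat_1_4 by auto
    then show ?thesis using 2 aba bcb by (auto simp: numeral_2_eq_2)
  qed
qed

lemma B4_hom:
  assumes "braid4 H a b c"
  obtains f where "group_hom B4 H f" "f (bgen 1) = a" "f (bgen 2) = b" "f (bgen 3) = c"
    "\<And>w. w \<in> words {1..<4} \<Longrightarrow> f (pres_class {1..<4} (braid_rels 4) w)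
      = word_eval H (\<lambda>i. if i = 1 then a else if i = 2 then b else c) w"
proof -
  interpret braid4 H a b c by fact
  let ?\<phi> = "\<lambda>i::nat. if i = 1 then a else if i = 2 then b else c"
  have \<phi>: "?\<phi> \<in> {1..<4} \<rightarrow> carrier H" by auto
  have rel: "word_eval H ?\<phi> u = word_eval H ?\<phi> v" if "(u, v) \<in> braid_rels 4" for u v
    using braid_word_eval_rel[OF assms that] .
  obtain f where f: "f \<in> hom (presented_group {1..<4} (braid_rels 4)) H"
    "\<And>w. w \<in> words {1..<4} \<Longrightarrow> f (pres_class {1..<4} (braid_rels 4) w) = word_eval H ?\<phi> w"
    "\<And>x. x \<in> {1..<4} \<Longrightarrow> f (pres_gen {1..<4} (braid_rels 4) x) = ?\<phi> x"
    by (rule presented_group_hom[OF \<phi> rel], assumption, rule that)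
  note f = f[folded bgen_def, folded braid_group_def]
  show thesis
    by (rule that[OF hom_group_hom[OF group_B4 is_group f(1)] _ _ _ f(2)])
      (use f(3) in \<open>simp_all\<close>)
qed

abbreviation S4 :: "(nat \<Rightarrow> nat) monoid" where
  "S4 \<equiv> sym_group 4"

abbreviation tau :: "nat \<Rightarrow> nat \<Rightarrow> nat" where
  "tau i \<equiv> Transposition.transpose i (Suc i)"

lemma group_S4: "group S4"
  by (rule sym_group_is_group)

lemma tau_closed: "i \<in> {1..<4} \<Longrightarrow> tau i \<in> carrier S4"
  by (auto simp: sym_group_def intro: permutes_swap_id)

lemma S4_mult [simp]: "f \<otimes>\<^bsub>S4\<^esub> g = f \<circ> g"
  by (simp add: sym_group_def)

lemma tau_invol: "i \<in> {1..<4} \<Longrightarrow> inv\<^bsub>S4\<^esub> (tau i) = tau i"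
  using tau_closed[of i] by (intro group.inv_equality[OF group_S4]) (auto simp: sym_group_def)

lemma word_perm_eq: "w \<in> words {1..<4} \<Longrightarrow> word_perm w = word_eval S4 tau w"
proof (induction w)
  case Nil
  show ?case by (simp add: word_perm_def sym_group_def)
next
  case (Cons a w)
  obtain i e where "a = (i, e)" by force
  then show ?case using Cons tau_invol[of i] by (simp add: word_perm_def)
qed

lemma coxeter4_S4: "coxeter4 S4 tau"
proof -
  interpret group S4 by (rule group_S4)
  have "tau 1 \<in> carrier S4" "tau 2 \<in> carrier S4" "tau 3 \<in> carrier S4"
    by (rule tau_closed; simp)+
  then show ?thesis
    by unfold_locales
      (auto simp: sym_group_def fun_eq_iff transpose_def numeral_2_eq_2 numeral_3_eq_3)
qed

lemma braid4_S4: "braid4 S4 (tau 1) (tau 2) (tau 3)"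
proof -
  interpret coxeter4 S4 tau by (rule coxeter4_S4)
  show ?thesis
    by unfold_locales (simp_all only: s_closed s13 s121 s232)
qed

text \<open>Transpositions are involutions satisfying the braid relations, so
  \<open>word_perm\<close> is an evaluation in the symmetric group and constant on a class;
  \<open>the_elem\<close> is applied to a singleton.\<close>

lemma braid_perm:
  assumes w: "w \<in> words {1..<4}"
  shows "braid_perm (pres_class {1..<4} (braid_rels 4) w) = word_perm w"
proof -
  let ?\<phi> = "\<lambda>i::nat. if i = 1 then tau 1 else if i = 2 then tau 2 else tau 3"
  interpret group S4 by (rule group_S4)
  have \<phi>: "?\<phi> \<in> {1..<4} \<rightarrow> carrier S4"
    using tau_closed[of 1] tau_closed[of 2] tau_closed[of 3] by auto
  have eq: "word_perm v = word_eval S4 ?\<phi> v" if "v \<in> words {1..<4}" for v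
    unfolding word_perm_eq[OF that] using that
  proof (induction v)
    case (Cons x v)
    obtain i e where x: "x = (i, e)" by force
    have "tau i = ?\<phi> i" using Cons.prems x nat_1_4[of i] by auto
    then show ?case using Cons x by simp
  qed simp
  have "word_perm v = word_perm w" if "pres_cong {1..<4} (braid_rels 4) w v" for v
  proof -
    have "word_eval S4 ?\<phi> w = word_eval S4 ?\<phi> v"
      by (rule word_eval_cong[OF \<phi> braid_word_eval_rel[OF braid4_S4] that])
    then show ?thesis using pres_cong_words[OF that] by (simp only: eq)
  qed
  moreover have "w \<in> pres_class {1..<4} (braid_rels 4) w"
    using w by (simp add: mem_pres_class pres_cong.refl)
  ultimately have "word_perm ` pres_class {1..<4} (braid_rels 4) w = {word_perm w}"
    unfolding mem_pres_class[symmetric] by blast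
  then show ?thesis by (simp add: braid_perm_def)
qed

lemma group_hom_braid_perm: "group_hom B4 S4 braid_perm"
proof (rule hom_group_hom[OF group_B4 group_S4], rule homI)
  interpret group S4 by (rule group_S4)
  have tau: "tau \<in> {1..<4} \<rightarrow> carrier S4" using tau_closed by auto
  show "braid_perm x \<in> carrier S4" if "x \<in> carrier B4" for x
    using that word_eval_closed[OF tau]
    by (auto simp: braid_group_def carrier_presented_group braid_perm word_perm_eq)
  show "braid_perm (x \<otimes>\<^bsub>B4\<^esub> y) = braid_perm x \<otimes>\<^bsub>S4\<^esub> braid_perm y"
    if "x \<in> carrier B4" "y \<in> carrier B4" for x y
    using that word_eval_append[OF tau]
    by (auto simp: braid_group_def carrier_presented_group braid_perm word_perm_eq presented_group_mult)
qed

interpretation bp: group_hom B4 S4 braid_perm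
  by (rule group_hom_braid_perm)

text \<open>A word with trivial permutation becomes trivial under every map of the braid group to a group
  with generators of order two, because it then factors through the Coxeter presentation.\<close>

lemma pure_braid_trivial:
  assumes H: "coxeter4 H s" and f: "group_hom B4 H f" "f (bgen 1) = s 1" "f (bgen 2) = s 2" "f (bgen 3) = s 3"
    and g: "g \<in> carrier B4" "braid_perm g = id"
  shows "f g = \<one>\<^bsub>H\<^esub>"
proof -
  interpret H: coxeter4 H s by fact
  interpret S: coxeter4 S4 tau by (rule coxeter4_S4)
  interpret f: group_hom B4 H f by fact
  obtain w where w: "w \<in> words {1..<4}" "g = pres_class {1..<4} (braid_rels 4) w"
    using g(1) by (auto simp: braid_group_def carrier_presented_group)
  \<comment> \<open>In the product group a single normal form serves for both components. The
    component in the symmetric group shows that it is empty, and then the component in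
    \<open>H\<close> is trivial.\<close>
  let ?K = "H \<times>\<times> S4" and ?s = "\<lambda>i. (s i, tau i)"
  interpret K: group ?K by (intro DirProd_group H.is_group group_S4)
  have K: "coxeter4 ?K ?s"
    by unfold_locales (simp_all only: DirProd_def monoid.simps partial_object.simps mem_Times_iff fst_conv snd_conv
      H.s_closed S.s_closed H.sq S.sq H.s13 S.s13 H.s121 S.s121 H.s232 S.s232 case_prod_conv simp_thms)
  have split: "word_eval ?K ?s v = (word_eval H s v, word_eval S4 tau v)" if "v \<in> words {1..<4}" for v
    using that
  proof (induction v)
    case Nil
    show ?case by (simp add: DirProd_def)
  next
    case (Cons x v)
    obtain i e where x: "x = (i, e)" by force
    then have "s i \<in> carrier H" "tau i \<in> carrier S4"
      using Cons.prems tau_closed[of i] H.s_closed nat_1_4[of i] by auto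
    then show ?case using Cons x inv_DirProd[OF H.is_group group_S4, of "s i" "tau i"]
      by (auto simp: DirProd_def)
  qed
  obtain w0 where w0: "w0 \<in> coxeter4_nf" "word_eval ?K ?s w = word_eval ?K ?s (positive_word w0)"
    using coxeter4.coxeter_nf[OF K w(1)] by auto
  have w0w: "positive_word w0 \<in> words {1..<4}"
    using w0(1) by (auto simp: coxeter4_nf_def)
  have "word_perm (positive_word w0) = word_perm w"
    using w0(2) unfolding split[OF w(1)] split[OF w0w] word_perm_eq[OF w(1)] word_perm_eq[OF w0w] by simp
  then have "w0 = []"
    using coxeter4_nf_perm[OF w0(1)] g(2) w braid_perm by simp
  then have "word_eval H s w = \<one>\<^bsub>H\<^esub>"
    using w0(2) split[OF w(1)] split[OF w0w] by simp
  moreover have "f g = word_eval H s w"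
    using w(1) unfolding w(2) pres_class_eq_word_eval[OF w(1)]
  proof (induction w)
    case (Cons x v)
    obtain i e where x: "x = (i, e)" by force
    have i: "i \<in> {1..<4}" "v \<in> words {1..<4}" using Cons.prems x by auto
    have cl: "word_eval (presented_group {1..<4} (braid_rels 4)) (pres_gen {1..<4} (braid_rels 4)) v \<in> carrier B4"
      unfolding braid_group_def
      by (rule group.word_eval_closed[OF group_presented_group, of _ "{1..<4}"]) (use i in auto)
    have "f (bgen i) = s i" using i(1) f(2-) unfolding nat_1_4 by auto
    then show ?case
      using Cons.IH[OF i(2)] cl bgen_closed[OF i(1)]
      unfolding x bgen_def[symmetric] braid_group_def[symmetric] word_eval_simps by simp
  qed (use f.hom_one in \<open>simp add: braid_group_def\<close>)
  ultimately show ?thesis by simp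
qed

abbreviation PB4 :: "nat word set monoid" where
  "PB4 \<equiv> pure_braid_group 4"

lemma carrier_PB4: "carrier PB4 = {g \<in> carrier B4. braid_perm g = id}"
  by (simp add: pure_braid_group_def kernel_def sym_group_def)

lemma PB4_simps [simp]: "x \<otimes>\<^bsub>PB4\<^esub> y = x \<otimes>\<^bsub>B4\<^esub> y" "\<one>\<^bsub>PB4\<^esub> = \<one>\<^bsub>B4\<^esub>"
  by (simp_all add: pure_braid_group_def)

lemma group_PB4: "group PB4"
  unfolding pure_braid_group_def
  using B.subgroup_imp_group[OF bp.subgroup_kernel] .

interpretation PB: group PB4 by (rule group_PB4)

lemma PB4_inv:
  assumes "x \<in> carrier PB4"
  shows "inv\<^bsub>PB4\<^esub> x = inv\<^bsub>B4\<^esub> x"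
proof -
  have "inv\<^bsub>PB4\<^esub> x \<otimes>\<^bsub>B4\<^esub> x = \<one>\<^bsub>B4\<^esub>" using PB.l_inv[OF assms] by simp
  moreover have "inv\<^bsub>PB4\<^esub> x \<in> carrier B4" "x \<in> carrier B4"
    using assms PB.inv_closed[OF assms] by (simp_all add: carrier_PB4)
  ultimately show ?thesis using B.inv_equality by metis
qed

lemma center_normal:
  fixes G (structure)
  assumes "group G"
  shows "center G \<lhd> G"
proof -
  interpret group G by fact
  have sub: "subgroup (center G) G"
  proof (rule subgroup.intro)
    fix x y assume x: "x \<in> center G" and y: "y \<in> center G"
    have "x \<otimes> y \<otimes> g = g \<otimes> (x \<otimes> y)" if g: "g \<in> carrier G" for g
    proof -
      have cl: "x \<in> carrier G" "y \<in> carrier G" and c: "x \<otimes> g = g \<otimes> x" "y \<otimes> g = g \<otimes> y"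
        using x y g unfolding center_def by blast+
      show ?thesis using cl g by (simp add: m_assoc c mult_tail[OF c(1)])
    qed
    then show "x \<otimes> y \<in> center G" using x y m_closed unfolding center_def by blast
  next
    fix x assume x: "x \<in> center G"
    then show "inv x \<in> center G"
      unfolding center_def using commute_inv(2) inv_closed by blast
  qed (auto simp: center_def)
  show ?thesis
  proof (rule normal_invI[OF sub])
    fix z g assume z: "z \<in> center G" and g: "g \<in> carrier G"
    then have "z \<in> carrier G" "g \<otimes> z = z \<otimes> g" unfolding center_def by auto
    then have "g \<otimes> z \<otimes> inv g = z" using g by (simp add: m_assoc)
    then show "g \<otimes> z \<otimes> inv g \<in> center G" using \<open>z \<in> center G\<close> by simp
  qed
qed

interpretation PZ: normal "center PB4" PB4
  by (rule center_normal[OF group_PB4])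

lemma group_P4_bar: "group P4_bar"
  unfolding P4_bar_def by (rule PZ.factorgroup_is_group)

abbreviation SD where "SD \<equiv> f3f2_group"

lemma B4_subset:
  assumes S: "subgroup S B4" and "bgen 1 \<in> S" "bgen 2 \<in> S" "bgen 3 \<in> S"
  shows "carrier B4 \<subseteq> S"
  unfolding braid_group_def
proof (rule presented_group_subset)
  show "subgroup S (presented_group {1..<4} (braid_rels 4))"
    using S by (simp add: braid_group_def)
  show "pres_gen {1..<4} (braid_rels 4) i \<in> S" if "i \<in> {1..<4}" for i
    using that assms(2-) unfolding nat_1_4 bgen_def[symmetric] by auto
qed

lemma f3f2_group_subset:
  assumes S: "subgroup S SD" and "{f3f2_gen X1, f3f2_gen X2, f3f2_gen X3, f3f2_gen P, f3f2_gen Q} \<subseteq> S"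
  shows "carrier SD \<subseteq> S"
proof (rule presented_group_subset[OF S])
  show "f3f2_gen x \<in> S" for x using assms(2) by (cases x) auto
qed

lemma f3f2_group_hom_eq:
  assumes "group_hom SD H f" "group_hom SD H f'"
    and "f (f3f2_gen X1) = f' (f3f2_gen X1)" "f (f3f2_gen X2) = f' (f3f2_gen X2)"
      "f (f3f2_gen X3) = f' (f3f2_gen X3)" "f (f3f2_gen P) = f' (f3f2_gen P)" "f (f3f2_gen Q) = f' (f3f2_gen Q)"
    and "g \<in> carrier SD"
  shows "f g = f' g"
proof (rule presented_group_hom_eq)
  show "f (f3f2_gen x) = f' (f3f2_gen x)" for x
    by (cases x) (use assms in auto)
  show "group H" "f \<in> hom SD H" "f' \<in> hom SD H"
    using assms(1,2) by (auto simp: group_hom_def group_hom_axioms_def)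
qed fact

subsection \<open>The homomorphism from \<open>F\<^sub>3 \<rtimes> F\<^sub>2\<close> to the pure braid group\<close>

lemma bgen_perm: "i \<in> {1..<4} \<Longrightarrow> braid_perm (bgen i) = tau i"
  unfolding bgen_def pres_gen_def by (subst braid_perm) (auto simp: word_perm_def)

lemma braid_perm_bgens: "braid_perm (bgen 1) = tau 1" "braid_perm (bgen 2) = tau 2" "braid_perm (bgen 3) = tau 3"
  by (rule bgen_perm; simp)+

lemma transpose_comp_cancel [simp]:
  "Transposition.transpose i j \<circ> Transposition.transpose i j = id"
  "Transposition.transpose i j \<circ> (Transposition.transpose i j \<circ> f) = f"
  by (simp_all add: fun_eq_iff)

lemma PB4_elems:
  "B.sqa \<in> carrier PB4" "B.sqb \<in> carrier PB4" "B.sqc \<in> carrier PB4" "B.da \<in> carrier PB4" "B.dc \<in> carrier PB4"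
  by (simp_all add: carrier_PB4 B.sqa_def B.sqb_def B.sqc_def B.da_def B.dc_def braid_perm_bgens)

lemma theta_exists:
  obtains \<theta> where "group_hom SD B4 \<theta>" "\<And>g. g \<in> carrier SD \<Longrightarrow> \<theta> g \<in> carrier PB4"
    "\<theta> (f3f2_gen X1) = B.sqc" "\<theta> (f3f2_gen X2) = B.dc \<otimes>\<^bsub>B4\<^esub> inv\<^bsub>B4\<^esub> B.sqb"
    "\<theta> (f3f2_gen X3) = B.sqa \<otimes>\<^bsub>B4\<^esub> B.da" "\<theta> (f3f2_gen P) = B.sqa"
    "\<theta> (f3f2_gen Q) = B.sqc \<otimes>\<^bsub>B4\<^esub> B.dc"
proof -
  obtain \<theta> where \<theta>: "group_hom SD B4 \<theta>"
    "\<theta> (f3f2_gen X1) = B.sqc" "\<theta> (f3f2_gen X2) = B.dc \<otimes>\<^bsub>B4\<^esub> inv\<^bsub>B4\<^esub> B.sqb"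
    "\<theta> (f3f2_gen X3) = B.sqa \<otimes>\<^bsub>B4\<^esub> B.da" "\<theta> (f3f2_gen P) = B.sqa"
    "\<theta> (f3f2_gen Q) = B.sqc \<otimes>\<^bsub>B4\<^esub> B.dc"
    using f3f2_group_hom[OF group_B4 B.f3f2_rels_braid] by metis
  interpret \<theta>: group_hom SD B4 \<theta> by fact
  have sub: "subgroup (carrier PB4) B4"
    using bp.subgroup_kernel by (simp add: pure_braid_group_def)
  have "subgroup {g \<in> carrier SD. \<theta> g \<in> carrier PB4} SD"
    by unfold_locales (auto simp: subgroup.m_closed[OF sub] subgroup.one_closed[OF sub] subgroup.m_inv_closed[OF sub])
  then have "carrier SD \<subseteq> {g \<in> carrier SD. \<theta> g \<in> carrier PB4}"
    by (rule f3f2_group_subset)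
      (use SD.closed in \<open>auto simp: \<theta> PB4_elems subgroup.m_closed[OF sub] subgroup.m_inv_closed[OF sub]\<close>)
  then show thesis using that[OF \<theta>(1) _ \<theta>(2-)] by blast
qed

text \<open>Modulo elements that are central in \<open>B\<^sub>4\<close>, the image of \<open>\<theta>\<close> is normal in \<open>B\<^sub>4\<close> and contains
  the squares of the generators. In the quotient the Coxeter relations hold.\<close>

lemma theta_surj:
  assumes \<theta>: "group_hom SD B4 \<theta>" "\<And>g. g \<in> carrier SD \<Longrightarrow> \<theta> g \<in> carrier PB4"
    "\<theta> (f3f2_gen X1) = B.sqc" "\<theta> (f3f2_gen X2) = B.dc \<otimes>\<^bsub>B4\<^esub> inv\<^bsub>B4\<^esub> B.sqb"
    "\<theta> (f3f2_gen X3) = B.sqa \<otimes>\<^bsub>B4\<^esub> B.da" "\<theta> (f3f2_gen P) = B.sqa"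
    "\<theta> (f3f2_gen Q) = B.sqc \<otimes>\<^bsub>B4\<^esub> B.dc"
    and h: "h \<in> carrier PB4"
  shows "\<exists>g\<in>carrier SD. \<exists>z\<in>center PB4. h = \<theta> g \<otimes>\<^bsub>B4\<^esub> z"
proof -
  interpret \<theta>: group_hom SD B4 \<theta> by fact
  \<comment> \<open>The center of B4 is adjoined because conjugation by a braid generator returns to
    the image of \<open>\<theta>\<close> only up to a full twist.\<close>
  define N where "N = {\<theta> g \<otimes>\<^bsub>B4\<^esub> z | g z. g \<in> carrier SD \<and> z \<in> center B4}"
  have zz: "z \<in> carrier B4" if "z \<in> center B4" for z using that by (simp add: center_def)
  have zc: "z \<otimes>\<^bsub>B4\<^esub> g = g \<otimes>\<^bsub>B4\<^esub> z" if "z \<in> center B4" "g \<in> carrier B4" for z g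
    using that by (simp add: center_def)
  interpret Z: normal "center B4" B4 by (rule center_normal[OF group_B4])
  have N_I: "\<theta> g \<otimes>\<^bsub>B4\<^esub> z \<in> N" if "g \<in> carrier SD" "z \<in> center B4" for g z
    using that unfolding N_def by blast
  have N_sub: "subgroup N B4"
  proof (rule subgroup.intro)
    show "N \<subseteq> carrier B4" by (auto simp: N_def zz)
    show "\<one>\<^bsub>B4\<^esub> \<in> N" using N_I[OF SD.one_closed Z.one_closed] by simp
    show "x \<otimes>\<^bsub>B4\<^esub> y \<in> N" if xy: "x \<in> N" "y \<in> N" for x y
    proof -
      obtain g z g' z' where 1: "x = \<theta> g \<otimes>\<^bsub>B4\<^esub> z" "y = \<theta> g' \<otimes>\<^bsub>B4\<^esub> z'" "g \<in> carrier SD" "g' \<in> carrier SD"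
        "z \<in> center B4" "z' \<in> center B4" using xy by (auto simp: N_def)
      have "x \<otimes>\<^bsub>B4\<^esub> y = \<theta> (g \<otimes>\<^bsub>SD\<^esub> g') \<otimes>\<^bsub>B4\<^esub> (z \<otimes>\<^bsub>B4\<^esub> z')"
        using 1 zz by (simp add: B.m_assoc B.mult_tail[OF zc[OF 1(5), of "\<theta> g'"]])
      then show ?thesis using N_I[of "g \<otimes>\<^bsub>SD\<^esub> g'" "z \<otimes>\<^bsub>B4\<^esub> z'"] 1 by simp
    qed
    show "inv\<^bsub>B4\<^esub> x \<in> N" if xN: "x \<in> N" for x
    proof -
      obtain g z where 1: "x = \<theta> g \<otimes>\<^bsub>B4\<^esub> z" "g \<in> carrier SD" "z \<in> center B4" using xN by (auto simp: N_def)
      have "inv\<^bsub>B4\<^esub> x = \<theta> (inv\<^bsub>SD\<^esub> g) \<otimes>\<^bsub>B4\<^esub> inv\<^bsub>B4\<^esub> z"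
        unfolding 1(1) using 1(2,3) zz zc[of "inv\<^bsub>B4\<^esub> z" "inv\<^bsub>B4\<^esub> \<theta> g"]
        by (subst B.inv_mult_group) auto
      then show ?thesis using N_I[of "inv\<^bsub>SD\<^esub> g" "inv\<^bsub>B4\<^esub> z"] 1 by simp
    qed
  qed
  note Nm = subgroup.m_closed[OF N_sub] and Ni = subgroup.m_inv_closed[OF N_sub]
  have \<theta>N: "\<theta> g \<in> N" if "g \<in> carrier SD" for g
    using N_I[OF that Z.one_closed] that by simp
  have zN: "z \<in> N" if "z \<in> center B4" for z
    using N_I[OF SD.one_closed that] zz[OF that] by simp
  have N1 [simp]: "B.sqa \<in> N" "B.sqc \<in> N"
    and N2: "B.sqa \<otimes>\<^bsub>B4\<^esub> B.da \<in> N" "B.sqc \<otimes>\<^bsub>B4\<^esub> B.dc \<in> N" "B.dc \<otimes>\<^bsub>B4\<^esub> inv\<^bsub>B4\<^esub> B.sqb \<in> N"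
    using \<theta>N[OF SD.closed(4)] \<theta>N[OF SD.closed(1)] \<theta>N[OF SD.closed(3)] \<theta>N[OF SD.closed(5)]
      \<theta>N[OF SD.closed(2)] by (simp_all only: \<theta>)
  have N3 [simp]: "B.da \<in> N" "B.dc \<in> N"
    using Nm[OF Ni[OF N1(1)] N2(1)] Nm[OF Ni[OF N1(2)] N2(2)] by simp_all
  have [simp]: "B.sqb \<in> N"
    using Nm[OF Ni[OF N2(3)] N3(2)] by (simp add: B.inv_mult_group B.m_assoc)
  interpret F: braid4 B4 "bgen 3" "bgen 2" "bgen 1" by (rule B.flip)
  have fl: "F.sqa = B.sqc" "F.sqc = B.sqa" "F.da = B.dc" "F.dc = B.da"
    by (simp_all add: F.sqa_def  F.sqc_def F.da_def F.dc_def B.sqa_def B.sqc_def B.da_def B.dc_def)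
  have central: "z \<in> center B4"
    if "z \<in> carrier B4" "bgen 1 \<otimes>\<^bsub>B4\<^esub> z = z \<otimes>\<^bsub>B4\<^esub> bgen 1" "bgen 2 \<otimes>\<^bsub>B4\<^esub> z = z \<otimes>\<^bsub>B4\<^esub> bgen 2"
      "bgen 3 \<otimes>\<^bsub>B4\<^esub> z = z \<otimes>\<^bsub>B4\<^esub> bgen 3" for z
  proof -
    have "subgroup {g \<in> carrier B4. z \<otimes>\<^bsub>B4\<^esub> g = g \<otimes>\<^bsub>B4\<^esub> z} B4"
    proof (rule subgroup.intro)
      show "x \<otimes>\<^bsub>B4\<^esub> y \<in> {g \<in> carrier B4. z \<otimes>\<^bsub>B4\<^esub> g = g \<otimes>\<^bsub>B4\<^esub> z}"
        if "x \<in> {g \<in> carrier B4. z \<otimes>\<^bsub>B4\<^esub> g = g \<otimes>\<^bsub>B4\<^esub> z}" "y \<in> {g \<in> carrier B4. z \<otimes>\<^bsub>B4\<^esub> g = g \<otimes>\<^bsub>B4\<^esub> z}" for x y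
        using that \<open>z \<in> carrier B4\<close> B.commute_mult[of z x y] by auto
      show "inv\<^bsub>B4\<^esub> x \<in> {g \<in> carrier B4. z \<otimes>\<^bsub>B4\<^esub> g = g \<otimes>\<^bsub>B4\<^esub> z}"
        if "x \<in> {g \<in> carrier B4. z \<otimes>\<^bsub>B4\<^esub> g = g \<otimes>\<^bsub>B4\<^esub> z}" for x
        using that \<open>z \<in> carrier B4\<close> B.commute_inv(1)[of z x] by auto
    qed (use that(1) in auto)
    then have "carrier B4 \<subseteq> {g \<in> carrier B4. z \<otimes>\<^bsub>B4\<^esub> g = g \<otimes>\<^bsub>B4\<^esub> z}"
      by (rule B4_subset) (simp_all only: mem_Collect_eq B.closed that simp_thms)
    then show ?thesis using that(1) unfolding center_def by blast
  qed
  have [simp]: "B.za \<in> N" "F.za \<in> N"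
    using B.za_central F.za_central by (auto intro!: zN central)

  \<comment> \<open>Conjugation by \<open>b\<close> is a homomorphism, and the five listed elements
    generate the images of the generators under \<open>\<theta>\<close>, so it suffices to conjugate
    these five.\<close>
  have conj_N: "b \<otimes>\<^bsub>B4\<^esub> (n \<otimes>\<^bsub>B4\<^esub> inv\<^bsub>B4\<^esub> b) \<in> N"
    if b: "b \<in> carrier B4" and n: "n \<in> N"
      and sq: "\<And>x. x \<in> {B.sqa, B.sqb, B.sqc, B.da, B.dc} \<Longrightarrow> b \<otimes>\<^bsub>B4\<^esub> (x \<otimes>\<^bsub>B4\<^esub> inv\<^bsub>B4\<^esub> b) \<in> N" for b n
  proof -
    define S where "S = {g \<in> carrier B4. b \<otimes>\<^bsub>B4\<^esub> (g \<otimes>\<^bsub>B4\<^esub> inv\<^bsub>B4\<^esub> b) \<in> N}"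
    have S: "subgroup S B4"
    proof (rule subgroup.intro)
      show "x \<otimes>\<^bsub>B4\<^esub> y \<in> S" if "x \<in> S" "y \<in> S" for x y
        using that b Nm[of "b \<otimes>\<^bsub>B4\<^esub> (x \<otimes>\<^bsub>B4\<^esub> inv\<^bsub>B4\<^esub> b)" "b \<otimes>\<^bsub>B4\<^esub> (y \<otimes>\<^bsub>B4\<^esub> inv\<^bsub>B4\<^esub> b)"]
        by (auto simp: S_def B.m_assoc)
      show "inv\<^bsub>B4\<^esub> x \<in> S" if "x \<in> S" for x
        using that b Ni[of "b \<otimes>\<^bsub>B4\<^esub> (x \<otimes>\<^bsub>B4\<^esub> inv\<^bsub>B4\<^esub> b)"]
        by (auto simp: S_def B.m_assoc B.inv_mult_group)
    qed (use b subgroup.one_closed[OF N_sub] in \<open>auto simp: S_def\<close>)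
    have gens: "B.sqa \<in> S" "B.sqb \<in> S" "B.sqc \<in> S" "B.da \<in> S" "B.dc \<in> S"
      using sq by (auto simp: S_def)
    have "subgroup {g \<in> carrier SD. \<theta> g \<in> S} SD"
      by unfold_locales (auto simp: subgroup.m_closed[OF S] subgroup.one_closed[OF S] subgroup.m_inv_closed[OF S])
    then have "carrier SD \<subseteq> {g \<in> carrier SD. \<theta> g \<in> S}"
      by (rule f3f2_group_subset)
        (use SD.closed gens in \<open>auto simp: \<theta> subgroup.m_closed[OF S] subgroup.m_inv_closed[OF S]\<close>)
    moreover have "z \<in> S" if "z \<in> center B4" for z
    proof -
      have "b \<otimes>\<^bsub>B4\<^esub> (z \<otimes>\<^bsub>B4\<^esub> inv\<^bsub>B4\<^esub> b) = z"
        using that b zz by (intro B.conj_eqI) (auto simp: zc)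
      then show ?thesis using that zz zN by (simp add: S_def)
    qed
    ultimately have "n \<in> S" using n subgroup.m_closed[OF S] by (auto simp: N_def)
    then show ?thesis by (simp add: S_def)
  qed
  have conj1: "bgen 1 \<otimes>\<^bsub>B4\<^esub> (n \<otimes>\<^bsub>B4\<^esub> inv\<^bsub>B4\<^esub> bgen 1) \<in> N" if "n \<in> N" for n
  proof (rule conj_N[OF B.closed(1) that])
    fix x assume "x \<in> {B.sqa, B.sqb, B.sqc, B.da, B.dc}"
    then consider "x = B.sqa" | "x = B.sqb" | "x = B.sqc" | "x = B.da" | "x = B.dc" by blast
    then show "bgen 1 \<otimes>\<^bsub>B4\<^esub> (x \<otimes>\<^bsub>B4\<^esub> inv\<^bsub>B4\<^esub> bgen 1) \<in> N"
    proof cases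
      case 1
      show ?thesis unfolding 1 B.conj_a(1) by ((intro Nm Ni)?, simp_all)
    next
      case 2
      show ?thesis unfolding 2 B.conj_a(4) by ((intro Nm Ni)?, simp_all)
    next
      case 3
      show ?thesis unfolding 3 B.conj_a(2) by ((intro Nm Ni)?, simp_all)
    next
      case 4
      show ?thesis unfolding 4 B.conj_a(3) by ((intro Nm Ni)?, simp_all)
    next
      \<comment> \<open>The full twist, in its mirrored form \<open>F.za\<close>, enters
        here.\<close>
      case 5
      show ?thesis unfolding 5 F.conj_c_da[unfolded fl] by ((intro Nm Ni)?, simp_all)
    qed
  qed
  have conj2: "bgen 2 \<otimes>\<^bsub>B4\<^esub> (n \<otimes>\<^bsub>B4\<^esub> inv\<^bsub>B4\<^esub> bgen 2) \<in> N" if "n \<in> N" for n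
  proof (rule conj_N[OF B.closed(2) that])
    fix x assume "x \<in> {B.sqa, B.sqb, B.sqc, B.da, B.dc}"
    then consider "x = B.sqa" | "x = B.sqb" | "x = B.sqc" | "x = B.da" | "x = B.dc" by blast
    then show "bgen 2 \<otimes>\<^bsub>B4\<^esub> (x \<otimes>\<^bsub>B4\<^esub> inv\<^bsub>B4\<^esub> bgen 2) \<in> N"
    proof cases
      case 1
      show ?thesis unfolding 1 B.conj_b(1) by ((intro Nm Ni)?, simp_all)
    next
      case 2
      show ?thesis unfolding 2 B.conj_b(2) by ((intro Nm Ni)?, simp_all)
    next
      case 3
      show ?thesis unfolding 3 F.conj_b(1)[unfolded fl] by ((intro Nm Ni)?, simp_all)
    next
      case 4
      show ?thesis unfolding 4 B.conj_b(3) by ((intro Nm Ni)?, simp_all)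
    next
      case 5
      show ?thesis unfolding 5 F.conj_b(3)[unfolded fl] by ((intro Nm Ni)?, simp_all)
    qed
  qed
  have conj3: "bgen 3 \<otimes>\<^bsub>B4\<^esub> (n \<otimes>\<^bsub>B4\<^esub> inv\<^bsub>B4\<^esub> bgen 3) \<in> N" if "n \<in> N" for n
  proof (rule conj_N[OF B.closed(3) that])
    fix x assume "x \<in> {B.sqa, B.sqb, B.sqc, B.da, B.dc}"
    then consider "x = B.sqa" | "x = B.sqb" | "x = B.sqc" | "x = B.da" | "x = B.dc" by blast
    then show "bgen 3 \<otimes>\<^bsub>B4\<^esub> (x \<otimes>\<^bsub>B4\<^esub> inv\<^bsub>B4\<^esub> bgen 3) \<in> N"
    proof cases
      case 1
      show ?thesis unfolding 1 F.conj_a(2)[unfolded fl] by ((intro Nm Ni)?, simp_all)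
    next
      case 2
      show ?thesis unfolding 2 F.conj_a(4)[unfolded fl] by ((intro Nm Ni)?, simp_all)
    next
      case 3
      show ?thesis unfolding 3 F.conj_a(1)[unfolded fl] by ((intro Nm Ni)?, simp_all)
    next
      case 4
      show ?thesis unfolding 4 B.conj_c_da by ((intro Nm Ni)?, simp_all)
    next
      case 5
      show ?thesis unfolding 5 F.conj_a(3)[unfolded fl] by ((intro Nm Ni)?, simp_all)
    qed
  qed
  have NB: "n \<in> carrier B4" if "n \<in> N" for n using that subgroup.subset[OF N_sub] by auto
  \<comment> \<open>Conjugation by the inverse of \<open>b\<close> is conjugation by
    \<open>b\<close> followed by conjugation by the inverse of \<open>b b\<close>, which lies in
    \<open>N\<close>.\<close>
  have conj_inv: "inv\<^bsub>B4\<^esub> b \<otimes>\<^bsub>B4\<^esub> (n \<otimes>\<^bsub>B4\<^esub> b) \<in> N"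
    if b: "b \<in> carrier B4" and n: "n \<in> N" and bb: "b \<otimes>\<^bsub>B4\<^esub> b \<in> N"
      and conj: "\<And>n. n \<in> N \<Longrightarrow> b \<otimes>\<^bsub>B4\<^esub> (n \<otimes>\<^bsub>B4\<^esub> inv\<^bsub>B4\<^esub> b) \<in> N" for b n
  proof -
    have "inv\<^bsub>B4\<^esub> (b \<otimes>\<^bsub>B4\<^esub> b) \<otimes>\<^bsub>B4\<^esub> ((b \<otimes>\<^bsub>B4\<^esub> (n \<otimes>\<^bsub>B4\<^esub> inv\<^bsub>B4\<^esub> b)) \<otimes>\<^bsub>B4\<^esub> (b \<otimes>\<^bsub>B4\<^esub> b)) \<in> N"
      by (rule Nm[OF Ni[OF bb] Nm[OF conj[OF n] bb]])
    then show ?thesis using b NB[OF n] by (simp add: B.m_assoc B.inv_mult_group)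
  qed
  have sq: "bgen 1 \<otimes>\<^bsub>B4\<^esub> bgen 1 \<in> N" "bgen 2 \<otimes>\<^bsub>B4\<^esub> bgen 2 \<in> N" "bgen 3 \<otimes>\<^bsub>B4\<^esub> bgen 3 \<in> N"
    unfolding B.sqa_def[symmetric] B.sqb_def[symmetric] B.sqc_def[symmetric] by simp_all
  define S where "S = {b \<in> carrier B4. \<forall>n\<in>N. b \<otimes>\<^bsub>B4\<^esub> (n \<otimes>\<^bsub>B4\<^esub> inv\<^bsub>B4\<^esub> b) \<in> N \<and> inv\<^bsub>B4\<^esub> b \<otimes>\<^bsub>B4\<^esub> (n \<otimes>\<^bsub>B4\<^esub> b) \<in> N}"
  have S_D: "x \<in> carrier B4" "x \<otimes>\<^bsub>B4\<^esub> (n \<otimes>\<^bsub>B4\<^esub> inv\<^bsub>B4\<^esub> x) \<in> N" "inv\<^bsub>B4\<^esub> x \<otimes>\<^bsub>B4\<^esub> (n \<otimes>\<^bsub>B4\<^esub> x) \<in> N"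
    if "x \<in> S" "n \<in> N" for x n
    using that by (auto simp: S_def)
  have "subgroup S B4"
  proof (rule subgroup.intro)
    show "S \<subseteq> carrier B4" by (auto simp: S_def)
    show "\<one>\<^bsub>B4\<^esub> \<in> S" by (simp add: S_def NB)
    fix x y assume x: "x \<in> S"
    then show "inv\<^bsub>B4\<^esub> x \<in> S" by (simp add: S_def)
    assume y: "y \<in> S"
    have cl: "x \<in> carrier B4" "y \<in> carrier B4" using x y by (auto simp: S_def)
    have "(x \<otimes>\<^bsub>B4\<^esub> y) \<otimes>\<^bsub>B4\<^esub> (n \<otimes>\<^bsub>B4\<^esub> inv\<^bsub>B4\<^esub> (x \<otimes>\<^bsub>B4\<^esub> y)) \<in> N"
      "inv\<^bsub>B4\<^esub> (x \<otimes>\<^bsub>B4\<^esub> y) \<otimes>\<^bsub>B4\<^esub> (n \<otimes>\<^bsub>B4\<^esub> (x \<otimes>\<^bsub>B4\<^esub> y)) \<in> N" if n: "n \<in> N" for n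
      using S_D(2)[OF x S_D(2)[OF y n]] S_D(3)[OF y S_D(3)[OF x n]] cl NB[OF n]
      by (simp_all add: B.m_assoc B.inv_mult_group)
    then show "x \<otimes>\<^bsub>B4\<^esub> y \<in> S" using cl by (simp add: S_def)
  qed
  moreover have "bgen 1 \<in> S"
  proof -
    have "inv\<^bsub>B4\<^esub> bgen 1 \<otimes>\<^bsub>B4\<^esub> (n \<otimes>\<^bsub>B4\<^esub> bgen 1) \<in> N" if "n \<in> N" for n
      by (rule conj_inv[OF B.closed(1) that sq(1) conj1])
    then show ?thesis unfolding S_def using conj1 B.closed(1) by blast
  qed
  moreover have "bgen 2 \<in> S"
  proof -
    have "inv\<^bsub>B4\<^esub> bgen 2 \<otimes>\<^bsub>B4\<^esub> (n \<otimes>\<^bsub>B4\<^esub> bgen 2) \<in> N" if "n \<in> N" for n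
      by (rule conj_inv[OF B.closed(2) that sq(2) conj2])
    then show ?thesis unfolding S_def using conj2 B.closed(2) by blast
  qed
  moreover have "bgen 3 \<in> S"
  proof -
    have "inv\<^bsub>B4\<^esub> bgen 3 \<otimes>\<^bsub>B4\<^esub> (n \<otimes>\<^bsub>B4\<^esub> bgen 3) \<in> N" if "n \<in> N" for n
      by (rule conj_inv[OF B.closed(3) that sq(3) conj3])
    then show ?thesis unfolding S_def using conj3 B.closed(3) by blast
  qed
  ultimately have "carrier B4 \<subseteq> S" by (rule B4_subset)
  then interpret N: normal N B4
    by (intro B.normal_invI[OF N_sub]) (auto simp: B.m_assoc NB dest: S_D(2))
  define f where "f = (\<lambda>x. N #>\<^bsub>B4\<^esub> x)"
  define H where "H = B4 Mod N"
  have f: "group_hom B4 H f"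
    unfolding f_def H_def
    by (rule hom_group_hom[OF group_B4 N.factorgroup_is_group N.r_coset_hom_Mod])
  have one: "\<one>\<^bsub>H\<^esub> = N" by (simp add: H_def FactGroup_def)
  have f1: "f x = \<one>\<^bsub>H\<^esub>" if "x \<in> N" for x
    using N.rcos_const[OF group_B4 that] by (simp add: f_def one)
  interpret f: group_hom B4 H f by (rule f)
  have cl: "f (bgen 1) \<in> carrier H" "f (bgen 2) \<in> carrier H" "f (bgen 3) \<in> carrier H" by simp_all
  have "coxeter4 H (\<lambda>i. f (bgen i))"
  proof unfold_locales
    show "f (bgen 1) \<otimes>\<^bsub>H\<^esub> f (bgen 1) = \<one>\<^bsub>H\<^esub>" "f (bgen 2) \<otimes>\<^bsub>H\<^esub> f (bgen 2) = \<one>\<^bsub>H\<^esub>"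
      "f (bgen 3) \<otimes>\<^bsub>H\<^esub> f (bgen 3) = \<one>\<^bsub>H\<^esub>"
      using f1[OF sq(1)] f1[OF sq(2)] f1[OF sq(3)] by simp_all
    show "f (bgen 3) \<otimes>\<^bsub>H\<^esub> f (bgen 1) = f (bgen 1) \<otimes>\<^bsub>H\<^esub> f (bgen 3)"
      using arg_cong[OF B.ac, of f] by simp
    show "f (bgen 2) \<otimes>\<^bsub>H\<^esub> (f (bgen 1) \<otimes>\<^bsub>H\<^esub> f (bgen 2)) = f (bgen 1) \<otimes>\<^bsub>H\<^esub> (f (bgen 2) \<otimes>\<^bsub>H\<^esub> f (bgen 1))"
      using arg_cong[OF B.aba, of f] by simp
    show "f (bgen 3) \<otimes>\<^bsub>H\<^esub> (f (bgen 2) \<otimes>\<^bsub>H\<^esub> f (bgen 3)) = f (bgen 2) \<otimes>\<^bsub>H\<^esub> (f (bgen 3) \<otimes>\<^bsub>H\<^esub> f (bgen 2))"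
      using arg_cong[OF B.bcb, of f] by simp
  qed (rule cl)+
  then have "f h = \<one>\<^bsub>H\<^esub>"
    by (rule pure_braid_trivial[OF _ f]) (use h in \<open>simp_all add: carrier_PB4\<close>)
  then have "h \<in> N"
    using h B.rcos_self[OF _ N_sub, of h] by (simp add: f_def one carrier_PB4)
  then obtain g z where gz: "h = \<theta> g \<otimes>\<^bsub>B4\<^esub> z" "g \<in> carrier SD" "z \<in> center B4"
    by (auto simp: N_def)
  \<comment> \<open>\<open>z\<close> is a product of pure braids, so its centrality in B4 gives
    centrality in P4.\<close>
  have "z = inv\<^bsub>PB4\<^esub> (\<theta> g) \<otimes>\<^bsub>B4\<^esub> h"
    using gz zz[OF gz(3)] by (simp add: PB4_inv \<theta>(2))
  then have "z \<in> carrier PB4"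
    using PB.m_closed[OF PB.inv_closed[OF \<theta>(2)[OF gz(2)]] h] by simp
  then have "z \<in> center PB4"
    using zc[OF gz(3)] unfolding center_def by (simp add: carrier_PB4)
  then show ?thesis using gz by blast
qed

subsection \<open>The braid action on \<open>F\<^sub>3 \<rtimes> F\<^sub>2\<close>\<close>

lemma (in group) conj_group_hom:
  assumes "h \<in> carrier G"
  shows "group_hom G G (\<lambda>x. h \<otimes> (x \<otimes> inv h))"
  by (rule hom_group_hom[OF is_group is_group], rule homI) (use assms in \<open>simp_all add: m_assoc\<close>)

definition inner :: "('a, 'm) monoid_scheme \<Rightarrow> 'a \<Rightarrow> 'a \<Rightarrow> 'a" where
  "inner G h = (\<lambda>x\<in>carrier G. h \<otimes>\<^bsub>G\<^esub> (x \<otimes>\<^bsub>G\<^esub> inv\<^bsub>G\<^esub> h))"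

lemma Bij_eqI: "f \<in> Bij S \<Longrightarrow> g \<in> Bij S \<Longrightarrow> (\<And>x. x \<in> S \<Longrightarrow> f x = g x) \<Longrightarrow> f = g"
  by (auto simp: Bij_def intro: extensionalityI)

lemma (in group) inner_Bij: "h \<in> carrier G \<Longrightarrow> inner G h \<in> Bij (carrier G)"
  unfolding inner_def by (rule BijI[where f' = "\<lambda>x. inv h \<otimes> (x \<otimes> h)"]) (simp_all add: m_assoc)

lemma (in group) inner_group_hom: "group_hom G (BijGroup (carrier G)) (inner G)"
proof (rule hom_group_hom[OF is_group group_BijGroup], rule homI)
  show "inner G x \<in> carrier (BijGroup (carrier G))" if "x \<in> carrier G" for x
    using that by (simp add: carrier_BijGroup inner_Bij)
  show "inner G (x \<otimes> y) = inner G x \<otimes>\<^bsub>BijGroup (carrier G)\<^esub> inner G y"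
    if "x \<in> carrier G" "y \<in> carrier G" for x y
    by (rule Bij_eqI[where S = "carrier G"])
      (use that in \<open>simp_all add: inner_Bij BijGroup_closed BijGroup_apply, simp_all add: inner_def m_assoc inv_mult_group\<close>)
qed

lemma group_hom_comp: "group_hom G H f \<Longrightarrow> group_hom H K g \<Longrightarrow> group_hom G K (\<lambda>x. g (f x))"
  by (auto simp: group_hom_def group_hom_axioms_def hom_def Pi_iff)

text \<open>The square of \<open>c\<close> is conjugation by \<open>h\<close>, so \<open>c\<close>
  followed by conjugation back is an inverse of \<open>c\<close>; it is two-sided because
  \<open>c\<close> fixes \<open>h\<close>.\<close>

lemma endo_square_Bij:
  assumes "group_hom G G c" "h \<in> carrier G" "c h = h"
    and sq: "\<And>x. x \<in> carrier G \<Longrightarrow> c (c x) = h \<otimes>\<^bsub>G\<^esub> (x \<otimes>\<^bsub>G\<^esub> inv\<^bsub>G\<^esub> h)"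
  shows "restrict c (carrier G) \<in> Bij (carrier G)"
proof -
  interpret c: group_hom G G c by fact
  show ?thesis
  proof (rule BijI[where f' = "\<lambda>x. inv\<^bsub>G\<^esub> h \<otimes>\<^bsub>G\<^esub> (c x \<otimes>\<^bsub>G\<^esub> h)"])
    show "inv\<^bsub>G\<^esub> h \<otimes>\<^bsub>G\<^esub> (c (c x) \<otimes>\<^bsub>G\<^esub> h) = x" if "x \<in> carrier G" for x
      using that assms(2) by (simp add: sq c.G.m_assoc)
    show "c (inv\<^bsub>G\<^esub> h \<otimes>\<^bsub>G\<^esub> (c x \<otimes>\<^bsub>G\<^esub> h)) = x" if "x \<in> carrier G" for x
      using that assms(2,3) by (simp add: sq c.G.m_assoc)
  qed (use assms(2) in simp_all)
qed

text \<open>Each braid generator acts through one of the endomorphisms of \<open>rels_c1\<close> to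
  \<open>rels_c3\<close>. Their squares are inner, which yields bijectivity as well as the values of
  \<open>\<rho>\<close> on squares. The conjugating elements are those that
  \<open>theta_exists\<close> sends to the same pure braids.\<close>

theorem braid_action:
  obtains \<rho> where "group_hom B4 (BijGroup (carrier SD)) \<rho>"
    "\<rho> B.sqa = inner SD (f3f2_gen P)"
    "\<rho> B.sqb = inner SD (inv\<^bsub>SD\<^esub> f3f2_gen X2 \<otimes>\<^bsub>SD\<^esub> (inv\<^bsub>SD\<^esub> f3f2_gen X1 \<otimes>\<^bsub>SD\<^esub> f3f2_gen Q))"
    "\<rho> B.sqc = inner SD (f3f2_gen X1)"
    "\<rho> B.da = inner SD (inv\<^bsub>SD\<^esub> f3f2_gen P \<otimes>\<^bsub>SD\<^esub> f3f2_gen X3)"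
    "\<rho> B.dc = inner SD (inv\<^bsub>SD\<^esub> f3f2_gen X1 \<otimes>\<^bsub>SD\<^esub> f3f2_gen Q)"
proof -
  let ?S = "carrier SD" and ?B = "BijGroup (carrier SD)"
  define x1 x2 x3 p q where x: "x1 = f3f2_gen X1" "x2 = f3f2_gen X2" "x3 = f3f2_gen X3"
    "p = f3f2_gen P" "q = f3f2_gen Q"
  note [simp] = SD.closed[folded x]
  note nf = SD.nf[folded x]
  obtain c1 where c1: "group_hom SD SD c1" "c1 x1 = x1" "c1 x2 = inv\<^bsub>SD\<^esub> (x3 \<otimes>\<^bsub>SD\<^esub> (x1 \<otimes>\<^bsub>SD\<^esub> x2))"
    "c1 x3 = x3" "c1 p = p" "c1 q = inv\<^bsub>SD\<^esub> q \<otimes>\<^bsub>SD\<^esub> (x1 \<otimes>\<^bsub>SD\<^esub> inv\<^bsub>SD\<^esub> p)"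
    by (rule f3f2_group_hom[OF SD.is_group SD.rels_c1, folded x])
  obtain c2 where c2: "group_hom SD SD c2" "c2 x1 = x2" "c2 x2 = inv\<^bsub>SD\<^esub> x2 \<otimes>\<^bsub>SD\<^esub> (x1 \<otimes>\<^bsub>SD\<^esub> x2)"
    "c2 x3 = x3" "c2 p = inv\<^bsub>SD\<^esub> p \<otimes>\<^bsub>SD\<^esub> (x3 \<otimes>\<^bsub>SD\<^esub> (inv\<^bsub>SD\<^esub> q \<otimes>\<^bsub>SD\<^esub> (x1 \<otimes>\<^bsub>SD\<^esub> x2)))" "c2 q = q"
    by (rule f3f2_group_hom[OF SD.is_group SD.rels_c2, folded x])
  obtain c3 where c3: "group_hom SD SD c3" "c3 x1 = x1" "c3 x2 = inv\<^bsub>SD\<^esub> x2 \<otimes>\<^bsub>SD\<^esub> (inv\<^bsub>SD\<^esub> x1 \<otimes>\<^bsub>SD\<^esub> q)"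
    "c3 x3 = inv\<^bsub>SD\<^esub> x3 \<otimes>\<^bsub>SD\<^esub> (p \<otimes>\<^bsub>SD\<^esub> inv\<^bsub>SD\<^esub> x1)" "c3 p = p" "c3 q = q"
    by (rule f3f2_group_hom[OF SD.is_group SD.rels_c3, folded x])
  interpret c1: group_hom SD SD c1 by fact
  interpret c2: group_hom SD SD c2 by fact
  interpret c3: group_hom SD SD c3 by fact
  note eqI = f3f2_group_hom_eq[folded x]
  define b where "b = inv\<^bsub>SD\<^esub> x2 \<otimes>\<^bsub>SD\<^esub> (inv\<^bsub>SD\<^esub> x1 \<otimes>\<^bsub>SD\<^esub> q)"
  have b [simp]: "b \<in> ?S" by (simp add: b_def)
  have c1c1: "c1 (c1 g) = p \<otimes>\<^bsub>SD\<^esub> (g \<otimes>\<^bsub>SD\<^esub> inv\<^bsub>SD\<^esub> p)" if "g \<in> ?S" for g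
    by (rule eqI[OF group_hom_comp[OF c1(1) c1(1)] SD.conj_group_hom _ _ _ _ _ that])
      (simp_all add: c1 nf)
  have c2c2: "c2 (c2 g) = b \<otimes>\<^bsub>SD\<^esub> (g \<otimes>\<^bsub>SD\<^esub> inv\<^bsub>SD\<^esub> b)" if "g \<in> ?S" for g
    by (rule eqI[OF group_hom_comp[OF c2(1) c2(1)] SD.conj_group_hom _ _ _ _ _ that])
      (simp_all add: c2 b_def nf)
  have c3c3: "c3 (c3 g) = x1 \<otimes>\<^bsub>SD\<^esub> (g \<otimes>\<^bsub>SD\<^esub> inv\<^bsub>SD\<^esub> x1)" if "g \<in> ?S" for g
    by (rule eqI[OF group_hom_comp[OF c3(1) c3(1)] SD.conj_group_hom _ _ _ _ _ that])
      (simp_all add: c3 nf)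
  have c1c3: "c1 (c3 g) = c3 (c1 g)" if "g \<in> ?S" for g
    by (rule eqI[OF group_hom_comp[OF c3(1) c1(1)] group_hom_comp[OF c1(1) c3(1)] _ _ _ _ _ that])
      (simp_all add: c1 c3 nf)
  have c121: "c1 (c2 (c1 g)) = c2 (c1 (c2 g))" if "g \<in> ?S" for g
    by (rule eqI[OF group_hom_comp[OF c1(1) group_hom_comp[OF c2(1) c1(1)]]
          group_hom_comp[OF c2(1) group_hom_comp[OF c1(1) c2(1)]] _ _ _ _ _ that])
      (simp_all add: c1 c2 nf)
  have c232: "c2 (c3 (c2 g)) = c3 (c2 (c3 g))" if "g \<in> ?S" for g
    by (rule eqI[OF group_hom_comp[OF c2(1) group_hom_comp[OF c3(1) c2(1)]]
          group_hom_comp[OF c3(1) group_hom_comp[OF c2(1) c3(1)]] _ _ _ _ _ that])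
      (simp_all add: c3 c2 nf)
  define C1 C2 C3 where C: "C1 = restrict c1 ?S" "C2 = restrict c2 ?S" "C3 = restrict c3 ?S"
  have bij: "C1 \<in> Bij ?S" "C2 \<in> Bij ?S" "C3 \<in> Bij ?S"
    unfolding C
    by (rule endo_square_Bij[OF c1(1) _ c1(5) c1c1], simp_all)
      (rule endo_square_Bij[OF c2(1) b _ c2c2], simp_all add: b_def c2 nf,
       rule endo_square_Bij[OF c3(1) _ c3(2) c3c3], simp_all)
  note Bsimps = carrier_BijGroup BijGroup_closed BijGroup_apply bij
  have app: "C1 g = c1 g" "C2 g = c2 g" "C3 g = c3 g" if "g \<in> ?S" for g
    using that by (simp_all add: C)
  have "braid4 ?B C1 C2 C3"
  proof (intro braid4.intro group_BijGroup braid4_axioms.intro)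
    show "C1 \<otimes>\<^bsub>?B\<^esub> C3 = C3 \<otimes>\<^bsub>?B\<^esub> C1"
      by (rule Bij_eqI[where S = ?S]) (simp_all add: Bsimps app c1c3)
    show "C1 \<otimes>\<^bsub>?B\<^esub> (C2 \<otimes>\<^bsub>?B\<^esub> C1) = C2 \<otimes>\<^bsub>?B\<^esub> (C1 \<otimes>\<^bsub>?B\<^esub> C2)"
      by (rule Bij_eqI[where S = ?S]) (simp_all add: Bsimps app c121)
    show "C2 \<otimes>\<^bsub>?B\<^esub> (C3 \<otimes>\<^bsub>?B\<^esub> C2) = C3 \<otimes>\<^bsub>?B\<^esub> (C2 \<otimes>\<^bsub>?B\<^esub> C3)"
      by (rule Bij_eqI[where S = ?S]) (simp_all add: Bsimps app c232)
  qed (simp_all add: Bsimps)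
  then obtain \<rho> where \<rho>: "group_hom B4 ?B \<rho>" "\<rho> (bgen 1) = C1" "\<rho> (bgen 2) = C2" "\<rho> (bgen 3) = C3"
    by (rule B4_hom)
  interpret \<rho>: group_hom B4 ?B \<rho> by fact
  show thesis
  proof (rule that[OF \<rho>(1), folded x])
    show "\<rho> B.sqa = inner SD p"
      by (rule Bij_eqI[where S = ?S]) (simp_all add: B.sqa_def \<rho> Bsimps SD.inner_Bij app c1c1, simp add: inner_def)
    show "\<rho> B.sqb = inner SD (inv\<^bsub>SD\<^esub> x2 \<otimes>\<^bsub>SD\<^esub> (inv\<^bsub>SD\<^esub> x1 \<otimes>\<^bsub>SD\<^esub> q))"
      unfolding b_def[symmetric]
      by (rule Bij_eqI[where S = ?S]) (simp_all add: B.sqb_def \<rho> Bsimps SD.inner_Bij app c2c2, simp add: inner_def)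
    show "\<rho> B.sqc = inner SD x1"
      by (rule Bij_eqI[where S = ?S]) (simp_all add: B.sqc_def \<rho> Bsimps SD.inner_Bij app c3c3, simp add: inner_def)
    \<comment> \<open>\<open>da\<close> acts as \<open>c2\<close>, conjugation by \<open>p\<close>
      and \<open>c2\<close> again, which is conjugation by \<open>c2 p\<close> composed with the
      square of \<open>c2\<close>, that is, with conjugation by \<open>b\<close>.\<close>
    have 1: "c2 p \<otimes>\<^bsub>SD\<^esub> b = inv\<^bsub>SD\<^esub> p \<otimes>\<^bsub>SD\<^esub> x3" by (simp add: c2 b_def nf)
    have 2: "c2 x1 \<otimes>\<^bsub>SD\<^esub> b = inv\<^bsub>SD\<^esub> x1 \<otimes>\<^bsub>SD\<^esub> q" by (simp add: c2 b_def nf)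
    have "c2 (c1 (c1 (c2 g))) = (c2 p \<otimes>\<^bsub>SD\<^esub> b) \<otimes>\<^bsub>SD\<^esub> (g \<otimes>\<^bsub>SD\<^esub> inv\<^bsub>SD\<^esub> (c2 p \<otimes>\<^bsub>SD\<^esub> b))" if "g \<in> ?S" for g
      using that by (simp add: c1c1 c2c2 SD.m_assoc SD.inv_mult_group)
    then show "\<rho> B.da = inner SD (inv\<^bsub>SD\<^esub> p \<otimes>\<^bsub>SD\<^esub> x3)"
      unfolding 1
      by (intro Bij_eqI[where S = ?S]) (simp_all add: B.da_def \<rho> Bsimps SD.inner_Bij app, simp add: inner_def)
    have "c2 (c3 (c3 (c2 g))) = (c2 x1 \<otimes>\<^bsub>SD\<^esub> b) \<otimes>\<^bsub>SD\<^esub> (g \<otimes>\<^bsub>SD\<^esub> inv\<^bsub>SD\<^esub> (c2 x1 \<otimes>\<^bsub>SD\<^esub> b))" if "g \<in> ?S" for g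
      using that by (simp add: c3c3 c2c2 SD.m_assoc SD.inv_mult_group)
    then show "\<rho> B.dc = inner SD (inv\<^bsub>SD\<^esub> x1 \<otimes>\<^bsub>SD\<^esub> q)"
      unfolding 2
      by (intro Bij_eqI[where S = ?S]) (simp_all add: B.dc_def \<rho> Bsimps SD.inner_Bij app, simp add: inner_def)
  qed
qed

text \<open>The braid action identifies the image of \<open>F\<^sub>3 \<rtimes> F\<^sub>2\<close> in \<open>P\<^sub>4\<close> with inner automorphisms, so an
  element that becomes central in \<open>P\<^sub>4\<close> is central.\<close>

theorem f3f2_group_iso_P4_bar: "\<exists>\<theta>. \<theta> \<in> iso SD P4_bar"
proof -
  obtain \<theta> where \<theta>: "group_hom SD B4 \<theta>" "\<And>g. g \<in> carrier SD \<Longrightarrow> \<theta> g \<in> carrier PB4"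
    "\<theta> (f3f2_gen X1) = B.sqc" "\<theta> (f3f2_gen X2) = B.dc \<otimes>\<^bsub>B4\<^esub> inv\<^bsub>B4\<^esub> B.sqb"
    "\<theta> (f3f2_gen X3) = B.sqa \<otimes>\<^bsub>B4\<^esub> B.da" "\<theta> (f3f2_gen P) = B.sqa"
    "\<theta> (f3f2_gen Q) = B.sqc \<otimes>\<^bsub>B4\<^esub> B.dc"
    by (rule theta_exists) (rule that)
  obtain \<rho> where \<rho>: "group_hom B4 (BijGroup (carrier SD)) \<rho>"
    "\<rho> B.sqa = inner SD (f3f2_gen P)"
    "\<rho> B.sqb = inner SD (inv\<^bsub>SD\<^esub> f3f2_gen X2 \<otimes>\<^bsub>SD\<^esub> (inv\<^bsub>SD\<^esub> f3f2_gen X1 \<otimes>\<^bsub>SD\<^esub> f3f2_gen Q))"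
    "\<rho> B.sqc = inner SD (f3f2_gen X1)"
    "\<rho> B.da = inner SD (inv\<^bsub>SD\<^esub> f3f2_gen P \<otimes>\<^bsub>SD\<^esub> f3f2_gen X3)"
    "\<rho> B.dc = inner SD (inv\<^bsub>SD\<^esub> f3f2_gen X1 \<otimes>\<^bsub>SD\<^esub> f3f2_gen Q)"
    by (rule braid_action) (rule that)
  interpret \<theta>: group_hom SD B4 \<theta> by fact
  interpret \<rho>: group_hom B4 "BijGroup (carrier SD)" \<rho> by fact
  interpret inn: group_hom SD "BijGroup (carrier SD)" "inner SD" by (rule SD.inner_group_hom)
  have \<rho>\<theta>: "\<rho> (\<theta> g) = inner SD g" if "g \<in> carrier SD" for g
  proof (rule f3f2_group_hom_eq[OF group_hom_comp[OF \<theta>(1) \<rho>(1)] SD.inner_group_hom _ _ _ _ _ that])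
    let ?b = "inv\<^bsub>SD\<^esub> f3f2_gen X2 \<otimes>\<^bsub>SD\<^esub> (inv\<^bsub>SD\<^esub> f3f2_gen X1 \<otimes>\<^bsub>SD\<^esub> f3f2_gen Q)"
    have "\<rho> (\<theta> (f3f2_gen X2)) = inner SD ((inv\<^bsub>SD\<^esub> f3f2_gen X1 \<otimes>\<^bsub>SD\<^esub> f3f2_gen Q) \<otimes>\<^bsub>SD\<^esub> inv\<^bsub>SD\<^esub> ?b)"
      unfolding inn.hom_mult[OF SD.m_closed[OF SD.inv_closed[OF SD.closed(1)] SD.closed(5)]
          SD.inv_closed[OF SD.m_closed[OF SD.inv_closed[OF SD.closed(2)] SD.m_closed[OF SD.inv_closed[OF SD.closed(1)] SD.closed(5)]]]]
        inn.hom_inv[OF SD.m_closed[OF SD.inv_closed[OF SD.closed(2)] SD.m_closed[OF SD.inv_closed[OF SD.closed(1)] SD.closed(5)]]]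
      by (simp only: \<theta>(4) \<rho>(3,6)[symmetric] \<rho>.hom_mult \<rho>.hom_inv B.sq_closed B.inv_closed)
    also have "(inv\<^bsub>SD\<^esub> f3f2_gen X1 \<otimes>\<^bsub>SD\<^esub> f3f2_gen Q) \<otimes>\<^bsub>SD\<^esub> inv\<^bsub>SD\<^esub> ?b = f3f2_gen X2"
      by (simp add: SD.m_assoc SD.inv_mult_group)
    finally show "\<rho> (\<theta> (f3f2_gen X2)) = inner SD (f3f2_gen X2)" .
    have "\<rho> (\<theta> (f3f2_gen X3)) = inner SD (f3f2_gen P \<otimes>\<^bsub>SD\<^esub> (inv\<^bsub>SD\<^esub> f3f2_gen P \<otimes>\<^bsub>SD\<^esub> f3f2_gen X3))"
      unfolding inn.hom_mult[OF SD.closed(4) SD.m_closed[OF SD.inv_closed[OF SD.closed(4)] SD.closed(3)]]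
      by (simp only: \<theta>(5) \<rho>(2,5)[symmetric] \<rho>.hom_mult B.sq_closed)
    then show "\<rho> (\<theta> (f3f2_gen X3)) = inner SD (f3f2_gen X3)" by simp
    have "\<rho> (\<theta> (f3f2_gen Q)) = inner SD (f3f2_gen X1 \<otimes>\<^bsub>SD\<^esub> (inv\<^bsub>SD\<^esub> f3f2_gen X1 \<otimes>\<^bsub>SD\<^esub> f3f2_gen Q))"
      unfolding inn.hom_mult[OF SD.closed(1) SD.m_closed[OF SD.inv_closed[OF SD.closed(1)] SD.closed(5)]]
      by (simp only: \<theta>(7) \<rho>(4,6)[symmetric] \<rho>.hom_mult B.sq_closed)
    then show "\<rho> (\<theta> (f3f2_gen Q)) = inner SD (f3f2_gen Q)" by simp
  qed (simp_all only: \<theta> \<rho>)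
  \<comment> \<open>The kernel of the map to inner automorphisms is the center, which is
    trivial.\<close>
  have inn_ker: "g = \<one>\<^bsub>SD\<^esub>" if g: "g \<in> carrier SD" and "inner SD g = \<one>\<^bsub>BijGroup (carrier SD)\<^esub>" for g
  proof (rule f3f2_group_center_trivial[OF g])
    fix h assume h: "h \<in> carrier SD"
    have "inner SD g h = h" using that(2) h by (simp add: BijGroup_def)
    then have "g \<otimes>\<^bsub>SD\<^esub> (h \<otimes>\<^bsub>SD\<^esub> inv\<^bsub>SD\<^esub> g) \<otimes>\<^bsub>SD\<^esub> g = h \<otimes>\<^bsub>SD\<^esub> g"
      using h by (simp add: inner_def)
    then show "g \<otimes>\<^bsub>SD\<^esub> h = h \<otimes>\<^bsub>SD\<^esub> g" using g h by (simp add: SD.m_assoc)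
  qed
  \<comment> \<open>Commutation of \<open>\<theta> g\<close> with \<open>\<theta> h\<close> holds in
    P4 only. Under \<open>\<rho>\<close> it says that \<open>g h\<close> and \<open>h g\<close> give
    the same inner automorphism, and \<open>inn_ker\<close> turns this into an equality in F3 x|
    F2.\<close>
  have ker: "g = \<one>\<^bsub>SD\<^esub>" if g: "g \<in> carrier SD" and cen: "\<theta> g \<in> center PB4" for g
  proof (rule f3f2_group_center_trivial[OF g])
    fix h assume h: "h \<in> carrier SD"
    have "\<theta> g \<otimes>\<^bsub>B4\<^esub> \<theta> h = \<theta> h \<otimes>\<^bsub>B4\<^esub> \<theta> g"
      using cen \<theta>(2)[OF h] unfolding center_def by simp
    then have "\<rho> (\<theta> (g \<otimes>\<^bsub>SD\<^esub> h)) = \<rho> (\<theta> (h \<otimes>\<^bsub>SD\<^esub> g))" using g h by simp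
    then have "inner SD (g \<otimes>\<^bsub>SD\<^esub> h) = inner SD (h \<otimes>\<^bsub>SD\<^esub> g)"
      using g h by (simp only: \<rho>\<theta> SD.m_closed)
    then have "inner SD ((g \<otimes>\<^bsub>SD\<^esub> h) \<otimes>\<^bsub>SD\<^esub> inv\<^bsub>SD\<^esub> (h \<otimes>\<^bsub>SD\<^esub> g)) = \<one>\<^bsub>BijGroup (carrier SD)\<^esub>"
      using g h by (simp del: inn.hom_mult add: inn.hom_mult[of "g \<otimes>\<^bsub>SD\<^esub> h" "inv\<^bsub>SD\<^esub> (h \<otimes>\<^bsub>SD\<^esub> g)"])
    then have "(g \<otimes>\<^bsub>SD\<^esub> h) \<otimes>\<^bsub>SD\<^esub> inv\<^bsub>SD\<^esub> (h \<otimes>\<^bsub>SD\<^esub> g) = \<one>\<^bsub>SD\<^esub>"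
      using g h by (intro inn_ker) simp_all
    then show "g \<otimes>\<^bsub>SD\<^esub> h = h \<otimes>\<^bsub>SD\<^esub> g"
      using g h by (metis SD.inv_closed SD.inv_equality SD.inv_inv SD.m_closed)
  qed
  define \<Theta> where "\<Theta> = (\<lambda>g. center PB4 #>\<^bsub>PB4\<^esub> \<theta> g)"
  have "group_hom SD PB4 \<theta>"
    by (rule hom_group_hom[OF SD.is_group group_PB4], rule homI) (use \<theta>(2) in simp_all)
  then have \<Theta>: "group_hom SD P4_bar \<Theta>"
    unfolding \<Theta>_def P4_bar_def
    by (rule group_hom_comp[OF _ hom_group_hom[OF group_PB4 PZ.factorgroup_is_group PZ.r_coset_hom_Mod]])
  interpret \<Theta>: group_hom SD P4_bar \<Theta> by (rule \<Theta>)
  have "inj_on \<Theta> (carrier SD)"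
    unfolding \<Theta>.inj_on_one_iff
  proof (intro allI impI)
    fix g assume g: "g \<in> carrier SD" and "\<Theta> g = \<one>\<^bsub>P4_bar\<^esub>"
    then have "center PB4 #>\<^bsub>PB4\<^esub> \<theta> g = center PB4"
      by (simp add: \<Theta>_def P4_bar_def FactGroup_def)
    then have "\<theta> g \<in> center PB4"
      using PB.rcos_self[OF \<theta>(2)[OF g] PZ.is_subgroup] by simp
    then show "g = \<one>\<^bsub>SD\<^esub>" using ker g by simp
  qed
  moreover have "\<Theta> ` carrier SD = carrier P4_bar"
  proof
    show "\<Theta> ` carrier SD \<subseteq> carrier P4_bar" by auto
    show "carrier P4_bar \<subseteq> \<Theta> ` carrier SD"
    proof
      fix A assume "A \<in> carrier P4_bar"
      then obtain h where h: "h \<in> carrier PB4" "A = center PB4 #>\<^bsub>PB4\<^esub> h"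
        by (auto simp: P4_bar_def FactGroup_def RCOSETS_def)
      obtain g z where gz: "g \<in> carrier SD" "z \<in> center PB4" "h = \<theta> g \<otimes>\<^bsub>B4\<^esub> z"
        using theta_surj[OF \<theta> h(1)] by blast
      have "z \<otimes>\<^bsub>PB4\<^esub> \<theta> g = \<theta> g \<otimes>\<^bsub>PB4\<^esub> z"
        using gz(2) \<theta>(2)[OF gz(1)] unfolding center_def by blast
      then have "h = z \<otimes>\<^bsub>PB4\<^esub> \<theta> g" using gz(3) by simp
      moreover have "z \<in> carrier PB4" using gz(2) unfolding center_def by blast
      ultimately have "A = (center PB4 #>\<^bsub>PB4\<^esub> z) #>\<^bsub>PB4\<^esub> \<theta> g"
        using PB.coset_mult_assoc[OF PZ.subset _ \<theta>(2)[OF gz(1)]] h(2) by simp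
      then have "A = \<Theta> g"
        using PZ.rcos_const[OF group_PB4 gz(2)] by (simp add: \<Theta>_def)
      then show "A \<in> \<Theta> ` carrier SD" using gz(1) by blast
    qed
  qed
  ultimately show ?thesis
    by (intro exI[of _ \<Theta>]) (simp add: iso_def bij_betw_def \<Theta>.homh)
qed

section \<open>Free products and the isomorphism with vP3\<close>

section \<open>Free products\<close>

lemma free_product_rel_words:
  assumes "group K" "group_hom G K f" "group_hom H K h" "(u, v) \<in> free_product_rels G H"
  shows "word_eval K (case_sum f h) u = word_eval K (case_sum f h) v"
proof -
  interpret f: group_hom G K f by fact
  interpret h: group_hom H K h by fact
  show ?thesis using assms(4)
    by (auto simp: free_product_rels_def)
qed

lemma free_product_hom:
  assumes "group_hom G K f" "group_hom H K h"
  obtains F where "group_hom (free_product G H) K F"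
    "\<And>x. x \<in> carrier G \<Longrightarrow> F (free_product_inl G H x) = f x"
    "\<And>y. y \<in> carrier H \<Longrightarrow> F (free_product_inr G H y) = h y"
proof -
  interpret f: group_hom G K f by fact
  interpret h: group_hom H K h by fact
  have cl: "case_sum f h \<in> free_product_gens G H \<rightarrow> carrier K"
    by (auto simp: free_product_gens_def)
  have rel: "word_eval K (case_sum f h) u = word_eval K (case_sum f h) v"
    if "(u, v) \<in> free_product_rels G H" for u v
    by (rule free_product_rel_words[OF f.H.is_group assms that])
  obtain F where F: "F \<in> hom (presented_group (free_product_gens G H) (free_product_rels G H)) K"
    "\<And>x. x \<in> free_product_gens G H \<Longrightarrow>
      F (pres_gen (free_product_gens G H) (free_product_rels G H) x) = case_sum f h x"
    by (rule f.H.presented_group_hom[OF cl rel], assumption, rule that)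
  show thesis
  proof (rule that)
    show "group_hom (free_product G H) K F"
      unfolding free_product_def by (rule hom_group_hom[OF group_presented_group f.H.is_group F(1)])
    show "F (free_product_inl G H x) = f x" if "x \<in> carrier G" for x
      using F(2)[of "Inl x"] that by (simp add: free_product_inl_def pres_gen_def free_product_gens_def)
    show "F (free_product_inr G H y) = h y" if "y \<in> carrier H" for y
      using F(2)[of "Inr y"] that by (simp add: free_product_inr_def pres_gen_def free_product_gens_def)
  qed
qed

lemma group_free_product: "group (free_product G H)"
  unfolding free_product_def by (rule group_presented_group)

lemma free_product_inl_group_hom:
  fixes G (structure)
  assumes "group G"
  shows "group_hom G (free_product G H) (free_product_inl G H)"
proof (rule hom_group_hom[OF assms group_free_product], rule homI)
  interpret group G by fact
  show "free_product_inl G H x \<in> carrier (free_product G H)" if "x \<in> carrier G" for x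
    using that by (simp add: free_product_inl_def free_product_def carrier_presented_group free_product_gens_def)
  show "free_product_inl G H (x \<otimes> y) = free_product_inl G H x \<otimes>\<^bsub>free_product G H\<^esub> free_product_inl G H y"
    if "x \<in> carrier G" "y \<in> carrier G" for x y
  proof -
    have "pres_cong (free_product_gens G H) (free_product_rels G H)
        (positive_word [Inl x, Inl y]) (positive_word [Inl (x \<otimes> y)])"
      by (rule pres_cong.rel) (use that in \<open>auto simp: free_product_rels_def free_product_gens_def\<close>)
    then show ?thesis
      using that unfolding free_product_inl_def free_product_def
      by (subst presented_group_mult) (auto simp: free_product_gens_def pres_class_eq_iff intro: pres_cong.sym)
  qed
qed

lemma free_product_inr_group_hom:
  fixes H (structure)
  assumes "group H"
  shows "group_hom H (free_product G H) (free_product_inr G H)"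
proof (rule hom_group_hom[OF assms group_free_product], rule homI)
  interpret group H by fact
  show "free_product_inr G H x \<in> carrier (free_product G H)" if "x \<in> carrier H" for x
    using that by (simp add: free_product_inr_def free_product_def carrier_presented_group free_product_gens_def)
  show "free_product_inr G H (x \<otimes> y) = free_product_inr G H x \<otimes>\<^bsub>free_product G H\<^esub> free_product_inr G H y"
    if "x \<in> carrier H" "y \<in> carrier H" for x y
  proof -
    have "pres_cong (free_product_gens G H) (free_product_rels G H)
        (positive_word [Inr x, Inr y]) (positive_word [Inr (x \<otimes> y)])"
      by (rule pres_cong.rel) (use that in \<open>auto simp: free_product_rels_def free_product_gens_def\<close>)
    then show ?thesis
      using that unfolding free_product_inr_def free_product_def
      by (subst presented_group_mult) (auto simp: free_product_gens_def pres_class_eq_iff intro: pres_cong.sym)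
  qed
qed

lemma free_product_hom_eq:
  assumes "group_hom (free_product G H) K f" "group_hom (free_product G H) K f'"
    and "\<And>x. x \<in> carrier G \<Longrightarrow> f (free_product_inl G H x) = f' (free_product_inl G H x)"
    and "\<And>y. y \<in> carrier H \<Longrightarrow> f (free_product_inr G H y) = f' (free_product_inr G H y)"
    and "g \<in> carrier (free_product G H)"
  shows "f g = f' g"
proof (rule presented_group_hom_eq[of K f "free_product_gens G H" "free_product_rels G H"])
  show "f (pres_gen (free_product_gens G H) (free_product_rels G H) x)
      = f' (pres_gen (free_product_gens G H) (free_product_rels G H) x)" if "x \<in> free_product_gens G H" for x
    using that assms(3,4)
    by (auto simp: free_product_gens_def[of G H] free_product_inl_def free_product_inr_def pres_gen_def)
qed (use assms in \<open>auto simp: free_product_def group_hom_def group_hom_axioms_def\<close>)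

text \<open>Besides the isomorphism, the embedding \<open>j\<close> of the free factor and the
  retraction \<open>r\<close> are recorded. They are all that the later comparison of the cohomology
  of the two groups uses.\<close>

theorem vP3_iso_free_product:
  obtains \<psi> j r where "\<psi> \<in> iso (free_product P4_bar integer_group) vP3"
    "group_hom P4_bar vP3 j" "group_hom vP3 P4_bar r"
    "\<And>x. x \<in> carrier P4_bar \<Longrightarrow> \<psi> (free_product_inl P4_bar integer_group x) = j x"
    "\<psi> (free_product_inr P4_bar integer_group 1) = vt"
    "\<And>x. x \<in> carrier P4_bar \<Longrightarrow> r (j x) = x"
    "j (r vx1) = vx1" "j (r vx2) = vx2" "j (r vx3) = vx3" "j (r vp) = vp" "j (r vq) = vq"
    "r vt = \<one>\<^bsub>P4_bar\<^esub>"
proof -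
  interpret V: f3f2 vP3 vx1 vx2 vx3 vp vq
    using group_vP3 vP3_f3f2_rels by (simp add: f3f2_def f3f2_axioms_def)
  obtain \<theta> where \<theta>: "\<theta> \<in> iso SD P4_bar" using f3f2_group_iso_P4_bar by blast
  have \<theta>h: "group_hom SD P4_bar \<theta>"
    by (rule hom_group_hom[OF SD.is_group group_P4_bar]) (use \<theta> in \<open>simp add: iso_def\<close>)
  interpret \<theta>: group_hom SD P4_bar \<theta> by (rule \<theta>h)
  define \<theta>' where "\<theta>' = inv_into (carrier SD) \<theta>"
  have bij: "bij_betw \<theta> (carrier SD) (carrier P4_bar)" using \<theta> by (simp add: iso_def)
  have \<theta>'h: "group_hom P4_bar SD \<theta>'"
    by (rule hom_group_hom[OF group_P4_bar SD.is_group])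
      (use SD.iso_set_sym[OF \<theta>] in \<open>simp add: iso_def \<theta>'_def\<close>)
  interpret \<theta>': group_hom P4_bar SD \<theta>' by (rule \<theta>'h)
  have \<theta>'\<theta>: "\<theta>' (\<theta> g) = g" if "g \<in> carrier SD" for g
    using that bij by (simp add: \<theta>'_def bij_betw_def)
  have \<theta>\<theta>': "\<theta> (\<theta>' y) = y" if "y \<in> carrier P4_bar" for y
    using that bij by (simp add: \<theta>'_def bij_betw_inv_into_right)
  obtain i where i: "group_hom SD vP3 i" "i (f3f2_gen X1) = vx1" "i (f3f2_gen X2) = vx2"
    "i (f3f2_gen X3) = vx3" "i (f3f2_gen P) = vp" "i (f3f2_gen Q) = vq"
    by (rule f3f2_group_hom[OF group_vP3 vP3_f3f2_rels]) (rule that)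
  interpret i: group_hom SD vP3 i by fact
  obtain s where s: "group_hom vP3 SD s" "s vx1 = f3f2_gen X1" "s vx2 = f3f2_gen X2"
    "s vx3 = f3f2_gen X3" "s vp = f3f2_gen P" "s vq = f3f2_gen Q" "s vt = \<one>\<^bsub>SD\<^esub>"
    by (rule vP3_hom[OF SD.is_group SD.rels SD.one_closed]) (rule that)
  interpret s: group_hom vP3 SD s by fact
  have si: "s (i g) = g" if "g \<in> carrier SD" for g
    by (rule f3f2_group_hom_eq[OF group_hom_comp[OF i(1) s(1)] _ _ _ _ _ _ that])
      (simp_all add: i s hom_group_hom[OF SD.is_group SD.is_group] hom_def)
  define j where "j = (\<lambda>x. i (\<theta>' x))"
  define r where "r = (\<lambda>g. \<theta> (s g))"
  have j: "group_hom P4_bar vP3 j" unfolding j_def by (rule group_hom_comp[OF \<theta>'h i(1)])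
  have r: "group_hom vP3 P4_bar r" unfolding r_def by (rule group_hom_comp[OF s(1) \<theta>h])
  interpret j: group_hom P4_bar vP3 j by (rule j)
  interpret r: group_hom vP3 P4_bar r by (rule r)
  have rj: "r (j x) = x" if "x \<in> carrier P4_bar" for x
    using that by (simp add: r_def j_def si \<theta>\<theta>')
  have jr: "j (r vx1) = vx1" "j (r vx2) = vx2" "j (r vx3) = vx3" "j (r vp) = vp" "j (r vq) = vq"
    by (simp_all add: r_def j_def s \<theta>'\<theta> i)
  have rt: "r vt = \<one>\<^bsub>P4_bar\<^esub>" by (simp add: r_def s)
  let ?P = "free_product P4_bar integer_group"
  have pow: "group_hom integer_group vP3 (\<lambda>n. vt [^]\<^bsub>vP3\<^esub> n)"
    by (rule hom_group_hom[OF group_integer_group group_vP3])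
      (auto simp: hom_def integer_group_def V.int_pow_mult)
  obtain \<psi> where \<psi>: "group_hom ?P vP3 \<psi>"
    "\<And>x. x \<in> carrier P4_bar \<Longrightarrow> \<psi> (free_product_inl P4_bar integer_group x) = j x"
    "\<And>n. n \<in> carrier integer_group \<Longrightarrow> \<psi> (free_product_inr P4_bar integer_group n) = vt [^]\<^bsub>vP3\<^esub> n"
    by (rule free_product_hom[OF j pow]) (rule that)
  interpret \<psi>: group_hom ?P vP3 \<psi> by fact
  let ?l = "free_product_inl P4_bar integer_group" and ?r = "free_product_inr P4_bar integer_group"
  interpret l: group_hom P4_bar ?P ?l by (rule free_product_inl_group_hom[OF group_P4_bar])
  interpret rr: group_hom integer_group ?P ?r by (rule free_product_inr_group_hom[OF group_integer_group])
  have rels: "f3f2_rels ?P (?l (\<theta> (f3f2_gen X1))) (?l (\<theta> (f3f2_gen X2))) (?l (\<theta> (f3f2_gen X3)))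
      (?l (\<theta> (f3f2_gen P))) (?l (\<theta> (f3f2_gen Q)))"
    by (rule SD.rels_hom[OF group_hom_comp[OF \<theta>h l.group_hom_axioms]])
  have r1: "?r 1 \<in> carrier ?P" by (rule rr.hom_closed) simp
  \<comment> \<open>The inverse of \<open>\<psi>\<close> comes from the universal property of
    vP3.\<close>
  obtain \<chi> where \<chi>: "group_hom vP3 ?P \<chi>" "\<chi> vx1 = ?l (\<theta> (f3f2_gen X1))" "\<chi> vx2 = ?l (\<theta> (f3f2_gen X2))"
    "\<chi> vx3 = ?l (\<theta> (f3f2_gen X3))" "\<chi> vp = ?l (\<theta> (f3f2_gen P))" "\<chi> vq = ?l (\<theta> (f3f2_gen Q))" "\<chi> vt = ?r 1"
    by (rule vP3_hom[OF group_free_product rels r1]) (rule that)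
  interpret \<chi>: group_hom vP3 ?P \<chi> by fact
  have id_hom: "group_hom G G (\<lambda>x. x)" if "group G" for G :: "('x, 'y) monoid_scheme"
    using that by (simp add: group_hom_def group_hom_axioms_def hom_def)
  have "\<chi> (\<psi> g) = g" if "g \<in> carrier ?P" for g
  proof (rule free_product_hom_eq[OF group_hom_comp[OF \<psi>(1) \<chi>(1)] id_hom[OF group_free_product] _ _ that])
    have eq: "\<chi> (i g) = ?l (\<theta> g)" if "g \<in> carrier SD" for g
      by (rule f3f2_group_hom_eq[OF group_hom_comp[OF i(1) \<chi>(1)] group_hom_comp[OF \<theta>h l.group_hom_axioms] _ _ _ _ _ that])
        (simp_all add: i \<chi>)
    show "\<chi> (\<psi> (?l x)) = ?l x" if "x \<in> carrier P4_bar" for x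
      using that by (simp add: \<psi>(2) j_def eq \<theta>\<theta>')
    show "\<chi> (\<psi> (?r n)) = ?r n" if "n \<in> carrier integer_group" for n
    proof -
      have "\<chi> (\<psi> (?r n)) = \<chi> (vt [^]\<^bsub>vP3\<^esub> n)" by (simp only: \<psi>(3)[OF that])
      also have "\<dots> = ?r 1 [^]\<^bsub>?P\<^esub> n" by (simp add: \<chi>.hom_int_pow \<chi>(7))
      also have "\<dots> = ?r n" using rr.hom_int_pow[of 1 n] by simp
      finally show ?thesis .
    qed
  qed
  moreover have "\<psi> (\<chi> g) = g" if "g \<in> carrier vP3" for g
    by (rule vP3_hom_eq[OF group_hom_comp[OF \<chi>(1) \<psi>(1)] id_hom[OF group_vP3] _ _ _ _ _ _ that])
      (simp_all add: \<chi> \<psi>(2,3) j_def \<theta>'\<theta> i V.int_pow_1)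
  ultimately have "bij_betw \<psi> (carrier ?P) (carrier vP3)"
    by (intro bij_betw_byWitness[where f' = \<chi>]) auto
  then have "\<psi> \<in> iso ?P vP3" by (simp add: iso_def \<psi>.homh)
  then show thesis
    by (rule that[OF _ j r \<psi>(2) _ rj jr rt]) (simp_all add: \<psi>(3))
qed

section \<open>Cup products with classes of degree one\<close>

section \<open>Degree one and cup products\<close>

definition additive_on :: "('g, 'm) monoid_scheme \<Rightarrow> ('g \<Rightarrow> complex) \<Rightarrow> bool" where
  "additive_on G h \<longleftrightarrow> (\<forall>x\<in>carrier G. \<forall>y\<in>carrier G. h (x \<otimes>\<^bsub>G\<^esub> y) = h x + h y)"

text \<open>A class in degree one is the singleton of its unique cocycle.\<close>

definition h1_val :: "('g list \<Rightarrow> complex) set \<Rightarrow> 'g \<Rightarrow> complex" where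
  "h1_val a x = the_elem a [x]"

definition h1_of :: "('g, 'm) monoid_scheme \<Rightarrow> ('g \<Rightarrow> complex) \<Rightarrow> ('g list \<Rightarrow> complex) set" where
  "h1_of G h = {\<lambda>xs\<in>tuples G 1. h (hd xs)}"

lemma tuples_1: "xs \<in> tuples G 1 \<longleftrightarrow> (\<exists>x\<in>carrier G. xs = [x])"
  unfolding One_nat_def by (cases xs) auto

lemma tuples_2: "xs \<in> tuples G 2 \<longleftrightarrow> (\<exists>x\<in>carrier G. \<exists>y\<in>carrier G. xs = [x, y])"
  unfolding numeral_2_eq_2 by (cases xs; cases "tl xs") auto

text \<open>The cochain of the cup product with the one-cochain \<open>h\<close> on the left;
  \<open>f\<close> may have any degree.\<close>

definition cross :: "('g \<Rightarrow> complex) \<Rightarrow> ('g list \<Rightarrow> complex) \<Rightarrow> 'g list \<Rightarrow> complex" where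
  "cross h f xs = h (hd xs) * f (tl xs)"

context group
begin

lemma additive_onD: "additive_on G h \<Longrightarrow> x \<in> carrier G \<Longrightarrow> y \<in> carrier G \<Longrightarrow> h (x \<otimes> y) = h x + h y"
  by (simp add: additive_on_def)

lemma additive_one: "additive_on G h \<Longrightarrow> h \<one> = 0"
  using additive_onD[of h \<one> \<one>] by simp

lemma additive_inv: "additive_on G h \<Longrightarrow> x \<in> carrier G \<Longrightarrow> h (inv x) = - h x"
  using additive_onD[of h x "inv x"] additive_one[of h] by (simp add: add_eq_0_iff)

lemma cocycle_1: "is_cocycle G 1 f \<longleftrightarrow> f \<in> tuples G 1 \<rightarrow>\<^sub>E UNIV \<and> additive_on G (\<lambda>x. f [x])"
proof -
  have "(\<forall>xs\<in>tuples G (Suc 1). cob G f xs = 0) \<longleftrightarrow> (\<forall>x\<in>carrier G. \<forall>y\<in>carrier G. cob G f [x, y] = 0)"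
    unfolding Suc_1 by (auto simp: tuples_2 simp del: cob_simps)
  then show ?thesis by (auto simp: is_cocycle_def additive_on_def algebra_simps)
qed

lemma coboundary_1: "is_coboundary G 1 f \<longleftrightarrow> (\<forall>x\<in>carrier G. f [x] = 0)"
proof -
  have "is_coboundary G 1 f \<longleftrightarrow> (\<exists>h. \<forall>xs\<in>tuples G 1. f xs = cob G h xs)"
    unfolding is_coboundary_def One_nat_def nat.case by simp
  also have "\<dots> \<longleftrightarrow> (\<forall>x\<in>carrier G. f [x] = 0)"
    by (auto simp: tuples_1 intro!: exI[of _ "\<lambda>_. 0"])
  finally show ?thesis .
qed

lemma coboundaries_1: "coboundaries G 1 = {\<lambda>xs\<in>tuples G 1. 0}"
  by (auto simp: coboundaries_iff coboundary_1 tuples_1 fun_eq_iff PiE_iff extensional_def)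

lemma coh_class_1:
  assumes "f \<in> tuples G 1 \<rightarrow>\<^sub>E UNIV"
  shows "coh_class G 1 f = {f}"
  using assms unfolding coh_class_def coboundaries_1 a_r_coset_def r_coset_def
  by (auto simp: fun_eq_iff PiE_iff extensional_def)

lemma h1_of_cocycle: "additive_on G h \<Longrightarrow> is_cocycle G 1 (\<lambda>xs\<in>tuples G 1. h (hd xs))"
  by (auto simp: cocycle_1 additive_on_def tuples_1)

lemma h1_of_eq: "h1_of G h = coh_class G 1 (\<lambda>xs\<in>tuples G 1. h (hd xs))"
  by (subst coh_class_1) (auto simp: h1_of_def)

lemma h1_of_closed: "additive_on G h \<Longrightarrow> h1_of G h \<in> carrier (group_cohomology G 1)"
  unfolding h1_of_eq carrier_cohomology using h1_of_cocycle by blast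

lemma h1_val_of [simp]: "x \<in> carrier G \<Longrightarrow> h1_val (h1_of G h) x = h x"
  by (simp add: h1_val_def h1_of_def tuples_1)

lemma h1_cases:
  assumes "a \<in> carrier (group_cohomology G 1)"
  obtains f where "is_cocycle G 1 f" "a = {f}" "\<And>x. h1_val a x = f [x]"
proof -
  obtain f where f: "is_cocycle G 1 f" "a = coh_class G 1 f"
    using assms by (auto simp: carrier_cohomology)
  then have "a = {f}" by (simp add: coh_class_1 is_cocycle_def)
  then show thesis using that[of f] f(1) by (simp add: h1_val_def)
qed

lemma h1_val_additive: "a \<in> carrier (group_cohomology G 1) \<Longrightarrow> additive_on G (h1_val a)"
  by (elim h1_cases) (simp add: cocycle_1 additive_on_def)

lemma h1_eqI:
  assumes "a \<in> carrier (group_cohomology G 1)" "b \<in> carrier (group_cohomology G 1)"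
    and "\<And>x. x \<in> carrier G \<Longrightarrow> h1_val a x = h1_val b x"
  shows "a = b"
proof -
  obtain f where f: "is_cocycle G 1 f" "a = {f}" "\<And>x. h1_val a x = f [x]" by (rule h1_cases[OF assms(1)]) (rule that)
  obtain g where g: "is_cocycle G 1 g" "b = {g}" "\<And>x. h1_val b x = g [x]" by (rule h1_cases[OF assms(2)]) (rule that)
  have "f = g"
    by (rule PiE_ext[of _ "tuples G 1" "\<lambda>_. UNIV"])
      (use f g assms(3) in \<open>auto simp: is_cocycle_def tuples_1\<close>)
  then show ?thesis using f g by simp
qed

lemma h1_add:
  assumes "a \<in> carrier (group_cohomology G 1)" "b \<in> carrier (group_cohomology G 1)" "x \<in> carrier G"
  shows "h1_val (a \<oplus>\<^bsub>group_cohomology G 1\<^esub> b) x = h1_val a x + h1_val b x"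
proof -
  obtain f where f: "is_cocycle G 1 f" "a = {f}" "\<And>x. h1_val a x = f [x]" by (rule h1_cases[OF assms(1)]) (rule that)
  obtain g where g: "is_cocycle G 1 g" "b = {g}" "\<And>x. h1_val b x = g [x]" by (rule h1_cases[OF assms(2)]) (rule that)
  have "a \<oplus>\<^bsub>group_cohomology G 1\<^esub> b = {\<lambda>xs\<in>tuples G 1. f xs + g xs}"
    using coh_class_add[OF f(1) g(1)] f(1,2) g(1,2) by (simp add: coh_class_1 is_cocycle_def)
  then show ?thesis using f g assms(3) by (simp add: h1_val_def tuples_1)
qed

lemma h1_smult:
  assumes "a \<in> carrier (group_cohomology G 1)" "x \<in> carrier G"
  shows "h1_val (c \<odot>\<^bsub>group_cohomology G 1\<^esub> a) x = c * h1_val a x"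
proof -
  obtain f where f: "is_cocycle G 1 f" "a = {f}" "\<And>x. h1_val a x = f [x]" by (rule h1_cases[OF assms(1)]) (rule that)
  have "c \<odot>\<^bsub>group_cohomology G 1\<^esub> a = {\<lambda>xs\<in>tuples G 1. c * f xs}"
    using coh_class_smult[OF f(1)] f(1,2) by (simp add: coh_class_1 is_cocycle_def)
  then show ?thesis using f assms(2) by (simp add: h1_val_def tuples_1)
qed

lemma h1_zero: "x \<in> carrier G \<Longrightarrow> h1_val \<zero>\<^bsub>group_cohomology G 1\<^esub> x = 0"
  by (simp add: coh_class_zero coboundaries_1 h1_val_def tuples_1)

lemma h1_eq_zero_iff:
  assumes "a \<in> carrier (group_cohomology G 1)"
  shows "a = \<zero>\<^bsub>group_cohomology G 1\<^esub> \<longleftrightarrow> (\<forall>x\<in>carrier G. h1_val a x = 0)"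
proof -
  interpret vectorspace class_ring "group_cohomology G 1" by (rule vectorspace_cohomology)
  show ?thesis using h1_zero h1_eqI[OF assms zero_closed] by auto
qed

text \<open>The Leibniz rule for a cocycle of degree one on the left; two entries must be visible,
  because the rule uses additivity on the first two.\<close>

lemma cob_cross:
  assumes "additive_on G h" "x \<in> carrier G" "y \<in> carrier G"
  shows "cob G (cross h f) (x # y # ys) = - h x * cob G f (y # ys)"
  using assms by (simp add: cross_def additive_onD inner_cob_linear distrib_right right_diff_distrib)

lemma cross_cocycle:
  assumes "additive_on G h" "is_cocycle G n f"
  shows "is_cocycle G (Suc n) (restrict (cross h f) (tuples G (Suc n)))"
proof -
  have "cob G (cross h f) xs = 0" if xs: "xs \<in> tuples G (Suc (Suc n))" for xs
  proof -
    obtain x l where l: "xs = x # l" "x \<in> carrier G" "l \<in> tuples G (Suc n)"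
      using xs by (rule tuples_Suc_E)
    obtain y ys where "l = y # ys" "y \<in> carrier G" "ys \<in> tuples G n" using l(3) by (rule tuples_Suc_E)
    with l assms show ?thesis unfolding is_cocycle_def by (simp add: cob_cross del: cob_simps)
  qed
  then show ?thesis by (auto simp: is_cocycle_def cob_restrict)
qed

lemma cross_coboundary:
  assumes "additive_on G h" "is_coboundary G n f"
  shows "is_coboundary G (Suc n) (cross h f)"
proof (cases n)
  case 0
  then show ?thesis using assms(2)
    by (auto simp: is_coboundary_def cross_def cob_linear elim!: tuples_Suc_E intro!: exI[of _ "\<lambda>_. 0"])
next
  case (Suc m)
  obtain g where g: "\<forall>xs\<in>tuples G n. f xs = cob G g xs"
    using assms(2) unfolding is_coboundary_def Suc nat.case by blast
  \<comment> \<open>The sign of the Leibniz rule makes minus \<open>cross h g\<close> the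
    primitive.\<close>
  have "cross h f xs = cob G (\<lambda>l. -1 * cross h g l) xs" if xs: "xs \<in> tuples G (Suc n)" for xs
  proof -
    obtain x l where l: "xs = x # l" "x \<in> carrier G" "l \<in> tuples G n"
      using xs by (rule tuples_Suc_E)
    obtain y ys where "l = y # ys" "y \<in> carrier G" "ys \<in> tuples G m"
      using l(3) unfolding Suc by (rule tuples_Suc_E)
    moreover have "cob G (\<lambda>l. -1 * cross h g l) xs = -1 * cob G (cross h g) xs" by (rule cob_linear(2))
    ultimately show ?thesis
      using l assms(1) g by (simp add: cob_cross cross_def[of h f] del: cob_simps)
  qed
  then show ?thesis unfolding is_coboundary_def nat.case by blast
qed

lemma mem_coh_class:
  assumes "is_cocycle G n f" "f' \<in> coh_class G n f"
  shows "is_cocycle G n f'" "is_coboundary G n (\<lambda>xs. f' xs - f xs)"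
proof -
  have "f' \<in> carrier (cocycles G n) \<and> coh_class G n f' = coh_class G n f"
    using cohomology_quotient(7)[of f n f'] assms by simp
  then show "is_cocycle G n f'" "is_coboundary G n (\<lambda>xs. f' xs - f xs)"
    using coh_class_eq_iff[of n f' f] assms(1) by simp_all
qed

lemma coh_class_self: "is_cocycle G n f \<Longrightarrow> f \<in> coh_class G n f"
  using cohomology_quotient(8)[of f n] by simp

text \<open>\<open>a\<close> has one representative, and \<open>cross\<close> preserves
  coboundaries, so the union in \<open>cup\<close> ranges over equal classes.\<close>

lemma cup_coh_class:
  assumes a: "a \<in> carrier (group_cohomology G 1)" and f: "is_cocycle G n f"
  shows "cup G 1 n a (coh_class G n f)
    = coh_class G (Suc n) (restrict (cross (h1_val a) f) (tuples G (Suc n)))"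
proof -
  obtain g where g: "is_cocycle G 1 g" "a = {g}" "\<And>x. h1_val a x = g [x]" by (rule h1_cases[OF a]) (rule that)
  have add: "additive_on G (h1_val a)" by (rule h1_val_additive[OF a])
  have eq: "(\<lambda>xs\<in>tuples G (1 + n). g (take 1 xs) * f' (drop 1 xs)) = restrict (cross (h1_val a) f') (tuples G (Suc n))" for f'
    using g(3) by (auto simp: cross_def One_nat_def fun_eq_iff elim!: tuples_Suc_E)
  have const: "coh_class G (Suc n) (restrict (cross (h1_val a) f') (tuples G (Suc n)))
      = coh_class G (Suc n) (restrict (cross (h1_val a) f) (tuples G (Suc n)))"
    if f': "f' \<in> coh_class G n f" for f'
  proof -
    note m = mem_coh_class[OF f f']
    have "is_coboundary G (Suc n) (cross (h1_val a) (\<lambda>xs. f' xs - f xs))"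
      by (rule cross_coboundary[OF add m(2)])
    then have "is_coboundary G (Suc n) (\<lambda>xs. restrict (cross (h1_val a) f') (tuples G (Suc n)) xs
        - restrict (cross (h1_val a) f) (tuples G (Suc n)) xs)"
      unfolding is_coboundary_def nat.case by (simp add: cross_def right_diff_distrib)
    then show ?thesis
      by (subst coh_class_eq_iff) (auto intro: cross_cocycle add m(1) f)
  qed
  have "cup G 1 n a (coh_class G n f) = (\<Union>f'\<in>coh_class G n f.
      coh_class G (1 + n) (\<lambda>xs\<in>tuples G (1 + n). g (take 1 xs) * f' (drop 1 xs)))"
    by (simp only: cup_def g(2) UN_insert UN_empty Un_empty_right)
  also have "\<dots> = (\<Union>f'\<in>coh_class G n f. coh_class G (Suc n) (restrict (cross (h1_val a) f) (tuples G (Suc n))))"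
    by (rule SUP_cong[OF HOL.refl]) (subst eq, subst plus_1_eq_Suc, rule const)
  also have "\<dots> = coh_class G (Suc n) (restrict (cross (h1_val a) f) (tuples G (Suc n)))"
    using coh_class_self[OF f] unfolding UN_constant by (simp only: split: if_split) blast
  finally show ?thesis .
qed

lemma cup_linear_map:
  assumes a: "a \<in> carrier (group_cohomology G 1)"
  shows "linear_map class_ring (group_cohomology G n) (group_cohomology G (Suc n)) (cup G 1 n a)"
proof (rule linear_mapI[OF vectorspace_cohomology vectorspace_cohomology])
  have add: "additive_on G (h1_val a)" by (rule h1_val_additive[OF a])
  note cc = cross_cocycle[OF add]
  show "cup G 1 n a x \<in> carrier (group_cohomology G (Suc n))" if "x \<in> carrier (group_cohomology G n)" for x
    using that cc by (auto simp: carrier_cohomology cup_coh_class[OF a])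
  have sum_cocycle: "is_cocycle G n (\<lambda>xs\<in>tuples G n. f xs + g xs)" "is_cocycle G n (\<lambda>xs\<in>tuples G n. c * f xs)"
    if "is_cocycle G n f" "is_cocycle G n g" for f g c
    using that by (auto simp: is_cocycle_def cob_restrict cob_linear)
  show "cup G 1 n a (x \<oplus>\<^bsub>group_cohomology G n\<^esub> y) = cup G 1 n a x \<oplus>\<^bsub>group_cohomology G (Suc n)\<^esub> cup G 1 n a y"
    if xy: "x \<in> carrier (group_cohomology G n)" "y \<in> carrier (group_cohomology G n)" for x y
  proof -
    obtain f g where fg: "is_cocycle G n f" "x = coh_class G n f" "is_cocycle G n g" "y = coh_class G n g"
      using xy by (auto simp: carrier_cohomology)
    have "restrict (cross (h1_val a) (\<lambda>xs\<in>tuples G n. f xs + g xs)) (tuples G (Suc n))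
        = (\<lambda>xs\<in>tuples G (Suc n). restrict (cross (h1_val a) f) (tuples G (Suc n)) xs + restrict (cross (h1_val a) g) (tuples G (Suc n)) xs)"
      by (auto simp: fun_eq_iff cross_def algebra_simps elim!: tuples_Suc_E)
    then show ?thesis
      using fg by (simp add: coh_class_add cup_coh_class[OF a] sum_cocycle cc)
  qed
  show "cup G 1 n a (c \<odot>\<^bsub>group_cohomology G n\<^esub> x) = c \<odot>\<^bsub>group_cohomology G (Suc n)\<^esub> cup G 1 n a x"
    if x: "x \<in> carrier (group_cohomology G n)" for c x
  proof -
    obtain f where f: "is_cocycle G n f" "x = coh_class G n f"
      using x by (auto simp: carrier_cohomology)
    have "restrict (cross (h1_val a) (\<lambda>xs\<in>tuples G n. c * f xs)) (tuples G (Suc n))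
        = (\<lambda>xs\<in>tuples G (Suc n). c * restrict (cross (h1_val a) f) (tuples G (Suc n)) xs)"
      by (auto simp: fun_eq_iff cross_def algebra_simps elim!: tuples_Suc_E)
    then show ?thesis
      using f by (simp add: coh_class_smult cup_coh_class[OF a] sum_cocycle cc)
  qed
qed

text \<open>Vanishing of a product becomes the existence of a function on the group. In this form it
  is visibly preserved under composition with homomorphisms.\<close>

lemma cup_1_1_eq_zero_iff:
  assumes a: "a \<in> carrier (group_cohomology G 1)" and b: "b \<in> carrier (group_cohomology G 1)"
  shows "cup G 1 1 a b = \<zero>\<^bsub>group_cohomology G 2\<^esub> \<longleftrightarrow>
    (\<exists>h. \<forall>x\<in>carrier G. \<forall>y\<in>carrier G. h1_val a x * h1_val b y = h x + h y - h (x \<otimes> y))"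
proof -
  obtain f where f: "is_cocycle G 1 f" "b = {f}" "\<And>x. h1_val b x = f [x]" by (rule h1_cases[OF b]) (rule that)
  have add: "additive_on G (h1_val a)" by (rule h1_val_additive[OF a])
  have "b = coh_class G 1 f" using f by (simp add: coh_class_1 is_cocycle_def)
  note c = cross_cocycle[OF add f(1), unfolded Suc_1]
  have ball_2: "(\<forall>xs\<in>tuples G 2. R xs) \<longleftrightarrow> (\<forall>x\<in>carrier G. \<forall>y\<in>carrier G. R [x, y])" for R
    by (auto simp: tuples_2)
  have "cup G 1 1 a b = \<zero>\<^bsub>group_cohomology G 2\<^esub> \<longleftrightarrow>
      is_coboundary G 2 (restrict (cross (h1_val a) f) (tuples G 2))"
    by (simp only: \<open>b = coh_class G 1 f\<close> cup_coh_class[OF a f(1), unfolded Suc_1] coh_class_zero coh_class_eq_zero_iff[OF c])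
  also have "\<dots> \<longleftrightarrow> (\<exists>h. \<forall>xs\<in>tuples G 2. restrict (cross (h1_val a) f) (tuples G 2) xs = cob G h xs)"
    by (simp add: is_coboundary_def numeral_2_eq_2)
  also have "\<dots> \<longleftrightarrow> (\<exists>h. \<forall>x\<in>carrier G. \<forall>y\<in>carrier G. h1_val a x * h1_val b y = h [y] - (h [x \<otimes> y] - h [x]))"
    by (simp add: ball_2 tuples_2 cross_def f(3)[symmetric])
  also have "\<dots> \<longleftrightarrow> (\<exists>h. \<forall>x\<in>carrier G. \<forall>y\<in>carrier G. h1_val a x * h1_val b y = h x + h y - h (x \<otimes> y))"
  proof
    assume "\<exists>h. \<forall>x\<in>carrier G. \<forall>y\<in>carrier G. h1_val a x * h1_val b y = h [y] - (h [x \<otimes> y] - h [x])"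
    then obtain h where "\<forall>x\<in>carrier G. \<forall>y\<in>carrier G. h1_val a x * h1_val b y = h [y] - (h [x \<otimes> y] - h [x])" by blast
    then show "\<exists>h. \<forall>x\<in>carrier G. \<forall>y\<in>carrier G. h1_val a x * h1_val b y = h x + h y - h (x \<otimes> y)"
      by (intro exI[of _ "\<lambda>x. h [x]"]) (simp add: algebra_simps)
  next
    assume "\<exists>h. \<forall>x\<in>carrier G. \<forall>y\<in>carrier G. h1_val a x * h1_val b y = h x + h y - h (x \<otimes> y)"
    then obtain h where "\<forall>x\<in>carrier G. \<forall>y\<in>carrier G. h1_val a x * h1_val b y = h x + h y - h (x \<otimes> y)" by blast
    then show "\<exists>h. \<forall>x\<in>carrier G. \<forall>y\<in>carrier G. h1_val a x * h1_val b y = h [y] - (h [x \<otimes> y] - h [x])"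
      by (intro exI[of _ "\<lambda>l. h (hd l)"]) (simp add: algebra_simps)
  qed
  finally show ?thesis .
qed

end

section \<open>Dimensions in the complex (A, a)\<close>

section \<open>The resonance complex in low degrees\<close>

lemma linear_map_subspaces:
  assumes "linear_map class_ring V W f"
  shows "VectorSpace.subspace class_ring (a_kernel V W f) V"
    "VectorSpace.subspace class_ring (f ` carrier V) W"
proof -
  interpret linear_map class_ring V W f by fact
  show "VectorSpace.subspace class_ring (a_kernel V W f) V"
    using kerT_is_subspace by (simp add: ker_def a_kernel_def')
  show "VectorSpace.subspace class_ring (f ` carrier V) W"
    using imT_is_subspace by (simp add: im_def)
qed

lemma dim_cohomology_of_complex_Suc:
  assumes d: "linear_map class_ring (M n) (M (Suc n)) (d n)"
    and d': "linear_map class_ring (M (Suc n)) (M (Suc (Suc n))) (d (Suc n))"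
    and dd: "\<And>x. x \<in> carrier (M n) \<Longrightarrow> d (Suc n) (d n x) = \<zero>\<^bsub>M (Suc (Suc n))\<^esub>"
    and fin: "vectorspace.fin_dim class_ring
      ((M (Suc n))\<lparr>carrier := a_kernel (M (Suc n)) (M (Suc (Suc n))) (d (Suc n))\<rparr>)"
  shows "vectorspace.dim class_ring (cohomology_of_complex M d (Suc n))
      + vectorspace.dim class_ring ((M (Suc n))\<lparr>carrier := d n ` carrier (M n)\<rparr>)
    = vectorspace.dim class_ring
      ((M (Suc n))\<lparr>carrier := a_kernel (M (Suc n)) (M (Suc (Suc n))) (d (Suc n))\<rparr>)"
proof -
  let ?K = "a_kernel (M (Suc n)) (M (Suc (Suc n))) (d (Suc n))" and ?B = "d n ` carrier (M n)"
  note K = linear_map_subspaces(1)[OF d'] and B = linear_map_subspaces(2)[OF d]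
  have "?B \<subseteq> ?K" using dd subspaceD(1)[OF B] by (auto simp: a_kernel_def')
  then have "VectorSpace.subspace class_ring ?B ((M (Suc n))\<lparr>carrier := ?K\<rparr>)"
    by (intro subspaceI[OF subspace_vectorspace[OF K]]) (use subspaceD[OF B] in auto)
  from dim_quotient_module[OF subspace_vectorspace[OF K] this fin]
  show ?thesis by (simp add: cohomology_of_complex_def)
qed

lemma dim_trivial:
  fixes V :: "(complex, 'v, 'm) module_scheme"
  assumes "vectorspace class_ring V" "carrier V = {\<zero>\<^bsub>V\<^esub>}"
  shows "vectorspace.fin_dim class_ring V" "vectorspace.dim class_ring V = 0"
proof -
  have *: "x = \<zero>\<^bsub>V\<^esub>" if "x \<in> carrier V" for x using that unfolding assms(2) by simp
  show "vectorspace.fin_dim class_ring V" "vectorspace.dim class_ring V = 0"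
    by (rule dim_dual_basis[OF assms(1), of 0 "\<lambda>_ _. 0" "\<lambda>_. \<zero>\<^bsub>V\<^esub>"]; (elim *)?; simp)+
qed

context group
begin

text \<open>The square of a class of degree one vanishes on the cochain level with an explicit
  primitive, which stays a primitive after multiplication by the cocycle \<open>f\<close>.\<close>

lemma cross_cross_coboundary:
  assumes h: "additive_on G h" and f: "is_cocycle G n f"
  shows "is_coboundary G (Suc (Suc n)) (cross h (cross h f))"
proof -
  \<comment> \<open>Chosen so that its coboundary is the product \<open>h x * h y\<close>; this is
    where division by 2 is used.\<close>
  define c where "c x = - (h x)\<^sup>2 / 2" for x
  have "cross h (cross h f) xs = cob G (cross c f) xs" if xs: "xs \<in> tuples G (Suc (Suc n))" for xs
  proof -
    obtain x l where l: "xs = x # l" "x \<in> carrier G" "l \<in> tuples G (Suc n)"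
      using xs by (rule tuples_Suc_E)
    obtain y ys where ys: "l = y # ys" "y \<in> carrier G" "ys \<in> tuples G n"
      using l(3) by (rule tuples_Suc_E)
    have "cob G (cross c f) xs = c y * f ys - (c (x \<otimes> y) * f ys - c x * inner_cob G f y ys)"
      by (simp add: l(1) ys(1) cross_def inner_cob_linear)
    moreover have "l \<in> tuples G (Suc n)" by (rule l(3))
    then have "cob G f l = 0" using f unfolding is_cocycle_def by blast
    then have "inner_cob G f y ys = f ys" by (simp add: ys(1))
    ultimately have "cob G (cross c f) xs = (c y - c (x \<otimes> y) + c x) * f ys"
      by (simp add: algebra_simps)
    also have "c y - c (x \<otimes> y) + c x = h x * h y"
      using l(2) ys(2) by (simp add: c_def additive_onD[OF h] power2_eq_square field_simps)
    finally show ?thesis by (simp add: l(1) ys(1) cross_def)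
  qed
  then show ?thesis unfolding is_coboundary_def nat.case by blast
qed

lemma is_coboundary_restrict: "is_coboundary G n (restrict f (tuples G n)) \<longleftrightarrow> is_coboundary G n f"
  by (auto simp: is_coboundary_def split: nat.split)

lemma cup_cup:
  assumes a: "a \<in> carrier (group_cohomology G 1)" and x: "x \<in> carrier (group_cohomology G n)"
  shows "cup G 1 (Suc n) a (cup G 1 n a x) = \<zero>\<^bsub>group_cohomology G (Suc (Suc n))\<^esub>"
proof -
  have add: "additive_on G (h1_val a)" by (rule h1_val_additive[OF a])
  obtain f where f: "is_cocycle G n f" "x = coh_class G n f"
    using x by (auto simp: carrier_cohomology)
  let ?F = "restrict (cross (h1_val a) f) (tuples G (Suc n))"
  have F: "is_cocycle G (Suc n) ?F" by (rule cross_cocycle[OF add f(1)])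
  have F': "is_cocycle G (Suc (Suc n)) (restrict (cross (h1_val a) ?F) (tuples G (Suc (Suc n))))"
    by (rule cross_cocycle[OF add F])
  have "restrict (cross (h1_val a) ?F) (tuples G (Suc (Suc n)))
      = restrict (cross (h1_val a) (cross (h1_val a) f)) (tuples G (Suc (Suc n)))"
    by (rule restrict_ext) (auto simp: cross_def elim!: tuples_Suc_E)
  then have "is_coboundary G (Suc (Suc n)) (restrict (cross (h1_val a) ?F) (tuples G (Suc (Suc n))))"
    using cross_cross_coboundary[OF add f(1)] by (simp add: is_coboundary_restrict)
  then show ?thesis
    unfolding f(2) cup_coh_class[OF a f(1)] cup_coh_class[OF a F] coh_class_zero coh_class_eq_zero_iff[OF F'] .
qed

lemma dim_resonance_Suc:
  assumes a: "a \<in> carrier (group_cohomology G 1)"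
    and fin: "vectorspace.fin_dim class_ring ((group_cohomology G (Suc n))\<lparr>carrier :=
      a_kernel (group_cohomology G (Suc n)) (group_cohomology G (Suc (Suc n))) (cup G 1 (Suc n) a)\<rparr>)"
  shows "vectorspace.dim class_ring (cohomology_of_complex (group_cohomology G) (\<lambda>n. cup G 1 n a) (Suc n))
      + vectorspace.dim class_ring ((group_cohomology G (Suc n))\<lparr>carrier :=
          cup G 1 n a ` carrier (group_cohomology G n)\<rparr>)
    = vectorspace.dim class_ring ((group_cohomology G (Suc n))\<lparr>carrier :=
      a_kernel (group_cohomology G (Suc n)) (group_cohomology G (Suc (Suc n))) (cup G 1 (Suc n) a)\<rparr>)"
  using dim_cohomology_of_complex_Suc[of "group_cohomology G" n "\<lambda>n. cup G 1 n a",
      OF cup_linear_map[OF a] cup_linear_map[OF a] cup_cup[OF a] fin] .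

text \<open>Cocycles of degree zero are constants, so the image is the span of \<open>a\<close>.
  This is the source of the summand that distinguishes \<open>a = 0\<close> in
  \<open>dim_resonance_1\<close>.\<close>

lemma cup_0_image:
  assumes a: "a \<in> carrier (group_cohomology G 1)"
  shows "cup G 1 0 a ` carrier (group_cohomology G 0) = {c \<odot>\<^bsub>group_cohomology G 1\<^esub> a | c. True}"
proof -
  interpret V: vectorspace class_ring "group_cohomology G 1" by (rule vectorspace_cohomology)
  have add: "additive_on G (h1_val a)" by (rule h1_val_additive[OF a])
  have *: "cup G 1 0 a (coh_class G 0 f) = f [] \<odot>\<^bsub>group_cohomology G 1\<^esub> a" if f: "is_cocycle G 0 f" for f
  proof (rule h1_eqI)
    have eq: "cup G 1 0 a (coh_class G 0 f) = h1_of G (\<lambda>x. h1_val a x * f [])"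
      unfolding cup_coh_class[OF a f] h1_of_eq
      unfolding One_nat_def
      by (rule arg_cong[of _ _ "coh_class G (Suc 0)"], rule restrict_ext) (auto simp: cross_def elim!: tuples_Suc_E)
    have add': "additive_on G (\<lambda>x. h1_val a x * f [])"
      using add by (simp add: additive_on_def distrib_right)
    show "cup G 1 0 a (coh_class G 0 f) \<in> carrier (group_cohomology G 1)"
      unfolding eq by (rule h1_of_closed[OF add'])
    show "f [] \<odot>\<^bsub>group_cohomology G 1\<^esub> a \<in> carrier (group_cohomology G 1)" using a by simp
    show "h1_val (cup G 1 0 a (coh_class G 0 f)) x = h1_val (f [] \<odot>\<^bsub>group_cohomology G 1\<^esub> a) x"
      if "x \<in> carrier G" for x
      using that by (simp add: eq h1_smult[OF a])
  qed
  have ex: "is_cocycle G 0 (\<lambda>xs\<in>tuples G 0. c)" for c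
    by (auto simp: is_cocycle_def elim!: tuples_Suc_E)
  show ?thesis
  proof (intro equalityI subsetI)
    fix z assume "z \<in> cup G 1 0 a ` carrier (group_cohomology G 0)"
    then obtain f where "is_cocycle G 0 f" "z = cup G 1 0 a (coh_class G 0 f)"
      unfolding carrier_cohomology by blast
    then show "z \<in> {c \<odot>\<^bsub>group_cohomology G 1\<^esub> a | c. True}" using * by blast
  next
    fix z assume "z \<in> {c \<odot>\<^bsub>group_cohomology G 1\<^esub> a | c. True}"
    then obtain c where "z = c \<odot>\<^bsub>group_cohomology G 1\<^esub> a" by blast
    then have "z = cup G 1 0 a (coh_class G 0 (\<lambda>xs\<in>tuples G 0. c))" using *[OF ex[of c]] by simp
    then show "z \<in> cup G 1 0 a ` carrier (group_cohomology G 0)"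
      unfolding carrier_cohomology using ex by blast
  qed
qed

lemma dim_cup_0_image:
  assumes a: "a \<in> carrier (group_cohomology G 1)"
  shows "vectorspace.dim class_ring ((group_cohomology G 1)\<lparr>carrier := cup G 1 0 a ` carrier (group_cohomology G 0)\<rparr>)
    = (if a = \<zero>\<^bsub>group_cohomology G 1\<^esub> then 0 else 1)"
proof -
  interpret V: vectorspace class_ring "group_cohomology G 1" by (rule vectorspace_cohomology)
  let ?B = "cup G 1 0 a ` carrier (group_cohomology G 0)"
  let ?V = "(group_cohomology G 1)\<lparr>carrier := ?B\<rparr>"
  have sub: "VectorSpace.subspace class_ring ?B (group_cohomology G 1)"
    using linear_map_subspaces(2)[OF cup_linear_map[OF a, of 0]] by (simp only: One_nat_def)
  have V: "vectorspace class_ring ?V" by (rule subspace_vectorspace[OF sub])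
  have inB: "v \<in> carrier (group_cohomology G 1)" if "v \<in> ?B" for v
    using subspaceD(1)[OF sub] that by blast
  show ?thesis
  proof (cases "a = \<zero>\<^bsub>group_cohomology G 1\<^esub>")
    case True
    have "c \<odot>\<^bsub>group_cohomology G 1\<^esub> a = \<zero>\<^bsub>group_cohomology G 1\<^esub>" for c
      using V.smult_r_null[of c] True by simp
    then have "?B = {\<zero>\<^bsub>group_cohomology G 1\<^esub>}" unfolding cup_0_image[OF a] by simp
    then have "carrier ?V = {\<zero>\<^bsub>?V\<^esub>}" by simp
    then show ?thesis using dim_trivial(2)[OF V] True by simp
  next
    case False
    then obtain x where x: "x \<in> carrier G" "h1_val a x \<noteq> 0" using h1_eq_zero_iff[OF a] by blast
    have "a = 1 \<odot>\<^bsub>group_cohomology G 1\<^esub> a" using V.smult_one[OF a] by (simp add: class_ring_simps)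
    then have aB: "a \<in> ?B" unfolding cup_0_image[OF a] by blast
    have "vectorspace.dim class_ring ?V = 1"
    proof (rule dim_dual_basis(2)[OF V, of 1 "\<lambda>_ v. h1_val v x / h1_val a x" "\<lambda>_. a"])
      show "v = \<zero>\<^bsub>?V\<^esub>" if v: "v \<in> carrier ?V" "\<And>i::nat. i < 1 \<Longrightarrow> h1_val v x / h1_val a x = 0" for v
      proof -
        have "v \<in> ?B" using v(1) by simp
        then obtain c where c: "v = c \<odot>\<^bsub>group_cohomology G 1\<^esub> a" unfolding cup_0_image[OF a] by blast
        then have "c = 0" using v(2)[of 0] x by (simp add: h1_smult[OF a])
        then show ?thesis using c V.lmult_0[OF a] by (simp add: class_ring_simps)
      qed
    qed (use aB x inB in \<open>auto simp: h1_add h1_smult add_divide_distrib\<close>)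
    then show ?thesis using False by simp
  qed
qed

definition annihilator :: "('a list \<Rightarrow> complex) set \<Rightarrow> ('a list \<Rightarrow> complex) set set" where
  "annihilator a = {b \<in> carrier (group_cohomology G 1). cup G 1 1 a b = \<zero>\<^bsub>group_cohomology G 2\<^esub>}"

lemma a_kernel_cup_1: "a_kernel (group_cohomology G 1) (group_cohomology G 2) (cup G 1 1 a) = annihilator a"
  by (simp only: a_kernel_def' annihilator_def)

lemma annihilator_subspace:
  "a \<in> carrier (group_cohomology G 1) \<Longrightarrow> VectorSpace.subspace class_ring (annihilator a) (group_cohomology G 1)"
  using linear_map_subspaces(1)[OF cup_linear_map[of a 1]] unfolding Suc_1 a_kernel_cup_1 .

lemma dim_resonance_1:
  assumes a: "a \<in> carrier (group_cohomology G 1)"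
    and "vectorspace.fin_dim class_ring ((group_cohomology G 1)\<lparr>carrier := annihilator a\<rparr>)"
  shows "vectorspace.dim class_ring (cohomology_of_complex (group_cohomology G) (\<lambda>n. cup G 1 n a) 1)
      + (if a = \<zero>\<^bsub>group_cohomology G 1\<^esub> then 0 else 1)
    = vectorspace.dim class_ring ((group_cohomology G 1)\<lparr>carrier := annihilator a\<rparr>)"
  using dim_resonance_Suc[OF a, of 0, folded One_nat_def, unfolded Suc_1 a_kernel_cup_1, OF assms(2)]
  unfolding dim_cup_0_image[OF a] .

text \<open>As degree three vanishes, the whole of degree two is the kernel; by rank and nullity the
  image of degree one has the dimension of degree one minus that of the annihilator.\<close>

lemma dim_resonance_2:
  assumes a: "a \<in> carrier (group_cohomology G 1)"
    and "vectorspace.fin_dim class_ring (group_cohomology G 1)" "vectorspace.fin_dim class_ring (group_cohomology G 2)"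
    and triv: "carrier (group_cohomology G 3) = {\<zero>\<^bsub>group_cohomology G 3\<^esub>}"
  shows "vectorspace.dim class_ring (cohomology_of_complex (group_cohomology G) (\<lambda>n. cup G 1 n a) 2)
      + vectorspace.dim class_ring (group_cohomology G 1)
    = vectorspace.dim class_ring (group_cohomology G 2)
      + vectorspace.dim class_ring ((group_cohomology G 1)\<lparr>carrier := annihilator a\<rparr>)"
proof -
  have S: "Suc (Suc 0) = 2" "Suc 2 = 3" "Suc (Suc 1) = 3" by simp_all
  interpret linear_map class_ring "group_cohomology G 2" "group_cohomology G 3" "cup G 1 2 a"
    using cup_linear_map[OF a, of 2] unfolding S .
  have "cup G 1 2 a x = \<zero>\<^bsub>group_cohomology G 3\<^esub>" if "x \<in> carrier (group_cohomology G 2)" for x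
    using T_im[OF that] triv by blast
  then have ker: "a_kernel (group_cohomology G 2) (group_cohomology G 3) (cup G 1 2 a) = carrier (group_cohomology G 2)"
    unfolding a_kernel_def' by blast
  have eq: "(group_cohomology G 2)\<lparr>carrier := carrier (group_cohomology G 2)\<rparr> = group_cohomology G 2" by simp
  have lin: "linear_map class_ring (group_cohomology G 1) (group_cohomology G 2) (cup G 1 1 a)"
    using cup_linear_map[OF a, of 1] unfolding Suc_1 .
  show ?thesis
    using dim_resonance_Suc[OF a, of 1] linear_map_rank_nullity(3)[OF lin assms(2)] assms(3)
    unfolding Suc_1 S ker eq by (simp add: annihilator_def)
qed

lemma dim_resonance_trivial:
  assumes a: "a \<in> carrier (group_cohomology G 1)"
    and triv: "carrier (group_cohomology G (Suc n)) = {\<zero>\<^bsub>group_cohomology G (Suc n)\<^esub>}"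
  shows "vectorspace.dim class_ring (cohomology_of_complex (group_cohomology G) (\<lambda>n. cup G 1 n a) (Suc n)) = 0"
proof -
  let ?K = "a_kernel (group_cohomology G (Suc n)) (group_cohomology G (Suc (Suc n))) (cup G 1 (Suc n) a)"
  note sub = linear_map_subspaces(1)[OF cup_linear_map[OF a, of "Suc n"]]
  have "?K = {\<zero>\<^bsub>group_cohomology G (Suc n)\<^esub>}"
    using subspaceD(1,2)[OF sub] triv by blast
  then show ?thesis
    using dim_resonance_Suc[OF a, of n] dim_trivial[OF subspace_vectorspace[OF sub]] by simp
qed

end

section \<open>Cohomology of a group with an acyclic Cayley complex\<close>

section \<open>Vanishing of cohomology above the dimension of an acyclic Cayley complex\<close>

context group
begin

text \<open>For cochains with values in functions on the group, translating the argument commutes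
  with the differential.\<close>

lemma inner_cob_translate:
  assumes "c \<in> carrier G" "x \<in> carrier G" "xs \<in> tuples G (Suc n)"
  shows "inner_cob G (\<lambda>l. V ((c \<otimes> hd l) # tl l)) x xs = inner_cob G V (c \<otimes> x) xs"
  using assms(3)
proof (rule tuples_Suc_E)
  fix y ys assume "xs = y # ys" "y \<in> carrier G" "ys \<in> tuples G n"
  then show ?thesis using assms(1,2) by (simp add: m_assoc)
qed

definition word_prod :: "('i \<Rightarrow> 'a) \<Rightarrow> 'i list \<Rightarrow> 'a" where
  "word_prod g is = foldr (\<lambda>i y. g i \<otimes> y) is \<one>"

text \<open>The sum of an edge function along the path that starts at \<open>x\<close> and follows a word of
  generators from right to left; the edge with label \<open>i\<close> leads from \<open>y\<close> to \<open>g i \<otimes> y\<close>.\<close>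

fun path_sum :: "('i \<Rightarrow> 'a) \<Rightarrow> ('i \<Rightarrow> 'a \<Rightarrow> complex) \<Rightarrow> 'i list \<Rightarrow> 'a \<Rightarrow> complex" where
  "path_sum g W [] x = 0"
| "path_sum g W (i # is) x = W i (word_prod g is \<otimes> x) + path_sum g W is x"

lemma word_prod_simps [simp]:
  "word_prod g [] = \<one>" "word_prod g (i # is) = g i \<otimes> word_prod g is"
  by (simp_all add: word_prod_def)

end

text \<open>The complex has the group elements as vertices, an edge for each generator and vertex,
  and a cell for each relation and vertex. \<open>generated\<close> expresses connectedness;
  \<open>exact\<close> and \<open>surj\<close> say that arbitrary complex cochains have no
  cohomology in degrees one and two.\<close>

locale acyclic_cayley_complex = group +
  fixes g :: "'i \<Rightarrow> 'a" and rels :: "('i list \<times> 'i list) set"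
  assumes g_closed [simp]: "g i \<in> carrier G"
    and generated: "\<And>S. subgroup S G \<Longrightarrow> range g \<subseteq> S \<Longrightarrow> carrier G \<subseteq> S"
    and rels: "\<And>u v. (u, v) \<in> rels \<Longrightarrow> word_prod g u = word_prod g v"
    and exact: "\<And>W. (\<And>u v x. (u, v) \<in> rels \<Longrightarrow> x \<in> carrier G \<Longrightarrow> path_sum g W u x = path_sum g W v x) \<Longrightarrow>
      \<exists>k. \<forall>i. \<forall>x\<in>carrier G. W i x = k (g i \<otimes> x) - k x"
    and surj: "\<And>z. \<exists>W. \<forall>(u, v)\<in>rels. \<forall>x\<in>carrier G. path_sum g W u x - path_sum g W v x = z (u, v) x"
begin

lemma word_prod_closed [simp]: "word_prod g is \<in> carrier G"
  by (induction "is") simp_all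

lemma path_sum_diff:
  "path_sum g (\<lambda>i x. W i x - W' i x) is x = path_sum g W is x - path_sum g W' is x"
  by (induction "is") simp_all

lemma path_sum_cong:
  "(\<And>i y. y \<in> carrier G \<Longrightarrow> W i y = W' i y) \<Longrightarrow> x \<in> carrier G \<Longrightarrow> path_sum g W is x = path_sum g W' is x"
  by (induction "is") simp_all

lemma path_sum_gradient:
  "x \<in> carrier G \<Longrightarrow> path_sum g (\<lambda>i x. k (g i \<otimes> x) - k x) is x = k (word_prod g is \<otimes> x) - k x"
  by (induction "is") (simp_all add: m_assoc)

lemma inner_cob_path_sum:
  assumes "x \<in> carrier G" "xs \<in> tuples G (Suc n)"
  shows "inner_cob G (\<lambda>l. path_sum g (\<lambda>i y. V i (y # tl l)) is (hd l)) x xs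
    = path_sum g (\<lambda>i y. inner_cob G (V i) y xs) is x"
proof (induction "is")
  case Nil
  then show ?case using inner_cob_linear(2)[of 0 "\<lambda>_. 0" x xs] by simp
next
  case (Cons i "is")
  then show ?case using assms by (simp add: inner_cob_linear inner_cob_translate)
qed

text \<open>The elements under whose translation \<open>k\<close> is invariant form a
  subgroup.\<close>

lemma invariant_constant:
  assumes inv: "\<And>i x. x \<in> carrier G \<Longrightarrow> k (g i \<otimes> x) = k x" and x: "x \<in> carrier G"
  shows "k x = k \<one>"
proof -
  let ?S = "{y \<in> carrier G. \<forall>x\<in>carrier G. k (y \<otimes> x) = k x}"
  have "subgroup ?S G"
  proof (rule subgroup.intro)
    show "y \<otimes> z \<in> ?S" if "y \<in> ?S" "z \<in> ?S" for y z using that by (auto simp: m_assoc)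
    show "inv y \<in> ?S" if y: "y \<in> ?S" for y
    proof -
      have "k (inv y \<otimes> x) = k x" if "x \<in> carrier G" for x
      proof -
        have "k (y \<otimes> (inv y \<otimes> x)) = k (inv y \<otimes> x)" using y that by blast
        moreover have "y \<otimes> (inv y \<otimes> x) = x" using y that by (simp add: m_assoc[symmetric])
        ultimately show ?thesis by simp
      qed
      then show ?thesis using y by simp
    qed
  qed auto
  then have "carrier G \<subseteq> ?S" by (rule generated) (use inv in auto)
  then have "k (x \<otimes> \<one>) = k \<one>" using x by blast
  then show ?thesis using x by simp
qed

text \<open>The functions on vertices, edges and cells of the complex form a resolution of the constants
  by acyclic modules; the proof moves a cocycle through this resolution. A cochain of degree
  \<open>n\<close> with values in the functions on the group is a function on nonempty lists of length
  \<open>n + 1\<close> whose head is the argument of the function, and \<^const>\<open>inner_cob\<close> is its coboundary.\<close>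

theorem is_coboundary_ge_3:
  assumes f: "is_cocycle G (Suc (Suc (Suc m))) f"
  shows "is_coboundary G (Suc (Suc (Suc m))) f"
proof -
  let ?D = "\<lambda>U l. inner_cob G U (hd l) (tl l)"
  let ?R = "\<lambda>u V l. path_sum g (\<lambda>i y. V i (y # tl l)) u (hd l)"
  \<comment> \<open>Read with its head as argument, \<open>f\<close> is a function-valued primitive
    of \<open>f\<close> itself, the latter taken with constant values.\<close>
  have D_f: "inner_cob G f x xs = f xs" if "x \<in> carrier G" "xs \<in> tuples G (Suc (Suc (Suc m)))" for x xs
  proof -
    have "cob G f (x # xs) = 0" using f that by (simp add: is_cocycle_def del: cob_simps)
    then show ?thesis by simp
  qed
  \<comment> \<open>Functions on the group form an acyclic module: putting the unit in the place of
    the argument is a contracting homotopy.\<close>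
  have contraction: "inner_cob G (\<lambda>l. U (\<one> # l)) x xs = U (x # xs)"
    if "inner_cob G U \<one> (x # xs) = 0" "x \<in> carrier G" for U x xs
    using that by simp
  define U1 where "U1 i l = f ((g i \<otimes> hd l) # tl l) - f l" for i l
  define V1 where "V1 i l = U1 i (\<one> # l)" for i l
  have D_U1: "inner_cob G (U1 i) x xs = 0" if x: "x \<in> carrier G" and xs: "xs \<in> tuples G (Suc (Suc (Suc m)))" for i x xs
  proof -
    have "inner_cob G (U1 i) x xs = inner_cob G f (g i \<otimes> x) xs - inner_cob G f x xs"
      unfolding U1_def[abs_def] inner_cob_minus using x xs by (simp add: inner_cob_translate)
    then show ?thesis using D_f x xs by simp
  qed
  have D_V1: "inner_cob G (V1 i) x xs = U1 i (x # xs)" if x: "x \<in> carrier G" and xs: "xs \<in> tuples G (Suc (Suc m))" for i x xs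
    unfolding V1_def by (rule contraction) (use x xs D_U1[of \<one> "x # xs"] in simp_all)
  \<comment> \<open>The difference of the sums of \<open>V1\<close> along the two sides of a cell.
    It is closed because the two sides end at the same vertex. Each of the passages to
    \<open>f\<close> as a function-valued cochain, to \<open>V1\<close> and to \<open>V2\<close>
    lowers the degree by one, whence the bound three.\<close>
  define U2 where "U2 r l = ?R (fst r) V1 l - ?R (snd r) V1 l" for r l
  define V2 where "V2 r l = U2 r (\<one> # l)" for r l
  have D_R: "inner_cob G (\<lambda>l. ?R u V l - ?R v V l) x xs
      = path_sum g (\<lambda>i y. inner_cob G (V i) y xs) u x - path_sum g (\<lambda>i y. inner_cob G (V i) y xs) v x"
    if "x \<in> carrier G" "xs \<in> tuples G (Suc n)" for u v V x xs n
    unfolding inner_cob_minus using that by (simp add: inner_cob_path_sum)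
  have D_U2: "inner_cob G (U2 r) x xs = 0"
    if r: "r \<in> rels" and x: "x \<in> carrier G" and xs: "xs \<in> tuples G (Suc (Suc m))" for r x xs
  proof -
    have sum: "path_sum g (\<lambda>i y. inner_cob G (V1 i) y xs) u x = f ((word_prod g u \<otimes> x) # xs) - f (x # xs)" for u
    proof -
      have "path_sum g (\<lambda>i y. inner_cob G (V1 i) y xs) u x = path_sum g (\<lambda>i y. f ((g i \<otimes> y) # xs) - f (y # xs)) u x"
        by (rule path_sum_cong) (use x xs in \<open>simp_all add: D_V1 U1_def\<close>)
      then show ?thesis using path_sum_gradient[of x "\<lambda>y. f (y # xs)" u] x by simp
    qed
    have "word_prod g (fst r) = word_prod g (snd r)" using r rels[of "fst r" "snd r"] by simp
    then show ?thesis
      unfolding U2_def[abs_def] D_R[OF x xs] sum by simp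
  qed
  have D_V2: "inner_cob G (V2 r) x xs = U2 r (x # xs)"
    if r: "r \<in> rels" and x: "x \<in> carrier G" and xs: "xs \<in> tuples G (Suc m)" for r x xs
    unfolding V2_def by (rule contraction) (use x xs D_U2[OF r, of \<one> "x # xs"] in simp_all)
  \<comment> \<open>\<open>surj\<close> is applied for each tail separately.\<close>
  have "\<forall>xs. \<exists>W. \<forall>r\<in>rels. \<forall>x\<in>carrier G. path_sum g W (fst r) x - path_sum g W (snd r) x = V2 r (x # xs)"
    using surj[of "\<lambda>r x. V2 r (x # _)"] by (simp add: case_prod_unfold)
  from choice[OF this] obtain W where W: "path_sum g (W xs) (fst r) x - path_sum g (W xs) (snd r) x = V2 r (x # xs)"
    if "r \<in> rels" "x \<in> carrier G" for xs r x by blast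
  define w where "w i l = W (tl l) i (hd l)" for i l
  \<comment> \<open>Subtracting the differential of \<open>w\<close> changes the sum around a cell
    \<open>r\<close> by the differential of \<open>V2 r\<close>, which equals the sum of
    \<open>V1\<close> around that cell. So the corrected edge function is closed.\<close>
  define V1' where "V1' i l = V1 i l - ?D (w i) l" for i l
  have closed: "path_sum g (\<lambda>i x. V1' i (x # xs)) (fst r) x = path_sum g (\<lambda>i x. V1' i (x # xs)) (snd r) x"
    if r: "r \<in> rels" and x: "x \<in> carrier G" and xs: "xs \<in> tuples G (Suc m)" for r x xs
  proof -
    have "path_sum g (\<lambda>i y. inner_cob G (w i) y xs) (fst r) x - path_sum g (\<lambda>i y. inner_cob G (w i) y xs) (snd r) x
        = inner_cob G (\<lambda>l. ?R (fst r) w l - ?R (snd r) w l) x xs"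
      by (rule D_R[OF x xs, symmetric])
    also have "\<dots> = inner_cob G (V2 r) x xs"
    proof (rule inner_cob_cong[OF _ x xs])
      fix l assume "l \<in> tuples G (Suc m)"
      then obtain y ys where "l = y # ys" "y \<in> carrier G" by (rule tuples_Suc_E)
      then show "?R (fst r) w l - ?R (snd r) w l = V2 r l" using W[OF r] by (simp add: w_def)
    qed
    also have "\<dots> = path_sum g (\<lambda>i x. V1 i (x # xs)) (fst r) x - path_sum g (\<lambda>i x. V1 i (x # xs)) (snd r) x"
      using D_V2[OF r x xs] by (simp add: U2_def)
    finally have "path_sum g (\<lambda>i y. inner_cob G (w i) y xs) (fst r) x
        = path_sum g (\<lambda>i x. V1 i (x # xs)) (fst r) x - path_sum g (\<lambda>i x. V1 i (x # xs)) (snd r) x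
          + path_sum g (\<lambda>i y. inner_cob G (w i) y xs) (snd r) x"
      by (simp only: diff_eq_eq)
    then show ?thesis by (simp add: V1'_def path_sum_diff)
  qed
  have "\<exists>k. \<forall>i. \<forall>x\<in>carrier G. V1' i (x # xs) = k (g i \<otimes> x) - k x" if "xs \<in> tuples G (Suc m)" for xs
    by (rule exact) (use closed[of "(_, _)"] that in simp)
  then have "\<forall>xs. \<exists>k. xs \<in> tuples G (Suc m) \<longrightarrow> (\<forall>i. \<forall>x\<in>carrier G. V1' i (x # xs) = k (g i \<otimes> x) - k x)"
    by blast
  from choice[OF this] obtain K where K: "V1' i (x # xs) = K xs (g i \<otimes> x) - K xs x"
    if "xs \<in> tuples G (Suc m)" "x \<in> carrier G" for xs i x by blast
  define k where "k l = K (tl l) (hd l)" for l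
  \<comment> \<open>Subtracting the differential of the potentials makes \<open>f\<close> invariant
    under translation of its argument, so it descends to an ordinary cochain \<open>h\<close>. Its
    differential is still \<open>f\<close>, because the square of the differential vanishes.\<close>
  define f' where "f' l = f l - ?D k l" for l
  have inv: "f' ((g i \<otimes> x) # xs) = f' (x # xs)" if x: "x \<in> carrier G" and xs: "xs \<in> tuples G (Suc (Suc m))" for i x xs
  proof -
    have "inner_cob G k (g i \<otimes> x) xs - inner_cob G k x xs = inner_cob G (\<lambda>l. k ((g i \<otimes> hd l) # tl l) - k l) x xs"
      unfolding inner_cob_minus using x xs by (simp add: inner_cob_translate)
    also have "\<dots> = inner_cob G (V1' i) x xs"
      by (rule inner_cob_cong[OF _ x xs]) (auto simp: k_def K elim!: tuples_Suc_E)
    also have "\<dots> = inner_cob G (V1 i) x xs - inner_cob G (?D (w i)) x xs"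
      unfolding V1'_def[abs_def] by (rule inner_cob_minus)
    also have "\<dots> = f ((g i \<otimes> x) # xs) - f (x # xs)"
      unfolding inner_cob_inner_cob[OF x xs] D_V1[OF x xs] by (simp add: U1_def)
    finally have "inner_cob G k (g i \<otimes> x) xs = f ((g i \<otimes> x) # xs) - f (x # xs) + inner_cob G k x xs"
      by (simp only: diff_eq_eq)
    then show ?thesis by (simp add: f'_def)
  qed
  define h where "h xs = f' (\<one> # xs)" for xs
  have f'_h: "f' (x # xs) = h xs" if "x \<in> carrier G" "xs \<in> tuples G (Suc (Suc m))" for x xs
    unfolding h_def by (rule invariant_constant[where k = "\<lambda>x. f' (x # xs)"]) (use inv that in simp_all)
  have "f xs = cob G h xs" if xs: "xs \<in> tuples G (Suc (Suc (Suc m)))" for xs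
  proof -
    have "inner_cob G f' \<one> xs = inner_cob G f \<one> xs - inner_cob G (?D k) \<one> xs"
      unfolding f'_def[abs_def] by (rule inner_cob_minus)
    also have "\<dots> = f xs" using D_f[of \<one> xs] inner_cob_inner_cob[of \<one> xs _ k] xs by simp
    finally have "f xs = inner_cob G f' \<one> xs" by simp
    also have "\<dots> = inner_cob G (\<lambda>l. h (tl l)) \<one> xs"
      by (rule inner_cob_cong[OF _ one_closed xs]) (auto simp: f'_h elim!: tuples_Suc_E)
    also have "\<dots> = cob G h xs"
    proof -
      have "xs \<noteq> []" using xs by auto
      show ?thesis unfolding inner_cob_tl[OF \<open>xs \<noteq> []\<close>] cob_def ..
    qed
    finally show ?thesis .
  qed
  then show ?thesis unfolding is_coboundary_def nat.case by blast
qed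

lemma cohomology_trivial_ge_3:
  assumes "n \<ge> 3"
  shows "carrier (group_cohomology G n) = {\<zero>\<^bsub>group_cohomology G n\<^esub>}"
proof -
  interpret vectorspace class_ring "group_cohomology G n" by (rule vectorspace_cohomology)
  obtain m where "n = 3 + m" using le_Suc_ex[OF assms] by blast
  then have n: "n = Suc (Suc (Suc m))" by simp
  have "z = \<zero>\<^bsub>group_cohomology G n\<^esub>" if z: "z \<in> carrier (group_cohomology G n)" for z
  proof -
    obtain f where f: "is_cocycle G n f" "z = coh_class G n f" using z unfolding carrier_cohomology by blast
    have "is_coboundary G n f" using is_coboundary_ge_3[of m f] f(1) unfolding n .
    then show ?thesis unfolding f(2) coh_class_zero coh_class_eq_zero_iff[OF f(1)] .
  qed
  then show ?thesis using zero_closed by blast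
qed

end

section \<open>Acyclicity of the Cayley complex of vP3\<close>

section \<open>The Cayley complex of \<open>vP\<^sub>3\<close>\<close>

interpretation vP3: f3f2 vP3 vx1 vx2 vx3 vp vq
  using group_vP3 vP3_f3f2_rels by (simp add: f3f2_def f3f2_axioms_def)

text \<open>The letter \<open>None\<close> stands for the generator of the free factor \<open>\<int>\<close>.\<close>

fun vP3_gen :: "f3f2_letter option \<Rightarrow> (nat \<times> nat) word set" where
  "vP3_gen (Some X1) = vx1" | "vP3_gen (Some X2) = vx2" | "vP3_gen (Some X3) = vx3"
| "vP3_gen (Some P) = vp" | "vP3_gen (Some Q) = vq" | "vP3_gen None = vt"

definition vP3_rels :: "(f3f2_letter list \<times> f3f2_letter list) list" where
  "vP3_rels = [([P, X1], [X1, P]), ([P, X3], [X3, P]), ([P, X2, X3, X1], [X3, X1, X2, P]),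
    ([Q, X1], [X1, Q]), ([Q, X2], [X2, Q]), ([Q, X3, X1, X2], [X1, X2, X3, Q])]"

definition vP3_cells :: "(f3f2_letter option list \<times> f3f2_letter option list) list" where
  "vP3_cells = map (map_prod (map Some) (map Some)) vP3_rels"

lemma letter_option_cases:
  obtains "i = Some X1" | "i = Some X2" | "i = Some X3" | "i = Some P" | "i = Some Q" | "i = None"
  by (cases i; cases "the i") auto

lemma vP3_gen_closed [simp]: "vP3_gen i \<in> carrier vP3"
  by (cases i rule: letter_option_cases) simp_all

lemma f3f2_rels_iff_word_prod:
  assumes "group H" "\<And>i. y i \<in> carrier H"
  shows "f3f2_rels H (y (Some X1)) (y (Some X2)) (y (Some X3)) (y (Some P)) (y (Some Q)) \<longleftrightarrow>
    (\<forall>(u, v)\<in>set vP3_cells. group.word_prod H y u = group.word_prod H y v)"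
proof -
  interpret H: group H by fact
  show ?thesis using assms(2) by (simp add: vP3_cells_def vP3_rels_def f3f2_rels_def)
qed

lemma vP3_cells_word_prod: "(u, v) \<in> set vP3_cells \<Longrightarrow> vP3.word_prod vP3_gen u = vP3.word_prod vP3_gen v"
  using f3f2_rels_iff_word_prod[OF group_vP3, of vP3_gen] vP3_f3f2_rels by auto

lemma vP3_hom_gen:
  assumes H: "group H" and y: "\<And>i. y i \<in> carrier H"
    and rels: "\<And>u v. (u, v) \<in> set vP3_cells \<Longrightarrow> group.word_prod H y u = group.word_prod H y v"
  obtains f where "group_hom vP3 H f" "\<And>i. f (vP3_gen i) = y i"
proof -
  have "f3f2_rels H (y (Some X1)) (y (Some X2)) (y (Some X3)) (y (Some P)) (y (Some Q))"
    unfolding f3f2_rels_iff_word_prod[where y = y, OF H y] using rels by auto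
  then obtain f where f: "group_hom vP3 H f" "f vx1 = y (Some X1)" "f vx2 = y (Some X2)" "f vx3 = y (Some X3)"
    "f vp = y (Some P)" "f vq = y (Some Q)" "f vt = y None"
    by (rule vP3_hom[OF H _ y[of None]]) (rule that)
  have "f (vP3_gen i) = y i" for i by (cases i rule: letter_option_cases) (simp_all add: f)
  then show thesis using that f(1) by blast
qed

lemma range_vP3_gen: "range vP3_gen \<subseteq> S \<Longrightarrow> {vx1, vx2, vx3, vp, vq, vt} \<subseteq> S"
  using vP3_gen.simps by (metis (no_types, lifting) insert_subset empty_subsetI range_subsetD)

lemma BijGroup_one: "s \<in> S \<Longrightarrow> \<one>\<^bsub>BijGroup S\<^esub> s = s"
  by (simp add: BijGroup_def)

text \<open>A closed edge function lifts the action of the group on itself to its product with the complex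
  numbers. The orbit of \<open>(\<one>, 0)\<close> is the graph of a potential.\<close>

lemma vP3_exact:
  assumes closed: "\<And>u v x. (u, v) \<in> set vP3_cells \<Longrightarrow> x \<in> carrier vP3 \<Longrightarrow>
    vP3.path_sum vP3_gen W u x = vP3.path_sum vP3_gen W v x"
  shows "\<exists>k. \<forall>i. \<forall>x\<in>carrier vP3. W i x = k (vP3_gen i \<otimes>\<^bsub>vP3\<^esub> x) - k x"
proof -
  let ?S = "carrier vP3 \<times> (UNIV :: complex set)"
  let ?B = "BijGroup ?S"
  interpret B: group ?B by (rule group_BijGroup)
  define T where "T i = restrict (\<lambda>(x, c). (vP3_gen i \<otimes>\<^bsub>vP3\<^esub> x, c + W i x)) ?S" for i
  have T: "T i \<in> Bij ?S" for i
    unfolding T_def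
    by (rule BijI[where f' = "\<lambda>(x, c). (inv\<^bsub>vP3\<^esub> vP3_gen i \<otimes>\<^bsub>vP3\<^esub> x, c - W i (inv\<^bsub>vP3\<^esub> vP3_gen i \<otimes>\<^bsub>vP3\<^esub> x))"]) auto
  have Tc: "T i \<in> carrier ?B" for i using T by (simp add: carrier_BijGroup)
  have wp_closed: "B.word_prod T is \<in> Bij ?S" for "is"
    by (induction "is") (use T B.one_closed B.m_closed in \<open>simp_all add: carrier_BijGroup\<close>)
  have wpv: "vP3.word_prod vP3_gen is \<in> carrier vP3" for "is" by (induction "is") simp_all
  have wp: "B.word_prod T is (x, c) = (vP3.word_prod vP3_gen is \<otimes>\<^bsub>vP3\<^esub> x, c + vP3.path_sum vP3_gen W is x)"
    if "x \<in> carrier vP3" for "is" x c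
  proof (induction "is")
    case Nil
    then show ?case using that by (simp add: BijGroup_one)
  next
    case (Cons i "is")
    then show ?case using that wpv
      by (simp add: BijGroup_apply T wp_closed) (simp add: T_def vP3.m_assoc)
  qed
  have rel: "B.word_prod T u = B.word_prod T v" if uv: "(u, v) \<in> set vP3_cells" for u v
  proof (rule extensionalityI)
    show "B.word_prod T u \<in> extensional ?S" "B.word_prod T v \<in> extensional ?S"
      using wp_closed by (simp_all add: Bij_def)
    show "B.word_prod T u xc = B.word_prod T v xc" if "xc \<in> ?S" for xc
      using that by (cases xc) (simp add: wp vP3_cells_word_prod[OF uv] closed[OF uv])
  qed
  obtain \<tau> where \<tau>: "group_hom vP3 ?B \<tau>" "\<And>i. \<tau> (vP3_gen i) = T i"
    by (rule vP3_hom_gen[OF B.is_group Tc]) (rule rel, assumption, rule that)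
  interpret \<tau>: group_hom vP3 ?B \<tau> by fact
  have \<tau>_Bij: "\<tau> y \<in> Bij ?S" if "y \<in> carrier vP3" for y
    using \<tau>.hom_closed[OF that] by (simp add: carrier_BijGroup)
  have \<tau>_mult: "\<tau> (y \<otimes>\<^bsub>vP3\<^esub> z) s = \<tau> y (\<tau> z s)" if "y \<in> carrier vP3" "z \<in> carrier vP3" "s \<in> ?S" for y z s
    using that by (simp add: BijGroup_apply \<tau>_Bij)
  have \<tau>_closed: "\<tau> y s \<in> ?S" if "y \<in> carrier vP3" "s \<in> ?S" for y s
    using \<tau>_Bij[OF that(1)] that(2) unfolding Bij_def by (auto dest: bij_betwE)
  \<comment> \<open>The first component of the lifted action is translation: true for the generators
    by definition of \<open>T\<close>, and the condition defines a subgroup.\<close>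
  let ?U = "{y \<in> carrier vP3. \<forall>s\<in>?S. fst (\<tau> y s) = y \<otimes>\<^bsub>vP3\<^esub> fst s}"
  have one: "\<tau> \<one>\<^bsub>vP3\<^esub> s = s" if "s \<in> ?S" for s using that by (simp add: BijGroup_one)
  have "subgroup ?U vP3"
  proof (rule subgroup.intro)
    show "\<one>\<^bsub>vP3\<^esub> \<in> ?U" using one by auto
    show "y \<otimes>\<^bsub>vP3\<^esub> z \<in> ?U" if yz: "y \<in> ?U" "z \<in> ?U" for y z
    proof -
      have "fst (\<tau> (y \<otimes>\<^bsub>vP3\<^esub> z) s) = y \<otimes>\<^bsub>vP3\<^esub> z \<otimes>\<^bsub>vP3\<^esub> fst s" if s: "s \<in> ?S" for s
      proof -
        have yz': "y \<in> carrier vP3" "z \<in> carrier vP3" "fst s \<in> carrier vP3" using yz s by auto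
        note fst = conjunct2[OF CollectD[OF yz(1)], rule_format] conjunct2[OF CollectD[OF yz(2)], rule_format]
        have "fst (\<tau> y (\<tau> z s)) = y \<otimes>\<^bsub>vP3\<^esub> fst (\<tau> z s)" by (rule fst(1)[OF \<tau>_closed[OF yz'(2) s]])
        also have "fst (\<tau> z s) = z \<otimes>\<^bsub>vP3\<^esub> fst s" by (rule fst(2)[OF s])
        finally show ?thesis using \<tau>_mult[OF yz'(1,2) s] yz' by (simp only: vP3.m_assoc)
      qed
      moreover have "y \<otimes>\<^bsub>vP3\<^esub> z \<in> carrier vP3" using yz by simp
      ultimately show ?thesis by blast
    qed
    show "inv\<^bsub>vP3\<^esub> y \<in> ?U" if y: "y \<in> ?U" for y
    proof -
      have yc: "y \<in> carrier vP3" using y by simp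
      have "fst (\<tau> (inv\<^bsub>vP3\<^esub> y) s) = inv\<^bsub>vP3\<^esub> y \<otimes>\<^bsub>vP3\<^esub> fst s" if s: "s \<in> ?S" for s
      proof -
        let ?s' = "\<tau> (inv\<^bsub>vP3\<^esub> y) s"
        have s': "?s' \<in> ?S" by (rule \<tau>_closed[OF vP3.inv_closed[OF yc] s])
        have "\<tau> y ?s' = s" using \<tau>_mult[OF yc vP3.inv_closed[OF yc] s] one[OF s] by (simp only: vP3.r_inv[OF yc])
        then have "fst s = y \<otimes>\<^bsub>vP3\<^esub> fst ?s'"
          using conjunct2[OF CollectD[OF y], rule_format, OF s'] by (simp only:)
        moreover have "fst ?s' \<in> carrier vP3" using s' by auto
        ultimately show ?thesis using yc by (simp only: vP3.inv_cancel_tail)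
      qed
      then show ?thesis using vP3.inv_closed[OF yc] by blast
    qed
  qed auto
  then have U: "carrier vP3 \<subseteq> ?U"
  proof (rule vP3_subset[OF _ range_vP3_gen])
    show "range vP3_gen \<subseteq> ?U" by (auto simp: \<tau>(2) T_def)
  qed
  have fst: "fst (\<tau> y s) = y \<otimes>\<^bsub>vP3\<^esub> fst s" if "y \<in> carrier vP3" "s \<in> ?S" for y s
    by (rule bspec[OF conjunct2[OF CollectD[OF subsetD[OF U that(1)]]] that(2)])
  define k where "k x = snd (\<tau> x (\<one>\<^bsub>vP3\<^esub>, 0))" for x
  have "k (vP3_gen i \<otimes>\<^bsub>vP3\<^esub> x) = k x + W i x" if x: "x \<in> carrier vP3" for i x
  proof -
    have "\<tau> x (\<one>\<^bsub>vP3\<^esub>, 0) = (x, k x)" using fst[OF x, of "(\<one>\<^bsub>vP3\<^esub>, 0)"] x by (simp add: k_def prod_eq_iff)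
    moreover have "\<tau> (vP3_gen i \<otimes>\<^bsub>vP3\<^esub> x) (\<one>\<^bsub>vP3\<^esub>, 0) = \<tau> (vP3_gen i) (\<tau> x (\<one>\<^bsub>vP3\<^esub>, 0))"
      by (rule \<tau>_mult) (use x in simp_all)
    ultimately show ?thesis
      using x unfolding k_def[of "vP3_gen i \<otimes>\<^bsub>vP3\<^esub> x"] \<tau>(2) by (simp add: T_def)
  qed
  then show ?thesis by (intro exI[of _ k]) simp
qed

text \<open>The three cell equations that involve the letter \<open>s\<close>, with weight zero on
  the edges labelled \<open>s\<close>, solved for the values at \<open>s x\<close> in terms of those
  at \<open>x\<close>. The system is triangular: the equation for \<open>c\<close> contains the new
  values for \<open>a\<close> and \<open>b\<close>, which come from the first two equations.\<close>

lemma (in group) twisting_bijection: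
  fixes za zb zc :: "'a \<Rightarrow> complex"
  assumes abc: "a \<noteq> b" "a \<noteq> c" "b \<noteq> c"
    and cl [simp]: "s \<in> carrier G" "ga \<in> carrier G" "gb \<in> carrier G" "gc \<in> carrier G"
  obtains T where "T \<in> Bij (UNIV :: ('i \<Rightarrow> 'a \<Rightarrow> complex) set)"
    "\<And>Z x. x \<in> carrier G \<Longrightarrow> T Z a (s \<otimes> x) = Z a x - za x"
    "\<And>Z x. x \<in> carrier G \<Longrightarrow> T Z b (s \<otimes> x) = Z b x - zb x"
    "\<And>Z x. x \<in> carrier G \<Longrightarrow> T Z c (s \<otimes> x) = Z a x + Z b (ga \<otimes> x) + Z c (gb \<otimes> (ga \<otimes> x)) - zc x
      - (T Z a (gc \<otimes> (s \<otimes> x)) + T Z b (ga \<otimes> (gc \<otimes> (s \<otimes> x))))"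
proof -
  define T where "T Z i x = (if x \<notin> carrier G then Z i x
    else if i = a then Z a (inv s \<otimes> x) - za (inv s \<otimes> x)
    else if i = b then Z b (inv s \<otimes> x) - zb (inv s \<otimes> x)
    else if i = c then Z a (inv s \<otimes> x) + Z b (ga \<otimes> (inv s \<otimes> x)) + Z c (gb \<otimes> (ga \<otimes> (inv s \<otimes> x))) - zc (inv s \<otimes> x)
      - (Z a (inv s \<otimes> (gc \<otimes> x)) - za (inv s \<otimes> (gc \<otimes> x))
         + (Z b (inv s \<otimes> (ga \<otimes> (gc \<otimes> x))) - zb (inv s \<otimes> (ga \<otimes> (gc \<otimes> x)))))
    else Z i x)" for Z i x
  \<comment> \<open>The same equations solved for the old values. In the third one \<open>y\<close>
    is chosen such that \<open>gb ga y\<close> is the given vertex.\<close>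
  define T' where "T' Z i x = (if x \<notin> carrier G then Z i x
    else if i = a then Z a (s \<otimes> x) + za x
    else if i = b then Z b (s \<otimes> x) + zb x
    else if i = c then (let y = inv ga \<otimes> (inv gb \<otimes> x) in
      Z c (s \<otimes> y) + Z a (gc \<otimes> (s \<otimes> y)) + Z b (ga \<otimes> (gc \<otimes> (s \<otimes> y))) + zc y
      - (Z a (s \<otimes> y) + za y) - (Z b (s \<otimes> (ga \<otimes> y)) + zb (ga \<otimes> y)))
    else Z i x)" for Z i x
  have T'T: "T' (T Z) = Z" for Z
    using abc by (auto simp: fun_eq_iff T_def T'_def Let_def)
  have TT': "T (T' Z) = Z" for Z
    using abc by (auto simp: fun_eq_iff T_def T'_def Let_def)
  have "restrict T UNIV \<in> Bij UNIV" by (rule BijI[where f' = T']) (simp_all add: T'T TT')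
  then have "T \<in> Bij UNIV" by (simp add: restrict_def)
  then show thesis
    by (rule that) (use abc in \<open>simp_all add: T_def\<close>)
qed

text \<open>The bijections attached to \<open>p\<close> and \<open>q\<close> fix exactly the edge functions with the given values on
  the cells. As they are local with respect to the cosets of the subgroup generated by the \<open>x\<^sub>i\<close>,
  an orbit of the action of the group that they define provides a fixed point.\<close>

lemma vP3_surj:
  "\<exists>W. \<forall>(u, v)\<in>set vP3_cells. \<forall>x\<in>carrier vP3.
    vP3.path_sum vP3_gen W u x - vP3.path_sum vP3_gen W v x = z (u, v) x"
proof -
  let ?a = "Some X1" and ?b = "Some X3" and ?c = "Some X2"
  let ?S = "UNIV :: (f3f2_letter option \<Rightarrow> (nat \<times> nat) word set \<Rightarrow> complex) set"
  let ?B = "BijGroup ?S"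
  interpret B: group ?B by (rule group_BijGroup)
  let ?z = "\<lambda>i. z (vP3_cells ! i)"
  obtain A where A: "A \<in> Bij ?S"
    "\<And>Z x. x \<in> carrier vP3 \<Longrightarrow> A Z ?a (vp \<otimes>\<^bsub>vP3\<^esub> x) = Z ?a x - ?z 0 x"
    "\<And>Z x. x \<in> carrier vP3 \<Longrightarrow> A Z ?b (vp \<otimes>\<^bsub>vP3\<^esub> x) = Z ?b x - ?z 1 x"
    "\<And>Z x. x \<in> carrier vP3 \<Longrightarrow> A Z ?c (vp \<otimes>\<^bsub>vP3\<^esub> x)
      = Z ?a x + Z ?b (vx1 \<otimes>\<^bsub>vP3\<^esub> x) + Z ?c (vx3 \<otimes>\<^bsub>vP3\<^esub> (vx1 \<otimes>\<^bsub>vP3\<^esub> x)) - ?z 2 x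
      - (A Z ?a (vx2 \<otimes>\<^bsub>vP3\<^esub> (vp \<otimes>\<^bsub>vP3\<^esub> x)) + A Z ?b (vx1 \<otimes>\<^bsub>vP3\<^esub> (vx2 \<otimes>\<^bsub>vP3\<^esub> (vp \<otimes>\<^bsub>vP3\<^esub> x))))"
    by (rule vP3.twisting_bijection[of ?a ?b ?c vp vx1 vx3 vx2 "?z 0" "?z 1" "?z 2"]; (rule that; assumption)?; simp)
  obtain A' where A': "A' \<in> Bij ?S"
    "\<And>Z x. x \<in> carrier vP3 \<Longrightarrow> A' Z ?c (vq \<otimes>\<^bsub>vP3\<^esub> x) = Z ?c x - ?z 4 x"
    "\<And>Z x. x \<in> carrier vP3 \<Longrightarrow> A' Z ?a (vq \<otimes>\<^bsub>vP3\<^esub> x) = Z ?a x - ?z 3 x"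
    "\<And>Z x. x \<in> carrier vP3 \<Longrightarrow> A' Z ?b (vq \<otimes>\<^bsub>vP3\<^esub> x)
      = Z ?c x + Z ?a (vx2 \<otimes>\<^bsub>vP3\<^esub> x) + Z ?b (vx1 \<otimes>\<^bsub>vP3\<^esub> (vx2 \<otimes>\<^bsub>vP3\<^esub> x)) - ?z 5 x
      - (A' Z ?c (vx3 \<otimes>\<^bsub>vP3\<^esub> (vq \<otimes>\<^bsub>vP3\<^esub> x)) + A' Z ?a (vx2 \<otimes>\<^bsub>vP3\<^esub> (vx3 \<otimes>\<^bsub>vP3\<^esub> (vq \<otimes>\<^bsub>vP3\<^esub> x))))"
    by (rule vP3.twisting_bijection[of ?c ?a ?b vq vx2 vx1 vx3 "?z 4" "?z 3" "?z 5"]; (rule that; assumption)?; simp)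
  have AB: "A \<in> carrier ?B" "A' \<in> carrier ?B" using A(1) A'(1) by (simp_all add: carrier_BijGroup)
  \<comment> \<open>With the \<open>x\<close> letters acting trivially the relations put no
    condition on the images of \<open>p\<close> and \<open>q\<close>.\<close>
  have "f3f2_rels ?B \<one>\<^bsub>?B\<^esub> \<one>\<^bsub>?B\<^esub> \<one>\<^bsub>?B\<^esub> A A'" using AB by (simp add: f3f2_rels_def)
  then obtain \<tau> where \<tau>: "group_hom vP3 ?B \<tau>" "\<tau> vx1 = \<one>\<^bsub>?B\<^esub>" "\<tau> vx2 = \<one>\<^bsub>?B\<^esub>" "\<tau> vx3 = \<one>\<^bsub>?B\<^esub>"
    "\<tau> vp = A" "\<tau> vq = A'" "\<tau> vt = \<one>\<^bsub>?B\<^esub>"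
    by (rule vP3_hom[OF B.is_group _ B.one_closed]) (rule that)
  interpret \<tau>: group_hom vP3 ?B \<tau> by fact
  define \<zeta> where "\<zeta> x = \<tau> x (\<lambda>_ _. 0)" for x
  have \<tau>_Bij: "\<tau> y \<in> Bij ?S" if "y \<in> carrier vP3" for y
    using \<tau>.hom_closed[OF that] by (simp add: carrier_BijGroup)
  have \<zeta>: "\<zeta> (vx1 \<otimes>\<^bsub>vP3\<^esub> x) = \<zeta> x" "\<zeta> (vx2 \<otimes>\<^bsub>vP3\<^esub> x) = \<zeta> x" "\<zeta> (vx3 \<otimes>\<^bsub>vP3\<^esub> x) = \<zeta> x"
    "\<zeta> (vp \<otimes>\<^bsub>vP3\<^esub> x) = A (\<zeta> x)" "\<zeta> (vq \<otimes>\<^bsub>vP3\<^esub> x) = A' (\<zeta> x)" if "x \<in> carrier vP3" for x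
    using that by (simp_all add: \<zeta>_def \<tau>(2-6) BijGroup_apply A(1) A'(1) \<tau>_Bij)
  \<comment> \<open>The edge function \<open>\<zeta> x\<close> is evaluated at its own vertex. It is
    unchanged along \<open>x\<close> edges, so each cell equation at \<open>x\<close> involves only
    \<open>\<zeta> x\<close> and its image under \<open>A\<close> or \<open>A'\<close>; edges
    labelled \<open>p\<close>, \<open>q\<close> and \<open>t\<close> have weight zero.\<close>
  define W where "W i x = (if i \<in> {?a, ?b, ?c} then \<zeta> x i x else 0)" for i x
  show ?thesis
    by (rule exI[of _ W])
      (simp add: vP3_cells_def vP3_rels_def W_def \<zeta> vP3.m_assoc One_nat_def
        A(2-4)[unfolded vP3_cells_def vP3_rels_def] A'(2-4)[unfolded vP3_cells_def vP3_rels_def])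
qed

interpretation vP3_complex: acyclic_cayley_complex vP3 vP3_gen "set vP3_cells"
proof unfold_locales
  show "carrier vP3 \<subseteq> S" if "subgroup S vP3" "range vP3_gen \<subseteq> S" for S
    by (rule vP3_subset[OF that(1) range_vP3_gen[OF that(2)]])
qed (use vP3_exact vP3_surj vP3_cells_word_prod in auto)

section \<open>H^1 and H^2 of vP3 in coordinates\<close>

section \<open>The cohomology of \<open>vP\<^sub>3\<close> in degrees one and two\<close>

subsection \<open>Degree one\<close>

definition coord :: "((nat \<times> nat) word set list \<Rightarrow> complex) set \<Rightarrow> f3f2_letter option \<Rightarrow> complex" where
  "coord a i = h1_val a (vP3_gen i)"

abbreviation "H1 \<equiv> group_cohomology vP3 1"
abbreviation "H2 \<equiv> group_cohomology vP3 2"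

lemma (in group) additive_word_prod:
  assumes "additive_on G h" "\<And>i. g i \<in> carrier G"
  shows "h (word_prod g is) = (\<Sum>i\<leftarrow>is. h (g i))"
proof -
  have "word_prod g is \<in> carrier G" for "is" by (induction "is") (simp_all add: assms(2))
  then show ?thesis by (induction "is") (simp_all add: assms additive_one additive_onD)
qed

text \<open>Every relation contains each letter equally often on both sides, so the values on the
  six generators may be prescribed freely.\<close>

lemma coord_ex: "\<exists>a\<in>carrier H1. \<forall>i. coord a i = c i"
proof -
  let ?A = "\<lparr>carrier = UNIV, monoid.mult = (+), one = 0\<rparr> :: complex monoid"
  have A: "group ?A" by (rule groupI) (auto intro: exI[of _ "- _"] add.left_inverse simp: add.assoc)
  interpret A: group ?A by (rule A)
  obtain h where h: "group_hom vP3 ?A h" "\<And>i. h (vP3_gen i) = c i"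
  proof (rule vP3_hom_gen[OF A, of c])
    show "A.word_prod c u = A.word_prod c v" if "(u, v) \<in> set vP3_cells" for u v
      using that by (auto simp: vP3_cells_def vP3_rels_def)
  qed (use that in auto)
  interpret h: group_hom vP3 ?A h by fact
  have add: "additive_on vP3 h" using h.hom_mult by (simp add: additive_on_def)
  show ?thesis
    by (rule bexI[OF _ vP3.h1_of_closed[OF add]]) (simp add: coord_def vP3.h1_val_of h(2))
qed

lemma coord_eqI:
  assumes a: "a \<in> carrier H1" and b: "b \<in> carrier H1" and eq: "\<And>i. coord a i = coord b i"
  shows "a = b"
proof (rule vP3.h1_eqI[OF a b])
  note add = vP3.h1_val_additive[OF a] vP3.h1_val_additive[OF b]
  let ?S = "{x \<in> carrier vP3. h1_val a x = h1_val b x}"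
  have "subgroup ?S vP3"
    by (rule subgroup.intro)
      (auto simp: add[THEN vP3.additive_onD] add[THEN vP3.additive_one] add[THEN vP3.additive_inv])
  then have "carrier vP3 \<subseteq> ?S"
    by (rule vP3_complex.generated) (use eq in \<open>auto simp: coord_def\<close>)
  then show "h1_val a x = h1_val b x" if "x \<in> carrier vP3" for x using that by blast
qed

lemma coord_linear:
  "a \<in> carrier H1 \<Longrightarrow> b \<in> carrier H1 \<Longrightarrow> coord (a \<oplus>\<^bsub>H1\<^esub> b) i = coord a i + coord b i"
  "a \<in> carrier H1 \<Longrightarrow> coord (c \<odot>\<^bsub>H1\<^esub> a) i = c * coord a i"
  "coord \<zero>\<^bsub>H1\<^esub> i = 0"
  by (simp_all add: coord_def vP3.h1_add vP3.h1_smult vP3.h1_zero)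

lemma coord_eq_zeroI: "a \<in> carrier H1 \<Longrightarrow> (\<And>i. coord a i = 0) \<Longrightarrow> a = \<zero>\<^bsub>H1\<^esub>"
  using coord_eqI[of a "\<zero>\<^bsub>H1\<^esub>"] vectorspace.axioms(1)[OF vP3.vectorspace_cohomology]
  by (metis coord_linear(3) module.axioms(2) abelian_group.axioms(1) abelian_monoid.zero_closed)

subsection \<open>Central extensions and degree two\<close>

context group
begin

lemma is_cocycle_2D:
  assumes "is_cocycle G 2 f" "x \<in> carrier G" "y \<in> carrier G" "z \<in> carrier G"
  shows "f [y, z] + f [x, y \<otimes> z] = f [x \<otimes> y, z] + f [x, y]"
proof -
  have "[x, y, z] \<in> tuples G (Suc 2)" using assms by (simp add: numeral_2_eq_2)
  then have "cob G f [x, y, z] = 0" using assms(1) unfolding is_cocycle_def by blast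
  then show ?thesis by (simp add: algebra_simps)
qed

text \<open>Cocycles are not assumed normalized; this accounts for the first component of the
  unit.\<close>

definition central_extension :: "('a list \<Rightarrow> complex) \<Rightarrow> (complex \<times> 'a) monoid" where
  "central_extension f = \<lparr>carrier = UNIV \<times> carrier G,
    monoid.mult = (\<lambda>(c, x) (d, y). (c + d + f [x, y], x \<otimes> y)), one = (- f [\<one>, \<one>], \<one>)\<rparr>"

lemma central_extension_simps [simp]:
  "(c, x) \<otimes>\<^bsub>central_extension f\<^esub> (d, y) = (c + d + f [x, y], x \<otimes> y)"
  "\<one>\<^bsub>central_extension f\<^esub> = (- f [\<one>, \<one>], \<one>)"
  "carrier (central_extension f) = UNIV \<times> carrier G"
  by (simp_all add: central_extension_def)

lemma group_central_extension:
  assumes f: "is_cocycle G 2 f"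
  shows "group (central_extension f)"
proof (rule groupI)
  show "X \<otimes>\<^bsub>central_extension f\<^esub> Y \<otimes>\<^bsub>central_extension f\<^esub> Z
      = X \<otimes>\<^bsub>central_extension f\<^esub> (Y \<otimes>\<^bsub>central_extension f\<^esub> Z)"
    if "X \<in> carrier (central_extension f)" "Y \<in> carrier (central_extension f)" "Z \<in> carrier (central_extension f)" for X Y Z
  proof -
    obtain c x d y e z where XYZ: "X = (c, x)" "Y = (d, y)" "Z = (e, z)" by (cases X; cases Y; cases Z) auto
    then have "x \<in> carrier G" "y \<in> carrier G" "z \<in> carrier G" using that by auto
    then show ?thesis using is_cocycle_2D[OF f, of x y z] by (simp add: XYZ m_assoc add_ac)
  qed
  have one: "f [\<one>, x] = f [\<one>, \<one>]" if "x \<in> carrier G" for x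
    using is_cocycle_2D[OF f, of \<one> \<one> x] that by simp
  show "\<one>\<^bsub>central_extension f\<^esub> \<otimes>\<^bsub>central_extension f\<^esub> X = X" if "X \<in> carrier (central_extension f)" for X
    using that one[of "snd X"] by (cases X) simp
  show "\<exists>Y\<in>carrier (central_extension f). Y \<otimes>\<^bsub>central_extension f\<^esub> X = \<one>\<^bsub>central_extension f\<^esub>"
    if "X \<in> carrier (central_extension f)" for X
  proof (cases X)
    case (Pair c x)
    then show ?thesis using that
      by (intro bexI[of _ "(- c - f [inv x, x] - f [\<one>, \<one>], inv x)"]) auto
  qed
qed auto

text \<open>The first component of the product of the canonical lifts of a word to the central extension.\<close>

fun word_sum :: "('i \<Rightarrow> 'a) \<Rightarrow> ('a list \<Rightarrow> complex) \<Rightarrow> 'i list \<Rightarrow> complex" where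
  "word_sum g f [] = - f [\<one>, \<one>]"
| "word_sum g f (i # is) = f [g i, word_prod g is] + word_sum g f is"

lemma word_sum_linear:
  "word_sum g (\<lambda>l. f l + f' l) is = word_sum g f is + word_sum g f' is"
  "word_sum g (\<lambda>l. c * f l) is = c * word_sum g f is"
  by (induction "is") (simp_all add: algebra_simps)

lemma word_sum_cong:
  assumes g: "\<And>i. g i \<in> carrier G" and eq: "\<And>l. l \<in> tuples G 2 \<Longrightarrow> f l = f' l"
  shows "word_sum g f is = word_sum g f' is"
proof -
  have "word_prod g is \<in> carrier G" for "is" by (induction "is") (simp_all add: g)
  then show ?thesis by (induction "is") (simp_all add: g eq tuples_2)
qed

lemma word_sum_coboundary:
  assumes g: "\<And>i. g i \<in> carrier G" and "\<And>l. l \<in> tuples G 2 \<Longrightarrow> f l = cob G h l"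
  shows "word_sum g f is = (\<Sum>i\<leftarrow>is. h [g i]) - h [word_prod g is]"
proof -
  have "word_prod g is \<in> carrier G" for "is" by (induction "is") (simp_all add: g)
  then have "word_sum g (cob G h) is = (\<Sum>i\<leftarrow>is. h [g i]) - h [word_prod g is]"
    by (induction "is") (simp_all add: g)
  then show ?thesis using word_sum_cong[of g f "cob G h", OF g assms(2)] by simp
qed

end

text \<open>If the canonical lifts of the generators satisfy the relations, the universal property provides
  a section of the central extension, and its first component is a cochain with coboundary \<open>- f\<close>.\<close>

lemma is_coboundary_2_iff:
  assumes f: "is_cocycle vP3 2 f"
  shows "is_coboundary vP3 2 f \<longleftrightarrow>
    (\<forall>(u, v)\<in>set vP3_cells. vP3.word_sum vP3_gen f u = vP3.word_sum vP3_gen f v)"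
proof
  have cob2: "is_coboundary vP3 2 f \<longleftrightarrow> (\<exists>h. \<forall>l\<in>tuples vP3 2. f l = cob vP3 h l)"
    by (simp add: is_coboundary_def numeral_2_eq_2)
  {
    assume "is_coboundary vP3 2 f"
    then obtain h where h: "\<And>l. l \<in> tuples vP3 2 \<Longrightarrow> f l = cob vP3 h l" unfolding cob2 by blast
    have "vP3.word_sum vP3_gen f u = vP3.word_sum vP3_gen f v" if uv: "(u, v) \<in> set vP3_cells" for u v
    proof -
      \<comment> \<open>The two sides of a relation are permutations of each other.\<close>
      have "(\<Sum>i\<leftarrow>u. k i) = (\<Sum>i\<leftarrow>v. k i)" for k :: "_ \<Rightarrow> complex"
        using uv by (auto simp: vP3_cells_def vP3_rels_def)
      then show ?thesis
        using vP3.word_sum_coboundary[of vP3_gen f h, OF vP3_gen_closed h] vP3_cells_word_prod[OF uv] by simp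
    qed
    then show "\<forall>(u, v)\<in>set vP3_cells. vP3.word_sum vP3_gen f u = vP3.word_sum vP3_gen f v" by blast
  }
  assume eq: "\<forall>(u, v)\<in>set vP3_cells. vP3.word_sum vP3_gen f u = vP3.word_sum vP3_gen f v"
  let ?E = "vP3.central_extension f"
  interpret E: group ?E by (rule vP3.group_central_extension[OF f])
  let ?y = "\<lambda>i. (0, vP3_gen i)"
  have wp: "E.word_prod ?y is = (vP3.word_sum vP3_gen f is, vP3.word_prod vP3_gen is)" for "is"
    by (induction "is") simp_all
  have rel: "E.word_prod ?y u = E.word_prod ?y v" if "(u, v) \<in> set vP3_cells" for u v
    using eq vP3_cells_word_prod[OF that] that by (auto simp: wp)
  obtain \<sigma> where \<sigma>: "group_hom vP3 ?E \<sigma>" "\<And>i. \<sigma> (vP3_gen i) = ?y i"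
    by (rule vP3_hom_gen[of ?E ?y, OF E.is_group]) (simp, rule rel, assumption, rule that)
  interpret \<sigma>: group_hom vP3 ?E \<sigma> by fact
  \<comment> \<open>The second component of the lift is an endomorphism fixing the generators, hence
    the identity, so the lift is a section.\<close>
  have "group_hom vP3 vP3 (\<lambda>x. snd (\<sigma> x))"
  proof (rule hom_group_hom[OF group_vP3 group_vP3], rule homI)
    show "snd (\<sigma> x) \<in> carrier vP3" if "x \<in> carrier vP3" for x
      using \<sigma>.hom_closed[OF that] by auto
    show "snd (\<sigma> (x \<otimes>\<^bsub>vP3\<^esub> y)) = snd (\<sigma> x) \<otimes>\<^bsub>vP3\<^esub> snd (\<sigma> y)" if "x \<in> carrier vP3" "y \<in> carrier vP3" for x y
      using that by (cases "\<sigma> x"; cases "\<sigma> y") simp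
  qed
  moreover have "group_hom vP3 vP3 (\<lambda>x. x)"
    by (rule hom_group_hom[OF group_vP3 group_vP3]) (simp add: hom_def)
  ultimately have snd: "snd (\<sigma> x) = x" if "x \<in> carrier vP3" for x
    by (rule vP3_hom_eq[OF _ _ _ _ _ _ _ _ that]) (simp_all add: \<sigma>(2)[of "Some _", unfolded vP3_gen.simps]
      \<sigma>(2)[of "Some X1", simplified] \<sigma>(2)[of "Some X2", simplified] \<sigma>(2)[of "Some X3", simplified]
      \<sigma>(2)[of "Some P", simplified] \<sigma>(2)[of "Some Q", simplified] \<sigma>(2)[of None, simplified])
  have mult: "fst (\<sigma> (x \<otimes>\<^bsub>vP3\<^esub> y)) = fst (\<sigma> x) + fst (\<sigma> y) + f [x, y]"
    if "x \<in> carrier vP3" "y \<in> carrier vP3" for x y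
    using that snd[of x] snd[of y] by (cases "\<sigma> x"; cases "\<sigma> y") simp
  have "f l = cob vP3 (\<lambda>l. - fst (\<sigma> (hd l))) l" if "l \<in> tuples vP3 2" for l
  proof -
    obtain x y where l: "l = [x, y]" "x \<in> carrier vP3" "y \<in> carrier vP3" using \<open>l \<in> _\<close> by (auto simp: tuples_2)
    then show ?thesis using mult[OF l(2,3)] by (simp del: \<sigma>.hom_mult)
  qed
  then show "is_coboundary vP3 2 f" unfolding cob2 by blast
qed

text \<open>In the third and sixth relation, the first two relations of the same letter are subtracted to make
  the cup products below a dual basis.\<close>

definition h2_coord :: "((nat \<times> nat) word set list \<Rightarrow> complex) \<Rightarrow> nat \<Rightarrow> complex" where
  "h2_coord f i = (let e = (\<lambda>j. vP3.word_sum vP3_gen f (fst (vP3_cells ! j)) - vP3.word_sum vP3_gen f (snd (vP3_cells ! j)))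
    in if i = 2 then e 2 - e 0 - e 1 else if i = 5 then e 5 - e 3 - e 4 else e i)"

lemma all_less_6: "(\<forall>i<6. R i) \<longleftrightarrow> R 0 \<and> R 1 \<and> R 2 \<and> R 3 \<and> R 4 \<and> R (5::nat)"
proof -
  have "i < 6 \<longleftrightarrow> i = 0 \<or> i = 1 \<or> i = 2 \<or> i = 3 \<or> i = 4 \<or> i = 5" for i :: nat by auto
  then show ?thesis by metis
qed

lemma h2_coord_zero_iff:
  assumes "is_cocycle vP3 2 f"
  shows "(\<forall>i<6. h2_coord f i = 0) \<longleftrightarrow> is_coboundary vP3 2 f"
proof -
  define e where "e j = vP3.word_sum vP3_gen f (fst (vP3_cells ! j)) - vP3.word_sum vP3_gen f (snd (vP3_cells ! j))" for j
  have "set vP3_cells = (!) vP3_cells ` {0, 1, 2, 3, 4, 5}" by (simp add: vP3_cells_def vP3_rels_def)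
  then have "is_coboundary vP3 2 f \<longleftrightarrow> e 0 = 0 \<and> e 1 = 0 \<and> e 2 = 0 \<and> e 3 = 0 \<and> e 4 = 0 \<and> e 5 = 0"
    unfolding is_coboundary_2_iff[OF assms] by (simp only: e_def case_prod_unfold ball_simps image_insert image_empty right_minus_eq simp_thms)
  moreover have "(\<forall>i<6. h2_coord f i = 0) \<longleftrightarrow>
      e 0 = 0 \<and> e 1 = 0 \<and> e 2 - e 0 - e 1 = 0 \<and> e 3 = 0 \<and> e 4 = 0 \<and> e 5 - e 3 - e 4 = 0"
    unfolding all_less_6 h2_coord_def Let_def e_def by simp
  ultimately show ?thesis by auto
qed

lemma h2_coord_linear:
  "h2_coord (\<lambda>l. f l + f' l) i = h2_coord f i + h2_coord f' i"
  "h2_coord (\<lambda>l. c * f l) i = c * h2_coord f i"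
  by (simp_all add: h2_coord_def vP3.word_sum_linear Let_def algebra_simps)

lemma h2_coord_cong: "(\<And>l. l \<in> tuples vP3 2 \<Longrightarrow> f l = f' l) \<Longrightarrow> h2_coord f i = h2_coord f' i"
  using vP3.word_sum_cong[of vP3_gen f f', OF vP3_gen_closed] by (simp add: h2_coord_def)

subsection \<open>Cup products\<close>

definition cup_cochain where
  "cup_cochain a b = (\<lambda>l\<in>tuples vP3 2. h1_val a (hd l) * h1_val b (hd (tl l)))"

lemma cup_eq_class:
  assumes a: "a \<in> carrier H1" and b: "b \<in> carrier H1"
  shows "is_cocycle vP3 2 (cup_cochain a b)" "cup vP3 1 1 a b = coh_class vP3 2 (cup_cochain a b)"
proof -
  obtain f where f: "is_cocycle vP3 1 f" "b = {f}" "\<And>x. h1_val b x = f [x]" by (rule vP3.h1_cases[OF b]) (rule that)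
  have eq: "restrict (cross (h1_val a) f) (tuples vP3 (Suc 1)) = cup_cochain a b"
    unfolding Suc_1 cup_cochain_def by (rule restrict_ext) (auto simp: tuples_2 cross_def f(3))
  show "is_cocycle vP3 2 (cup_cochain a b)"
    using vP3.cross_cocycle[OF vP3.h1_val_additive[OF a] f(1)] unfolding eq unfolding Suc_1 .
  have "b = coh_class vP3 1 f" using f by (simp add: vP3.coh_class_1 is_cocycle_def)
  then show "cup vP3 1 1 a b = coh_class vP3 2 (cup_cochain a b)"
    using vP3.cup_coh_class[OF a f(1)] unfolding eq unfolding Suc_1 by simp
qed

definition wedge where
  "wedge a b i j = coord a (Some i) * coord b (Some j) - coord a (Some j) * coord b (Some i)"

text \<open>On a product cochain \<open>word_sum\<close> is the sum over pairs of positions of the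
  coordinate of \<open>a\<close> at the earlier letter times that of \<open>b\<close> at the later
  one. Comparing the two sides of a relation, only pairs whose order is reversed survive, each as a
  2 x 2 determinant.\<close>

lemma h2_coord_cup:
  assumes a: "a \<in> carrier H1" and b: "b \<in> carrier H1"
  shows "h2_coord (cup_cochain a b) 0 = wedge a b P X1"
    "h2_coord (cup_cochain a b) 1 = wedge a b P X3"
    "h2_coord (cup_cochain a b) 2 = wedge a b P X2 - wedge a b X1 X2 - wedge a b X3 X2"
    "h2_coord (cup_cochain a b) 3 = wedge a b Q X1"
    "h2_coord (cup_cochain a b) 4 = wedge a b Q X2"
    "h2_coord (cup_cochain a b) 5 = wedge a b Q X3 - wedge a b X1 X3 - wedge a b X2 X3"
proof -
  note add = vP3.h1_val_additive[OF a] vP3.h1_val_additive[OF b]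
  define F where "F l = h1_val a (hd l) * h1_val b (hd (tl l))" for l
  have F: "h2_coord (cup_cochain a b) i = h2_coord F i" for i
    by (rule h2_coord_cong) (simp add: cup_cochain_def F_def)
  have sum: "vP3.word_sum vP3_gen F [] = 0"
    "vP3.word_sum vP3_gen F (i # is) = coord a i * (\<Sum>j\<leftarrow>is. coord b j) + vP3.word_sum vP3_gen F is" for i "is"
    using vP3.additive_word_prod[OF add(2), of vP3_gen "is"]
    by (simp_all add: F_def coord_def vP3.additive_one[OF add(1)])
  note s = h2_coord_def vP3_cells_def vP3_rels_def Let_def sum wedge_def
  show "h2_coord (cup_cochain a b) 0 = wedge a b P X1"
    "h2_coord (cup_cochain a b) 1 = wedge a b P X3"
    "h2_coord (cup_cochain a b) 2 = wedge a b P X2 - wedge a b X1 X2 - wedge a b X3 X2"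
    "h2_coord (cup_cochain a b) 3 = wedge a b Q X1"
    "h2_coord (cup_cochain a b) 4 = wedge a b Q X2"
    "h2_coord (cup_cochain a b) 5 = wedge a b Q X3 - wedge a b X1 X3 - wedge a b X2 X3"
    unfolding F
    by (simp_all add: s One_nat_def del: vP3.word_sum.simps, simp_all add: algebra_simps)
qed

theorem cup_eq_zero_iff:
  assumes a: "a \<in> carrier H1" and b: "b \<in> carrier H1"
  shows "cup vP3 1 1 a b = \<zero>\<^bsub>H2\<^esub> \<longleftrightarrow>
    wedge a b P X1 = 0 \<and> wedge a b P X3 = 0 \<and> wedge a b P X2 - wedge a b X1 X2 - wedge a b X3 X2 = 0 \<and>
    wedge a b Q X1 = 0 \<and> wedge a b Q X2 = 0 \<and> wedge a b Q X3 - wedge a b X1 X3 - wedge a b X2 X3 = 0"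
proof -
  note c = cup_eq_class[OF a b]
  have "cup vP3 1 1 a b = \<zero>\<^bsub>H2\<^esub> \<longleftrightarrow> (\<forall>i<6. h2_coord (cup_cochain a b) i = 0)"
    unfolding c(2) vP3.coh_class_zero vP3.coh_class_eq_zero_iff[OF c(1)] h2_coord_zero_iff[OF c(1)] ..
  then show ?thesis unfolding all_less_6 h2_coord_cup[OF a b] .
qed

text \<open>\<open>is\<close> lists coordinates that determine the elements of \<open>N\<close>, and
  \<open>e\<close> the coordinate vectors of the dual basis, which exist as classes by
  \<open>coord_ex\<close>.\<close>

lemma dim_by_coords:
  assumes N: "VectorSpace.subspace class_ring N H1"
    and e: "\<And>i a. i < length is \<Longrightarrow> a \<in> carrier H1 \<Longrightarrow> coord a = e ! i \<Longrightarrow> a \<in> N"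
      "\<And>i j. i < length is \<Longrightarrow> j < length is \<Longrightarrow> (e ! j) (is ! i) = (if i = j then 1 else 0)"
    and sep: "\<And>a i. a \<in> N \<Longrightarrow> (\<And>j. j \<in> set is \<Longrightarrow> coord a j = 0) \<Longrightarrow> coord a i = 0"
  shows "vectorspace.fin_dim class_ring (H1\<lparr>carrier := N\<rparr>)"
    "vectorspace.dim class_ring (H1\<lparr>carrier := N\<rparr>) = length is"
proof -
  have "\<exists>a\<in>carrier H1. coord a = e ! j" for j using coord_ex[of "e ! j"] by (auto simp: fun_eq_iff)
  then obtain b where b: "b j \<in> carrier H1" "coord (b j) = e ! j" for j by metis
  have NV: "a \<in> carrier H1" if "a \<in> N" for a using subspaceD(1)[OF N] that by blast
  note d = dim_dual_basis[OF subspace_vectorspace[OF N], of "length is" "\<lambda>i a. coord a (is ! i)" b]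
  have 1: "a = \<zero>\<^bsub>H1\<lparr>carrier := N\<rparr>\<^esub>"
    if "a \<in> carrier (H1\<lparr>carrier := N\<rparr>)" "\<And>i. i < length is \<Longrightarrow> coord a (is ! i) = 0" for a
  proof -
    have "a \<in> N" using that(1) by simp
    moreover have "coord a j = 0" if "j \<in> set is" for j using \<open>\<And>i. i < length is \<Longrightarrow> _\<close> that by (auto simp: in_set_conv_nth)
    ultimately have "coord a i = 0" for i using sep by blast
    then show ?thesis using coord_eq_zeroI[OF NV[OF \<open>a \<in> N\<close>]] by simp
  qed
  show "vectorspace.fin_dim class_ring (H1\<lparr>carrier := N\<rparr>)"
    "vectorspace.dim class_ring (H1\<lparr>carrier := N\<rparr>) = length is"
    by (rule d; (fact 1 | simp add: coord_linear NV b e))+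
qed

fun coords :: "complex \<Rightarrow> complex \<Rightarrow> complex \<Rightarrow> complex \<Rightarrow> complex \<Rightarrow> complex \<Rightarrow> f3f2_letter option \<Rightarrow> complex" where
  "coords x1 x2 x3 p q t (Some X1) = x1"
| "coords x1 x2 x3 p q t (Some X2) = x2"
| "coords x1 x2 x3 p q t (Some X3) = x3"
| "coords x1 x2 x3 p q t (Some P) = p"
| "coords x1 x2 x3 p q t (Some Q) = q"
| "coords x1 x2 x3 p q t None = t"

lemma dim_H1: "vectorspace.fin_dim class_ring H1" "vectorspace.dim class_ring H1 = 6"
proof -
  interpret vectorspace class_ring H1 by (rule vP3.vectorspace_cohomology)
  let ?is = "[Some X1, Some X2, Some X3, Some P, Some Q, None]"
  let ?e = "[coords 1 0 0 0 0 0, coords 0 1 0 0 0 0, coords 0 0 1 0 0 0, coords 0 0 0 1 0 0, coords 0 0 0 0 1 0, coords 0 0 0 0 0 1]"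
  have len: "length ?is = 6" by simp
  have sub: "VectorSpace.subspace class_ring (carrier H1) H1"
    by (rule subspaceI[OF vP3.vectorspace_cohomology]) auto
  have e: "\<forall>i<6. \<forall>j<6. (?e ! j) (?is ! i) = (if i = j then 1 else 0)"
    unfolding all_less_6 by (simp add: One_nat_def)
  have all: "coord a i = 0" if "\<And>j. j \<in> set ?is \<Longrightarrow> coord a j = 0" for a i
    by (rule that) (cases i rule: letter_option_cases; simp)
  note d = dim_by_coords[OF sub, of ?is ?e, unfolded len, OF _ e[rule_format] all, simplified]
  show "vectorspace.fin_dim class_ring H1" "vectorspace.dim class_ring H1 = 6"
    by (rule d; simp)+
qed

lemma dim_H2: "vectorspace.fin_dim class_ring H2" "vectorspace.dim class_ring H2 = 6"
proof -
  \<comment> \<open>Well defined on classes, since the coordinates of a coboundary vanish.\<close>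
  define \<phi> where "\<phi> i A = h2_coord (SOME f. is_cocycle vP3 2 f \<and> A = coh_class vP3 2 f) i" for i A
  have \<phi>: "\<phi> i (coh_class vP3 2 f) = h2_coord f i" if f: "is_cocycle vP3 2 f" and i: "i < 6" for i f
  proof -
    define f' where "f' = (SOME f'. is_cocycle vP3 2 f' \<and> coh_class vP3 2 f = coh_class vP3 2 f')"
    have f': "is_cocycle vP3 2 f' \<and> coh_class vP3 2 f = coh_class vP3 2 f'"
      unfolding f'_def by (rule someI[of _ f]) (simp add: f)
    let ?g = "\<lambda>l\<in>tuples vP3 2. f l + -1 * f' l"
    have g: "is_cocycle vP3 2 ?g"
      using f f' vP3.cob_linear(1)[of f "\<lambda>l. -1 * f' l"] vP3.cob_linear(2)[of "-1" f']
      by (simp add: is_cocycle_def vP3.cob_restrict)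
    have "is_coboundary vP3 2 (\<lambda>l. f l - f' l)" using f f' vP3.coh_class_eq_iff by blast
    then have "is_coboundary vP3 2 ?g" unfolding vP3.is_coboundary_restrict by simp
    then have "h2_coord ?g i = 0" using h2_coord_zero_iff[OF g] i by blast
    also have "h2_coord ?g i = h2_coord (\<lambda>l. f l + -1 * f' l) i" by (rule h2_coord_cong) simp
    finally have "h2_coord f i = h2_coord f' i" unfolding h2_coord_linear by simp
    then show ?thesis by (simp add: \<phi>_def f'_def)
  qed
  have rep: "\<exists>f. is_cocycle vP3 2 f \<and> A = coh_class vP3 2 f" if "A \<in> carrier H2" for A
    using that unfolding vP3.carrier_cohomology by blast
  have "\<exists>a\<in>carrier H1. coord a = c" for c using coord_ex[of c] by (auto simp: fun_eq_iff)
  then obtain A where A: "A c \<in> carrier H1" "coord (A c) = c" for c by metis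
  \<comment> \<open>The products of the \<open>P\<close> class with those of \<open>X1\<close>,
    \<open>X3\<close>, \<open>X2\<close>, then of the \<open>Q\<close> class with those of
    \<open>X1\<close>, \<open>X2\<close>, \<open>X3\<close>: one for each relation, in the order of
    \<open>vP3_cells\<close>.\<close>
  let ?x = "\<lambda>j. A ([coords 0 0 0 1 0 0, coords 0 0 0 1 0 0, coords 0 0 0 1 0 0, coords 0 0 0 0 1 0, coords 0 0 0 0 1 0, coords 0 0 0 0 1 0] ! j)"
  let ?y = "\<lambda>j. A ([coords 1 0 0 0 0 0, coords 0 0 1 0 0 0, coords 0 1 0 0 0 0, coords 1 0 0 0 0 0, coords 0 1 0 0 0 0, coords 0 0 1 0 0 0] ! j)"
  let ?b = "\<lambda>j. coh_class vP3 2 (cup_cochain (?x j) (?y j))"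
  have coc: "is_cocycle vP3 2 (cup_cochain (?x j) (?y j))" for j using cup_eq_class(1) A(1) by blast
  have dual: "\<forall>i<6. \<forall>j<6. h2_coord (cup_cochain (?x j) (?y j)) i = (if i = j then 1 else 0)"
    unfolding all_less_6 h2_coord_cup[OF A(1) A(1)] wedge_def A(2) by (simp add: One_nat_def)
  have *: "i < 6 \<Longrightarrow> x \<in> carrier H2 \<Longrightarrow> y \<in> carrier H2 \<Longrightarrow> \<phi> i (x \<oplus>\<^bsub>H2\<^esub> y) = \<phi> i x + \<phi> i y"
    "i < 6 \<Longrightarrow> x \<in> carrier H2 \<Longrightarrow> \<phi> i (c \<odot>\<^bsub>H2\<^esub> x) = c * \<phi> i x"
    "j < 6 \<Longrightarrow> ?b j \<in> carrier H2" 
    "i < 6 \<Longrightarrow> j < 6 \<Longrightarrow> \<phi> i (?b j) = (if i = j then 1 else 0)"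
    "x \<in> carrier H2 \<Longrightarrow> (\<And>i. i < 6 \<Longrightarrow> \<phi> i x = 0) \<Longrightarrow> x = \<zero>\<^bsub>H2\<^esub>" for i j c x y
  proof -
    show "\<phi> i (x \<oplus>\<^bsub>H2\<^esub> y) = \<phi> i x + \<phi> i y" if i: "i < 6" and xy: "x \<in> carrier H2" "y \<in> carrier H2"
    proof -
      obtain f g where fg: "is_cocycle vP3 2 f" "x = coh_class vP3 2 f" "is_cocycle vP3 2 g" "y = coh_class vP3 2 g"
        using rep xy by blast
      have s: "is_cocycle vP3 2 (\<lambda>xs\<in>tuples vP3 2. f xs + g xs)"
        using fg by (simp add: is_cocycle_def vP3.cob_restrict vP3.cob_linear)
      have "h2_coord (\<lambda>xs\<in>tuples vP3 2. f xs + g xs) i = h2_coord (\<lambda>xs. f xs + g xs) i" by (rule h2_coord_cong) simp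
      then show ?thesis using i fg s by (simp add: vP3.coh_class_add \<phi> h2_coord_linear)
    qed
    show "\<phi> i (c \<odot>\<^bsub>H2\<^esub> x) = c * \<phi> i x" if i: "i < 6" and x: "x \<in> carrier H2"
    proof -
      obtain f where f: "is_cocycle vP3 2 f" "x = coh_class vP3 2 f" using rep x by blast
      have s: "is_cocycle vP3 2 (\<lambda>xs\<in>tuples vP3 2. c * f xs)"
        using f by (simp add: is_cocycle_def vP3.cob_restrict vP3.cob_linear)
      have "h2_coord (\<lambda>xs\<in>tuples vP3 2. c * f xs) i = h2_coord (\<lambda>xs. c * f xs) i" by (rule h2_coord_cong) simp
      then show ?thesis using i f s by (simp add: vP3.coh_class_smult \<phi> h2_coord_linear)
    qed
    show "?b j \<in> carrier H2" unfolding vP3.carrier_cohomology using coc by blast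
    show "\<phi> i (?b j) = (if i = j then 1 else 0)" if "i < 6" "j < 6"
      unfolding \<phi>[OF coc that(1)] using dual that by blast
    show "x = \<zero>\<^bsub>H2\<^esub>" if x: "x \<in> carrier H2" and z: "\<And>i. i < 6 \<Longrightarrow> \<phi> i x = 0"
    proof -
      obtain f where f: "is_cocycle vP3 2 f" "x = coh_class vP3 2 f" using rep x by blast
      have "\<forall>i<6. h2_coord f i = 0" using z \<phi>[OF f(1)] f(2) by simp
      then show ?thesis
        unfolding f(2) vP3.coh_class_zero vP3.coh_class_eq_zero_iff[OF f(1)] h2_coord_zero_iff[OF f(1), symmetric] .
    qed
  qed
  show "vectorspace.fin_dim class_ring H2" "vectorspace.dim class_ring H2 = 6"
    by (rule dim_dual_basis[OF vP3.vectorspace_cohomology, where n = 6 and \<phi> = \<phi> and b = ?b]; fact *)+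
qed

section \<open>Pairs of classes with product zero\<close>

section \<open>Annihilators in the cohomology of \<open>vP\<^sub>3\<close>\<close>

definition on_line :: "(f3f2_letter option \<Rightarrow> complex) \<Rightarrow> bool" where
  "on_line c \<longleftrightarrow> (\<forall>i. c (Some i) = 0)"

text \<open>Send the generators to P4 as in \<open>theta_exists\<close> and let a_ij be the value of
  a class on A_ij; modulo the center these values sum to zero. Then 0, 1, 3, 4 are the local
  components of the triples 234, 134, 124, 123, where the other a_ij vanish, and 2 is the nonlocal
  component a_12 = a_34, a_13 = a_24, a_14 = a_23. The \<open>None\<close> coordinate is free, so
  dimension two becomes three.\<close>

definition in_plane :: "nat \<Rightarrow> (f3f2_letter option \<Rightarrow> complex) \<Rightarrow> bool" where
  "in_plane k c \<longleftrightarrow>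
    (if k = 0 then c (Some P) = 0 \<and> c (Some Q) = 0 \<and> c (Some X1) + c (Some X2) + c (Some X3) = 0
     else if k = 1 then c (Some P) = 0 \<and> c (Some X2) = 0 \<and> c (Some X1) = c (Some Q)
     else if k = 2 then c (Some Q) = 0 \<and> c (Some X3) = 0 \<and> c (Some X1) = c (Some P)
     else if k = 3 then c (Some X1) = 0 \<and> c (Some X3) = c (Some P) \<and> c (Some X2) = c (Some Q)
     else c (Some X1) = 0 \<and> c (Some X2) = 0 \<and> c (Some X3) = 0)"

lemma in_plane_simps:
  "in_plane 0 c \<longleftrightarrow> c (Some P) = 0 \<and> c (Some Q) = 0 \<and> c (Some X1) + c (Some X2) + c (Some X3) = 0"
  "in_plane 1 c \<longleftrightarrow> c (Some P) = 0 \<and> c (Some X2) = 0 \<and> c (Some X1) = c (Some Q)"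
  "in_plane 2 c \<longleftrightarrow> c (Some Q) = 0 \<and> c (Some X3) = 0 \<and> c (Some X1) = c (Some P)"
  "in_plane 3 c \<longleftrightarrow> c (Some X1) = 0 \<and> c (Some X3) = c (Some P) \<and> c (Some X2) = c (Some Q)"
  "in_plane 4 c \<longleftrightarrow> c (Some X1) = 0 \<and> c (Some X2) = 0 \<and> c (Some X3) = 0"
  by (simp_all add: in_plane_def)

definition proportional :: "(f3f2_letter option \<Rightarrow> complex) \<Rightarrow> (f3f2_letter option \<Rightarrow> complex) \<Rightarrow> bool" where
  "proportional c d \<longleftrightarrow> (\<forall>i j. c (Some i) * d (Some j) = c (Some j) * d (Some i))"

lemma all_letters: "(\<forall>i. R i) \<longleftrightarrow> R X1 \<and> R X2 \<and> R X3 \<and> R P \<and> R Q"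
  by (metis f3f2_letter.exhaust)

lemma all_less_5: "(\<forall>k<5. R k) \<longleftrightarrow> R 0 \<and> R 1 \<and> R 2 \<and> R 3 \<and> R (4::nat)"
proof -
  have "i < 5 \<longleftrightarrow> i = 0 \<or> i = 1 \<or> i = 2 \<or> i = 3 \<or> i = 4" for i :: nat by auto
  then show ?thesis by metis
qed

lemma ex_less_5: "(\<exists>k<5. R k) \<longleftrightarrow> R 0 \<or> R 1 \<or> R 2 \<or> R 3 \<or> R (4::nat)"
  using all_less_5[of "\<lambda>k. \<not> R k"] by blast

text \<open>The vanishing of the product as a system of six bilinear equations: its solutions are
  the proportional pairs and the pairs in a common plane. The first disjunct lists six of the ten
  minors; the other four are among the hypotheses. The case split makes suitable factors nonzero so
  that every branch is an ideal membership problem.\<close>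

lemma wedge_cases:
  fixes p p' q q' a1 a2 a3 b1 b2 b3 :: complex
  assumes r: "p * b1 = a1 * p'" "p * b3 = a3 * p'" "(p - a1 - a3) * b2 = a2 * (p' - b1 - b3)"
    "q * b1 = a1 * q'" "q * b2 = a2 * q'" "(q - a1 - a2) * b3 = a3 * (q' - b1 - b2)"
  shows "a1 * b2 = a2 * b1 \<and> a1 * b3 = a3 * b1 \<and> a2 * b3 = a3 * b2 \<and> a2 * p' = p * b2 \<and> a3 * q' = q * b3 \<and> p * q' = q * p'
    \<or> p = 0 \<and> q = 0 \<and> a1 + a2 + a3 = 0 \<and> p' = 0 \<and> q' = 0 \<and> b1 + b2 + b3 = 0
    \<or> p = 0 \<and> a2 = 0 \<and> a1 = q \<and> p' = 0 \<and> b2 = 0 \<and> b1 = q'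
    \<or> q = 0 \<and> a3 = 0 \<and> a1 = p \<and> q' = 0 \<and> b3 = 0 \<and> b1 = p'
    \<or> a1 = 0 \<and> a3 = p \<and> a2 = q \<and> b1 = 0 \<and> b3 = p' \<and> b2 = q'
    \<or> a1 = 0 \<and> a2 = 0 \<and> a3 = 0 \<and> b1 = 0 \<and> b2 = 0 \<and> b3 = 0"
    (is "?M \<or> ?L1 \<or> ?L2 \<or> ?L3 \<or> ?L4 \<or> ?L5")
proof -
  consider (0) "p = 0" "p' = 0" "q = 0" "q' = 0" | (1) "p = 0" "p' = 0" "q \<noteq> 0 \<or> q' \<noteq> 0"
    | (2) "p \<noteq> 0 \<or> p' \<noteq> 0" "q = 0" "q' = 0" | (3) "p \<noteq> 0 \<or> p' \<noteq> 0" "q \<noteq> 0 \<or> q' \<noteq> 0" by blast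
  then show ?thesis
  proof cases
    case 0
    consider "a1 + a2 + a3 \<noteq> 0" | "b1 + b2 + b3 \<noteq> 0" | "a1 + a2 + a3 = 0" "b1 + b2 + b3 = 0" by blast
    then show ?thesis
    proof cases
      case 1
      have ?M by (intro conjI; use r 0 1 in Groebner_Basis.algebra)
      then show ?thesis ..
    next
      case 2
      have ?M by (intro conjI; use r 0 2 in Groebner_Basis.algebra)
      then show ?thesis ..
    qed (use 0 in blast)
  next
    case 1
    note Q = 1
    consider "a2 \<noteq> 0 \<or> b2 \<noteq> 0" | "a2 = 0" "b2 = 0" "q - a1 \<noteq> 0 \<or> q' - b1 \<noteq> 0" | "a2 = 0" "b2 = 0" "a1 = q" "b1 = q'" by (metis eq_iff_diff_eq_0)
    then show ?thesis
    proof cases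
      case 1
      from 1 Q(3) have ?M by (elim disjE; intro conjI; use r Q(1,2) in Groebner_Basis.algebra)
      then show ?thesis ..
    next
      case 2
      from 2(3) Q(3) have ?M by (elim disjE; intro conjI; use r Q(1,2) 2(1,2) in Groebner_Basis.algebra)
      then show ?thesis ..
    qed (use Q in blast)
  next
    case 2
    note P = 2
    consider "a3 \<noteq> 0 \<or> b3 \<noteq> 0" | "a3 = 0" "b3 = 0" "p - a1 \<noteq> 0 \<or> p' - b1 \<noteq> 0" | "a3 = 0" "b3 = 0" "a1 = p" "b1 = p'" by (metis eq_iff_diff_eq_0)
    then show ?thesis
    proof cases
      case 1
      from 1 P(1) have ?M by (elim disjE; intro conjI; use r P(2,3) in Groebner_Basis.algebra)
      then show ?thesis ..
    next
      case 2
      from 2(3) P(1) have ?M by (elim disjE; intro conjI; use r P(2,3) 2(1,2) in Groebner_Basis.algebra)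
      then show ?thesis ..
    qed (use P in blast)
  next
    case 3
    note PQ = 3
    \<comment> \<open>By the hypotheses \<open>(a1, b1)\<close> and \<open>(a3, b3)\<close> are
      multiples of \<open>(p, p')\<close>, while \<open>(a1, b1)\<close> and \<open>(a2, b2)\<close>
      are multiples of \<open>(q, q')\<close>. If \<open>(a1, b1)\<close> is nonzero, it links all
      five pairs.\<close>
    consider (a) "a1 \<noteq> 0 \<or> b1 \<noteq> 0" | (b) "a1 = 0" "b1 = 0" "a3 = 0" "b3 = 0" "a2 \<noteq> 0 \<or> b2 \<noteq> 0"
      | (c) "a1 = 0" "b1 = 0" "a2 = 0" "b2 = 0" "a3 \<noteq> 0 \<or> b3 \<noteq> 0" | (d) ?L5
      | (e) "a1 = 0" "b1 = 0" "a2 \<noteq> 0 \<or> b2 \<noteq> 0" "a3 \<noteq> 0 \<or> b3 \<noteq> 0" by blast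
    then show ?thesis
    proof cases
      case a
      from a PQ have ?M by (elim disjE; intro conjI; use r in Groebner_Basis.algebra)
      then show ?thesis ..
    next
      case b
      from b(5) PQ have ?M by (elim disjE; intro conjI; use r b(1-4) in Groebner_Basis.algebra)
      then show ?thesis ..
    next
      case c
      from c(5) PQ have ?M by (elim disjE; intro conjI; use r c(1-4) in Groebner_Basis.algebra)
      then show ?thesis ..
    next
      case d
      then show ?thesis by blast
    next
      case e
      \<comment> \<open>With \<open>a1 = b1 = 0\<close> the third and sixth equations compare
        \<open>(a2, b2)\<close> with \<open>(p - a3, p' - b3)\<close> and \<open>(a3, b3)\<close>
        with \<open>(q - a2, q' - b2)\<close>. If both differences vanish, the fourth plane
        alternative \<open>?L4\<close> holds.\<close>
      consider "p - a3 \<noteq> 0 \<or> p' - b3 \<noteq> 0" | "q - a2 \<noteq> 0 \<or> q' - b2 \<noteq> 0" | "a3 = p" "b3 = p'" "a2 = q" "b2 = q'" by (metis eq_iff_diff_eq_0)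
      then show ?thesis
      proof cases
        case 1
        then have "a2 * b3 = a3 * b2" by (elim disjE; use r e(1,2) in Groebner_Basis.algebra)
        note * = this
        from e(4) have "a2 * p' = p * b2" by (elim disjE; use r(2) * in Groebner_Basis.algebra)
        moreover from e(3) have "a3 * q' = q * b3" by (elim disjE; use r(5) * in Groebner_Basis.algebra)
        moreover from e(3) have "p * q' = q * p'" by (elim disjE; use r(5) \<open>a2 * p' = p * b2\<close> in Groebner_Basis.algebra)
        ultimately have ?M using e(1,2) * by simp
        then show ?thesis ..
      next
        case 2
        then have "a2 * b3 = a3 * b2" by (elim disjE; use r e(1,2) in Groebner_Basis.algebra)
        note * = this
        from e(4) have "a2 * p' = p * b2" by (elim disjE; use r(2) * in Groebner_Basis.algebra)
        moreover from e(3) have "a3 * q' = q * b3" by (elim disjE; use r(5) * in Groebner_Basis.algebra)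
        moreover from e(3) have "p * q' = q * p'" by (elim disjE; use r(5) \<open>a2 * p' = p * b2\<close> in Groebner_Basis.algebra)
        ultimately have ?M using e(1,2) * by simp
        then show ?thesis ..
      qed (use e in blast)
    qed
  qed
qed

lemma cup_eq_zero_iff':
  assumes a: "a \<in> carrier H1" and b: "b \<in> carrier H1"
  shows "cup vP3 1 1 a b = \<zero>\<^bsub>H2\<^esub> \<longleftrightarrow>
    proportional (coord a) (coord b) \<or> (\<exists>k<5. in_plane k (coord a) \<and> in_plane k (coord b))" (is "?l \<longleftrightarrow> ?r")
proof
  assume ?l
  then have w: "wedge a b P X1 = 0" "wedge a b P X3 = 0" "wedge a b P X2 - wedge a b X1 X2 - wedge a b X3 X2 = 0"
    "wedge a b Q X1 = 0" "wedge a b Q X2 = 0" "wedge a b Q X3 - wedge a b X1 X3 - wedge a b X2 X3 = 0"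
    unfolding cup_eq_zero_iff[OF a b] by blast+
  let ?a = "\<lambda>i. coord a (Some i)" and ?b = "\<lambda>i. coord b (Some i)"
  have r: "?a P * ?b X1 = ?a X1 * ?b P" "?a P * ?b X3 = ?a X3 * ?b P"
    "(?a P - ?a X1 - ?a X3) * ?b X2 = ?a X2 * (?b P - ?b X1 - ?b X3)"
    "?a Q * ?b X1 = ?a X1 * ?b Q" "?a Q * ?b X2 = ?a X2 * ?b Q"
    "(?a Q - ?a X1 - ?a X2) * ?b X3 = ?a X3 * (?b Q - ?b X1 - ?b X2)"
    using w unfolding wedge_def by Groebner_Basis.algebra+
  note wedge_cases[OF r]
  then show ?r
  proof (elim disjE)
    assume *: "?a X1 * ?b X2 = ?a X2 * ?b X1 \<and> ?a X1 * ?b X3 = ?a X3 * ?b X1 \<and> ?a X2 * ?b X3 = ?a X3 * ?b X2 \<and>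
      ?a X2 * ?b P = ?a P * ?b X2 \<and> ?a X3 * ?b Q = ?a Q * ?b X3 \<and> ?a P * ?b Q = ?a Q * ?b P"
    \<comment> \<open>The four minors missing from \<open>wedge_cases\<close> are the equations
      \<open>r(1,2,4,5)\<close>.\<close>
    have "proportional (coord a) (coord b)"
      unfolding proportional_def all_letters using * r(1,2,4,5) by simp
    then show ?r ..
  qed (rule disjI2, simp add: ex_less_5 in_plane_simps)+
next
  assume ?r
  then show ?l
  proof
    assume "proportional (coord a) (coord b)"
    then have "wedge a b i j = 0" for i j by (simp add: proportional_def wedge_def)
    then show ?l by (simp add: cup_eq_zero_iff[OF a b])
  next
    assume "\<exists>k<5. in_plane k (coord a) \<and> in_plane k (coord b)"
    then show ?l
      unfolding ex_less_5 cup_eq_zero_iff[OF a b] wedge_def in_plane_simps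
      by (elim disjE conjE; intro conjI; Groebner_Basis.algebra)
  qed
qed

lemma in_plane_on_line:
  assumes "in_plane j c" "in_plane k c" "j < 5" "k < 5" "j \<noteq> k"
  shows "on_line c"
proof -
  have "\<forall>j<5. \<forall>k<5. j \<noteq> k \<longrightarrow> in_plane j c \<longrightarrow> in_plane k c \<longrightarrow> on_line c"
    unfolding all_less_5 in_plane_simps on_line_def all_letters by auto
  then show ?thesis using assms by blast
qed

lemma on_line_in_plane: "on_line c \<Longrightarrow> in_plane k c"
  by (simp add: on_line_def in_plane_def)

lemma on_line_proportional: "on_line c \<Longrightarrow> proportional c d"
  by (simp add: on_line_def proportional_def)

lemma in_plane_proportional:
  assumes "in_plane k c" "\<not> on_line c" "proportional c d"
  shows "in_plane k d"
proof -
  obtain i where i: "c (Some i) \<noteq> 0" using assms(2) by (auto simp: on_line_def)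
  define m where "m = d (Some i) / c (Some i)"
  have d: "d (Some j) = m * c (Some j)" for j
    using i assms(3)[unfolded proportional_def, rule_format, of i j] by (simp add: m_def field_simps)
  show ?thesis using assms(1) by (auto simp: in_plane_def d simp flip: distrib_left)
qed

definition plane :: "nat \<Rightarrow> ((nat \<times> nat) word set list \<Rightarrow> complex) set set" where
  "plane k = {a \<in> carrier H1. in_plane k (coord a)}"

lemma annihilator_on_line: "a \<in> carrier H1 \<Longrightarrow> on_line (coord a) \<Longrightarrow> vP3.annihilator a = carrier H1"
  unfolding vP3.annihilator_def using cup_eq_zero_iff' on_line_proportional by blast

text \<open>Away from the t-line, \<open>a\<close> lies in no second plane, and a class proportional
  to \<open>a\<close> up to its t-coordinate lies in the same plane.\<close>

lemma annihilator_in_plane: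
  assumes "a \<in> carrier H1" "\<not> on_line (coord a)" "in_plane k (coord a)" "k < 5"
  shows "vP3.annihilator a = plane k"
proof -
  have "cup vP3 1 1 a b = \<zero>\<^bsub>H2\<^esub> \<longleftrightarrow> in_plane k (coord b)" if "b \<in> carrier H1" for b
    unfolding cup_eq_zero_iff'[OF assms(1) that]
    using in_plane_on_line[OF assms(3)] in_plane_proportional[OF assms(3,2)] assms by metis
  then show ?thesis unfolding vP3.annihilator_def plane_def by blast
qed

lemma plane_subspace: "VectorSpace.subspace class_ring (plane k) H1"
proof (rule subspaceI[OF vP3.vectorspace_cohomology])
  interpret vectorspace class_ring H1 by (rule vP3.vectorspace_cohomology)
  show "\<zero>\<^bsub>H1\<^esub> \<in> plane k" by (simp add: plane_def in_plane_def coord_linear)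
  show "x \<oplus>\<^bsub>H1\<^esub> y \<in> plane k" if "x \<in> plane k" "y \<in> plane k" for x y
  proof -
    have eq: "r + r' + (s + s') + (t + t') = (r + s + t) + (r' + s' + t')" for r r' s s' t t' :: complex by simp
    show ?thesis using that by (auto simp: plane_def in_plane_def coord_linear eq)
  qed
  show "c \<odot>\<^bsub>H1\<^esub> x \<in> plane k" if "x \<in> plane k" for c x
    using that by (auto simp: plane_def in_plane_def coord_linear simp flip: distrib_left)
qed (auto simp: plane_def)

lemma dim_plane:
  assumes "k < 5"
  shows "vectorspace.fin_dim class_ring (H1\<lparr>carrier := plane k\<rparr>)"
    "vectorspace.dim class_ring (H1\<lparr>carrier := plane k\<rparr>) = 3"
proof -
  let ?is = "[[Some X1, Some X2, None], [Some X1, Some X3, None], [Some X1, Some X2, None],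
    [Some X2, Some X3, None], [Some P, Some Q, None]] ! k"
  let ?T = "coords 0 0 0 0 0 1"
  let ?e = "[[coords 1 0 (-1) 0 0 0, coords 0 1 (-1) 0 0 0, ?T], [coords 1 0 0 0 1 0, coords 0 0 1 0 0 0, ?T],
    [coords 1 0 0 1 0 0, coords 0 1 0 0 0 0, ?T], [coords 0 1 0 0 1 0, coords 0 0 1 1 0 0, ?T],
    [coords 0 0 0 1 0 0, coords 0 0 0 0 1 0, ?T]] ! k"
  have all_less_3: "(\<forall>i<3. R i) \<longleftrightarrow> R 0 \<and> R 1 \<and> R (2::nat)" for R
  proof -
    have "i < 3 \<longleftrightarrow> i = 0 \<or> i = 1 \<or> i = 2" for i :: nat by auto
    then show ?thesis by metis
  qed
  have k: "k = 0 \<or> k = 1 \<or> k = 2 \<or> k = 3 \<or> k = 4" using assms by auto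
  then have len: "length ?is = 3" by (elim disjE) (simp_all add: One_nat_def)
  have 1: "\<forall>i<3. in_plane k (?e ! i)" unfolding all_less_3
    using k by (elim disjE) (simp_all add: in_plane_def One_nat_def)
  have 2: "\<forall>i<3. \<forall>j<3. (?e ! j) (?is ! i) = (if i = j then 1 else 0)" unfolding all_less_3
    using k by (elim disjE) (simp_all add: One_nat_def)
  have 3: "coord a i = 0" if "a \<in> plane k" "\<And>j. j \<in> set ?is \<Longrightarrow> coord a j = 0" for a i
    using k that by (elim disjE; cases i rule: letter_option_cases) (simp_all add: plane_def in_plane_def One_nat_def)
  note d = dim_by_coords[OF plane_subspace, of ?is ?e k, unfolded len]
  show "vectorspace.fin_dim class_ring (H1\<lparr>carrier := plane k\<rparr>)"
    "vectorspace.dim class_ring (H1\<lparr>carrier := plane k\<rparr>) = 3"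
    by (rule d; (fact 3 | use 1 2 in \<open>simp add: plane_def\<close>))+
qed

lemma dim_annihilator:
  assumes a: "a \<in> carrier H1"
  shows "vectorspace.fin_dim class_ring (H1\<lparr>carrier := vP3.annihilator a\<rparr>)"
    "vectorspace.dim class_ring (H1\<lparr>carrier := vP3.annihilator a\<rparr>)
      = (if on_line (coord a) then 6 else if \<exists>k<5. in_plane k (coord a) then 3 else 2)"
proof -
  consider "on_line (coord a)" | k where "\<not> on_line (coord a)" "k < 5" "in_plane k (coord a)"
    | "\<not> on_line (coord a)" "\<not> (\<exists>k<5. in_plane k (coord a))" by blast
  then have "vectorspace.fin_dim class_ring (H1\<lparr>carrier := vP3.annihilator a\<rparr>) \<and>
    vectorspace.dim class_ring (H1\<lparr>carrier := vP3.annihilator a\<rparr>)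
      = (if on_line (coord a) then 6 else if \<exists>k<5. in_plane k (coord a) then 3 else 2)"
  proof cases
    case 1
    have "H1\<lparr>carrier := carrier H1\<rparr> = H1" by simp
    then show ?thesis using 1 dim_H1 unfolding annihilator_on_line[OF a 1] by simp
  next
    case (2 k)
    have "\<exists>k<5. in_plane k (coord a)" using 2 by blast
    then show ?thesis using 2(1) dim_plane[OF 2(2)] unfolding annihilator_in_plane[OF a 2(1,3,2)] by simp
  next
    case 3
    then obtain i where i: "coord a (Some i) \<noteq> 0" by (auto simp: on_line_def)
    \<comment> \<open>The annihilator is spanned by \<open>a\<close>, with its t-coordinate removed
      and scaled to 1 at a nonzero coordinate \<open>i\<close>, and by the t-direction.\<close>
    let ?e = "[\<lambda>j. if j = None then 0 else coord a j / coord a (Some i), coords 0 0 0 0 0 1]"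
    let ?is = "[Some i, None]"
    have len: "length ?is = 2" by simp
    have less_2: "j < 2 \<Longrightarrow> j = 0 \<or> j = 1" for j :: nat by auto
    have ann: "b \<in> vP3.annihilator a \<longleftrightarrow> b \<in> carrier H1 \<and> proportional (coord a) (coord b)" for b
      unfolding vP3.annihilator_def using cup_eq_zero_iff'[OF a] 3(2) by blast
    have T: "coords 0 0 0 0 0 1 (Some j) = 0" for j by (cases j) simp_all
    have 1: "proportional (coord a) (?e ! j)" if "j < 2" for j
      using less_2[OF that] by (elim disjE) (simp_all add: proportional_def T One_nat_def)
    have 2: "(?e ! j) (?is ! l) = (if l = j then 1 else 0)" if "j < 2" "l < 2" for j l
      using less_2[OF that(1)] less_2[OF that(2)] by (elim disjE) (simp_all add: i T One_nat_def)
    have sep: "coord b j = 0" if b: "b \<in> vP3.annihilator a" "\<And>j. j \<in> set ?is \<Longrightarrow> coord b j = 0" for b j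
    proof (cases j)
      case (Some l)
      have "coord a (Some i) * coord b (Some l) = coord a (Some l) * coord b (Some i)"
        using b(1) ann unfolding proportional_def by blast
      then show ?thesis using Some i b(2) by simp
    qed (use b(2) in simp)
    note d = dim_by_coords[OF vP3.annihilator_subspace[OF a], of ?is ?e, unfolded len]
    have "vectorspace.fin_dim class_ring (H1\<lparr>carrier := vP3.annihilator a\<rparr>)"
      "vectorspace.dim class_ring (H1\<lparr>carrier := vP3.annihilator a\<rparr>) = 2"
      by (rule d; (fact sep | simp only: 1 2 ann))+
    then show ?thesis using 3 by simp
  qed
  then show "vectorspace.fin_dim class_ring (H1\<lparr>carrier := vP3.annihilator a\<rparr>)"
    "vectorspace.dim class_ring (H1\<lparr>carrier := vP3.annihilator a\<rparr>)
      = (if on_line (coord a) then 6 else if \<exists>k<5. in_plane k (coord a) then 3 else 2)" by blast+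
qed

section \<open>Comparison with the free factor\<close>

section \<open>Pullbacks in degree one\<close>

definition pull :: "('g, 'm) monoid_scheme \<Rightarrow> ('g \<Rightarrow> 'k) \<Rightarrow> ('k list \<Rightarrow> complex) set \<Rightarrow> ('g list \<Rightarrow> complex) set" where
  "pull G \<phi> a = h1_of G (\<lambda>x. h1_val a (\<phi> x))"

lemma coh_pullback_1:
  assumes G: "group G" and K: "group K" and a: "a \<in> carrier (group_cohomology K 1)"
  shows "coh_pullback G 1 \<phi> a = pull G \<phi> a"
proof -
  interpret G: group G by fact
  interpret K: group K by fact
  obtain f where f: "is_cocycle K 1 f" "a = {f}" "\<And>x. h1_val a x = f [x]" by (rule K.h1_cases[OF a]) (rule that)
  have "(\<lambda>xs\<in>tuples G 1. f (map \<phi> xs)) = (\<lambda>xs\<in>tuples G 1. h1_val a (\<phi> (hd xs)))"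
    by (rule restrict_ext) (auto simp: tuples_1 f(3))
  then show ?thesis unfolding coh_pullback_def f(2)[symmetric] pull_def G.h1_of_eq by (simp add: f(2))
qed

lemma (in group_hom) additive_comp: "additive_on H k \<Longrightarrow> additive_on G (\<lambda>x. k (h x))"
  by (simp add: additive_on_def)

lemma (in group_hom) pull_closed:
  "a \<in> carrier (group_cohomology H 1) \<Longrightarrow> pull G h a \<in> carrier (group_cohomology G 1)"
  unfolding pull_def by (intro G.h1_of_closed additive_comp H.h1_val_additive)

lemma (in group) h1_val_pull [simp]: "x \<in> carrier G \<Longrightarrow> h1_val (pull G \<phi> a) x = h1_val a (\<phi> x)"
  by (simp add: pull_def)

lemma (in group_hom) pull_add:
  assumes a: "a \<in> carrier (group_cohomology H 1)" and b: "b \<in> carrier (group_cohomology H 1)"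
  shows "pull G h (a \<oplus>\<^bsub>group_cohomology H 1\<^esub> b) = pull G h a \<oplus>\<^bsub>group_cohomology G 1\<^esub> pull G h b"
proof -
  interpret VG: vectorspace class_ring "group_cohomology G 1" by (rule G.vectorspace_cohomology)
  interpret VH: vectorspace class_ring "group_cohomology H 1" by (rule H.vectorspace_cohomology)
  show ?thesis by (rule G.h1_eqI) (use a b in \<open>simp_all add: pull_closed G.h1_add H.h1_add\<close>)
qed

lemma (in group_hom) pull_smult:
  assumes a: "a \<in> carrier (group_cohomology H 1)"
  shows "pull G h (c \<odot>\<^bsub>group_cohomology H 1\<^esub> a) = c \<odot>\<^bsub>group_cohomology G 1\<^esub> pull G h a"
proof -
  interpret VG: vectorspace class_ring "group_cohomology G 1" by (rule G.vectorspace_cohomology)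
  interpret VH: vectorspace class_ring "group_cohomology H 1" by (rule H.vectorspace_cohomology)
  show ?thesis by (rule G.h1_eqI) (use a in \<open>simp_all add: pull_closed G.h1_smult H.h1_smult\<close>)
qed

text \<open>A primitive of the product is composed with \<open>h\<close>.\<close>

lemma (in group_hom) cup_pull:
  assumes a: "a \<in> carrier (group_cohomology H 1)" and b: "b \<in> carrier (group_cohomology H 1)"
    and 0: "cup H 1 1 a b = \<zero>\<^bsub>group_cohomology H 2\<^esub>"
  shows "cup G 1 1 (pull G h a) (pull G h b) = \<zero>\<^bsub>group_cohomology G 2\<^esub>"
proof -
  obtain k where "\<forall>x\<in>carrier H. \<forall>y\<in>carrier H. h1_val a x * h1_val b y = k x + k y - k (x \<otimes>\<^bsub>H\<^esub> y)"
    using 0 unfolding H.cup_1_1_eq_zero_iff[OF a b] by blast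
  then show ?thesis
    unfolding G.cup_1_1_eq_zero_iff[OF pull_closed[OF a] pull_closed[OF b]]
    by (intro exI[of _ "\<lambda>x. k (h x)"]) simp
qed

section \<open>The free factor \<open>P4_bar\<close>\<close>

text \<open>On degree one, \<open>J\<close> restricts a class to the free factor and
  \<open>R\<close> extends a class by zero on \<open>vt\<close>. As \<open>r\<close> retracts onto
  the factor, \<open>J\<close> after \<open>R\<close> is the identity, and \<open>R\<close> after
  \<open>J\<close> only erases the t-coordinate.\<close>

locale free_factor =
  fixes j r
  assumes j: "group_hom P4_bar vP3 j" and r: "group_hom vP3 P4_bar r"
    and r_j: "\<And>x. x \<in> carrier P4_bar \<Longrightarrow> r (j x) = x"
    and j_r: "j (r vx1) = vx1" "j (r vx2) = vx2" "j (r vx3) = vx3" "j (r vp) = vp" "j (r vq) = vq"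
    and r_vt: "r vt = \<one>\<^bsub>P4_bar\<^esub>"
begin

sublocale j: group_hom P4_bar vP3 j by (rule j)
sublocale r: group_hom vP3 P4_bar r by (rule r)

abbreviation "H1' \<equiv> group_cohomology P4_bar 1"
abbreviation "J \<equiv> pull P4_bar j"
abbreviation "R \<equiv> pull vP3 r"

lemma J_R: "b \<in> carrier H1' \<Longrightarrow> J (R b) = b"
  by (rule j.G.h1_eqI) (simp_all add: j.pull_closed r.pull_closed r_j)

lemma coord_R_J: "coord (R (J a)) (Some i) = coord a (Some i)"
  by (cases i) (simp_all add: coord_def j_r)

lemma coord_R: "b \<in> carrier H1' \<Longrightarrow> coord (R b) None = 0"
  by (simp add: coord_def r_vt j.G.additive_one j.G.h1_val_additive)

text \<open>If the restricted product vanishes, so does the product of \<open>R (J a)\<close> and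
  \<open>R (J b)\<close>. By \<open>cup_eq_zero_iff\<close> the t-coordinate has no influence on
  vanishing, so this is the product of \<open>a\<close> and \<open>b\<close>. Thus H^2 of the free
  factor need not be computed.\<close>

lemma cup_J:
  assumes a: "a \<in> carrier H1" and b: "b \<in> carrier H1"
  shows "cup P4_bar 1 1 (J a) (J b) = \<zero>\<^bsub>group_cohomology P4_bar 2\<^esub> \<longleftrightarrow> cup vP3 1 1 a b = \<zero>\<^bsub>H2\<^esub>"
proof
  assume "cup P4_bar 1 1 (J a) (J b) = \<zero>\<^bsub>group_cohomology P4_bar 2\<^esub>"
  then have "cup vP3 1 1 (R (J a)) (R (J b)) = \<zero>\<^bsub>H2\<^esub>"
    by (rule r.cup_pull[OF j.pull_closed[OF a] j.pull_closed[OF b]])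
  then show "cup vP3 1 1 a b = \<zero>\<^bsub>H2\<^esub>"
    unfolding cup_eq_zero_iff[OF r.pull_closed[OF j.pull_closed[OF a]] r.pull_closed[OF j.pull_closed[OF b]]]
      cup_eq_zero_iff[OF a b] wedge_def coord_R_J .
qed (rule j.cup_pull[OF a b])

lemma J_eq_zero_iff:
  assumes a: "a \<in> carrier H1"
  shows "J a = \<zero>\<^bsub>H1'\<^esub> \<longleftrightarrow> on_line (coord a)"
proof
  assume *: "J a = \<zero>\<^bsub>H1'\<^esub>"
  have "coord (R \<zero>\<^bsub>H1'\<^esub>) (Some i) = 0" for i
    unfolding coord_def by (simp add: j.G.h1_zero)
  then show "on_line (coord a)" using coord_R_J[of a] unfolding * on_line_def by metis
next
  assume l: "on_line (coord a)"
  have RJ: "R (J a) \<in> carrier H1" by (intro r.pull_closed j.pull_closed a)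
  have "coord (R (J a)) i = 0" for i
    using l coord_R[OF j.pull_closed[OF a]] by (cases i) (simp_all add: coord_R_J on_line_def)
  then have "R (J a) = \<zero>\<^bsub>H1\<^esub>" by (rule coord_eq_zeroI[OF RJ])
  then have "J a = J \<zero>\<^bsub>H1\<^esub>" using J_R[OF j.pull_closed[OF a]] by simp
  then have "h1_val (J a) x = 0" if "x \<in> carrier P4_bar" for x using that by (simp add: vP3.h1_zero)
  then show "J a = \<zero>\<^bsub>H1'\<^esub>" unfolding j.G.h1_eq_zero_iff[OF j.pull_closed[OF a]] by blast
qed

end

definition line :: "((nat \<times> nat) word set list \<Rightarrow> complex) set set" where
  "line = {a \<in> carrier H1. on_line (coord a)}"

lemma line_subspace: "VectorSpace.subspace class_ring line H1"
proof (rule subspaceI[OF vP3.vectorspace_cohomology])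
  interpret vectorspace class_ring H1 by (rule vP3.vectorspace_cohomology)
  show "\<zero>\<^bsub>H1\<^esub> \<in> line" by (simp add: line_def on_line_def coord_linear)
  show "x \<oplus>\<^bsub>H1\<^esub> y \<in> line" if "x \<in> line" "y \<in> line" for x y
    using that by (simp add: line_def on_line_def coord_linear)
  show "c \<odot>\<^bsub>H1\<^esub> x \<in> line" if "x \<in> line" for c x
    using that smult_closed[of c x] by (simp add: line_def on_line_def coord_linear)
qed (auto simp: line_def)

lemma dim_line: "vectorspace.dim class_ring (H1\<lparr>carrier := line\<rparr>) = 1"
proof -
  have T: "coords 0 0 0 0 0 1 (Some i) = 0" for i by (cases i) simp_all
  have sep: "coord a i = 0" if "a \<in> line" "\<And>j. j \<in> set [None] \<Longrightarrow> coord a j = 0" for a i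
    using that by (cases i) (simp_all add: line_def on_line_def)
  have 1: "a \<in> line" if "i < length [None]" "a \<in> carrier H1" "coord a = [coords 0 0 0 0 0 1] ! i" for i a
    using that by (simp add: line_def on_line_def T One_nat_def)
  have "vectorspace.dim class_ring (H1\<lparr>carrier := line\<rparr>) = length [None :: f3f2_letter option]"
    by (rule dim_by_coords(2)[OF line_subspace, where e = "[coords 0 0 0 0 0 1]"]; (fact sep | fact 1 | simp add: One_nat_def))
  then show ?thesis by (simp add: One_nat_def)
qed

context free_factor
begin

lemma J_annihilator:
  assumes a: "a \<in> carrier H1"
  shows "linear_map class_ring (H1\<lparr>carrier := vP3.annihilator a\<rparr>) (H1'\<lparr>carrier := j.G.annihilator (J a)\<rparr>) J"
    "J ` vP3.annihilator a = j.G.annihilator (J a)"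
proof -
  note sub = vP3.annihilator_subspace[OF a] j.G.annihilator_subspace[OF j.pull_closed[OF a]]
  have sH: "b \<in> carrier H1" if "b \<in> vP3.annihilator a" for b using that by (simp add: vP3.annihilator_def)
  have cl: "J b \<in> j.G.annihilator (J a)" if b: "b \<in> vP3.annihilator a" for b
    using b cup_J[OF a sH[OF b]] j.pull_closed[OF sH[OF b]]
    unfolding vP3.annihilator_def j.G.annihilator_def by blast
  show "linear_map class_ring (H1\<lparr>carrier := vP3.annihilator a\<rparr>) (H1'\<lparr>carrier := j.G.annihilator (J a)\<rparr>) J"
    by (rule linear_mapI[OF sub[THEN subspace_vectorspace]]) (simp_all add: cl sH j.pull_add j.pull_smult)
  show "J ` vP3.annihilator a = j.G.annihilator (J a)"
  proof (intro equalityI subsetI)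
    fix b assume b: "b \<in> j.G.annihilator (J a)"
    then have bH: "b \<in> carrier H1'" by (simp add: j.G.annihilator_def)
    have "R b \<in> vP3.annihilator a"
      using b cup_J[OF a r.pull_closed[OF bH]] r.pull_closed[OF bH] J_R[OF bH]
      unfolding vP3.annihilator_def j.G.annihilator_def by simp
    then show "b \<in> J ` vP3.annihilator a" by (intro image_eqI[of b J "R b"]) (simp_all add: J_R[OF bH])
  next
    fix b assume "b \<in> J ` vP3.annihilator a"
    then show "b \<in> j.G.annihilator (J a)" by (elim imageE) (simp only: cl)
  qed
qed

text \<open>Restriction maps annihilator onto annihilator with kernel the t-line, which annihilates
  every class.\<close>

lemma dim_annihilator_J:
  assumes a: "a \<in> carrier H1"
  shows "vectorspace.fin_dim class_ring (H1'\<lparr>carrier := j.G.annihilator (J a)\<rparr>)"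
    "vectorspace.dim class_ring (H1\<lparr>carrier := vP3.annihilator a\<rparr>)
      = vectorspace.dim class_ring (H1'\<lparr>carrier := j.G.annihilator (J a)\<rparr>) + 1"
proof -
  note J = J_annihilator[OF a]
  show "vectorspace.fin_dim class_ring (H1'\<lparr>carrier := j.G.annihilator (J a)\<rparr>)"
    by (rule linear_map.image_fin_dim[OF J(1) dim_annihilator(1)[OF a]]) (simp add: J(2))
  have "b \<in> vP3.annihilator a" if "b \<in> line" for b
  proof -
    have b: "b \<in> carrier H1" "on_line (coord b)" using that by (simp_all add: line_def)
    have "proportional (coord a) (coord b)" using b(2) by (simp add: on_line_def proportional_def)
    then show ?thesis unfolding vP3.annihilator_def using cup_eq_zero_iff'[OF a b(1)] b(1) by blast
  qed
  moreover have "b \<in> carrier H1" if "b \<in> vP3.annihilator a" for b using that by (simp add: vP3.annihilator_def)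
  ultimately have ker: "{b \<in> vP3.annihilator a. J b = \<zero>\<^bsub>H1'\<^esub>} = line"
    using J_eq_zero_iff unfolding line_def by blast
  show "vectorspace.dim class_ring (H1\<lparr>carrier := vP3.annihilator a\<rparr>)
      = vectorspace.dim class_ring (H1'\<lparr>carrier := j.G.annihilator (J a)\<rparr>) + 1"
    using linear_map_rank_nullity(3)[OF J(1) dim_annihilator(1)[OF a]] by (simp add: J(2) ker dim_line)
qed

end

section \<open>The resonance varieties of vP3 and of P4 modulo its center\<close>

section \<open>Resonance varieties\<close>

definition ann_dim :: "((nat \<times> nat) word set list \<Rightarrow> complex) set \<Rightarrow> int" where
  "ann_dim a = (if on_line (coord a) then 6 else if \<exists>k<5. in_plane k (coord a) then 3 else 2)"

lemma int_dim_annihilator: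
  "a \<in> carrier H1 \<Longrightarrow> int (vectorspace.dim class_ring (H1\<lparr>carrier := vP3.annihilator a\<rparr>)) = ann_dim a"
  by (auto simp: dim_annihilator(2) ann_dim_def)

lemma resonance_variety_1:
  "resonance_variety 1 d vP3 = {a \<in> carrier H1. d + (if a = \<zero>\<^bsub>H1\<^esub> then 0 else 1) \<le> ann_dim a}"
proof -
  have "int (vectorspace.dim class_ring (cohomology_of_complex (group_cohomology vP3) (\<lambda>n. cup vP3 1 n a) 1)) \<ge> d
    \<longleftrightarrow> d + (if a = \<zero>\<^bsub>H1\<^esub> then 0 else 1) \<le> ann_dim a" if a: "a \<in> carrier H1" for a
    using vP3.dim_resonance_1[OF a dim_annihilator(1)[OF a]] int_dim_annihilator[OF a] by (auto split: if_splits)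
  then show ?thesis unfolding resonance_variety_def by blast
qed

text \<open>The dimensions of H^1 and H^2 are both 6 and cancel in \<open>dim_resonance_2\<close>,
  leaving the dimension of the annihilator.\<close>

lemma resonance_variety_2: "resonance_variety 2 d vP3 = {a \<in> carrier H1. d \<le> ann_dim a}"
proof -
  have "vectorspace.dim class_ring (cohomology_of_complex (group_cohomology vP3) (\<lambda>n. cup vP3 1 n a) 2)
    = vectorspace.dim class_ring (H1\<lparr>carrier := vP3.annihilator a\<rparr>)" if a: "a \<in> carrier H1" for a
    using vP3.dim_resonance_2[OF a dim_H1(1) dim_H2(1) vP3_complex.cohomology_trivial_ge_3[OF order.refl]]
    unfolding dim_H1(2) dim_H2(2) by simp
  then show ?thesis unfolding resonance_variety_def using int_dim_annihilator by auto
qed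

lemma resonance_variety_ge_3:
  assumes "i \<ge> 3" "d \<ge> 1"
  shows "resonance_variety i d vP3 = {}"
proof -
  obtain n where n: "i = Suc n" using assms(1) by (cases i) auto
  have "vectorspace.dim class_ring (cohomology_of_complex (group_cohomology vP3) (\<lambda>n. cup vP3 1 n a) i) = 0"
    if a: "a \<in> carrier H1" for a
    unfolding n by (rule vP3.dim_resonance_trivial[OF a vP3_complex.cohomology_trivial_ge_3]) (use assms n in simp)
  then show ?thesis using assms(2) unfolding resonance_variety_def by auto
qed

text \<open>The annihilator of \<open>J a\<close> is one dimension smaller than that of
  \<open>a\<close>, and another dimension is lost to the span of \<open>J a\<close> unless
  \<open>a\<close> is on the t-line.\<close>

lemma (in free_factor) resonance_variety_J:
  assumes a: "a \<in> carrier H1"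
  shows "J a \<in> resonance_variety 1 d P4_bar \<longleftrightarrow> d + 1 + (if on_line (coord a) then 0 else 1) \<le> ann_dim a"
  using j.G.dim_resonance_1[OF j.pull_closed[OF a] dim_annihilator_J(1)[OF a]] dim_annihilator_J(2)[OF a]
    int_dim_annihilator[OF a] j.pull_closed[OF a]
  unfolding J_eq_zero_iff[OF a] resonance_variety_def by (auto split: if_splits)

lemma ann_dim_on_line: "on_line (coord a) \<Longrightarrow> ann_dim a = 6"
  by (simp add: ann_dim_def)

lemma ann_dim_bounds: "2 \<le> ann_dim a" "ann_dim a \<le> 6"
  by (simp_all add: ann_dim_def)

lemma zero_on_line: "on_line (coord \<zero>\<^bsub>H1\<^esub>)"
  by (simp add: on_line_def coord_linear)

lemma ann_dim_iff:
  "1 + (if a = \<zero>\<^bsub>H1\<^esub> then 0 else 1) \<le> ann_dim a"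
  "2 + (if a = \<zero>\<^bsub>H1\<^esub> then 0 else 1) \<le> ann_dim a \<longleftrightarrow> (\<exists>k<5. in_plane k (coord a))"
  "3 \<le> d \<Longrightarrow> d \<le> 5 \<Longrightarrow> d + (if a = \<zero>\<^bsub>H1\<^esub> then 0 else 1) \<le> ann_dim a \<longleftrightarrow> on_line (coord a)"
  "6 + (if a = \<zero>\<^bsub>H1\<^esub> then 0 else 1) \<le> ann_dim a \<longleftrightarrow> a = \<zero>\<^bsub>H1\<^esub>"
proof -
  define z l pl where "z \<longleftrightarrow> a = \<zero>\<^bsub>H1\<^esub>" and "l \<longleftrightarrow> on_line (coord a)" and "pl \<longleftrightarrow> (\<exists>k<5. in_plane k (coord a))"
  have zl: "z \<Longrightarrow> l" unfolding z_def l_def by (simp only: zero_on_line)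
  have lpl: "l \<Longrightarrow> pl" unfolding l_def pl_def using on_line_in_plane[of "coord a" 0] by (intro exI[of _ 0]) simp
  have ad: "ann_dim a = (if l then 6 else if pl then 3 else 2)" unfolding ann_dim_def l_def pl_def ..
  show "1 + (if a = \<zero>\<^bsub>H1\<^esub> then 0 else 1) \<le> ann_dim a"
    "2 + (if a = \<zero>\<^bsub>H1\<^esub> then 0 else 1) \<le> ann_dim a \<longleftrightarrow> (\<exists>k<5. in_plane k (coord a))"
    "3 \<le> d \<Longrightarrow> d \<le> 5 \<Longrightarrow> d + (if a = \<zero>\<^bsub>H1\<^esub> then 0 else 1) \<le> ann_dim a \<longleftrightarrow> on_line (coord a)"
    "6 + (if a = \<zero>\<^bsub>H1\<^esub> then 0 else 1) \<le> ann_dim a \<longleftrightarrow> a = \<zero>\<^bsub>H1\<^esub>"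
    unfolding z_def[symmetric] l_def[symmetric] pl_def[symmetric] ad
    using zl lpl by (cases z; cases l; cases pl; simp)+
qed

lemma resonance_variety_1_small:
  "resonance_variety 1 1 vP3 = carrier H1"
  "resonance_variety 1 2 vP3 = (\<Union>k<5. plane k)"
  "3 \<le> d \<Longrightarrow> d \<le> 5 \<Longrightarrow> resonance_variety 1 d vP3 = line"
  "resonance_variety 1 6 vP3 = {\<zero>\<^bsub>H1\<^esub>}"
proof -
  interpret vectorspace class_ring H1 by (rule vP3.vectorspace_cohomology)
  show "resonance_variety 1 1 vP3 = carrier H1"
    unfolding resonance_variety_1 using ann_dim_iff(1) by blast
  have "a \<in> (\<Union>k<5. plane k) \<longleftrightarrow> a \<in> carrier H1 \<and> (\<exists>k<5. in_plane k (coord a))" for a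
    by (auto simp: plane_def)
  then show "resonance_variety 1 2 vP3 = (\<Union>k<5. plane k)"
    unfolding resonance_variety_1 ann_dim_iff(2) by blast
  show "resonance_variety 1 d vP3 = line" if d: "3 \<le> d" "d \<le> 5"
    unfolding resonance_variety_1 line_def ann_dim_iff(3)[OF d] ..
  show "resonance_variety 1 6 vP3 = {\<zero>\<^bsub>H1\<^esub>}"
    unfolding resonance_variety_1 ann_dim_iff(4) using zero_closed by blast
qed

lemma plane_inter: "j < 5 \<Longrightarrow> k < 5 \<Longrightarrow> j \<noteq> k \<Longrightarrow> plane j \<inter> plane k = line"
  using in_plane_on_line on_line_in_plane unfolding plane_def line_def by blast

text \<open>Two equal planes would equal their intersection, but the dimensions are 3 and 1.\<close>

lemma inj_plane: "inj_on plane {..<5}"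
proof (rule inj_onI, rule ccontr)
  fix j k :: nat assume jk: "j \<in> {..<5}" "k \<in> {..<5}" "plane j = plane k" "j \<noteq> k"
  then have "plane k = line" using plane_inter[of j k] by simp
  then show False using dim_plane(2)[of k] dim_line jk(2) by simp
qed

section \<open>The coordinates given by the free product\<close>

text \<open>The structure is transported along the t-coordinate, which maps H^1 onto the complex
  numbers.\<close>

lemma vectorspace_complex_line: "vectorspace class_ring complex_line"
proof (rule vectorspace_image(1)[OF vP3.vectorspace_cohomology[of 1], of "\<lambda>a. coord a None"])
  have "c \<in> (\<lambda>a. coord a None) ` carrier H1" for c
  proof -
    obtain a where "a \<in> carrier H1" "\<forall>i. coord a i = c" using coord_ex[of "\<lambda>_. c"] by blast
    then show ?thesis by (intro image_eqI[of _ _ a]) simp_all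
  qed
  then show "(\<lambda>a. coord a None) ` carrier H1 = carrier complex_line" by (auto simp: complex_line_def)
qed (simp_all add: complex_line_def coord_linear)

lemma (in free_factor) free_factor_coords:
  assumes \<psi>: "\<And>x. x \<in> carrier P4_bar \<Longrightarrow> \<psi> (free_product_inl P4_bar integer_group x) = j x"
    "\<psi> (free_product_inr P4_bar integer_group 1) = vt"
    and a: "a \<in> carrier H1"
  shows "free_factor_coords P4_bar \<psi> a = (J a, coord a None)"
proof -
  have "coh_pullback P4_bar 1 (\<psi> \<circ> free_product_inl P4_bar integer_group) a = J a"
    unfolding coh_pullback_1[OF j.G.is_group group_vP3 a] pull_def h1_of_def
    by (rule arg_cong[of _ _ "\<lambda>f. {f}"], rule restrict_ext) (auto simp: tuples_1 \<psi>(1))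
  moreover have "[1] \<in> tuples integer_group 1" by (simp add: tuples_1 integer_group_def)
  then have "H1_integer_eval (coh_pullback integer_group 1 (\<psi> \<circ> free_product_inr P4_bar integer_group) a) = coord a None"
    unfolding coh_pullback_1[OF group_integer_group group_vP3 a] pull_def h1_of_def H1_integer_eval_def
    by (simp add: \<psi>(2) coord_def)
  ultimately show ?thesis by (simp add: free_factor_coords_def)
qed

lemma (in free_factor) coords_linear_bij:
  "linear_map class_ring H1 (direct_sum H1' complex_line) (\<lambda>a. (J a, coord a None))"
  "bij_betw (\<lambda>a. (J a, coord a None)) (carrier H1) (carrier (direct_sum H1' complex_line))"
proof -
  interpret V: vectorspace class_ring H1 by (rule vP3.vectorspace_cohomology)
  note car = direct_sum_def complex_line_def
  show "linear_map class_ring H1 (direct_sum H1' complex_line) (\<lambda>a. (J a, coord a None))"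
    by (rule linear_mapI[OF vP3.vectorspace_cohomology
        direct_sum_is_vs[OF j.G.vectorspace_cohomology vectorspace_complex_line]])
      (simp_all add: car j.pull_closed j.pull_add j.pull_smult coord_linear)
  have inj: "inj_on (\<lambda>a. (J a, coord a None)) (carrier H1)"
  proof (rule inj_onI, rule coord_eqI)
    fix a b i assume ab: "a \<in> carrier H1" "b \<in> carrier H1" "(J a, coord a None) = (J b, coord b None)"
    then show "coord a i = coord b i"
      by (cases i) (simp, metis coord_R_J prod.inject)
  qed
  have "\<exists>a\<in>carrier H1. J a = b \<and> coord a None = c" if b: "b \<in> carrier H1'" for b c
  proof -
    obtain t where t: "t \<in> carrier H1" "\<And>i. coord t i = (if i = None then c else 0)"
      using coord_ex[of "\<lambda>i. if i = None then c else 0"] by blast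
    have Rb: "R b \<in> carrier H1" by (rule r.pull_closed[OF b])
    let ?a = "R b \<oplus>\<^bsub>H1\<^esub> t"
    have "on_line (coord t)" by (simp add: on_line_def t)
    then have "J ?a = b \<oplus>\<^bsub>H1'\<^esub> \<zero>\<^bsub>H1'\<^esub>" using J_eq_zero_iff[OF t(1)] by (simp add: j.pull_add[OF Rb t(1)] J_R[OF b])
    moreover have "b \<oplus>\<^bsub>H1'\<^esub> \<zero>\<^bsub>H1'\<^esub> = b"
    proof -
      interpret vectorspace class_ring H1' by (rule j.G.vectorspace_cohomology)
      show ?thesis using b by simp
    qed
    moreover have "coord ?a None = c" by (simp add: coord_linear Rb t coord_R[OF b])
    ultimately show ?thesis using Rb t(1) by (intro bexI[of _ ?a]) auto
  qed
  note surj = this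
  have "(\<lambda>a. (J a, coord a None)) ` carrier H1 = carrier (direct_sum H1' complex_line)"
  proof (intro equalityI subsetI)
    fix z assume "z \<in> carrier (direct_sum H1' complex_line)"
    then have z: "fst z \<in> carrier H1'" by (auto simp: car)
    obtain a where "a \<in> carrier H1" "J a = fst z" "coord a None = snd z" using surj[OF z, of "snd z"] by blast
    then show "z \<in> (\<lambda>a. (J a, coord a None)) ` carrier H1" by (intro image_eqI[of _ _ a]) simp_all
  qed (auto simp: car j.pull_closed)
  then show "bij_betw (\<lambda>a. (J a, coord a None)) (carrier H1) (carrier (direct_sum H1' complex_line))"
    using inj by (simp add: bij_betw_def)
qed

lemma (in free_factor) coords_image:
  assumes "\<And>a. a \<in> carrier H1 \<Longrightarrow> a \<in> A \<longleftrightarrow> J a \<in> B" "A \<subseteq> carrier H1" "B \<subseteq> carrier H1'"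
  shows "(\<lambda>a. (J a, coord a None)) ` A = B \<times> UNIV"
proof (intro equalityI subsetI)
  fix z assume z: "z \<in> B \<times> (UNIV :: complex set)"
  then have "z \<in> carrier (direct_sum H1' complex_line)" using assms(3) by (auto simp: direct_sum_def complex_line_def)
  then obtain a where "a \<in> carrier H1" "z = (J a, coord a None)"
    using coords_linear_bij(2) unfolding bij_betw_def by blast
  then show "z \<in> (\<lambda>a. (J a, coord a None)) ` A" using assms(1) z by auto
qed (use assms in auto)

theorem (in free_factor) resonance_coords:
  assumes "i \<ge> 1" "d \<ge> 1"
  shows "(\<lambda>a. (J a, coord a None)) ` resonance_variety i d vP3 =
    (if i = 1 \<and> d \<le> 5 then resonance_variety 1 (d - 1) P4_bar \<times> UNIV
     else if i = 1 \<and> d = 6 then {\<zero>\<^bsub>direct_sum H1' complex_line\<^esub>}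
     else if i = 2 \<and> d \<le> 6 then resonance_variety 1 (d - 2) P4_bar \<times> UNIV
     else {})"
proof -
  have sub: "resonance_variety i d vP3 \<subseteq> carrier H1" "resonance_variety 1 d' P4_bar \<subseteq> carrier H1'" for i d'
    by (auto simp: resonance_variety_def)
  consider "i = 1" "d \<le> 5" | "i = 1" "d = 6" | "i = 1" "d > 6" | "i = 2" "d \<le> 6" | "i = 2" "d > 6" | "i \<ge> 3"
    using assms by linarith
  then show ?thesis
  proof cases
    case 1
    have "a \<in> resonance_variety 1 d vP3 \<longleftrightarrow> J a \<in> resonance_variety 1 (d - 1) P4_bar" if a: "a \<in> carrier H1" for a
    proof -
      define z where "z \<longleftrightarrow> a = \<zero>\<^bsub>H1\<^esub>"
      have z: "z \<Longrightarrow> on_line (coord a)" unfolding z_def by (simp only: zero_on_line)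
      have "a \<in> resonance_variety 1 d vP3 \<longleftrightarrow> d + (if z then 0 else 1) \<le> ann_dim a"
        unfolding resonance_variety_1 z_def using a by blast
      \<comment> \<open>The two conditions differ only for nonzero classes on the t-line. There the
        annihilator has dimension 6, and both hold as long as \<open>d \<le> 5\<close>; for
        \<open>d = 6\<close> only the zero class remains.\<close>
      also have "\<dots> \<longleftrightarrow> d - 1 + 1 + (if on_line (coord a) then 0 else 1) \<le> ann_dim a"
        using z 1(2) ann_dim_on_line[of a] by (cases "on_line (coord a)"; cases z) simp_all
      finally show ?thesis unfolding resonance_variety_J[OF a] .
    qed
    from coords_image[OF this sub] show ?thesis unfolding 1(1) using 1(2) by (simp only: if_True simp_thms)
  next
    case 2
    interpret V: vectorspace class_ring H1 by (rule vP3.vectorspace_cohomology)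
    have "J \<zero>\<^bsub>H1\<^esub> = \<zero>\<^bsub>H1'\<^esub>"
      unfolding J_eq_zero_iff[OF V.zero_closed] by (rule zero_on_line)
    then have "(\<lambda>a. (J a, coord a None)) ` {\<zero>\<^bsub>H1\<^esub>} = {\<zero>\<^bsub>direct_sum H1' complex_line\<^esub>}"
      by (simp only: image_insert image_empty coord_linear(3)) (simp add: direct_sum_def complex_line_def)
    then show ?thesis unfolding 2 resonance_variety_1_small(4) by simp
  next
    case 3
    have "\<not> d + (if a = \<zero>\<^bsub>H1\<^esub> then 0 else 1) \<le> ann_dim a" for a
    proof -
      have "0 \<le> (if a = \<zero>\<^bsub>H1\<^esub> then 0 else 1 :: int)" by (simp split: if_split)
      then show ?thesis using ann_dim_bounds(2)[of a] 3(2) by linarith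
    qed
    then have "resonance_variety i d vP3 = {}"
      unfolding 3(1) resonance_variety_1 by blast
    then show ?thesis using 3 by simp
  next
    case 4
    \<comment> \<open>On the t-line both sides hold because \<open>d \<le> 6\<close>; elsewhere both
      say that \<open>d\<close> is at most the dimension of the annihilator.\<close>
    have "a \<in> resonance_variety 2 d vP3 \<longleftrightarrow> J a \<in> resonance_variety 1 (d - 2) P4_bar" if a: "a \<in> carrier H1" for a
      unfolding resonance_variety_J[OF a] resonance_variety_2 using a 4(2) ann_dim_on_line[of a]
      by (cases "on_line (coord a)") simp_all
    from coords_image[OF this sub] show ?thesis unfolding 4(1) using 4(2) by simp
  next
    case 5
    have "\<not> d \<le> ann_dim a" for a using ann_dim_bounds(2)[of a] 5(2) by linarith
    then have "resonance_variety i d vP3 = {}" unfolding 5(1) resonance_variety_2 by blast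
    then show ?thesis using 5 by simp
  next
    case 6
    then show ?thesis using resonance_variety_ge_3[OF 6 assms(2)] by simp
  qed
qed

theorem proposition4p5:
  shows
    "(\<exists>\<psi> \<in> iso (free_product P4_bar integer_group) vP3.
        linear_map class_ring (group_cohomology vP3 1)
          (direct_sum (group_cohomology P4_bar 1) complex_line) (free_factor_coords P4_bar \<psi>) \<and>
        bij_betw (free_factor_coords P4_bar \<psi>)
          (carrier (group_cohomology vP3 1))
          (carrier (direct_sum (group_cohomology P4_bar 1) complex_line)) \<and>
        (\<forall>(i::nat) (d::int). i \<ge> 1 \<longrightarrow> d \<ge> 1 \<longrightarrow>
          free_factor_coords P4_bar \<psi> ` resonance_variety i d vP3 =
            (if i = 1 \<and> d \<le> 5 then resonance_variety 1 (d - 1) P4_bar \<times> UNIV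
             else if i = 1 \<and> d = 6 then {\<zero>\<^bsub>direct_sum (group_cohomology P4_bar 1) complex_line\<^esub>}
             else if i = 2 \<and> d \<le> 6 then resonance_variety 1 (d - 2) P4_bar \<times> UNIV
             else {}))) \<and>
     resonance_variety 1 1 vP3 = carrier (group_cohomology vP3 1) \<and>
     vectorspace class_ring (group_cohomology vP3 1) \<and>
     vectorspace.fin_dim class_ring (group_cohomology vP3 1) \<and>
     vectorspace.dim class_ring (group_cohomology vP3 1) = 6 \<and>
     (\<exists>\<L>. card \<L> = 5 \<and>
        (\<forall>L\<in>\<L>. VectorSpace.subspace class_ring L (group_cohomology vP3 1) \<and>
           vectorspace.dim class_ring ((group_cohomology vP3 1)\<lparr>carrier := L\<rparr>) = 3) \<and>
        resonance_variety 1 2 vP3 = \<Union>\<L> \<and>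
        (\<forall>L\<in>\<L>. \<forall>M\<in>\<L>. L \<noteq> M \<longrightarrow> L \<inter> M = resonance_variety 1 3 vP3)) \<and>
     VectorSpace.subspace class_ring (resonance_variety 1 3 vP3) (group_cohomology vP3 1) \<and>
     vectorspace.dim class_ring
       ((group_cohomology vP3 1)\<lparr>carrier := resonance_variety 1 3 vP3\<rparr>) = 1 \<and>
     resonance_variety 1 3 vP3 = resonance_variety 1 4 vP3 \<and>
     resonance_variety 1 4 vP3 = resonance_variety 1 5 vP3"
proof -
  obtain \<psi> j r where \<psi>: "\<psi> \<in> iso (free_product P4_bar integer_group) vP3"
    and jr: "group_hom P4_bar vP3 j" "group_hom vP3 P4_bar r"
    and \<psi>': "\<And>x. x \<in> carrier P4_bar \<Longrightarrow> \<psi> (free_product_inl P4_bar integer_group x) = j x"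
      "\<psi> (free_product_inr P4_bar integer_group 1) = vt"
    and j_r: "\<And>x. x \<in> carrier P4_bar \<Longrightarrow> r (j x) = x"
      "j (r vx1) = vx1" "j (r vx2) = vx2" "j (r vx3) = vx3" "j (r vp) = vp" "j (r vq) = vq"
      "r vt = \<one>\<^bsub>P4_bar\<^esub>"
    by (rule vP3_iso_free_product) (rule that)
  interpret F: free_factor j r by (rule free_factor.intro) (fact jr j_r)+
  let ?F = "free_factor_coords P4_bar \<psi>" and ?F' = "\<lambda>a. (pull P4_bar j a, coord a None)"
  \<comment> \<open>The map in the statement agrees on the carrier of H^1 with the concrete one, for
    which all claims have been shown; they are transferred below.\<close>
  have F: "?F a = ?F' a" if "a \<in> carrier H1" for a by (rule F.free_factor_coords[OF \<psi>' that])
  interpret V: vectorspace class_ring H1 by (rule vP3.vectorspace_cohomology)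
  interpret L: linear_map class_ring H1 "direct_sum (group_cohomology P4_bar 1) complex_line" ?F'
    by (rule F.coords_linear_bij(1))
  have lin: "linear_map class_ring H1 (direct_sum (group_cohomology P4_bar 1) complex_line) ?F"
  proof (rule linear_mapI[OF V.vectorspace_axioms L.W.vectorspace_axioms])
    fix x y and c :: complex
    assume x: "x \<in> carrier H1"
    show "?F x \<in> carrier (direct_sum (group_cohomology P4_bar 1) complex_line)"
      unfolding F[OF x] by (rule L.T_im[OF x])
    show "?F (c \<odot>\<^bsub>H1\<^esub> x) = c \<odot>\<^bsub>direct_sum (group_cohomology P4_bar 1) complex_line\<^esub> ?F x"
    proof -
      have c: "c \<in> carrier class_ring" by simp
      show ?thesis unfolding F[OF x] F[OF V.smult_closed[OF c x]] by (rule L.T_smult[OF c x])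
    qed
    assume y: "y \<in> carrier H1"
    show "?F (x \<oplus>\<^bsub>H1\<^esub> y) = ?F x \<oplus>\<^bsub>direct_sum (group_cohomology P4_bar 1) complex_line\<^esub> ?F y"
      unfolding F[OF x] F[OF y] F[OF V.a_closed[OF x y]] by (rule L.T_add[OF x y])
  qed
  have bij: "bij_betw ?F (carrier H1) (carrier (direct_sum (group_cohomology P4_bar 1) complex_line))"
    using F.coords_linear_bij(2) by (subst bij_betw_cong[OF F])
  have img: "?F ` resonance_variety i d vP3 = ?F' ` resonance_variety i d vP3" for i d
    by (rule image_cong[OF HOL.refl F]) (unfold resonance_variety_def, blast)
  have R3: "resonance_variety 1 3 vP3 = line" "resonance_variety 1 4 vP3 = line" "resonance_variety 1 5 vP3 = line"
    by (simp_all add: resonance_variety_1_small(3))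
  have card: "card (plane ` {..<5}) = 5" using card_image[OF inj_plane] by simp
  have inter: "L \<inter> M = line" if LM: "L \<in> plane ` {..<5}" "M \<in> plane ` {..<5}" "L \<noteq> M" for L M
    using LM plane_inter by blast
  have planes: "VectorSpace.subspace class_ring L H1 \<and> vectorspace.dim class_ring (H1\<lparr>carrier := L\<rparr>) = 3"
    if "L \<in> plane ` {..<5}" for L
    using that plane_subspace dim_plane(2) by blast
  show ?thesis
  proof (intro conjI)
    show "\<exists>\<psi> \<in> iso (free_product P4_bar integer_group) vP3.
        linear_map class_ring (group_cohomology vP3 1)
          (direct_sum (group_cohomology P4_bar 1) complex_line) (free_factor_coords P4_bar \<psi>) \<and>
        bij_betw (free_factor_coords P4_bar \<psi>)
          (carrier (group_cohomology vP3 1))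
          (carrier (direct_sum (group_cohomology P4_bar 1) complex_line)) \<and>
        (\<forall>(i::nat) (d::int). i \<ge> 1 \<longrightarrow> d \<ge> 1 \<longrightarrow>
          free_factor_coords P4_bar \<psi> ` resonance_variety i d vP3 =
            (if i = 1 \<and> d \<le> 5 then resonance_variety 1 (d - 1) P4_bar \<times> UNIV
             else if i = 1 \<and> d = 6 then {\<zero>\<^bsub>direct_sum (group_cohomology P4_bar 1) complex_line\<^esub>}
             else if i = 2 \<and> d \<le> 6 then resonance_variety 1 (d - 2) P4_bar \<times> UNIV
             else {}))"
      by (intro bexI[OF _ \<psi>] conjI lin bij allI impI) (unfold img, rule F.resonance_coords)
    show "\<exists>\<L>. card \<L> = 5 \<and>
        (\<forall>L\<in>\<L>. VectorSpace.subspace class_ring L (group_cohomology vP3 1) \<and>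
           vectorspace.dim class_ring ((group_cohomology vP3 1)\<lparr>carrier := L\<rparr>) = 3) \<and>
        resonance_variety 1 2 vP3 = \<Union>\<L> \<and>
        (\<forall>L\<in>\<L>. \<forall>M\<in>\<L>. L \<noteq> M \<longrightarrow> L \<inter> M = resonance_variety 1 3 vP3)"
      unfolding R3 resonance_variety_1_small(2)
      by (intro exI[of _ "plane ` {..<5}"] conjI ballI impI card inter HOL.refl planes[THEN conjunct1] planes[THEN conjunct2])
  qed (simp_all add: R3 line_subspace dim_line dim_H1 resonance_variety_1_small(1) V.vectorspace_axioms)
qed

end
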